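(* Let $q\ge r\ge1$ be integers, $v_x,v_y>0$ known, $v_0\ge v_x$, $v_w=(1/v_x+1/v_y)^{-1}$. Let $\hat p_H$ be the Bayesian predictive density with respect to the hierarchical prior $\pi_H$ with second-stage density $\pi_2$ defined in the context, and for $v\in[v_w,v_x]$ and $W\in\mathbb R^{r\times q}$ let $f_\pi(\Lambda;W)$, $\pi_2^J(\Lambda)$ and $m(W)=\int_{\mathcal R_r}f_\pi(\Lambda;W)\,d\Lambda$ be as defined in the context (all depending on $v$). Put $$M=M(W)=\int_{\mathcal R_r}\Lambda f_\pi(\Lambda;W)\,d\Lambda .$$ Assume that $f_\pi(\Lambda;W)=0$ for all $\Lambda\in\partial\mathcal R_r$. Then $\hat p_H$ is minimax relative to the Kullback-Leibler loss if $\Delta(W;\pi_2^J)\le0$ (for all $W\in\mathbb R^{r\times q}$ and all $v\in[v_w,v_x]$), where $$\Delta(W;\pi_2^J)=\Delta_1(W;\pi_2^J)-\Delta_2(W;\pi_2^J)-(q-3r-3)\,\mathrm{tr}\,M$$ with $$\Delta_1(W;\pi_2^J)=4\int_{\mathcal R_r}\frac{1}{\pi_2^J(\Lambda)}\mathrm{tr}\{\Lambda^2\mathcal D_\Lambda\pi_2^J(\Lambda)\}f_\pi(\Lambda;W)\,d\Lambda,$$ $$\Delta_2(W;\pi_2^J)=\frac{2}{m(W)}\int_{\mathcal R_r}\frac{1}{\pi_2^J(\Lambda)}\mathrm{tr}\{\Lambda M\mathcal D_\Lambda\pi_2^J(\Lambda)\}f_\pi(\Lambda;W)\,d\Lambda,$$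 provided all the integrals are finite.
   Context: Prediction problem: $X\mid\Theta\sim\mathcal N_{r\times q}(\Theta,v_xI_r\otimes I_q)$ and $Y\mid\Theta\sim\mathcal N_{r\times q}(\Theta,v_yI_r\otimes I_q)$ are independent given $\Theta$, i.e. $p(X\mid\Theta)=(2\pi v_x)^{-qr/2}\exp(-\|X-\Theta\|^2/(2v_x))$ and similarly $p(Y\mid\Theta)$ with $v_y$, where $\|A\|^2=\mathrm{tr}(AA^\top)$. The matrix $\Theta\in\mathbb R^{r\times q}$ is unknown. A predictive density $\hat p=\hat p(Y\mid X)$ is an estimate of the density $p(Y\mid\Theta)$ based on $X$. The Kullback-Leibler (KL) loss is $L_{KL}(\Theta,\hat p)=\int_{\mathbb R^{r\times q}}p(Y\mid\Theta)\log\frac{p(Y\mid\Theta)}{\hat p(Y\mid X)}\,dY$ and the risk is $R_{KL}(\Theta,\hat p)=\int_{\mathbb R^{r\times q}} p(X\mid\Theta)L_{KL}(\Theta,\hat p)\,dX$. $\hat p$ is minimax if $\sup_\Theta R_{KL}(\Theta,\hat p)=\inf_{\tilde p}\sup_\Theta R_{KL}(\Theta,\tilde p)$ over all predictive densities $\tilde p$. For a (proper or improper) prior density $\pi(\Theta)$ with $\int p(X\mid\Theta)\pi(\Theta)\,d\Theta<\infty$ for all $X$, the Bayesian predictive density is $\hat p_\pi(Y\mid X)=\dfrac{\int p(X\mid\Theta)p(Y\mid\Theta)\pi(\Theta)\,d\Theta}{\int p(X\mid\Theta)\pi(\Theta)\,d\Theta}$. Hierarchical prior: $\mathcal R_r$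 is the set of real symmetric $r\times r$ matrices $\Lambda$ such that $\Lambda$ and $I_r-\Lambda$ are both positive definite, and $\partial\mathcal R_r$ is its boundary in the space of symmetric matrices. For $\Omega\in\mathcal R_r$, $$\pi_1(\Theta\mid\Omega)=(2\pi v_0)^{-qr/2}|\Omega(I_r-\Omega)^{-1}|^{q/2}\exp\Big[-\frac1{2v_0}\mathrm{tr}\{\Omega(I_r-\Omega)^{-1}\Theta\Theta^\top\}\Big],$$ $\pi_2(\Omega)$ is a (proper or improper) prior density that is a differentiable function on $\mathcal R_r$, and $\pi_H(\Theta)=\int_{\mathcal R_r}\pi_1(\Theta\mid\Omega)\pi_2(\Omega)\,d\Omega$. $\hat p_H$ is the Bayesian predictive density with respect to $\pi_H$. It is assumed that the marginal density $\int p(W\mid\Theta)\pi_H(\Theta)\,d\Theta$ of $W\mid\Theta\sim\mathcal N_{r\times q}(\Theta,vI_r\otimes I_q)$ is finite when $v=v_x$. With $v_1=v/v_0$, define for $\Lambda\in\mathcal R_r$ $$\pi_2^J(\Lambda)=v_1^{r(r+1)/2}|v_1I_r+(1-v_1)\Lambda|^{-r-1}\,\pi_2\big[\Lambda\{v_1I_r+(1-v_1)\Lambda\}^{-1}\big],$$ $$f_\pi(\Lambda;W)=(2\pi v)^{-qr/2}|\Lambda|^{q/2}\pi_2^J(\Lambda)\exp\Big[-\frac1{2v}\mathrm{tr}(\Lambda WW^\top)\Big].$$ The values of $f_\pi(\cdot;W)$ on $\partial\mathcal R_r$ are understood as those of its continuous extension from $\mathcal R_r$. $\mathcal D_\Lambda$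 is the $r\times r$ symmetric matrix of differential operators with respect to $\Lambda=(\lambda_{ij})$ with $(i,j)$ entry $\frac{1+\delta_{ij}}2\frac{\partial}{\partial\lambda_{ij}}$ ($\delta_{ij}$ the Kronecker delta; the independent variables are $\lambda_{ij}$, $i\le j$); for a scalar function $g$, $\mathcal D_\Lambda g$ is the $r\times r$ matrix with entries $\frac{1+\delta_{ij}}2\frac{\partial g}{\partial\lambda_{ij}}$. *)

theory Defs
  imports "HOL-Analysis.Analysis"
begin

section \<open>Normal densities, predictive densities and Kullback-Leibler risk\<close>

text \<open>An \<open>r \<times> q\<close> matrix has type \<^typ>\<open>real^'q^'r\<close>. The norm of this type is the Frobenius
  norm, and its \<open>lborel\<close> is Lebesgue measure in the entries.\<close>

definition matnormal :: "real \<Rightarrow> real^'q^'r \<Rightarrow> real^'q^'r \<Rightarrow> real" where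
  "matnormal v \<Theta> W =
     (2 * pi * v) powr (- (real (CARD('q) * CARD('r)) / 2)) * exp (- (norm (W - \<Theta>))\<^sup>2 / (2 * v))"

text \<open>The Lebesgue integral with values in \<open>[-\<infinity>, \<infinity>]\<close>. The function \<^const>\<open>e2ennreal\<close> sends
  negative numbers to 0, so the two terms are the integrals of the positive and negative parts.\<close>

definition ext_integral :: "'a measure \<Rightarrow> ('a \<Rightarrow> ereal) \<Rightarrow> ereal" where
  "ext_integral M f =
     enn2ereal (\<integral>\<^sup>+ x. e2ennreal (f x) \<partial>M) - enn2ereal (\<integral>\<^sup>+ x. e2ennreal (- f x) \<partial>M)"

text \<open>A predictive density is written \<open>p X Y\<close> for \<open>p(Y | X)\<close>.\<close>

definition predictive_density :: "(real^'q^'r \<Rightarrow> real^'q^'r \<Rightarrow> real) \<Rightarrow> bool" where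
  "predictive_density p \<longleftrightarrow>
     (\<lambda>(X, Y). p X Y) \<in> borel_measurable borel \<and>
     (\<forall>X Y. 0 \<le> p X Y) \<and>
     (\<forall>X. (\<integral>\<^sup>+ Y. ennreal (p X Y) \<partial>lborel) = 1)"

text \<open>The integrand \<open>p log (p / p')\<close> is \<open>\<infinity>\<close> where \<open>p' = 0\<close>, since the normal density \<open>p\<close> is
  positive.\<close>

definition KL_loss ::
    "real \<Rightarrow> (real^'q^'r \<Rightarrow> real^'q^'r \<Rightarrow> real) \<Rightarrow> real^'q^'r \<Rightarrow> real^'q^'r \<Rightarrow> ereal" where
  "KL_loss vy p \<Theta> X = ext_integral lborel (\<lambda>Y.
     if p X Y = 0 then \<infinity>
     else ereal (matnormal vy \<Theta> Y * ln (matnormal vy \<Theta> Y / p X Y)))"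

definition KL_risk ::
    "real \<Rightarrow> real \<Rightarrow> (real^'q^'r \<Rightarrow> real^'q^'r \<Rightarrow> real) \<Rightarrow> real^'q^'r \<Rightarrow> ereal" where
  "KL_risk vx vy p \<Theta> =
     ext_integral lborel (\<lambda>X. ereal (matnormal vx \<Theta> X) * KL_loss vy p \<Theta> X)"

definition KL_minimax ::
    "real \<Rightarrow> real \<Rightarrow> (real^'q^'r \<Rightarrow> real^'q^'r \<Rightarrow> real) \<Rightarrow> bool" where
  "KL_minimax vx vy p \<longleftrightarrow>
     predictive_density p \<and>
     (SUP \<Theta>. KL_risk vx vy p \<Theta>) =
     (INF p'\<in>{p' :: real^'q^'r \<Rightarrow> real^'q^'r \<Rightarrow> real. predictive_density p'}. SUP \<Theta>. KL_risk vx vy p' \<Theta>)"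

text \<open>Prior densities on \<open>\<Theta>\<close> take values in \<open>[0, \<infinity>]\<close>, because the mixture prior below may be
  infinite at some points, for instance at \<open>\<Theta> = 0\<close>.\<close>

definition marginal :: "real \<Rightarrow> (real^'q^'r \<Rightarrow> ennreal) \<Rightarrow> real^'q^'r \<Rightarrow> ennreal" where
  "marginal v \<pi> W = (\<integral>\<^sup>+ \<Theta>. ennreal (matnormal v \<Theta> W) * \<pi> \<Theta> \<partial>lborel)"

definition bayes_predictive ::
    "real \<Rightarrow> real \<Rightarrow> (real^'q^'r \<Rightarrow> ennreal) \<Rightarrow> real^'q^'r \<Rightarrow> real^'q^'r \<Rightarrow> real" where
  "bayes_predictive vx vy \<pi> X Y = enn2real
     ((\<integral>\<^sup>+ \<Theta>. ennreal (matnormal vx \<Theta> X) * ennreal (matnormal vy \<Theta> Y) * \<pi> \<Theta> \<partial>lborel)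
      / marginal vx \<pi> X)"


section \<open>Symmetric matrices\<close>

definition sym_matrices :: "(real^'r^'r) set" where
  "sym_matrices = {A. transpose A = A}"

definition pos_def :: "real^'r^'r \<Rightarrow> bool" where
  "pos_def A \<longleftrightarrow> transpose A = A \<and> (\<forall>x. x \<noteq> 0 \<longrightarrow> 0 < x \<bullet> (A *v x))"

definition RR :: "(real^'r^'r) set" where
  "RR = {\<Lambda> \<in> sym_matrices. pos_def \<Lambda> \<and> pos_def (mat 1 - \<Lambda>)}"

text \<open>The boundary is taken in the space of symmetric matrices; \<^const>\<open>RR\<close> has empty interior in
  the space of all matrices when \<open>r \<ge> 2\<close>.\<close>

definition bdry_RR :: "(real^'r^'r) set" where
  "bdry_RR = top_of_set sym_matrices frontier_of RR"

text \<open>Lebesgue measure in the independent entries \<open>\<lambda>\<^sub>i\<^sub>j\<close>, \<open>i \<le> j\<close>, transported to the symmetric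
  matrices. The linear order on the index type is used only to select these entries.\<close>

definition sym_lborel :: "(real^'r::{finite,linorder}^'r::{finite,linorder}) measure" where
  "sym_lborel = distr (\<Pi>\<^sub>M p\<in>{(i, j). i \<le> j}. lborel) borel
     (\<lambda>x. \<chi> i j. x (min i j, max i j))"

text \<open>The variable \<open>\<lambda>\<^sub>i\<^sub>j\<close> occupies the entries \<open>(i, j)\<close> and \<open>(j, i)\<close>, so the partial derivative
  with respect to it is the derivative in the direction \<open>sym_unit i j\<close>.\<close>

definition sym_unit :: "'r \<Rightarrow> 'r \<Rightarrow> real^'r^'r" where
  "sym_unit i j = (\<chi> k l. if (k = i \<and> l = j) \<or> (k = j \<and> l = i) then 1 else 0)"

definition sym_partial :: "'r \<Rightarrow> 'r \<Rightarrow> (real^'r^'r \<Rightarrow> real) \<Rightarrow> real^'r^'r \<Rightarrow> real" where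
  "sym_partial i j g \<Lambda> = deriv (\<lambda>t. g (\<Lambda> + t *\<^sub>R sym_unit i j)) 0"

definition DD :: "(real^'r^'r \<Rightarrow> real) \<Rightarrow> real^'r^'r \<Rightarrow> real^'r^'r" where
  "DD g \<Lambda> = (\<chi> i j. (1 + (if i = j then 1 else 0)) / 2 * sym_partial i j g \<Lambda>)"


section \<open>The hierarchical prior\<close>

definition prior1 :: "real \<Rightarrow> real^'r^'r \<Rightarrow> real^'q^'r \<Rightarrow> real" where
  "prior1 v0 \<Omega> \<Theta> =
     (2 * pi * v0) powr (- (real (CARD('q) * CARD('r)) / 2)) *
     det (\<Omega> ** matrix_inv (mat 1 - \<Omega>)) powr (real CARD('q) / 2) *
     exp (- trace (\<Omega> ** matrix_inv (mat 1 - \<Omega>) ** \<Theta> ** transpose \<Theta>) / (2 * v0))"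

definition hier_prior ::
    "real \<Rightarrow> (real^'r::{finite,linorder}^'r::{finite,linorder} \<Rightarrow> real) \<Rightarrow> real^'q^'r::{finite,linorder} \<Rightarrow> ennreal" where
  "hier_prior v0 \<pi>2 \<Theta> =
     (\<integral>\<^sup>+ \<Omega>\<in>RR. ennreal (prior1 v0 \<Omega> \<Theta> * \<pi>2 \<Omega>) \<partial>sym_lborel)"

definition prior2J :: "real \<Rightarrow> real \<Rightarrow> (real^'r^'r \<Rightarrow> real) \<Rightarrow> real^'r^'r \<Rightarrow> real" where
  "prior2J v0 v \<pi>2 \<Lambda> =
     (let r = real CARD('r); v1 = v / v0; B = v1 *\<^sub>R mat 1 + (1 - v1) *\<^sub>R \<Lambda>
      in v1 powr (r * (r + 1) / 2) * det B powr (- r - 1) * \<pi>2 (\<Lambda> ** matrix_inv B))"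

definition f_pi ::
    "real \<Rightarrow> real \<Rightarrow> (real^'r^'r \<Rightarrow> real) \<Rightarrow> real^'q^'r \<Rightarrow> real^'r^'r \<Rightarrow> real" where
  "f_pi v0 v \<pi>2 W \<Lambda> =
     (2 * pi * v) powr (- (real (CARD('q) * CARD('r)) / 2)) *
     det \<Lambda> powr (real CARD('q) / 2) * prior2J v0 v \<pi>2 \<Lambda> *
     exp (- trace (\<Lambda> ** W ** transpose W) / (2 * v))"

definition m_pi ::
    "real \<Rightarrow> real \<Rightarrow> (real^'r::{finite,linorder}^'r::{finite,linorder} \<Rightarrow> real) \<Rightarrow> real^'q^'r::{finite,linorder} \<Rightarrow> real" where
  "m_pi v0 v \<pi>2 W = (LINT \<Lambda>:RR|sym_lborel. f_pi v0 v \<pi>2 W \<Lambda>)"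

definition M_pi ::
    "real \<Rightarrow> real \<Rightarrow> (real^'r::{finite,linorder}^'r::{finite,linorder} \<Rightarrow> real) \<Rightarrow> real^'q^'r::{finite,linorder} \<Rightarrow> real^'r::{finite,linorder}^'r::{finite,linorder}" where
  "M_pi v0 v \<pi>2 W = (LINT \<Lambda>:RR|sym_lborel. f_pi v0 v \<pi>2 W \<Lambda> *\<^sub>R \<Lambda>)"

text \<open>The integrands of the first two terms of \<open>\<Delta>\<close>. At a zero of the nonnegative function
  \<open>prior2J\<close> in \<^const>\<open>RR\<close>, its derivative vanishes as well, so the convention \<open>1 / 0 = 0\<close> gives
  the same value as cancelling \<open>prior2J\<close> against the factor of it in \<open>f_pi\<close>.\<close>

definition Delta1_integrand ::
    "real \<Rightarrow> real \<Rightarrow> (real^'r^'r \<Rightarrow> real) \<Rightarrow> real^'q^'r \<Rightarrow> real^'r^'r \<Rightarrow> real" where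
  "Delta1_integrand v0 v \<pi>2 W \<Lambda> =
     1 / prior2J v0 v \<pi>2 \<Lambda> * trace (\<Lambda> ** \<Lambda> ** DD (prior2J v0 v \<pi>2) \<Lambda>) * f_pi v0 v \<pi>2 W \<Lambda>"

definition Delta2_integrand ::
    "real \<Rightarrow> real \<Rightarrow> (real^'r::{finite,linorder}^'r::{finite,linorder} \<Rightarrow> real) \<Rightarrow> real^'q^'r::{finite,linorder} \<Rightarrow> real^'r::{finite,linorder}^'r::{finite,linorder} \<Rightarrow> real" where
  "Delta2_integrand v0 v \<pi>2 W \<Lambda> =
     1 / prior2J v0 v \<pi>2 \<Lambda> *
     trace (\<Lambda> ** M_pi v0 v \<pi>2 W ** DD (prior2J v0 v \<pi>2) \<Lambda>) * f_pi v0 v \<pi>2 W \<Lambda>"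

definition Delta1 ::
    "real \<Rightarrow> real \<Rightarrow> (real^'r::{finite,linorder}^'r::{finite,linorder} \<Rightarrow> real) \<Rightarrow> real^'q^'r::{finite,linorder} \<Rightarrow> real" where
  "Delta1 v0 v \<pi>2 W = 4 * (LINT \<Lambda>:RR|sym_lborel. Delta1_integrand v0 v \<pi>2 W \<Lambda>)"

definition Delta2 ::
    "real \<Rightarrow> real \<Rightarrow> (real^'r::{finite,linorder}^'r::{finite,linorder} \<Rightarrow> real) \<Rightarrow> real^'q^'r::{finite,linorder} \<Rightarrow> real" where
  "Delta2 v0 v \<pi>2 W =
     2 / m_pi v0 v \<pi>2 W * (LINT \<Lambda>:RR|sym_lborel. Delta2_integrand v0 v \<pi>2 W \<Lambda>)"

definition Delta ::
    "real \<Rightarrow> real \<Rightarrow> (real^'r::{finite,linorder}^'r::{finite,linorder} \<Rightarrow> real) \<Rightarrow> real^'q^'r::{finite,linorder} \<Rightarrow> real" where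
  "Delta v0 v \<pi>2 W =
     Delta1 v0 v \<pi>2 W - Delta2 v0 v \<pi>2 W
     - (real CARD('q) - 3 * real CARD('r) - 3) * trace (M_pi v0 v \<pi>2 W)"

end

theory Submission
  imports Defs "HOL-Probability.Probability"
begin

text \<open>Let \<open>m\<^sub>v\<close> be the marginal density of \<open>W \<sim> N(\<Theta>, v I)\<close> under the prior. The product of the two sampling densities
  factors through the pooled observation, which has variance \<open>vw\<close>, so the risk of \<open>pH\<close> exceeds the constant risk of the
  uniform-prior density by \<open>E ln m\<^sub>v\<^sub>x - E ln m\<^sub>v\<^sub>w\<close>. That constant risk is a lower bound for the maximal risk of every
  predictive density, by comparison with normal priors of variance \<open>\<tau> \<rightarrow> \<infinity>\<close>. It remains to see that \<open>E ln m\<^sub>v\<close> does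
  not increase on \<open>[vw, vx]\<close>. By Stein's identity its \<open>v\<close>-derivative is the mean of a nonnegative multiple of the Laplacian
  of \<open>\<surd>m\<^sub>v\<close>. Integrating the latter by parts over \<open>\<Lambda>\<close>, along the fields \<open>\<Lambda>\<^sup>2\<close> and \<open>(\<Lambda> M + M \<Lambda>) / 2\<close> and without
  boundary terms since \<open>f_pi\<close> vanishes there, bounds it by a multiple of \<open>Delta\<close>.\<close>

section \<open>Spectral calculus of symmetric matrices\<close>

text \<open>The mixture is used in two parametrisations. In \<open>f_pi\<close> the variable is
  \<Lambda> = v \<open>prec v0 v \<Omega>\<close>; this gives the exponent a form suited to
  integration by parts, but the weight \<open>prior2J\<close> then varies with v. The v-derivative
  is therefore taken in the variable \<Omega>, where the measure with density \<pi>2 stays fixed and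
  only the normal density \<open>phi\<close> moves. The map \<open>mob\<close> passes from one to
  the other. Finiteness of the marginal at vx controls all smaller variances, because
  \<open>phi\<close> at v is at most a constant times \<open>phi\<close> at vx and W = 0.

  Let \<open>S\<close> and \<open>sq\<close> be the unnormalised posterior means of the precision
  matrix P and of |P W|^2. Then grad m = - S W and Lap m = sq - q tr S, and the inequality to prove
  is 2 m Lap m - |grad m|^2 <= 0, whose left side is 4 m^(3/2) Lap sqrt m. The numbers in
  \<open>Delta\<close> come from divergences: on symmetric r x r matrices \<Lambda>^2 has divergence
  (r+1) tr \<Lambda>, the field (\<Lambda>M + M\<Lambda>)/2 has (r+1)/2 tr M, and the factor
  det^(q/2) adds q/2 times the trace to each.\<close>

lemma trace_transpose: "trace (transpose A) = trace (A::real^'n^'n)"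
  by (simp add: trace_def transpose_def)

lemma self_adjoint_iff_symmetric:
  fixes A :: "real^'n^'n"
  assumes "transpose A = A"
  shows "x \<bullet> (A *v y) = (A *v x) \<bullet> y"
  by (metis assms dot_lmul_matrix vector_transpose_matrix)

text \<open>A maximiser x of the quadratic form on the unit sphere of S is an eigenvector. The
  residual w = A x - l x stays in S by invariance, and maximality along x + t w bounds a term linear
  in t by one quadratic in t, which forces w = 0.\<close>

lemma symmetric_eigenvector_exists:
  fixes A :: "real^'n^'n"
  assumes A: "transpose A = A" and S: "subspace S" "S \<noteq> {0}" and inv: "\<And>x. x \<in> S \<Longrightarrow> A *v x \<in> S"
  obtains x l where "x \<in> S" "norm x = 1" "A *v x = l *\<^sub>R x"
proof -
  let ?K = "S \<inter> sphere 0 1"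
  obtain y where y: "y \<in> S" "y \<noteq> 0" using S by (metis subspace_0 subsetI subset_singletonD insert_iff all_not_in_conv)
  have "(1 / norm y) *\<^sub>R y \<in> ?K" using y S by (simp add: subspace_scale)
  hence ne: "?K \<noteq> {}" by blast
  have cK: "compact ?K" by (simp add: S closed_Int_compact closed_subspace)
  have "continuous_on ?K (\<lambda>x. x \<bullet> (A *v x))" by (intro continuous_intros linear_continuous_on) (auto simp: matrix_vector_mul_bounded_linear)
  from continuous_attains_sup[OF cK ne this] obtain x where x: "x \<in> ?K"
    and mx: "\<And>y. y \<in> ?K \<Longrightarrow> y \<bullet> (A *v y) \<le> x \<bullet> (A *v x)" by blast
  define l where "l = x \<bullet> (A *v x)"
  have nx: "x \<bullet> x = 1" using x by (simp add: norm_eq_1)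
  have le: "y \<bullet> (A *v y) \<le> l * (y \<bullet> y)" if "y \<in> S" for y
  proof (cases "y = 0")
    case False
    have "(1 / norm y) *\<^sub>R y \<in> ?K" using that False S by (simp add: subspace_scale)
    from mx[OF this] have "(1/norm y) * ((1/norm y) * (y \<bullet> (A *v y))) \<le> l"
      by (simp add: matrix_vector_mult_scaleR l_def)
    thus ?thesis using False by (simp add: dot_square_norm power2_eq_square field_simps)
  qed simp
  define w where "w = A *v x - l *\<^sub>R x"
  have wS: "w \<in> S" using x inv S by (simp add: w_def subspace_diff subspace_scale)
  have xw: "x \<bullet> (A *v w) = (A *v x) \<bullet> w" by (rule self_adjoint_iff_symmetric[OF A])
  have quad: "2 * t * (w \<bullet> w) \<le> t^2 * (l * (w \<bullet> w) - w \<bullet> (A *v w))" for t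
  proof -
    have "x + t *\<^sub>R w \<in> S" using x wS S by (simp add: subspace_add subspace_scale)
    from le[OF this] have "l + 2 * t * ((A *v x) \<bullet> w) + t^2 * (w \<bullet> (A *v w)) \<le> l * (1 + 2 * t * (x \<bullet> w) + t^2 * (w \<bullet> w))"
      by (simp add: inner_add matrix_vector_right_distrib matrix_vector_mult_scaleR l_def[symmetric] nx
          inner_commute[of w "A *v x"] xw inner_commute[of w x] power2_eq_square algebra_simps)
    moreover have "(A *v x) \<bullet> w = w \<bullet> w + l * (x \<bullet> w)" by (simp add: w_def inner_diff_left)
    ultimately show ?thesis by (simp add: algebra_simps)
  qed
  have "w \<bullet> w = 0"
  proof (rule ccontr)
    assume "w \<bullet> w \<noteq> 0"
    hence p: "w \<bullet> w > 0" by simp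
    define c where "c = l * (w \<bullet> w) - w \<bullet> (A *v w)"
    \<comment> \<open>Small enough that the quadratic side, divided by t, is at most w \<bullet> w,
      while the linear side is 2 (w \<bullet> w).\<close>
    define t where "t = (w \<bullet> w) / (\<bar>c\<bar> + 1)"
    have t: "t > 0" using p by (simp add: t_def)
    have "2 * t * (w \<bullet> w) \<le> t^2 * c" using quad c_def by blast
    hence "2 * (w \<bullet> w) \<le> t * c" using t by (simp add: power2_eq_square)
    also have "t * c \<le> t * (\<bar>c\<bar> + 1)" using t by (intro mult_left_mono) auto
    also have "\<dots> = w \<bullet> w" by (simp add: t_def)
    finally show False using p by simp
  qed
  hence "A *v x = l *\<^sub>R x" by (simp add: w_def)
  thus ?thesis using x that by auto
qed

text \<open>Induction on the dimension: the vectors of S orthogonal to an eigenvector form an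
  invariant subspace again, because A is self-adjoint. The general invariant subspace S is what the
  induction needs; only S = \<open>UNIV\<close> is used afterwards.\<close>

lemma symmetric_eigenbasis_subspace:
  fixes A :: "real^'n^'n"
  assumes A: "transpose A = A"
  shows "subspace S \<Longrightarrow> (\<And>x. x \<in> S \<Longrightarrow> A *v x \<in> S) \<Longrightarrow>
    \<exists>B. finite B \<and> B \<subseteq> S \<and> card B = dim S \<and> pairwise orthogonal B \<and> (\<forall>x\<in>B. norm x = 1 \<and> (\<exists>l. A *v x = l *\<^sub>R x))"
proof (induction "dim S" arbitrary: S)
  case 0
  thus ?case by (intro exI[of _ "{}"]) auto
next
  case (Suc n)
  hence "S \<noteq> {0}" by auto
  then obtain x l where x: "x \<in> S" "norm x = 1" "A *v x = l *\<^sub>R x"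
    using symmetric_eigenvector_exists[OF A] Suc.prems by metis
  let ?T = "{y \<in> S. orthogonal x y}"
  have T: "subspace ?T" using Suc.prems(1) by (auto simp: subspace_def orthogonal_def inner_add)
  have eqT: "?T = {y \<in> S. \<forall>x\<in>span {x}. orthogonal x y}"
    by (auto simp: span_singleton orthogonal_def)
  hence "dim ?T + dim {x} = dim S"
    using dim_subspace_orthogonal_to_vectors[of "span {x}" S] x Suc.prems
    by (simp add: span_minimal)
  moreover have "dim {x} = 1" using x by (intro dim_eq_card_independent[THEN trans]) auto
  ultimately have d: "dim ?T = n" using Suc.hyps by simp
  have invT: "A *v y \<in> ?T" if "y \<in> ?T" for y
    using that Suc.prems(2)[of y] by (auto simp: orthogonal_def self_adjoint_iff_symmetric[OF A] x)
  from Suc.hyps(1)[OF d[symmetric] T invT] obtain B where B: "finite B" "B \<subseteq> ?T" "card B = n"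
    "pairwise orthogonal B" "\<forall>x\<in>B. norm x = 1 \<and> (\<exists>l. A *v x = l *\<^sub>R x)" using d by auto
  have "\<not> orthogonal x x" using x(2) by (metis norm_zero orthogonal_self zero_neq_one)
  hence "x \<notin> B" using B(2) by blast
  hence "finite (insert x B) \<and> insert x B \<subseteq> S \<and> card (insert x B) = dim S \<and> pairwise orthogonal (insert x B) \<and> (\<forall>x\<in>insert x B. norm x = 1 \<and> (\<exists>l. A *v x = l *\<^sub>R x))"
    using B x Suc.hyps by (auto simp: pairwise_insert orthogonal_commute)
  thus ?case by blast
qed

text \<open>A calculus for functions of one symmetric matrix: for a fixed orthogonal
  \<open>U\<close>, sums, products, inverses, trace and determinant act on the eigenvalues
  \<open>d\<close>, so an identity that involves a single symmetric matrix becomes a scalar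
  identity.\<close>

definition spmat :: "real^'n^'n \<Rightarrow> ('n \<Rightarrow> real) \<Rightarrow> real^'n^'n" where
  "spmat U d = U ** (\<chi> i j. if i = j then d i else 0) ** transpose U"

lemma spmat_nth: "spmat U d $ i $ j = (\<Sum>k\<in>UNIV. U $ i $ k * d k * U $ j $ k)"
  unfolding spmat_def matrix_matrix_mult_def transpose_def
  by (auto intro!: sum.cong simp: if_distrib[of "\<lambda>x. _ * x"] cong: if_cong)

theorem spectral_theorem:
  fixes A :: "real^'n^'n"
  assumes A: "transpose A = A"
  obtains U d where "orthogonal_matrix U" "A = spmat U d"
proof -
  obtain B where B: "finite B" "card B = CARD('n)" "pairwise orthogonal B" "\<And>x. x \<in> B \<Longrightarrow> norm x = 1"
     "\<forall>x\<in>B. \<exists>l. A *v x = l *\<^sub>R x"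
    using symmetric_eigenbasis_subspace[OF A, of UNIV] by (auto simp: dim_UNIV)
  then obtain e where e: "bij_betw e (UNIV::'n set) B" by (metis finite_same_card_bij finite)
  from B(5) obtain l where l: "\<And>x. x \<in> B \<Longrightarrow> A *v x = l x *\<^sub>R x" by metis
  have eB: "e i \<in> B" for i using e by (auto simp: bij_betw_def)
  have ee: "e i \<bullet> e j = (if i = j then 1 else 0)" for i j
  proof (cases "i = j")
    case True thus ?thesis using B(4)[OF eB[of j]] by (simp add: norm_eq_1)
  next
    case False
    hence "e i \<noteq> e j" using e by (auto simp: bij_betw_def inj_on_def)
    thus ?thesis using B(3) eB False by (auto simp: pairwise_def orthogonal_def)
  qed
  define U where "U = (\<chi> i j. e j $ i)"
  have U: "orthogonal_matrix U"
    unfolding orthogonal_matrix matrix_matrix_mult_def transpose_def U_def mat_def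
    using ee by (simp add: vec_eq_iff inner_vec_def)
  define D where "D = ((\<chi> i j. if i = j then l (e i) else 0)::real^'n^'n)"
  have AU: "A ** U = U ** D"
  proof -
    have "(A ** U) $ i $ j = (U ** D) $ i $ j" for i j
    proof -
      have "(A ** U) $ i $ j = (A *v e j) $ i" by (simp add: matrix_matrix_mult_def matrix_vector_mult_def U_def)
      also have "\<dots> = l (e j) * e j $ i" by (simp add: l eB)
      also have "\<dots> = (U ** D) $ i $ j"
        by (simp add: matrix_matrix_mult_def U_def D_def if_distrib[of "\<lambda>x. _ * x"] cong: if_cong)
      finally show ?thesis .
    qed
    thus ?thesis by (simp add: vec_eq_iff)
  qed
  have "A = A ** (U ** transpose U)" using U by (simp add: orthogonal_matrix_def)
  also have "\<dots> = spmat U (\<lambda>i. l (e i))" by (simp add: matrix_mul_assoc AU spmat_def D_def)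
  finally show ?thesis using U that by blast
qed

lemma matrix_inv_unique_right:
  fixes A :: "real^'n^'n"
  assumes "A ** B = mat 1"
  shows "matrix_inv A = B"
proof -
  have BA: "B ** A = mat 1" using assms matrix_left_right_inverse by blast
  have "A ** matrix_inv A = mat 1 \<and> matrix_inv A ** A = mat 1"
    unfolding matrix_inv_def by (rule someI_ex) (use assms BA in blast)
  thus ?thesis by (metis BA matrix_mul_assoc matrix_mul_lid matrix_mul_rid)
qed

section \<open>The matrix product as a bilinear map, and arithmetic of spectral forms\<close>

lemma bounded_bilinear_matrix_mult:
  "bounded_bilinear ((**) :: real^'m^'n \<Rightarrow> real^'k^'m \<Rightarrow> real^'k^'n)"
  unfolding bilinear_conv_bounded_bilinear[symmetric] bilinear_def
  by (auto intro!: linearI simp: vec_eq_iff matrix_matrix_mult_def sum_distrib_left sum.distrib[symmetric]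
      distrib_left distrib_right intro!: sum.cong)

lemmas matrix_mult_diff_left = bounded_bilinear.diff_left[OF bounded_bilinear_matrix_mult]
lemmas matrix_mult_diff_right = bounded_bilinear.diff_right[OF bounded_bilinear_matrix_mult]
lemmas matrix_mult_add_left = bounded_bilinear.add_left[OF bounded_bilinear_matrix_mult]
lemmas matrix_mult_add_right = bounded_bilinear.add_right[OF bounded_bilinear_matrix_mult]
lemmas matrix_mult_scaleR_left = bounded_bilinear.scaleR_left[OF bounded_bilinear_matrix_mult]
lemmas matrix_mult_scaleR_right = bounded_bilinear.scaleR_right[OF bounded_bilinear_matrix_mult]
lemmas matrix_mult_zero_left = bounded_bilinear.zero_left[OF bounded_bilinear_matrix_mult]
lemmas matrix_mult_zero_right = bounded_bilinear.zero_right[OF bounded_bilinear_matrix_mult]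
lemmas continuous_on_matrix_mult [continuous_intros] =
  bounded_bilinear.continuous_on[OF bounded_bilinear_matrix_mult]

lemma spmat_add: "spmat U d + spmat U e = spmat U (\<lambda>i. d i + e i)"
  by (simp add: vec_eq_iff spmat_nth sum.distrib[symmetric] algebra_simps)
lemma spmat_diff: "spmat U d - spmat U e = spmat U (\<lambda>i. d i - e i)"
  by (simp add: vec_eq_iff spmat_nth sum_subtractf[symmetric] algebra_simps)
lemma spmat_scaleR: "c *\<^sub>R spmat U d = spmat U (\<lambda>i. c * d i)"
  by (simp add: vec_eq_iff spmat_nth sum_distrib_left algebra_simps)
lemma transpose_spmat [simp]: "transpose (spmat U d) = spmat U d"
  by (simp add: vec_eq_iff spmat_nth transpose_def mult_ac)
lemma spmat_1:
  assumes "orthogonal_matrix U" shows "mat 1 = spmat U (\<lambda>i. 1)"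
proof -
  have "(\<chi> i j. if i = j then 1 else 0) = (mat 1 :: real^'a^'a)" by (simp add: mat_def)
  thus ?thesis using assms by (simp add: spmat_def orthogonal_matrix_def)
qed
lemma spmat_mult:
  assumes "orthogonal_matrix U" shows "spmat U d ** spmat U e = spmat U (\<lambda>i. d i * e i)"
proof -
  let ?D = "\<lambda>d. (\<chi> i j. if i = j then d i else 0)::real^'a^'a"
  have "spmat U d ** spmat U e = U ** (?D d ** (transpose U ** U) ** ?D e) ** transpose U"
    by (simp add: spmat_def matrix_mul_assoc)
  also have "\<dots> = U ** (?D d ** ?D e) ** transpose U" using assms by (simp add: orthogonal_matrix_def)
  also have "?D d ** ?D e = ?D (\<lambda>i. d i * e i)"
    by (simp add: vec_eq_iff matrix_matrix_mult_def if_distrib[of "\<lambda>x. _ * x"] cong: if_cong)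
  finally show ?thesis by (simp add: spmat_def)
qed
lemma det_orthogonal_mult: "orthogonal_matrix U \<Longrightarrow> det U * det (transpose U) = (1::real)"
  by (metis det_I det_mul orthogonal_matrix_def)
lemma det_spmat:
  assumes "orthogonal_matrix U" shows "det (spmat U d) = (\<Prod>i\<in>UNIV. d i)"
proof -
  have "det (spmat U d) = (det U * det (transpose U)) * det ((\<chi> i j. if i = j then d i else 0)::real^'a^'a)"
    by (simp add: spmat_def det_mul)
  also have "det ((\<chi> i j. if i = j then d i else 0)::real^'a^'a) = (\<Prod>i\<in>UNIV. d i)"
    by (subst det_diagonal) auto
  finally show ?thesis using det_orthogonal_mult[OF assms] by simp
qed
lemma orthogonal_matrix_col_dot:
  assumes "orthogonal_matrix U" shows "(\<Sum>i\<in>UNIV. U $ i $ k * U $ i $ l) = (if k = l then 1 else (0::real))"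
proof -
  have "(transpose U ** U) $ k $ l = (mat 1::real^'a^'a) $ k $ l" using assms by (simp add: orthogonal_matrix_def)
  thus ?thesis by (simp add: matrix_matrix_mult_def transpose_def mat_def)
qed
lemma trace_spmat:
  assumes "orthogonal_matrix U" shows "trace (spmat U d) = (\<Sum>i\<in>UNIV. d i)"
proof -
  have "trace (spmat U d) = (\<Sum>k\<in>UNIV. d k * (\<Sum>i\<in>UNIV. U $ i $ k * U $ i $ k))"
    unfolding trace_def spmat_nth by (subst sum.swap) (simp add: sum_distrib_left mult_ac)
  thus ?thesis by (simp add: orthogonal_matrix_col_dot[OF assms])
qed
lemma matrix_inv_spmat:
  assumes "orthogonal_matrix U" "\<And>i. d i \<noteq> 0" shows "matrix_inv (spmat U d) = spmat U (\<lambda>i. 1 / d i)"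
  by (rule matrix_inv_unique_right) (simp add: spmat_mult assms spmat_1[OF assms(1)])

lemma inner_matrix_eq_trace: "A \<bullet> B = trace (transpose A ** (B::real^'m^'n))"
  unfolding inner_vec_def trace_def matrix_matrix_mult_def transpose_def
  by (simp add: inner_vec_def, subst sum.swap, rule refl)

lemma norm_spmat:
  assumes "orthogonal_matrix U" shows "(norm (spmat U d))\<^sup>2 = (\<Sum>i\<in>UNIV. (d i)\<^sup>2)"
  unfolding power2_norm_eq_inner inner_matrix_eq_trace by (simp add: spmat_mult assms trace_spmat power2_eq_square)

text \<open>The Frobenius norm is the Euclidean norm of the eigenvalues; the square root of the
  dimension is replaced by the dimension itself to keep the constant simple.\<close>

lemma norm_spmat_le:
  fixes U :: "real^'n^'n"
  assumes "orthogonal_matrix U" "\<And>i. \<bar>d i\<bar> \<le> c" shows "norm (spmat U d) \<le> real CARD('n) * c"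
proof -
  have c: "c \<ge> 0" using assms(2) by (meson abs_ge_zero order_trans)
  have "(norm (spmat U d))\<^sup>2 \<le> (\<Sum>i\<in>(UNIV::'n set). c^2)"
    unfolding norm_spmat[OF assms(1)] using assms(2) by (intro sum_mono) (simp add: abs_le_square_iff[symmetric] c)
  also have "\<dots> = CARD('n) * c^2" by simp
  also have "\<dots> \<le> (real CARD('n))\<^sup>2 * c^2"
    by (intro mult_right_mono self_le_power) auto
  finally show ?thesis using c by (simp add: power_mult_distrib[symmetric] power2_le_iff_abs_le)
qed

section \<open>Positive definiteness in terms of eigenvalues\<close>

lemma spmat_quadratic: "x \<bullet> (spmat U d *v x) = (\<Sum>k\<in>UNIV. d k * ((transpose U *v x) $ k)\<^sup>2)"
proof -
  let ?D = "(\<chi> i j. if i = j then d i else 0)::real^'a^'a"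
  have "x \<bullet> (spmat U d *v x) = (transpose U *v x) \<bullet> (?D *v (transpose U *v x))"
  proof -
    have "x \<bullet> (U *v y) = (transpose U *v x) \<bullet> y" for y by (simp add: dot_lmul_matrix)
    thus ?thesis by (simp only: spmat_def matrix_vector_mul_assoc[symmetric])
  qed
  also have "\<dots> = (\<Sum>k\<in>UNIV. d k * ((transpose U *v x) $ k)\<^sup>2)"
  proof -
    have "(?D *v y) $ k = d k * y $ k" for y k
      by (simp add: matrix_vector_mult_def if_distrib[of "\<lambda>x. x * _"] cong: if_cong)
    thus ?thesis by (simp add: inner_vec_def power2_eq_square mult_ac)
  qed
  finally show ?thesis .
qed

lemma pos_def_spmat:
  fixes U :: "real^'n^'n"
  assumes U: "orthogonal_matrix U" shows "pos_def (spmat U d) \<longleftrightarrow> (\<forall>i. 0 < d i)"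
proof
  assume p: "pos_def (spmat U d)"
  show "\<forall>i. 0 < d i"
  proof
    fix i
    define x where "x = U *v axis i 1"
    have tx: "transpose U *v x = axis i 1" using U by (simp only: x_def matrix_vector_mul_assoc) (simp add: orthogonal_matrix_def)
    hence "x \<noteq> 0" by (metis axis_eq_0_iff matrix_vector_mult_0_right zero_neq_one)
    hence "0 < x \<bullet> (spmat U d *v x)" using p by (simp add: pos_def_def)
    thus "0 < d i" unfolding spmat_quadratic tx
      by (simp add: axis_def if_distrib[of "\<lambda>x. x^2"] if_distrib[of "\<lambda>x. _ * x"] cong: if_cong)
  qed
next
  assume d: "\<forall>i. 0 < d i"
  have "0 < x \<bullet> (spmat U d *v x)" if "x \<noteq> 0" for x
  proof -
    have "transpose U *v x \<noteq> 0"
    proof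
      assume "transpose U *v x = 0"
      hence "(U ** transpose U) *v x = 0" by (simp only: matrix_vector_mul_assoc[symmetric]) (metis matrix_vector_mult_0_right)
      thus False using U that by (simp add: orthogonal_matrix_def)
    qed
    then obtain k where k: "(transpose U *v x) $ k \<noteq> 0" by (auto simp: vec_eq_iff)
    show ?thesis unfolding spmat_quadratic
      by (rule sum_pos2[of _ k]) (use k d in \<open>auto intro!: mult_nonneg_nonneg intro: less_imp_le\<close>)
  qed
  thus "pos_def (spmat U d)" by (simp add: pos_def_def)
qed

lemma RR_spmat:
  assumes U: "orthogonal_matrix U" shows "spmat U d \<in> RR \<longleftrightarrow> (\<forall>i. 0 < d i \<and> d i < 1)"
  by (auto simp: RR_def sym_matrices_def spmat_1[OF U] spmat_diff pos_def_spmat[OF U])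

lemma pos_def_obtain:
  assumes "pos_def A"
  obtains U d where "orthogonal_matrix U" "A = spmat U d" "\<And>i. 0 < d i"
proof -
  have "transpose A = A" using assms by (auto simp: pos_def_def)
  then obtain U d where U: "orthogonal_matrix U" "A = spmat U d" by (rule spectral_theorem)
  show ?thesis using that[OF U] assms U(2) pos_def_spmat[OF U(1)] by auto
qed

lemma RR_obtain:
  assumes "A \<in> RR"
  obtains U d where "orthogonal_matrix U" "A = spmat U d" "\<And>i. 0 < d i" "\<And>i. d i < 1"
proof -
  have "transpose A = A" using assms by (auto simp: RR_def sym_matrices_def)
  then obtain U d where U: "orthogonal_matrix U" "A = spmat U d" by (rule spectral_theorem)
  show ?thesis using that[OF U] assms U(2) RR_spmat[OF U(1)] by auto
qed

section \<open>Lebesgue measure on the symmetric matrices\<close>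

text \<open>Index type of the independent entries. With it the symmetric matrices are coordinatised
  by the Euclidean space \<open>real^'r upair\<close>, and theorems on differentiation and Lebesgue
  measure in such spaces become applicable.\<close>

typedef (overloaded) ('r::linorder) upair = "{(i::'r, j). i \<le> j}"
  by (rule exI[of _ "(undefined, undefined)"]) simp

instance upair :: ("{finite,linorder}") finite
proof
  have "(UNIV :: 'a upair set) = Abs_upair ` {(i, j). i \<le> j}"
    by (rule type_definition.Abs_image[OF type_definition_upair, symmetric])
  moreover have "finite {(i::'a, j). i \<le> j}" by (rule finite_subset[OF subset_UNIV]) simp
  ultimately show "finite (UNIV :: 'a upair set)" by (metis finite_imageI)
qed

text \<open>The change-of-variables theorem of the library needs some well-order on the index type.\<close>

definition enum_index :: "'a::finite \<Rightarrow> nat" where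
  "enum_index = (SOME f. inj f)"

lemma inj_enum_index: "inj (enum_index :: 'a::finite \<Rightarrow> nat)"
proof -
  obtain f :: "'a \<Rightarrow> nat" and n :: nat where "inj f"
    using finite_imp_inj_to_nat_seg[OF finite[of "UNIV :: 'a set"]] by metis
  thus ?thesis unfolding enum_index_def by (rule someI[of inj])
qed

instantiation upair :: ("{finite,linorder}") wellorder
begin
definition less_eq_upair :: "'a upair \<Rightarrow> 'a upair \<Rightarrow> bool" where
  "less_eq_upair a b \<longleftrightarrow> enum_index a \<le> enum_index b"
definition less_upair :: "'a upair \<Rightarrow> 'a upair \<Rightarrow> bool" where
  "less_upair a b \<longleftrightarrow> enum_index a < enum_index b"
instance
proof
  fix P :: "'a upair \<Rightarrow> bool" and a
  assume H: "\<And>x. (\<And>y. y < x \<Longrightarrow> P y) \<Longrightarrow> P x"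
  show "P a" by (rule measure_induct_rule[of enum_index], rule H, simp add: less_upair_def)
next
  fix x y z :: "'a upair"
  show "(x < y) = (x \<le> y \<and> \<not> y \<le> x)" by (auto simp: less_eq_upair_def less_upair_def)
  show "x \<le> x" by (simp add: less_eq_upair_def)
  show "x \<le> y \<Longrightarrow> y \<le> z \<Longrightarrow> x \<le> z" by (simp add: less_eq_upair_def)
  show "x \<le> y \<Longrightarrow> y \<le> x \<Longrightarrow> x = y"
    unfolding less_eq_upair_def by (rule injD[OF inj_enum_index]) simp
  show "x \<le> y \<or> y \<le> x" by (auto simp: less_eq_upair_def)
qed
end

definition upair :: "'r::linorder \<Rightarrow> 'r \<Rightarrow> 'r upair" where
  "upair i j = Abs_upair (min i j, max i j)"

definition sym_of_vec :: "real^('r::{finite,linorder}) upair \<Rightarrow> real^'r::{finite,linorder}^'r::{finite,linorder}" where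
  "sym_of_vec x = (\<chi> i j. x $ upair i j)"

definition vec_of_sym :: "real^'r::{finite,linorder}^'r::{finite,linorder} \<Rightarrow> real^('r::{finite,linorder}) upair" where
  "vec_of_sym A = (\<chi> p. A $ fst (Rep_upair p) $ snd (Rep_upair p))"

lemma Rep_upair_le: "fst (Rep_upair p) \<le> snd (Rep_upair p)"
  using Rep_upair[of p] by auto

lemma upair_Rep: "upair (fst (Rep_upair p)) (snd (Rep_upair p)) = p"
  using Rep_upair_le[of p] by (simp add: upair_def min_absorb1 max_absorb2 Rep_upair_inverse)

lemma Rep_upair_upair: "Rep_upair (upair i j) = (min i j, max i j)"
  unfolding upair_def by (rule Abs_upair_inverse) (auto simp: min_def max_def)

lemma vec_of_sym_of_vec [simp]: "vec_of_sym (sym_of_vec x) = x"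
  by (simp add: vec_of_sym_def sym_of_vec_def vec_eq_iff upair_Rep)

lemma transpose_eq_nth: "transpose A = A \<Longrightarrow> A $ i $ j = A $ j $ i"
  by (metis transpose_def vec_lambda_beta)

lemma sym_of_vec_of_sym [simp]:
  assumes "transpose A = A" shows "sym_of_vec (vec_of_sym A) = A"
proof -
  have "sym_of_vec (vec_of_sym A) $ i $ j = A $ i $ j" for i j
    using transpose_eq_nth[OF assms, of i j]
    by (simp add: vec_of_sym_def sym_of_vec_def Rep_upair_upair min_def max_def)
  thus ?thesis by (simp add: vec_eq_iff)
qed

lemma transpose_sym_of_vec [simp]: "transpose (sym_of_vec x) = sym_of_vec x"
  by (simp add: sym_of_vec_def transpose_def vec_eq_iff upair_def min.commute max.commute)

lemma linear_sym_of_vec: "linear sym_of_vec"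
  by (rule linearI) (auto simp: sym_of_vec_def vec_eq_iff)

lemma linear_vec_of_sym: "linear vec_of_sym"
  by (rule linearI) (auto simp: vec_of_sym_def vec_eq_iff)

lemmas bounded_linear_sym_of_vec = linear_conv_bounded_linear[THEN iffD1, OF linear_sym_of_vec]
lemmas bounded_linear_vec_of_sym = linear_conv_bounded_linear[THEN iffD1, OF linear_vec_of_sym]

lemma borel_measurable_sym_of_vec [measurable]: "sym_of_vec \<in> borel \<rightarrow>\<^sub>M borel"
  by (intro borel_measurable_continuous_onI linear_continuous_on bounded_linear_sym_of_vec)

lemma sym_matrices_iff: "A \<in> sym_matrices \<longleftrightarrow> transpose A = A"
  by (simp add: sym_matrices_def)

lemma continuous_on_transpose [continuous_intros]:
  "continuous_on S f \<Longrightarrow> continuous_on S (\<lambda>x. transpose (f x :: real^'n^'m))"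
  unfolding transpose_def by (intro continuous_on_vec_lambda continuous_on_component)

lemma closed_sym_matrices: "closed sym_matrices"
  unfolding sym_matrices_def by (intro closed_Collect_eq continuous_on_transpose continuous_on_id)

text \<open>The bridge from the product measure that defines \<open>sym_lborel\<close> to the
  Lebesgue measure of the coordinate space: on a box both give the product of the side lengths over
  the entries with i \<le> j, and boxes determine the measure.\<close>

lemma sym_lborel_eq: "(sym_lborel :: (real^'r::{finite,linorder}^'r::{finite,linorder}) measure) = distr lborel borel sym_of_vec"
proof -
  let ?I = "{(i::'r, j). i \<le> j}"
  let ?P = "\<Pi>\<^sub>M p\<in>?I. (lborel :: real measure)"
  interpret product_sigma_finite "\<lambda>p::'r\<times>'r. lborel :: real measure" ..
  define c where "c = (\<lambda>x. (\<chi> p. x (Rep_upair p)) :: real^('r upair))"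
  have [measurable]: "(\<lambda>x. x (Rep_upair p)) \<in> ?P \<rightarrow>\<^sub>M borel" for p
    using measurable_component_singleton[of "Rep_upair p" ?I "\<lambda>_. lborel :: real measure"] Rep_upair[of p] by simp
  have cm [measurable]: "c \<in> ?P \<rightarrow>\<^sub>M borel"
  proof -
    have "(\<lambda>x. c x \<bullet> b) \<in> borel_measurable ?P" if "b \<in> Basis" for b
      using that by (auto simp: c_def Basis_vec_def inner_axis)
    thus ?thesis by (subst borel_measurable_euclidean_space) auto
  qed
  have bij: "bij_betw Rep_upair (UNIV::'r upair set) ?I"
    by (simp add: bij_betw_def inj_on_def Rep_upair_inject type_definition.Rep_range[OF type_definition_upair])
  have "(lborel :: (real^('r upair)) measure) = distr ?P borel c"
  proof (rule lborel_eqI)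
    fix l u :: "real^('r upair)"
    assume le: "\<And>b. b \<in> Basis \<Longrightarrow> l \<bullet> b \<le> u \<bullet> b"
    have le': "l $ p \<le> u $ p" for p using le[of "axis p 1"] by (simp add: inner_axis axis_in_Basis_iff)
    let ?l = "\<lambda>p. l $ Abs_upair p" and ?u = "\<lambda>p. u $ Abs_upair p"
    have "c -` box l u \<inter> space ?P = (\<Pi>\<^sub>E p\<in>?I. {?l p <..< ?u p})"
    proof (intro set_eqI iffI)
      fix x assume x: "x \<in> c -` box l u \<inter> space ?P"
      hence "l $ p < x (Rep_upair p) \<and> x (Rep_upair p) < u $ p" for p
        by (auto simp: c_def mem_box_cart)
      from this[of "Abs_upair _"] have "?l p < x p \<and> x p < ?u p" if "p \<in> ?I" for p
        using that by (metis Abs_upair_inverse)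
      thus "x \<in> (\<Pi>\<^sub>E p\<in>?I. {?l p <..< ?u p})" using x by (auto simp: space_PiM PiE_iff)
    next
      fix x assume x: "x \<in> (\<Pi>\<^sub>E p\<in>?I. {?l p <..< ?u p})"
      hence "?l (Rep_upair p) < x (Rep_upair p) \<and> x (Rep_upair p) < ?u (Rep_upair p)" for p
        using Rep_upair[of p] unfolding PiE_iff by (metis greaterThanLessThan_iff)
      thus "x \<in> c -` box l u \<inter> space ?P" using x
        by (auto simp: c_def mem_box_cart Rep_upair_inverse space_PiM PiE_iff)
    qed
    hence "emeasure (distr ?P borel c) (box l u) = emeasure ?P (\<Pi>\<^sub>E p\<in>?I. {?l p <..< ?u p})"
      by (subst emeasure_distr) auto
    also have "\<dots> = (\<Prod>p\<in>?I. emeasure lborel {?l p <..< ?u p})" by (subst emeasure_PiM) auto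
    also have "\<dots> = (\<Prod>p\<in>?I. ennreal (?u p - ?l p))"
      by (intro prod.cong refl) (use le' in auto)
    also have "\<dots> = (\<Prod>p\<in>UNIV. ennreal (u $ p - l $ p))"
      by (subst prod.reindex_bij_betw[OF bij, symmetric]) (simp add: Rep_upair_inverse)
    also have "\<dots> = ennreal (\<Prod>p\<in>UNIV. u $ p - l $ p)" by (intro prod_ennreal) (use le' in auto)
    also have "(\<Prod>p\<in>UNIV. u $ p - l $ p) = (\<Prod>b\<in>Basis. (u - l) \<bullet> b)"
      unfolding Basis_vec_def by (simp add: image_UN prod.UNION_disjoint inner_axis axis_eq_axis)
    finally show "emeasure (distr ?P borel c) (box l u) = (\<Prod>b\<in>Basis. (u - l) \<bullet> b)" .
  qed auto
  hence "distr (lborel :: (real^('r upair)) measure) borel sym_of_vec = distr (distr ?P borel c) borel sym_of_vec" by simp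
  also have "\<dots> = distr ?P borel (sym_of_vec \<circ> c)" by (rule distr_distr) auto
  also have "sym_of_vec \<circ> c = (\<lambda>x. \<chi> i j. x (min i j, max i j))"
    by (auto simp: fun_eq_iff sym_of_vec_def c_def Rep_upair_upair)
  finally show ?thesis by (simp add: sym_lborel_def)
qed

lemma sets_sym_lborel [simp, measurable_cong]: "sets sym_lborel = sets borel"
  by (simp add: sym_lborel_eq)
lemma space_sym_lborel [simp]: "space sym_lborel = UNIV"
  by (simp add: sym_lborel_eq)

lemma nn_integral_sym_lborel:
  "f \<in> borel_measurable borel \<Longrightarrow> (\<integral>\<^sup>+ A. f A \<partial>sym_lborel) = (\<integral>\<^sup>+ x. f (sym_of_vec x) \<partial>lborel)"
  unfolding sym_lborel_eq by (subst nn_integral_distr) auto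

text \<open>A ball of matrices pulls back to a bounded set of coordinates, since
  \<open>vec_of_sym\<close> is a bounded left inverse of \<open>sym_of_vec\<close>; so balls have
  finite measure.\<close>

lemma sigma_finite_sym_lborel: "sigma_finite_measure (sym_lborel :: (real^'r::{finite,linorder}^'r::{finite,linorder}) measure)"
proof
  let ?B = "\<lambda>n::nat. ball (0::real^'r::{finite,linorder}^'r::{finite,linorder}) n"
  have "emeasure sym_lborel (?B n) \<noteq> \<infinity>" for n
  proof -
    obtain K where K: "\<And>x. norm (vec_of_sym x) \<le> norm (x::real^'r::{finite,linorder}^'r::{finite,linorder}) * K"
      using bounded_linear_vec_of_sym bounded_linear.bounded by metis
    have "bounded (sym_of_vec -` ?B n)"
    proof (rule boundedI)
      fix x assume "x \<in> sym_of_vec -` ?B n"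
      hence a: "norm (sym_of_vec x) \<le> n" by simp
      have "norm x = norm (vec_of_sym (sym_of_vec x))" by simp
      also have "\<dots> \<le> norm (sym_of_vec x) * K" by (rule K)
      also have "\<dots> \<le> n * \<bar>K\<bar>" by (rule order_trans[OF mult_left_mono[OF abs_ge_self norm_ge_zero] mult_right_mono[OF a abs_ge_zero]])
      finally show "norm x \<le> n * \<bar>K\<bar>" .
    qed
    from emeasure_bounded_finite[OF this] show ?thesis
      by (auto simp: sym_lborel_eq emeasure_distr top.not_eq_extremum)
  qed
  hence fin: "\<forall>a\<in>range ?B. emeasure sym_lborel a \<noteq> \<infinity>" by blast
  have "x \<in> (\<Union>n. ?B n)" for x using reals_Archimedean2[of "norm x"] by auto
  hence "(\<Union>n. ?B n) = UNIV" by blast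
  hence "\<Union>(range ?B) = space sym_lborel" by simp
  moreover have "range ?B \<subseteq> sets sym_lborel" by auto
  moreover have "countable (range ?B)" by simp
  ultimately show "\<exists>A::(real^'r::{finite,linorder}^'r::{finite,linorder}) set set. countable A \<and> A \<subseteq> sets sym_lborel \<and> \<Union>A = space sym_lborel \<and> (\<forall>a\<in>A. emeasure sym_lborel a \<noteq> \<infinity>)"
    using fin by meson
qed

section \<open>Jacobian determinants of congruences\<close>

definition congr_vec :: "real^'r::{finite,linorder}^'r::{finite,linorder} \<Rightarrow> real^('r::{finite,linorder}) upair \<Rightarrow> real^('r::{finite,linorder}) upair" where
  "congr_vec P x = vec_of_sym (P ** sym_of_vec x ** transpose P)"

lemma linear_congr_vec: "linear (congr_vec P)"
  unfolding congr_vec_def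
  by (rule linearI) (simp_all add: linear_add[OF linear_sym_of_vec] linear_scale[OF linear_sym_of_vec]
    matrix_mult_add_left matrix_mult_add_right matrix_mult_scaleR_left matrix_mult_scaleR_right
    linear_add[OF linear_vec_of_sym] linear_scale[OF linear_vec_of_sym])

lemma det_congr_vec_mult:
  "det (matrix (congr_vec (P ** Q))) = det (matrix (congr_vec P)) * det (matrix (congr_vec Q))"
proof -
  have "congr_vec (P ** Q) = congr_vec P \<circ> congr_vec Q"
    by (auto simp: fun_eq_iff congr_vec_def matrix_transpose_mul matrix_mul_assoc)
  thus ?thesis by (simp add: matrix_compose_gen linear_congr_vec matrix_compose det_mul)
qed

lemma diag_mult_nth: "((\<chi> i j. if i = j then d i else 0) ** A) $ i $ k = d i * (A::real^'m^'n) $ i $ k"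
  by (simp add: matrix_matrix_mult_def if_distrib[of "\<lambda>x. x * _"] cong: if_cong)

lemma mult_diag_nth:
  "(A ** transpose (\<chi> i j. if i = j then d i else 0)) $ i $ k = d k * (A::real^'n^'m) $ i $ k"
  by (simp add: matrix_matrix_mult_def transpose_def if_distrib[of "\<lambda>x. _ * x"] cong: if_cong)

text \<open>In the coordinates the map is diagonal, with the factor d_i d_j for the entry (i, j), i
  \<le> j. Reflecting the second factors turns the product into one over all pairs times one over
  the diagonal, so that every d_i is counted r + 1 times.\<close>

lemma det_congr_vec_diag:
  "det (matrix (congr_vec ((\<chi> i j. if i = j then d i else 0) :: real^'r::{finite,linorder}^'r::{finite,linorder}))) = (\<Prod>i\<in>UNIV. d i) ^ (CARD('r) + 1)"
proof -
  let ?D = "(\<chi> i j. if i = j then d i else 0) :: real^'r::{finite,linorder}^'r::{finite,linorder}"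
  let ?I = "{(i::'r, j). i \<le> j}"
  let ?f = "\<lambda>p. fst (Rep_upair p)" and ?s = "\<lambda>p. snd (Rep_upair p)"
  have *: "congr_vec ?D x $ p = d (?f p) * d (?s p) * x $ p" for x p
  proof -
    have "(?D ** sym_of_vec x ** transpose ?D) $ i $ j = d i * d j * sym_of_vec x $ i $ j" for i j
      by (simp only: diag_mult_nth mult_diag_nth mult.assoc mult.commute mult.left_commute)
    thus ?thesis by (simp add: congr_vec_def vec_of_sym_def sym_of_vec_def upair_Rep)
  qed
  have "det (matrix (congr_vec ?D)) = (\<Prod>p\<in>UNIV. d (?f p) * d (?s p))"
    by (subst det_diagonal) (auto simp: matrix_def * axis_def)
  also have "\<dots> = (\<Prod>(i,j)\<in>?I. d i * d j)"
  proof -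
    have bij: "bij_betw Rep_upair (UNIV::'r upair set) ?I"
      by (simp add: bij_betw_def inj_on_def Rep_upair_inject type_definition.Rep_range[OF type_definition_upair])
    show ?thesis by (subst prod.reindex_bij_betw[OF bij, symmetric]) (simp add: case_prod_unfold)
  qed
  also have "\<dots> = (\<Prod>(i,j)\<in>?I. d i) * (\<Prod>(i,j)\<in>?I. d j)" by (simp add: prod.distrib[symmetric] case_prod_unfold)
  also have "(\<Prod>(i,j)\<in>?I. d j) = (\<Prod>(i,j)\<in>{(i,j). j \<le> i}. d i)"
    by (rule prod.reindex_bij_witness[of _ prod.swap prod.swap]) auto
  also have "(\<Prod>(i,j)\<in>?I. d i) = (\<Prod>(i,j)\<in>{(i,j). i < j}. d i) * (\<Prod>(i,j)\<in>{(i,j). i = j}. d i)"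
    by (subst prod.union_disjoint[symmetric]) (auto intro!: prod.cong)
  also have "(\<Prod>(i,j)\<in>{(i::'r,j). i = j}. d i) = (\<Prod>i\<in>UNIV. d i)"
    by (rule prod.reindex_bij_witness[of _ "\<lambda>i. (i,i)" fst]) auto
  also have "(\<Prod>(i,j)\<in>{(i,j). i < j}. d i) * (\<Prod>i\<in>UNIV. d i) * (\<Prod>(i,j)\<in>{(i,j). j \<le> i}. d i) =
     (\<Prod>i\<in>UNIV. d i) * ((\<Prod>(i,j)\<in>{(i,j). i < j}. d i) * (\<Prod>(i,j)\<in>{(i,j). j \<le> i}. d i))" by simp
  also have "(\<Prod>(i,j)\<in>{(i,j). i < j}. d i) * (\<Prod>(i,j)\<in>{(i,j). j \<le> i}. d i) = (\<Prod>(i,j)\<in>UNIV\<times>(UNIV::'r set). d i)"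
  proof -
    have "{(i::'r,j). i < j} \<union> {(i,j). j \<le> i} = UNIV\<times>UNIV" by auto
    thus ?thesis by (subst prod.union_disjoint[symmetric]) auto
  qed
  also have "(\<Prod>(i,j)\<in>UNIV\<times>(UNIV::'r set). d i) = (\<Prod>i\<in>UNIV. d i) ^ CARD('r)"
    by (subst prod.cartesian_product[symmetric]) (simp add: prod_power_distrib)
  finally show ?thesis by simp
qed

text \<open>The determinant is multiplicative in the congruence, so the contributions of
  \<open>U\<close> and its transpose cancel and the diagonal case remains.\<close>

lemma det_congr_vec_spmat:
  assumes U: "orthogonal_matrix U"
  shows "det (matrix (congr_vec (spmat U d :: real^'r::{finite,linorder}^'r::{finite,linorder}))) = (\<Prod>i\<in>UNIV. d i) ^ (CARD('r) + 1)"
proof -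
  have "det (matrix (congr_vec U)) * det (matrix (congr_vec (transpose U))) = det (matrix (congr_vec (mat 1 :: real^'r::{finite,linorder}^'r::{finite,linorder})))"
    using U by (simp add: det_congr_vec_mult[symmetric] orthogonal_matrix_def)
  also have "\<dots> = 1" using det_congr_vec_diag[of "\<lambda>_::'r. 1"] by (simp add: mat_def)
  finally have 1: "det (matrix (congr_vec U)) * det (matrix (congr_vec (transpose U))) = 1" .
  have "det (matrix (congr_vec (spmat U d))) = (det (matrix (congr_vec U)) * det (matrix (congr_vec (transpose U)))) *
     det (matrix (congr_vec (\<chi> i j. if i = j then d i else 0)))"
    by (simp add: spmat_def det_congr_vec_mult)
  thus ?thesis by (simp only: 1 det_congr_vec_diag)
qed

lemma nn_integral_change_of_variables:
  fixes G :: "real^'m::{finite,wellorder} \<Rightarrow> real^'m::{finite,wellorder}" and g :: "real^'m::{finite,wellorder} \<Rightarrow> ennreal"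
  assumes S: "S \<in> sets borel" and GS: "G ` S \<in> sets borel"
    and der: "\<And>x. x \<in> S \<Longrightarrow> (G has_derivative G' x) (at x within S)"
    and inj: "inj_on G S"
    and J: "\<And>x. x \<in> S \<Longrightarrow> J x = \<bar>det (matrix (G' x))\<bar>"
    and Jm: "(\<lambda>x. indicator S x * J x) \<in> borel_measurable borel"
    and g [measurable]: "g \<in> borel_measurable borel"
  shows "(\<integral>\<^sup>+ x. ennreal (J x) * g (G x) * indicator S x \<partial>lborel) = (\<integral>\<^sup>+ x. g x * indicator (G ` S) x \<partial>lborel)"
proof -
  define K where "K x = indicator S x * J x" for x
  have K0: "K x \<ge> 0" for x using J by (auto simp: K_def indicator_def)
  have Km [measurable]: "K \<in> borel_measurable borel" using Jm by (simp add: K_def[abs_def])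
  note S [measurable] GS [measurable]
  \<comment> \<open>Extending \<open>G\<close> by 0 makes it a globally measurable map; the density
    \<open>K\<close> vanishes where the value was changed.\<close>
  define T where "T x = (if x \<in> S then G x else 0)" for x
  have cont: "continuous_on S G"
    using der by (auto simp: continuous_on_eq_continuous_within intro: has_derivative_continuous)
  have Tm [measurable]: "T \<in> borel_measurable borel"
    unfolding T_def by (rule borel_measurable_continuous_on_if[OF S cont]) auto
  let ?M1 = "distr (density lborel (\<lambda>x. ennreal (K x))) borel T"
  let ?M2 = "density lborel (indicator (G ` S)) :: (real^'m::{finite,wellorder}) measure"
  have "?M1 = ?M2"
  proof (rule measure_eqI)
    fix A assume "A \<in> sets ?M1"
    hence A [measurable]: "A \<in> sets borel" by simp
    define S' where "S' = S \<inter> T -` A"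
    have S' [measurable]: "S' \<in> sets borel" unfolding S'_def using measurable_sets[OF Tm A] by auto
    have TA: "T -` A \<in> sets borel" using measurable_sets[OF Tm A] by simp
    have S'_eq: "G ` S' = G ` S \<inter> A" by (auto simp: S'_def T_def)
    have GS' [measurable]: "G ` S' \<in> sets borel" unfolding S'_eq by auto
    have 1: "emeasure ?M1 A = (\<integral>\<^sup>+ x. ennreal (K x * indicator S' x) \<partial>lborel)"
      by (simp add: emeasure_distr emeasure_density TA)
         (intro nn_integral_cong, auto simp: indicator_def S'_def K_def)
    have 2: "emeasure ?M2 A = emeasure lborel (G ` S')"
    proof -
      have "emeasure ?M2 A = (\<integral>\<^sup>+ x. indicator (G ` S) x * indicator A x \<partial>lborel)"
        by (rule emeasure_density) auto
      also have "\<dots> = (\<integral>\<^sup>+ x. indicator (G ` S') x \<partial>lborel)"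
        by (simp add: S'_eq indicator_inter_arith)
      finally show ?thesis by simp
    qed
    have iff: "(emeasure lborel (G ` S') = ennreal r) \<longleftrightarrow> ((\<integral>\<^sup>+ x. ennreal (K x * indicator S' x) \<partial>lborel) = ennreal r)"
      if r: "r \<ge> 0" for r
    proof -
      have "emeasure lborel (G ` S') = ennreal r \<longleftrightarrow> G ` S' \<in> lmeasurable \<and> measure lebesgue (G ` S') = r"
      proof
        assume "emeasure lborel (G ` S') = ennreal r"
        thus "G ` S' \<in> lmeasurable \<and> measure lebesgue (G ` S') = r"
          using r by (simp add: fmeasurable_def measure_def)
      next
        assume "G ` S' \<in> lmeasurable \<and> measure lebesgue (G ` S') = r"
        thus "emeasure lborel (G ` S') = ennreal r"
          using emeasure_eq_measure2[of "G ` S'" lebesgue] by simp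
      qed
      also have "\<dots> \<longleftrightarrow> ((\<lambda>x. \<bar>det (matrix (G' x))\<bar>) has_integral r) S'"
        by (rule has_measure_differentiable_image)
           (use der inj S' in \<open>auto simp: S'_def intro: has_derivative_subset inj_on_subset\<close>)
      also have "\<dots> \<longleftrightarrow> ((\<lambda>x. K x * indicator S' x) has_integral r) UNIV"
        by (subst has_integral_restrict_UNIV[symmetric], rule has_integral_cong)
           (auto simp: K_def S'_def J indicator_def)
      also have "\<dots> \<longleftrightarrow> (\<integral>\<^sup>+ x. ennreal (K x * indicator S' x) \<partial>lborel) = ennreal r"
        by (subst has_integral_iff_nn_integral_lebesgue)
           (auto simp: K0 nn_integral_completion r indicator_def intro!: measurable_completion)
      finally show ?thesis .
    qed
    have "emeasure lborel (G ` S') = (\<integral>\<^sup>+ x. ennreal (K x * indicator S' x) \<partial>lborel)"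
      (is "?a = ?b")
    proof (cases ?a rule: ennreal_cases)
      case (real r)
      hence "?b = ennreal r" using iff[of r] by blast
      thus ?thesis using real by simp
    next
      case top
      show ?thesis
      proof (cases ?b rule: ennreal_cases)
        case (real r)
        hence "?a = ennreal r" using iff[of r] by blast
        thus ?thesis using top by simp
      next
        case top': top
        show ?thesis unfolding top top' ..
      qed
    qed
    thus "emeasure ?M1 A = emeasure ?M2 A" using 1 2 by simp
  qed simp
  hence "(\<integral>\<^sup>+ x. g x \<partial>?M1) = (\<integral>\<^sup>+ x. g x \<partial>?M2)" by simp
  moreover have "(\<integral>\<^sup>+ x. g x \<partial>?M1) = (\<integral>\<^sup>+ x. ennreal (K x) * g (T x) \<partial>lborel)"
    by (simp add: nn_integral_distr nn_integral_density)
  moreover have "\<dots> = (\<integral>\<^sup>+ x. ennreal (J x) * g (G x) * indicator S x \<partial>lborel)"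
    by (intro nn_integral_cong) (auto simp: K_def T_def indicator_def)
  ultimately show ?thesis by (simp add: nn_integral_density mult.commute)
qed

lemma has_derivative_sym_of_vec: "(sym_of_vec has_derivative sym_of_vec) F"
  by (rule bounded_linear_imp_has_derivative[OF bounded_linear_sym_of_vec])
lemma has_derivative_vec_of_sym: "(vec_of_sym has_derivative vec_of_sym) F"
  by (rule bounded_linear_imp_has_derivative[OF bounded_linear_vec_of_sym])

text \<open>A derivative of the form H \<mapsto> P H P with symmetric P is a congruence, whose
  Jacobian in coordinates is det P to the power r + 1. Both kinds of substitution used below,
  fractional linear maps and congruences, have derivatives of this form.\<close>

lemma nn_integral_sym_change_of_variables:
  fixes T :: "real^'r::{finite,linorder}^'r::{finite,linorder} \<Rightarrow> real^'r::{finite,linorder}^'r::{finite,linorder}"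
  assumes S [measurable]: "S \<in> sets borel" and TS [measurable]: "T ` S \<in> sets borel"
    and SS: "S \<subseteq> sym_matrices" "T ` S \<subseteq> sym_matrices"
    and der: "\<And>A. A \<in> S \<Longrightarrow> (T has_derivative (\<lambda>H. P A ** H ** P A)) (at A within S)"
    and P: "\<And>A. A \<in> S \<Longrightarrow> transpose (P A) = P A"
    and J: "\<And>A. A \<in> S \<Longrightarrow> J A = \<bar>det (P A)\<bar> ^ (CARD('r) + 1)"
    and Jm [measurable]: "(\<lambda>A. indicator S A * J A) \<in> borel_measurable borel"
    and inj: "inj_on T S"
    and g [measurable]: "g \<in> borel_measurable borel"
  shows "(\<integral>\<^sup>+ A. ennreal (J A) * g (T A) * indicator S A \<partial>sym_lborel) = (\<integral>\<^sup>+ A. g A * indicator (T ` S) A \<partial>sym_lborel)"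
proof -
  let ?s = sym_of_vec and ?v = vec_of_sym
  define S' where "S' = ?s -` S"
  define G where "G x = ?v (T (?s x))" for x
  have sG: "?s (G x) = T (?s x)" if "x \<in> S'" for x
    using that SS by (auto simp: G_def S'_def sym_matrices_iff)
  have S' [measurable]: "S' \<in> sets borel" using measurable_sets[OF borel_measurable_sym_of_vec S] by (simp add: S'_def)
  have sS': "?s ` S' = S"
  proof (intro equalityI subsetI)
    fix A assume A: "A \<in> S"
    hence sv: "?s (?v A) = A" using SS by (auto simp: sym_matrices_iff)
    hence "?v A \<in> S'" using A by (simp add: S'_def)
    thus "A \<in> ?s ` S'" using sv by (metis imageI)
  qed (auto simp: S'_def)
  have iff: "x \<in> G ` S' \<longleftrightarrow> ?s x \<in> T ` S" for x
  proof
    assume "x \<in> G ` S'"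
    then obtain y where y: "y \<in> S'" "x = G y" by blast
    have "?s y \<in> S" using y(1) by (simp add: S'_def)
    thus "?s x \<in> T ` S" using sG[OF y(1)] y(2) by simp
  next
    assume "?s x \<in> T ` S"
    then obtain A where A: "A \<in> S" "?s x = T A" by blast
    then obtain y where y: "y \<in> S'" "A = ?s y" using sS' by blast
    have "G y = ?v (?s x)" using A(2) y(2) by (simp add: G_def)
    hence "G y = x" by simp
    thus "x \<in> G ` S'" using y(1) by blast
  qed
  hence "G ` S' = ?s -` (T ` S)" by (intro set_eqI) (simp only: vimage_eq)
  hence GS: "G ` S' \<in> sets borel" using measurable_sets[OF borel_measurable_sym_of_vec TS] by simp
  have cont: "continuous_on S T"
    using der by (auto simp: continuous_on_eq_continuous_within intro: has_derivative_continuous)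
  have Tm [measurable]: "(\<lambda>A. if A \<in> S then T A else 0) \<in> borel_measurable borel"
    by (rule borel_measurable_continuous_on_if[OF S cont]) auto
  have "(\<integral>\<^sup>+ A. ennreal (J A) * g (T A) * indicator S A \<partial>sym_lborel) =
     (\<integral>\<^sup>+ A. ennreal (indicator S A * J A) * g (if A \<in> S then T A else 0) \<partial>sym_lborel)"
    by (intro nn_integral_cong) (auto simp: indicator_def)
  also have "\<dots> = (\<integral>\<^sup>+ x. ennreal (indicator S (?s x) * J (?s x)) * g (if ?s x \<in> S then T (?s x) else 0) \<partial>lborel)"
    by (rule nn_integral_sym_lborel) measurable
  also have "\<dots> = (\<integral>\<^sup>+ x. ennreal (J (?s x)) * g (?s (G x)) * indicator S' x \<partial>lborel)"
    by (intro nn_integral_cong) (auto simp: indicator_def S'_def sG)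
  also have "\<dots> = (\<integral>\<^sup>+ x. g (?s x) * indicator (G ` S') x \<partial>lborel)"
  proof (rule nn_integral_change_of_variables[OF S' GS, where G' = "\<lambda>x. congr_vec (P (?s x))" and g = "\<lambda>x. g (?s x)"])
    fix x assume x: "x \<in> S'"
    hence xS: "?s x \<in> S" by (simp add: S'_def)
    have "(T has_derivative (\<lambda>H. P (?s x) ** H ** P (?s x))) (at (?s x) within ?s ` S')"
      using der[OF xS] by (simp add: sS')
    from diff_chain_within[OF diff_chain_within[OF has_derivative_sym_of_vec this] has_derivative_vec_of_sym]
    show "(G has_derivative congr_vec (P (?s x))) (at x within S')"
      by (simp add: o_def G_def[abs_def] congr_vec_def[abs_def] P[OF xS])
    obtain U d where U: "orthogonal_matrix U" "P (?s x) = spmat U d" using P[OF xS] by (rule spectral_theorem)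
    show "J (?s x) = \<bar>det (matrix (congr_vec (P (?s x))))\<bar>"
      by (simp add: J[OF xS] U det_congr_vec_spmat det_spmat power_abs[symmetric] del: power_Suc)
  next
    show "inj_on G S'"
    proof (rule inj_onI)
      fix x y assume xy: "x \<in> S'" "y \<in> S'" "G x = G y"
      hence "T (?s x) = T (?s y)" using sG[OF xy(1)] sG[OF xy(2)] by simp
      hence "?s x = ?s y" using inj xy by (auto simp: inj_on_def S'_def)
      hence "?v (?s x) = ?v (?s y)" by simp
      thus "x = y" by simp
    qed
    have "(\<lambda>x. indicator S (?s x) * J (?s x)) \<in> borel_measurable borel" by measurable
    thus "(\<lambda>x. indicator S' x * J (?s x)) \<in> borel_measurable borel"
      by (simp add: S'_def indicator_def)
  qed measurable
  also have "\<dots> = (\<integral>\<^sup>+ x. g (?s x) * indicator (T ` S) (?s x) \<partial>lborel)"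
    by (intro nn_integral_cong) (auto simp: indicator_def iff)
  also have "\<dots> = (\<integral>\<^sup>+ A. g A * indicator (T ` S) A \<partial>sym_lborel)"
    by (rule nn_integral_sym_lborel[symmetric]) measurable
  finally show ?thesis .
qed

section \<open>Determinant, inverse and the topology of positive definite matrices\<close>

lemma continuous_on_det [continuous_intros]:
  "continuous_on S f \<Longrightarrow> continuous_on S (\<lambda>x. det (f x :: real^'n^'n))"
  unfolding det_def by (intro continuous_intros)

lemma differentiable_det: "(det :: real^'n^'n \<Rightarrow> real) differentiable (at A within S)"
proof -
  have "\<exists>D. ((\<lambda>A. \<Prod>i\<in>UNIV. A $ i $ p i) has_derivative D) (at A within S)" for p :: "'n \<Rightarrow> 'n"
    by (rule exI, rule has_derivative_prod)
       (rule bounded_linear_imp_has_derivative, intro bounded_linear_compose[OF bounded_linear_vec_nth bounded_linear_vec_nth])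
  hence "(\<lambda>A. \<Prod>i\<in>UNIV. A $ i $ p i) differentiable (at A within S)" for p :: "'n \<Rightarrow> 'n"
    by (simp add: differentiable_def)
  thus ?thesis unfolding det_def[abs_def] by (intro differentiable_sum differentiable_mult differentiable_const ballI) auto
qed

lemma norm_matrix_vector_le: "norm ((B::real^'m^'n) *v x) \<le> norm B * norm x"
proof -
  have "(norm (B *v x))\<^sup>2 = (\<Sum>i\<in>UNIV. (B $ i \<bullet> x)\<^sup>2)"
    by (simp only: power2_norm_eq_inner inner_vec_def[of "B *v x"] matrix_vector_mul_component) (simp add: power2_eq_square)
  also have "\<dots> \<le> (\<Sum>i\<in>UNIV. (norm (B $ i))\<^sup>2 * (norm x)\<^sup>2)"
    unfolding power_mult_distrib[symmetric]
    by (intro sum_mono) (simp add: abs_le_square_iff[symmetric] Cauchy_Schwarz_ineq2)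
  also have "\<dots> = (norm B)\<^sup>2 * (norm x)\<^sup>2"
  proof -
    have "(norm B)\<^sup>2 = (\<Sum>i\<in>UNIV. (norm (B $ i))\<^sup>2)"
      by (simp only: power2_norm_eq_inner inner_vec_def[of B])
    thus ?thesis by (simp only: sum_distrib_right)
  qed
  finally show ?thesis by (simp add: power_mult_distrib[symmetric] power2_le_iff_abs_le)
qed

text \<open>By compactness the quadratic form has a positive minimum e on the unit sphere, and a
  perturbation of norm less than e leaves it positive. The set contains non-symmetric matrices as
  well; this makes it open among all matrices, so that \<open>RR\<close> is its trace, with a second
  such set, on the symmetric ones.\<close>

lemma open_quadratic_pos: "open {A::real^'n^'n. \<forall>x. x \<noteq> 0 \<longrightarrow> 0 < x \<bullet> (A *v x)}"
proof (rule openI)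
  fix A assume "A \<in> {A::real^'n^'n. \<forall>x. x \<noteq> 0 \<longrightarrow> 0 < x \<bullet> (A *v x)}"
  hence A: "\<And>x. x \<noteq> 0 \<Longrightarrow> 0 < x \<bullet> (A *v x)" by auto
  have ne: "sphere (0::real^'n) 1 \<noteq> {}" by simp
  have "continuous_on (sphere 0 1) (\<lambda>x. x \<bullet> (A *v x))" by (intro continuous_intros linear_continuous_on) (auto simp: matrix_vector_mul_bounded_linear)
  from continuous_attains_inf[OF compact_sphere ne this] obtain y where y: "y \<in> sphere 0 1"
    and mn: "\<And>x. x \<in> sphere 0 1 \<Longrightarrow> y \<bullet> (A *v y) \<le> x \<bullet> (A *v x)" by blast
  define e where "e = y \<bullet> (A *v y)"
  have "y \<noteq> 0" using y by auto
  hence e: "e > 0" using A by (simp add: e_def)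
  have "ball A e \<subseteq> {A. \<forall>x. x \<noteq> 0 \<longrightarrow> 0 < x \<bullet> (A *v x)}"
  proof (intro subsetI CollectI allI impI)
    fix B and x :: "real^'n" assume B: "B \<in> ball A e" and x: "x \<noteq> 0"
    have "(1 / norm x) *\<^sub>R x \<in> sphere 0 1" using x by simp
    from mn[OF this] have "e \<le> (1/norm x) * ((1/norm x) * (x \<bullet> (A *v x)))"
      by (simp add: matrix_vector_mult_scaleR e_def)
    hence 1: "e * (norm x)\<^sup>2 \<le> x \<bullet> (A *v x)" using x by (simp add: field_simps power2_eq_square)
    have "\<bar>x \<bullet> ((B - A) *v x)\<bar> \<le> norm x * (norm (B - A) * norm x)"
      by (rule order_trans[OF Cauchy_Schwarz_ineq2 mult_left_mono[OF norm_matrix_vector_le norm_ge_zero]])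
    also have "\<dots> < e * (norm x)\<^sup>2" using B x by (simp add: dist_norm norm_minus_commute power2_eq_square)
    finally have 2: "\<bar>x \<bullet> ((B - A) *v x)\<bar> < e * (norm x)\<^sup>2" .
    have "x \<bullet> (B *v x) = x \<bullet> (A *v x) + x \<bullet> ((B - A) *v x)"
      by (simp add: matrix_vector_mult_diff_rdistrib inner_diff_right)
    thus "0 < x \<bullet> (B *v x)" using 1 2 by linarith
  qed
  thus "\<exists>e>0. ball A e \<subseteq> {A. \<forall>x. x \<noteq> 0 \<longrightarrow> 0 < x \<bullet> (A *v x)}" using e by blast
qed

lemma pos_def_openin:
  obtains V :: "(real^'n^'n) set" where "open V" "Collect pos_def = sym_matrices \<inter> V"
  by (rule that[OF open_quadratic_pos]) (auto simp: pos_def_def sym_matrices_def)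

lemma RR_openin:
  obtains V :: "(real^'n^'n) set" where "open V" "RR = sym_matrices \<inter> V"
proof -
  let ?Q = "{A::real^'n^'n. \<forall>x. x \<noteq> 0 \<longrightarrow> 0 < x \<bullet> (A *v x)}"
  have "open ((\<lambda>A. mat 1 - A) -` ?Q)" by (intro open_vimage open_quadratic_pos continuous_intros)
  hence "open (?Q \<inter> (\<lambda>A. mat 1 - A) -` ?Q)" using open_quadratic_pos by (rule open_Int[rotated])
  moreover have "transpose (mat 1 - A) = mat 1 - A" if "transpose A = A" for A :: "real^'n^'n"
    using that by (simp add: transpose_def vec_eq_iff mat_def)
  hence "RR = sym_matrices \<inter> (?Q \<inter> (\<lambda>A. mat 1 - A) -` ?Q)"
    by (auto simp: RR_def sym_matrices_def pos_def_def)
  ultimately show ?thesis using that by blast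
qed

lemma borel_pos_def [measurable]: "Collect pos_def \<in> sets (borel :: (real^'n^'n) measure)"
proof -
  obtain V :: "(real^'n^'n) set" where V: "open V" "Collect pos_def = sym_matrices \<inter> V" by (rule pos_def_openin)
  show ?thesis unfolding V(2) by (intro sets.Int borel_closed closed_sym_matrices borel_open V(1))
qed
lemma borel_RR [measurable]: "RR \<in> sets (borel :: (real^'n^'n) measure)"
proof -
  obtain V :: "(real^'n^'n) set" where V: "open V" "RR = sym_matrices \<inter> V" by (rule RR_openin)
  show ?thesis unfolding V(2) by (intro sets.Int borel_closed closed_sym_matrices borel_open V(1))
qed

lemma RR_pos_def: "A \<in> RR \<Longrightarrow> pos_def A" by (simp add: RR_def)
lemma RR_symmetric: "A \<in> RR \<Longrightarrow> transpose A = A" by (simp add: RR_def sym_matrices_def)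

lemma invertible_matrix_inv:
  fixes A :: "real^'n^'n" assumes "invertible A"
  shows "A ** matrix_inv A = mat 1" "matrix_inv A ** A = mat 1"
proof -
  have "A ** matrix_inv A = mat 1 \<and> matrix_inv A ** A = mat 1"
    unfolding matrix_inv_def by (rule someI_ex) (use assms in \<open>auto simp: invertible_def\<close>)
  thus "A ** matrix_inv A = mat 1" "matrix_inv A ** A = mat 1" by auto
qed

text \<open>By Cramer's rule the entries of the inverse are quotients of determinants.\<close>

lemma continuous_on_matrix_inv [continuous_intros]:
  fixes f :: "'a::topological_space \<Rightarrow> real^'n^'n"
  assumes f: "continuous_on S f" and nz: "\<And>x. x \<in> S \<Longrightarrow> det (f x) \<noteq> 0"
  shows "continuous_on S (\<lambda>x. matrix_inv (f x))"
proof -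
  let ?C = "\<lambda>x k l. (\<chi> i j. if j = k then (axis l 1 :: real^'n) $ i else f x $ i $ j) :: real^'n^'n"
  have eq: "matrix_inv (f x) $ k $ l = det (?C x k l) / det (f x)" if "x \<in> S" for x k l
  proof -
    have "invertible (f x)" using nz[OF that] by (simp add: invertible_det_nz)
    hence "f x *v (matrix_inv (f x) *v axis l 1) = axis l 1"
      by (simp add: matrix_vector_mul_assoc invertible_matrix_inv)
    hence "matrix_inv (f x) *v axis l 1 = (\<chi> k. det (?C x k l) / det (f x))" using nz[OF that] by (subst (asm) cramer) auto
    hence "(matrix_inv (f x) *v axis l 1) $ k = det (?C x k l) / det (f x)" by simp
    thus ?thesis by (simp add: matrix_vector_mult_def axis_def if_distrib[of "\<lambda>x. _ * x"] cong: if_cong)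
  qed
  have C: "continuous_on S (\<lambda>x. ?C x k l)" for k l
  proof (intro continuous_on_vec_lambda)
    fix i j show "continuous_on S (\<lambda>x. if j = k then (axis l 1 :: real^'n) $ i else f x $ i $ j)"
      using f by (cases "j = k") (auto intro!: continuous_intros)
  qed
  have "continuous_on S (\<lambda>x. \<chi> k l. det (?C x k l) / det (f x))"
    by (intro continuous_on_vec_lambda continuous_on_divide continuous_on_det C f) (use nz in auto)
  thus ?thesis by (rule continuous_on_eq) (auto simp: vec_eq_iff eq)
qed

section \<open>Fractional linear substitutions\<close>

lemma affine_spmat:
  assumes "orthogonal_matrix U"
  shows "b *\<^sub>R mat 1 + c *\<^sub>R spmat U d = spmat U (\<lambda>i. b + c * d i)"
  by (simp add: spmat_1[OF assms] spmat_scaleR spmat_add)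

text \<open>The substitution behind \<open>prior2J\<close> is \<open>\<Omega> = mob (v / v0) (1 - v / v0) \<Lambda>\<close>.\<close>

definition mob :: "real \<Rightarrow> real \<Rightarrow> real^'n^'n \<Rightarrow> real^'n^'n" where
  "mob b c A = A ** matrix_inv (b *\<^sub>R mat 1 + c *\<^sub>R A)"

lemma mob_spmat:
  assumes "orthogonal_matrix U" "\<And>i. b + c * d i \<noteq> 0"
  shows "mob b c (spmat U d) = spmat U (\<lambda>i. d i / (b + c * d i))"
  by (simp add: mob_def affine_spmat matrix_inv_spmat spmat_mult assms)

lemma affine_pos_def:
  fixes A :: "real^'n^'n"
  assumes A: "pos_def A" and bc: "0 < b" "0 \<le> c"
  shows "0 < det (b *\<^sub>R mat 1 + c *\<^sub>R A)" and "norm (matrix_inv (b *\<^sub>R mat 1 + c *\<^sub>R A)) \<le> real CARD('n) * (1 / b)"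
    and "invertible (b *\<^sub>R mat 1 + c *\<^sub>R A)"
    and "transpose (matrix_inv (b *\<^sub>R mat 1 + c *\<^sub>R A)) = matrix_inv (b *\<^sub>R mat 1 + c *\<^sub>R A)"
    and "A ** matrix_inv (b *\<^sub>R mat 1 + c *\<^sub>R A) = matrix_inv (b *\<^sub>R mat 1 + c *\<^sub>R A) ** A"
    and "det (matrix_inv (b *\<^sub>R mat 1 + c *\<^sub>R A)) = 1 / det (b *\<^sub>R mat 1 + c *\<^sub>R A)"
proof -
  obtain U d where U: "orthogonal_matrix U" and Ad: "A = spmat U d" and d: "\<And>i. 0 < d i" by (rule pos_def_obtain[OF A]) blast
  have p: "0 < b + c * d i" for i using bc d[of i] by (simp add: add_pos_nonneg less_imp_le)
  hence nz: "b + c * d i \<noteq> 0" for i by (metis less_irrefl)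
  have B: "b *\<^sub>R mat 1 + c *\<^sub>R A = spmat U (\<lambda>i. b + c * d i)" by (simp add: Ad affine_spmat U)
  have iB: "matrix_inv (b *\<^sub>R mat 1 + c *\<^sub>R A) = spmat U (\<lambda>i. 1 / (b + c * d i))"
    unfolding B by (rule matrix_inv_spmat[OF U nz])
  show dp: "0 < det (b *\<^sub>R mat 1 + c *\<^sub>R A)" unfolding B det_spmat[OF U] by (intro prod_pos p)
  show "invertible (b *\<^sub>R mat 1 + c *\<^sub>R A)" using dp by (simp add: invertible_det_nz)
  show "norm (matrix_inv (b *\<^sub>R mat 1 + c *\<^sub>R A)) \<le> real CARD('n) * (1 / b)"
  proof (unfold iB, rule norm_spmat_le[OF U])
    fix i
    have "1 / (b + c * d i) \<le> 1 / b" using bc d[of i] p[of i] by (intro divide_left_mono mult_pos_pos) (auto simp: less_imp_le)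
    thus "\<bar>1 / (b + c * d i)\<bar> \<le> 1 / b" using p[of i] by simp
  qed
  show "transpose (matrix_inv (b *\<^sub>R mat 1 + c *\<^sub>R A)) = matrix_inv (b *\<^sub>R mat 1 + c *\<^sub>R A)" by (simp add: iB)
  show "A ** matrix_inv (b *\<^sub>R mat 1 + c *\<^sub>R A) = matrix_inv (b *\<^sub>R mat 1 + c *\<^sub>R A) ** A"
    unfolding iB unfolding Ad by (simp add: spmat_mult U)
  show "det (matrix_inv (b *\<^sub>R mat 1 + c *\<^sub>R A)) = 1 / det (b *\<^sub>R mat 1 + c *\<^sub>R A)"
    unfolding iB unfolding B det_spmat[OF U] by (simp add: prod_dividef)
qed

text \<open>A resolvent identity. With B = b I + c A and B' = b I + c A' the terms in c cancel in B
  A' - A B' = b (A' - A); multiplying by the inverses and commuting A with the inverse of B gives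
  the claim. Differentiability and injectivity of \<open>mob\<close> both rest on this exact
  formula.\<close>

lemma mob_diff:
  fixes A A' :: "real^'n^'n"
  assumes A: "pos_def A" "pos_def A'" and bc: "0 < b" "0 \<le> c"
  shows "mob b c A' - mob b c A = b *\<^sub>R (matrix_inv (b *\<^sub>R mat 1 + c *\<^sub>R A) ** (A' - A) ** matrix_inv (b *\<^sub>R mat 1 + c *\<^sub>R A'))"
proof -
  let ?B = "b *\<^sub>R mat 1 + c *\<^sub>R A" and ?B' = "b *\<^sub>R mat 1 + c *\<^sub>R A'"
  let ?I = "matrix_inv ?B" and ?I' = "matrix_inv ?B'"
  note i = invertible_matrix_inv[OF affine_pos_def(3)[OF A(1) bc]] and i' = invertible_matrix_inv[OF affine_pos_def(3)[OF A(2) bc]]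
  have "b *\<^sub>R (A' - A) = ?B ** A' - A ** ?B'"
    by (simp add: matrix_mult_add_left matrix_mult_add_right matrix_mult_scaleR_left matrix_mult_scaleR_right scaleR_diff_right)
  hence "b *\<^sub>R (?I ** (A' - A) ** ?I') = ?I ** (?B ** A' - A ** ?B') ** ?I'"
    by (metis matrix_mult_scaleR_left matrix_mult_scaleR_right)
  also have "\<dots> = (?I ** ?B) ** A' ** ?I' - ?I ** A ** (?B' ** ?I')"
    by (simp only: matrix_mult_diff_left matrix_mult_diff_right matrix_mul_assoc)
  also have "\<dots> = A' ** ?I' - ?I ** A" by (simp only: i i' matrix_mul_lid matrix_mul_rid)
  also have "?I ** A = A ** ?I" by (rule affine_pos_def(5)[OF A(1) bc, symmetric])
  finally show ?thesis by (simp add: mob_def)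
qed

text \<open>By the exact difference formula the error of linearisation contains the difference of
  two resolvents, which is itself linear in Y - A, so the error is quadratic. On positive definite
  matrices the resolvents are bounded uniformly. Distributing sqrt b over the two outer factors
  gives the form H \<mapsto> P H P that the change of variables expects.\<close>

lemma has_derivative_mob:
  fixes A :: "real^'n^'n"
  assumes A: "pos_def A" and bc: "0 < b" "0 \<le> c"
  defines "P \<equiv> sqrt b *\<^sub>R matrix_inv (b *\<^sub>R mat 1 + c *\<^sub>R A)"
  shows "(mob b c has_derivative (\<lambda>H. P ** H ** P)) (at A within Collect pos_def)"
proof -
  define B where "B = (\<lambda>A::real^'n^'n. b *\<^sub>R mat 1 + c *\<^sub>R A)"
  define I where "I = (\<lambda>A. matrix_inv (B A))"
  have PP: "P ** H ** P = b *\<^sub>R (I A ** H ** I A)" for H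
    using bc by (simp add: P_def I_def B_def matrix_mult_scaleR_left matrix_mult_scaleR_right)
  obtain K where K: "K > 0" "\<And>(X :: real^'n^'n) (Y :: real^'n^'n). norm (X ** Y) \<le> norm X * norm Y * K"
    using bounded_bilinear.pos_bounded[OF bounded_bilinear_matrix_mult] by blast
  define m where "m = real CARD('n) * (1 / b)"
  have m0: "m \<ge> 0" using bc by (simp add: m_def)
  have nI: "norm (I X) \<le> m" if "pos_def X" for X using affine_pos_def(2)[OF that bc] by (simp add: I_def B_def m_def)
  have Id: "I Y - I A = - c *\<^sub>R (I Y ** (Y - A) ** I A)" if Y: "pos_def Y" for Y
  proof -
    have i: "B A ** I A = mat 1" "I Y ** B Y = mat 1"
      using invertible_matrix_inv(1)[OF affine_pos_def(3)[OF A bc]] invertible_matrix_inv(2)[OF affine_pos_def(3)[OF Y bc]]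
      by (simp_all add: B_def I_def)
    have "- c *\<^sub>R (Y - A) = B A - B Y" by (simp add: B_def scaleR_diff_right)
    hence "- c *\<^sub>R (I Y ** (Y - A) ** I A) = I Y ** (B A - B Y) ** I A"
      by (metis matrix_mult_scaleR_left matrix_mult_scaleR_right)
    also have "\<dots> = I Y ** (B A ** I A) - (I Y ** B Y) ** I A"
      by (simp only: matrix_mult_diff_left matrix_mult_diff_right matrix_mul_assoc)
    finally show ?thesis by (simp only: i matrix_mul_lid matrix_mul_rid)
  qed
  have le2: "norm (X ** Y) \<le> x * y * K" if "norm X \<le> x" "norm Y \<le> y" for X Y :: "real^'n^'n" and x y
  proof -
    have "norm X * norm Y * K \<le> x * y * K"
      using that K(1) order_trans[OF norm_ge_zero that(1)] by (intro mult_right_mono mult_mono) auto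
    thus ?thesis using K(2)[of X Y] by linarith
  qed
  \<comment> \<open>Constant of the quadratic error bound: \<open>m\<close> bounds the resolvents,
    and each factor \<open>K\<close> comes from one matrix product.\<close>
  define L where "L = b * ((m * 1 * K) * (c * ((m * 1 * K) * m * K)) * K)"
  show ?thesis
  proof (rule has_derivativeI_sandwich[where e = 1 and H = "\<lambda>Y. L * norm (Y - A)"])
    show "bounded_linear (\<lambda>H. P ** H ** P)"
      by (rule bounded_linear_compose[OF bounded_bilinear.bounded_linear_left[OF bounded_bilinear_matrix_mult]
            bounded_bilinear.bounded_linear_right[OF bounded_bilinear_matrix_mult]])
    have "((\<lambda>Y. L * norm (Y - A)) \<longlongrightarrow> L * norm (A - A)) (at A within Collect pos_def)"
      by (intro tendsto_intros)
    thus "((\<lambda>Y. L * norm (Y - A)) \<longlongrightarrow> 0) (at A within Collect pos_def)" by simp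
  next
    fix Y assume Y: "Y \<in> Collect pos_def" and ne: "Y \<noteq> A"
    hence pY: "pos_def Y" by simp
    define h where "h = norm (Y - A)"
    have h: "h > 0" using ne by (simp add: h_def)
    have "mob b c Y - mob b c A - P ** (Y - A) ** P = b *\<^sub>R (I A ** (Y - A) ** (I Y - I A))"
      unfolding PP using mob_diff[OF A pY bc]
      by (simp only: matrix_mult_diff_right scaleR_diff_right I_def B_def)
    also have "norm \<dots> \<le> b * ((m * h * K) * (c * ((m * h * K) * m * K)) * K)"
    proof -
      have 1: "norm (I A ** (Y - A)) \<le> m * h * K" by (rule le2[OF nI[OF A]]) (simp add: h_def)
      have 2: "norm (I Y ** (Y - A) ** I A) \<le> (m * h * K) * m * K"
        by (rule le2[OF le2[OF nI[OF pY]] nI[OF A]]) (simp add: h_def)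
      have 3: "norm (I Y - I A) \<le> c * ((m * h * K) * m * K)"
        unfolding Id[OF pY] using mult_left_mono[OF 2 bc(2)] bc(2) by simp
      show ?thesis using mult_left_mono[OF le2[OF 1 3], of b] bc(1) by simp
    qed
    also have "\<dots> = L * h * h" by (simp add: L_def mult_ac)
    finally have "norm (mob b c Y - mob b c A - P ** (Y - A) ** P) \<le> L * h * h" .
    thus "norm (mob b c Y - mob b c A - P ** (Y - A) ** P) / norm (Y - A) \<le> L * norm (Y - A)"
      using h by (simp add: h_def[symmetric] field_simps)
  qed simp
qed

lemma inj_on_mob:
  assumes bc: "0 < b" "0 \<le> c" shows "inj_on (mob b c) (Collect pos_def)"
proof (rule inj_onI)
  fix A A' :: "real^'n^'n" assume pA: "A \<in> Collect pos_def" "A' \<in> Collect pos_def" and eq: "mob b c A = mob b c A'"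
  hence A: "pos_def A" "pos_def A'" by auto
  let ?B = "b *\<^sub>R mat 1 + c *\<^sub>R A" and ?B' = "b *\<^sub>R mat 1 + c *\<^sub>R A'"
  have "b *\<^sub>R (matrix_inv ?B ** (A' - A) ** matrix_inv ?B') = 0" using mob_diff[OF A bc] eq by simp
  hence "matrix_inv ?B ** (A' - A) ** matrix_inv ?B' = 0" using bc by simp
  hence "?B ** (matrix_inv ?B ** (A' - A) ** matrix_inv ?B') ** ?B' = 0"
    by (simp only: matrix_mult_zero_left matrix_mult_zero_right)
  moreover have "?B ** (matrix_inv ?B ** (A' - A) ** matrix_inv ?B') ** ?B' = (?B ** matrix_inv ?B) ** (A' - A) ** (matrix_inv ?B' ** ?B')"
    by (simp only: matrix_mul_assoc)
  ultimately have "A' - A = 0"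
    by (simp only: invertible_matrix_inv[OF affine_pos_def(3)[OF A(1) bc]] invertible_matrix_inv[OF affine_pos_def(3)[OF A(2) bc]] matrix_mul_lid matrix_mul_rid)
  thus "A = A'" by simp
qed

text \<open>Inverse of d \<mapsto> d / (b + c d) on the positive numbers, to be applied to
  eigenvalues.\<close>

lemma scalar_mob_inverse:
  fixes b c g :: real
  assumes "0 < b" "0 \<le> c" "0 < g" "c * g < 1"
  shows "b * g / (1 - c * g) / (b + c * (b * g / (1 - c * g))) = g" and "0 < b * g / (1 - c * g)"
proof -
  have p: "1 - c * g > 0" using assms by simp
  have "b + c * (b * g / (1 - c * g)) = b / (1 - c * g)" using p by (simp add: field_simps)
  thus "b * g / (1 - c * g) / (b + c * (b * g / (1 - c * g))) = g" using p assms by simp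
  show "0 < b * g / (1 - c * g)" using p assms by simp
qed

text \<open>On eigenvalues the map is a bijection from the positive numbers onto the positive g with
  c g < 1.\<close>

lemma mob_image_pos_def:
  fixes b c :: real
  assumes bc: "0 < b" "0 \<le> c"
  shows "mob b c ` Collect pos_def = {A::real^'n^'n. pos_def A \<and> pos_def (mat 1 - c *\<^sub>R A)}"
proof (intro equalityI subsetI)
  fix G :: "real^'n^'n" assume "G \<in> mob b c ` Collect pos_def"
  then obtain A where A: "pos_def A" "G = mob b c A" by blast
  obtain U d where U: "orthogonal_matrix U" and Ad: "A = spmat U d" and d: "\<And>i. 0 < d i" by (rule pos_def_obtain[OF A(1)]) blast
  have p: "0 < b + c * d i" for i using bc d[of i] by (simp add: add_pos_nonneg less_imp_le)
  have G: "G = spmat U (\<lambda>i. d i / (b + c * d i))"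
    unfolding A(2) Ad by (rule mob_spmat[OF U]) (use p in \<open>auto simp: less_le\<close>)
  have "mat 1 - c *\<^sub>R G = spmat U (\<lambda>i. 1 - c * (d i / (b + c * d i)))"
    by (simp add: G spmat_1[OF U] spmat_scaleR spmat_diff)
  moreover have "0 < 1 - c * (d i / (b + c * d i))" for i using p[of i] bc by (simp add: field_simps)
  ultimately show "G \<in> {A. pos_def A \<and> pos_def (mat 1 - c *\<^sub>R A)}"
    using G d p by (simp add: pos_def_spmat[OF U])
next
  fix G :: "real^'n^'n" assume "G \<in> {A. pos_def A \<and> pos_def (mat 1 - c *\<^sub>R A)}"
  hence G: "pos_def G" "pos_def (mat 1 - c *\<^sub>R G)" by auto
  obtain U g where U: "orthogonal_matrix U" and Gg: "G = spmat U g" and g: "\<And>i. 0 < g i" by (rule pos_def_obtain[OF G(1)]) blast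
  have "mat 1 - c *\<^sub>R G = spmat U (\<lambda>i. 1 - c * g i)" by (simp add: Gg spmat_1[OF U] spmat_scaleR spmat_diff)
  hence cg: "c * g i < 1" for i using G(2) pos_def_spmat[OF U] by simp
  note s = scalar_mob_inverse[OF bc g cg]
  define A where "A = spmat U (\<lambda>i. b * g i / (1 - c * g i))"
  have "pos_def A" using s(2) by (simp add: A_def pos_def_spmat[OF U])
  moreover have "mob b c A = G"
  proof -
    have "0 < b + c * (b * g i / (1 - c * g i))" for i
      by (rule add_pos_nonneg[OF bc(1) mult_nonneg_nonneg[OF bc(2) less_imp_le[OF s(2)]]])
    hence "b + c * (b * g i / (1 - c * g i)) \<noteq> 0" for i by (metis less_irrefl)
    from mob_spmat[OF U this] show ?thesis by (simp only: A_def Gg s(1))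
  qed
  ultimately show "G \<in> mob b c ` Collect pos_def" by blast
qed

text \<open>The condition b + c = 1 says that the eigenvalue map d \<mapsto> d / (b + c d) fixes 1,
  besides 0, so it maps the unit interval onto itself.\<close>

lemma mob_image_RR:
  fixes b c :: real
  assumes bc: "0 < b" "0 \<le> c" "b + c = 1"
  shows "mob b c ` RR = (RR :: (real^'n^'n) set)"
proof (intro equalityI subsetI)
  fix G :: "real^'n^'n" assume "G \<in> mob b c ` RR"
  then obtain A where A: "A \<in> RR" "G = mob b c A" by blast
  obtain U d where U: "orthogonal_matrix U" and Ad: "A = spmat U d" and d: "\<And>i. 0 < d i" "\<And>i. d i < 1" by (rule RR_obtain[OF A(1)]) blast
  have p: "0 < b + c * d i" for i using bc d[of i] by (simp add: add_pos_nonneg less_imp_le)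
  have G: "G = spmat U (\<lambda>i. d i / (b + c * d i))"
    unfolding A(2) Ad by (rule mob_spmat[OF U]) (use p in \<open>auto simp: less_le\<close>)
  have "d i / (b + c * d i) < 1" for i
  proof -
    have "d i = b * d i + c * d i" using bc(3) by (simp add: distrib_right[symmetric])
    moreover have "b * d i < b" using d(2)[of i] bc(1) by simp
    ultimately have "d i < b + c * d i" by linarith
    thus ?thesis using p[of i] by simp
  qed
  thus "G \<in> RR" unfolding G RR_spmat[OF U] using d p by simp
next
  fix G :: "real^'n^'n" assume G: "G \<in> RR"
  obtain U g where U: "orthogonal_matrix U" and Gg: "G = spmat U g" and g: "\<And>i. 0 < g i" "\<And>i. g i < 1" by (rule RR_obtain[OF G]) blast
  have cg: "c * g i < 1" for i
  proof -
    have "c * g i \<le> 1 * g i" using bc g(1)[of i] by (intro mult_right_mono) auto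
    thus ?thesis using g(2)[of i] by linarith
  qed
  note s = scalar_mob_inverse[OF bc(1,2) g(1) cg]
  define A where "A = spmat U (\<lambda>i. b * g i / (1 - c * g i))"
  have "b * g i / (1 - c * g i) < 1" for i
  proof -
    have "b * g i + c * g i < 1" using g(2)[of i] bc(3) by (simp add: distrib_right[symmetric])
    thus ?thesis using cg[of i] by (simp add: field_simps)
  qed
  hence "A \<in> RR" using s(2) by (simp add: A_def RR_spmat[OF U])
  moreover have "mob b c A = G"
  proof -
    have "0 < b + c * (b * g i / (1 - c * g i))" for i
      by (rule add_pos_nonneg[OF bc(1) mult_nonneg_nonneg[OF bc(2) less_imp_le[OF s(2)]]])
    hence "b + c * (b * g i / (1 - c * g i)) \<noteq> 0" for i by (metis less_irrefl)
    from mob_spmat[OF U this] show ?thesis by (simp only: A_def Gg s(1))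
  qed
  ultimately show "G \<in> mob b c ` RR" by blast
qed

lemma pos_def_subset_sym: "Collect pos_def \<subseteq> sym_matrices"
  by (auto simp: sym_matrices_def pos_def_def)

lemma det_scaleR: "det (c *\<^sub>R A) = c ^ CARD('n) * det (A::real^'n^'n)"
proof -
  have "c *\<^sub>R A = (\<chi> i. c *s (A $ i))" by (simp add: vec_eq_iff)
  thus ?thesis using det_rows_mul[of "\<lambda>_. c" "\<lambda>i. A $ i"] by simp
qed

text \<open>The power r + 1 of the determinant of P = sqrt b (b I + c A)^(-1), hence the Jacobian of
  \<open>mob\<close>. For b = v / v0 and c = 1 - v / v0 it is the factor of \<pi>2 in
  \<open>prior2J\<close>.\<close>

definition mob_jac :: "real \<Rightarrow> real \<Rightarrow> real^'n^'n \<Rightarrow> real" where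
  "mob_jac b c A = (sqrt b ^ CARD('n) / det (b *\<^sub>R mat 1 + c *\<^sub>R A)) ^ (CARD('n) + 1)"

lemma mob_jac_pos: "pos_def A \<Longrightarrow> 0 < b \<Longrightarrow> 0 \<le> c \<Longrightarrow> 0 < mob_jac b c A"
  unfolding mob_jac_def by (intro zero_less_power divide_pos_pos affine_pos_def(1)) auto

lemma nn_integral_mob:
  fixes g :: "real^'r::{finite,linorder}^'r::{finite,linorder} \<Rightarrow> ennreal"
  assumes bc: "0 < b" "0 \<le> c" and S: "S \<in> sets borel" "S \<subseteq> Collect pos_def" "mob b c ` S \<in> sets borel"
    and g: "g \<in> borel_measurable borel"
  shows "(\<integral>\<^sup>+ A. ennreal (mob_jac b c A) * g (mob b c A) * indicator S A \<partial>sym_lborel) = (\<integral>\<^sup>+ A. g A * indicator (mob b c ` S) A \<partial>sym_lborel)"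
proof (rule nn_integral_sym_change_of_variables[where P = "\<lambda>A. sqrt b *\<^sub>R matrix_inv (b *\<^sub>R mat 1 + c *\<^sub>R A)"])
  have "mob b c A \<in> Collect pos_def" if "A \<in> S" for A
    using mob_image_pos_def[OF bc] that S(2) by blast
  thus "S \<subseteq> sym_matrices" "mob b c ` S \<subseteq> sym_matrices" using S(2) by (auto simp: sym_matrices_def pos_def_def)
  show "inj_on (mob b c) S" by (rule inj_on_subset[OF inj_on_mob[OF bc] S(2)])
  have nz: "det (b *\<^sub>R mat 1 + c *\<^sub>R A) \<noteq> 0" if "A \<in> S" for A
  proof -
    have "pos_def A" using that S(2) by blast
    from affine_pos_def(1)[OF this bc] show ?thesis by simp
  qed
  have "continuous_on S (\<lambda>A. mob_jac b c A)"
    unfolding mob_jac_def by (intro continuous_intros ballI nz)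
  from borel_measurable_continuous_on_if[OF S(1) this, of "\<lambda>_. 0"]
  have "(\<lambda>A. if A \<in> S then mob_jac b c A else 0) \<in> borel_measurable borel" by auto
  moreover have "(\<lambda>A. indicator S A * mob_jac b c A) = (\<lambda>A. if A \<in> S then mob_jac b c A else 0)"
    by (auto simp: indicator_def)
  ultimately show "(\<lambda>A. indicator S A * mob_jac b c A) \<in> borel_measurable borel" by simp
  fix A assume "A \<in> S"
  hence A: "pos_def A" using S(2) by blast
  show "(mob b c has_derivative (\<lambda>H. sqrt b *\<^sub>R matrix_inv (b *\<^sub>R mat 1 + c *\<^sub>R A) ** H ** (sqrt b *\<^sub>R matrix_inv (b *\<^sub>R mat 1 + c *\<^sub>R A)))) (at A within S)"
    by (rule has_derivative_subset[OF has_derivative_mob[OF A bc] S(2)])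
  show "transpose (sqrt b *\<^sub>R matrix_inv (b *\<^sub>R mat 1 + c *\<^sub>R A)) = sqrt b *\<^sub>R matrix_inv (b *\<^sub>R mat 1 + c *\<^sub>R A)"
    by (simp add: transpose_scalar affine_pos_def(4)[OF A bc])
  have "det (sqrt b *\<^sub>R matrix_inv (b *\<^sub>R mat 1 + c *\<^sub>R A)) = sqrt b ^ CARD('r) / det (b *\<^sub>R mat 1 + c *\<^sub>R A)"
    by (simp add: det_scaleR affine_pos_def(6)[OF A bc])
  moreover have "0 < sqrt b ^ CARD('r) / det (b *\<^sub>R mat 1 + c *\<^sub>R A)"
    using affine_pos_def(1)[OF A bc] bc by (intro divide_pos_pos) auto
  ultimately have "\<bar>det (sqrt b *\<^sub>R matrix_inv (b *\<^sub>R mat 1 + c *\<^sub>R A))\<bar> = sqrt b ^ CARD('r) / det (b *\<^sub>R mat 1 + c *\<^sub>R A)"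
    by (simp only: abs_of_pos)
  thus "mob_jac b c A = \<bar>det (sqrt b *\<^sub>R matrix_inv (b *\<^sub>R mat 1 + c *\<^sub>R A))\<bar> ^ (CARD('r) + 1)"
    by (simp only: mob_jac_def)
qed (use S g in auto)

section \<open>Congruences of positive definite matrices\<close>

lemma pos_def_congruence:
  fixes A E :: "real^'n^'n"
  assumes A: "pos_def A" and E: "transpose E = E" "det E \<noteq> 0"
  shows "pos_def (E ** A ** E)"
proof -
  have t: "transpose (E ** A ** E) = E ** A ** E"
    using A E(1) by (simp add: matrix_transpose_mul matrix_mul_assoc pos_def_def)
  have "0 < x \<bullet> ((E ** A ** E) *v x)" if x: "x \<noteq> 0" for x
  proof -
    have "E *v x \<noteq> 0"
    proof
      assume "E *v x = 0"
      hence "matrix_inv E *v (E *v x) = 0" by (simp only: matrix_vector_mult_0_right)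
      hence "x = 0" using E(2) by (simp add: matrix_vector_mul_assoc invertible_matrix_inv invertible_det_nz)
      thus False using x by simp
    qed
    hence "0 < (E *v x) \<bullet> (A *v (E *v x))" using A by (simp add: pos_def_def)
    also have "\<dots> = x \<bullet> (E *v (A *v (E *v x)))" by (rule self_adjoint_iff_symmetric[OF E(1), symmetric])
    also have "\<dots> = x \<bullet> ((E ** A ** E) *v x)" by (simp add: matrix_vector_mul_assoc matrix_mul_assoc)
    finally show ?thesis .
  qed
  thus ?thesis using t by (simp add: pos_def_def)
qed

lemma congruence_cancel:
  fixes A E :: "real^'n^'n"
  assumes "det E \<noteq> 0"
  shows "matrix_inv E ** (E ** A ** E) ** matrix_inv E = A" "E ** (matrix_inv E ** A ** matrix_inv E) ** E = A"
proof -
  note i = invertible_matrix_inv[of E, OF invertible_det_nz[THEN iffD2, OF assms]]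
  have "matrix_inv E ** (E ** A ** E) ** matrix_inv E = (matrix_inv E ** E) ** A ** (E ** matrix_inv E)" by (simp only: matrix_mul_assoc)
  thus "matrix_inv E ** (E ** A ** E) ** matrix_inv E = A" by (simp only: i matrix_mul_lid matrix_mul_rid)
  have "E ** (matrix_inv E ** A ** matrix_inv E) ** E = (E ** matrix_inv E) ** A ** (matrix_inv E ** E)" by (simp only: matrix_mul_assoc)
  thus "E ** (matrix_inv E ** A ** matrix_inv E) ** E = A" by (simp only: i matrix_mul_lid matrix_mul_rid)
qed

lemma nn_integral_congruence:
  fixes g :: "real^'r::{finite,linorder}^'r::{finite,linorder} \<Rightarrow> ennreal"
  assumes U: "orthogonal_matrix U" and e: "\<And>i. 0 < e i" and g: "g \<in> borel_measurable borel"
  defines "E \<equiv> spmat U e"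
  shows "(\<integral>\<^sup>+ A. ennreal (det E ^ (CARD('r) + 1)) * g (E ** A ** E) * indicator (Collect pos_def) A \<partial>sym_lborel) = (\<integral>\<^sup>+ A. g A * indicator (Collect pos_def) A \<partial>sym_lborel)"
proof -
  have dE: "det E > 0" unfolding E_def det_spmat[OF U] by (intro prod_pos e)
  have tE: "transpose E = E" by (simp add: E_def)
  have iE: "matrix_inv E = spmat U (\<lambda>i. 1 / e i)" unfolding E_def by (rule matrix_inv_spmat[OF U]) (metis e less_irrefl)
  have diE: "det (matrix_inv E) \<noteq> 0" unfolding iE det_spmat[OF U] using e by (auto simp: prod_zero_iff) (metis less_irrefl)
  have img: "(\<lambda>A. E ** A ** E) ` Collect pos_def = Collect pos_def"
  proof (intro equalityI subsetI)
    fix A :: "real^'r::{finite,linorder}^'r::{finite,linorder}" assume "A \<in> Collect pos_def"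
    hence "pos_def (matrix_inv E ** A ** matrix_inv E)" using diE by (intro pos_def_congruence) (auto simp: iE)
    moreover have "A = E ** (matrix_inv E ** A ** matrix_inv E) ** E" using dE by (simp add: congruence_cancel)
    ultimately show "A \<in> (\<lambda>A. E ** A ** E) ` Collect pos_def" by blast
  qed (use dE tE in \<open>auto intro!: pos_def_congruence\<close>)
  have "(\<integral>\<^sup>+ A. ennreal (det E ^ (CARD('r) + 1)) * g (E ** A ** E) * indicator (Collect pos_def) A \<partial>sym_lborel) = (\<integral>\<^sup>+ A. g A * indicator ((\<lambda>A. E ** A ** E) ` Collect pos_def) A \<partial>sym_lborel)"
  proof (rule nn_integral_sym_change_of_variables[where P = "\<lambda>_. E" and T = "\<lambda>A. E ** A ** E"])
    show "inj_on (\<lambda>A. E ** A ** E) (Collect pos_def)"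
      using dE by (intro inj_on_inverseI[of _ "\<lambda>A. matrix_inv E ** A ** matrix_inv E"]) (simp add: congruence_cancel)
    fix A :: "real^'r::{finite,linorder}^'r::{finite,linorder}" show "((\<lambda>A. E ** A ** E) has_derivative (\<lambda>H. E ** H ** E)) (at A within Collect pos_def)"
      by (rule bounded_linear_imp_has_derivative, rule bounded_linear_compose[OF bounded_bilinear.bounded_linear_left[OF bounded_bilinear_matrix_mult]
            bounded_bilinear.bounded_linear_right[OF bounded_bilinear_matrix_mult]])
    show "det E ^ (CARD('r) + 1) = \<bar>det E\<bar> ^ (CARD('r) + 1)" using dE by simp
  qed (simp_all add: img tE g pos_def_subset_sym)
  thus ?thesis unfolding img .
qed

section \<open>Differentiation under the integral sign and normal integrals\<close>

text \<open>Fubini on the unit interval times M. Integrating over x first gives I at every time t;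
  integrating over t first gives the increment \<open>Kb\<close> - \<open>Ka\<close>, whose integral
  vanishes. The common bound on the L1 norms makes H integrable on the product; this is what a flow
  with the right Jacobian provides when no pointwise domination is at hand.\<close>

lemma integral_flow_zero:
  fixes H :: "real \<Rightarrow> 'a \<Rightarrow> real"
  assumes M: "sigma_finite_measure M"
    and Hm: "(\<lambda>(t, x). indicator {0..1} t * H t x) \<in> borel_measurable (lborel \<Otimes>\<^sub>M M)"
    and bound: "\<And>t. t \<in> {0..1} \<Longrightarrow> (\<integral>\<^sup>+ x. ennreal \<bar>H t x\<bar> \<partial>M) \<le> ennreal C"
    and I: "\<And>t. t \<in> {0..1} \<Longrightarrow> (\<integral> x. H t x \<partial>M) = I"
    and K: "\<And>x. x \<in> space M \<Longrightarrow> ((\<lambda>t. H t x) has_integral (Kb x - Ka x)) {0..1}"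
    and Ka: "integrable M Ka" and Kb: "integrable M Kb" and eq: "(\<integral> x. Kb x \<partial>M) = (\<integral> x. Ka x \<partial>M)"
  shows "I = 0"
proof -
  interpret M: sigma_finite_measure M by (rule M)
  interpret pair_sigma_finite lborel M ..
  let ?H = "\<lambda>t x. indicator {0..1} t * H t x"
  have nn: "(\<integral>\<^sup>+ x. ennreal (norm (?H t x)) \<partial>M) \<le> ennreal C * indicator {0..1} t" for t
    using bound[of t] by (cases "t \<in> {0..1}") (auto simp: indicator_def)
  have "(\<integral>\<^sup>+ p. ennreal (norm (case p of (t, x) \<Rightarrow> ?H t x)) \<partial>(lborel \<Otimes>\<^sub>M M)) = (\<integral>\<^sup>+ t. (\<integral>\<^sup>+ x. ennreal (norm (?H t x)) \<partial>M) \<partial>lborel)"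
    using Hm by (subst M.nn_integral_fst[symmetric]) (auto simp: split_beta')
  also have "\<dots> \<le> (\<integral>\<^sup>+ t. ennreal C * indicator {0..1::real} t \<partial>lborel)"
    by (intro nn_integral_mono nn)
  also have "\<dots> = ennreal C" by (subst nn_integral_cmult_indicator) auto
  also have "\<dots> < \<infinity>" by simp
  finally have int: "integrable (lborel \<Otimes>\<^sub>M M) (\<lambda>(t, x). ?H t x)"
    by (intro integrableI_bounded Hm)
  have "(\<integral>t. (\<integral>x. ?H t x \<partial>M) \<partial>lborel) = (\<integral>x. (\<integral>t. ?H t x \<partial>lborel) \<partial>M)"
    using Fubini_integral[OF int] by simp
  moreover have "(\<integral>t. (\<integral>x. ?H t x \<partial>M) \<partial>lborel) = I"
  proof -
    have eq: "(\<integral>x. ?H t x \<partial>M) = indicator {0..1} t * I" for t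
      using I[of t] by (cases "t \<in> {0..1}") auto
    show ?thesis by (simp only: eq) simp
  qed
  moreover have "(\<integral>x. (\<integral>t. ?H t x \<partial>lborel) \<partial>M) = (\<integral>x. Kb x - Ka x \<partial>M)"
  proof (rule integral_cong_AE)
    show "(\<lambda>x. \<integral>t. ?H t x \<partial>lborel) \<in> borel_measurable M"
      using borel_measurable_integrable[OF integrable_snd[OF int]] by simp
    show "(\<lambda>x. Kb x - Ka x) \<in> borel_measurable M" using Ka Kb by auto
    \<comment> \<open>Fubini yields Lebesgue integrability in t for almost every x only; at such x
      the Lebesgue integral coincides with the gauge integral given by \<open>K\<close>.\<close>
    show "AE x in M. (\<integral>t. ?H t x \<partial>lborel) = Kb x - Ka x"
      using AE_integrable_snd[OF int] AE_space
    proof eventually_elim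
      case (elim x)
      hence "((\<lambda>t. ?H t x) has_integral (\<integral>t. ?H t x \<partial>lborel)) UNIV" by (intro has_integral_integral_lborel) simp
      moreover have "((\<lambda>t. ?H t x) has_integral (Kb x - Ka x)) UNIV"
      proof -
        have "(\<lambda>t. ?H t x) = (\<lambda>t. if t \<in> {0..1} then H t x else 0)" by (auto simp: indicator_def)
        thus ?thesis using K[OF elim(2)] by (simp only: has_integral_restrict_UNIV)
      qed
      ultimately show ?case by (rule has_integral_unique)
    qed
  qed
  ultimately show ?thesis using Ka Kb eq by simp
qed

text \<open>Dominated convergence for the difference quotients, which the mean value inequality
  bounds by \<open>B\<close>. The derivative is taken within the closed interval, so that it is also
  available, one-sided, at the ends of the range of variances.\<close>

lemma has_real_derivative_integral:
  fixes f :: "real \<Rightarrow> 'a \<Rightarrow> real"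
  assumes ab: "a < b" and t0: "t0 \<in> {a..b}"
    and int: "\<And>t. t \<in> {a..b} \<Longrightarrow> integrable M (f t)"
    and der: "\<And>t x. t \<in> {a..b} \<Longrightarrow> x \<in> space M \<Longrightarrow> ((\<lambda>t. f t x) has_real_derivative f' t x) (at t within {a..b})"
    and bd: "\<And>t x. t \<in> {a..b} \<Longrightarrow> x \<in> space M \<Longrightarrow> \<bar>f' t x\<bar> \<le> B x"
    and B: "integrable M B"
  shows "integrable M (f' t0)" (is ?A)
    and "((\<lambda>t. \<integral>x. f t x \<partial>M) has_real_derivative (\<integral>x. f' t0 x \<partial>M)) (at t0 within {a..b})" (is ?B)
proof -
  have seq: "f' t0 \<in> borel_measurable M \<and> (\<lambda>n. \<integral>x. (f (X n) x - f t0 x) / (X n - t0) \<partial>M) \<longlonglongrightarrow> (\<integral>x. f' t0 x \<partial>M)"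
    if X: "\<And>n. X n \<in> {a..b} - {t0}" "X \<longlonglongrightarrow> t0" for X :: "nat \<Rightarrow> real"
  proof -
    have lim: "(\<lambda>n. (f (X n) x - f t0 x) / (X n - t0)) \<longlonglongrightarrow> f' t0 x" if x: "x \<in> space M" for x
    proof -
      have "((\<lambda>t. (f t x - f t0 x) / (t - t0)) \<longlongrightarrow> f' t0 x) (at t0 within {a..b})"
        using der[OF t0 x] by (simp add: has_field_derivative_iff)
      thus ?thesis using X unfolding tendsto_at_iff_sequentially comp_def by blast
    qed
    have m: "(\<lambda>x. (f (X n) x - f t0 x) / (X n - t0)) \<in> borel_measurable M" for n
      using int[OF t0] int[of "X n"] X(1)[of n] by auto
    have m': "f' t0 \<in> borel_measurable M" by (rule borel_measurable_LIMSEQ_real[OF lim m])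
    have "(\<lambda>n. \<integral>x. (f (X n) x - f t0 x) / (X n - t0) \<partial>M) \<longlonglongrightarrow> (\<integral>x. f' t0 x \<partial>M)"
    proof (rule integral_dominated_convergence[where w = B])
      show "AE x in M. (\<lambda>n. (f (X n) x - f t0 x) / (X n - t0)) \<longlonglongrightarrow> f' t0 x" using lim by auto
      show "AE x in M. norm ((f (X n) x - f t0 x) / (X n - t0)) \<le> B x" for n
      proof (rule AE_I2)
        fix x assume x: "x \<in> space M"
        have "norm (f (X n) x - f t0 x) \<le> B x * norm (X n - t0)"
          by (rule field_differentiable_bound[of "{a..b}"]) (use der bd x X(1)[of n] t0 in auto)
        thus "norm ((f (X n) x - f t0 x) / (X n - t0)) \<le> B x"
          using X(1)[of n] by (simp add: field_simps)
      qed
    qed (use m m' B in auto)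
    thus ?thesis using m' by simp
  qed
  \<comment> \<open>One sequence tending to t0 gives the measurability of \<open>f' t0\<close>, as a
    limit of difference quotients, and with it integrability.\<close>
  obtain X where X: "\<And>n. X n \<in> {a..b} - {t0}" "X \<longlonglongrightarrow> t0"
  proof -
    have "t0 islimpt {a..b}" using ab t0 by (simp add: connected_imp_perfect_aff_dim islimpt_Icc)
    thus ?thesis using that by (auto simp: islimpt_sequential)
  qed
  have m': "f' t0 \<in> borel_measurable M" using seq[OF X] by simp
  show ?A by (rule Bochner_Integration.integrable_bound[OF B m']) (rule AE_I2, use bd[OF t0] in \<open>force intro: order_trans\<close>)
  have "((\<lambda>t. ((\<integral>x. f t x \<partial>M) - (\<integral>x. f t0 x \<partial>M)) / (t - t0)) \<longlongrightarrow> (\<integral>x. f' t0 x \<partial>M)) (at t0 within {a..b})"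
    unfolding tendsto_at_iff_sequentially comp_def
  proof (intro allI impI)
    fix X :: "nat \<Rightarrow> real" assume X: "\<forall>i. X i \<in> {a..b} - {t0}" "X \<longlonglongrightarrow> t0"
    have "(\<integral>x. (f (X n) x - f t0 x) / (X n - t0) \<partial>M) = ((\<integral>x. f (X n) x \<partial>M) - (\<integral>x. f t0 x \<partial>M)) / (X n - t0)" for n
      using int[OF t0] int[of "X n"] X(1) by simp
    thus "(\<lambda>n. ((\<integral>x. f (X n) x \<partial>M) - (\<integral>x. f t0 x \<partial>M)) / (X n - t0)) \<longlonglongrightarrow> (\<integral>x. f' t0 x \<partial>M)"
      using seq[of X] X by simp
  qed
  thus ?B by (simp add: has_field_derivative_iff)
qed

section \<open>Translation invariance and integrals of directional derivatives\<close>

lemma nn_integral_lborel_shift: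
  fixes f :: "'a::euclidean_space \<Rightarrow> ennreal"
  assumes [measurable]: "f \<in> borel_measurable borel"
  shows "(\<integral>\<^sup>+ x. f (t + x) \<partial>lborel) = (\<integral>\<^sup>+ x. f x \<partial>lborel)"
proof -
  have "(lborel :: 'a measure) = distr lborel borel (\<lambda>x. t + x)"
    using lborel_affine[of 1 t] by (simp add: density_1)
  hence "(\<integral>\<^sup>+ x. f x \<partial>lborel) = (\<integral>\<^sup>+ x. f x \<partial>distr lborel borel (\<lambda>x. t + x))" by simp
  also have "\<dots> = (\<integral>\<^sup>+ x. f (t + x) \<partial>lborel)" by (rule nn_integral_distr) auto
  finally show ?thesis by simp
qed

lemma integral_lborel_shift:
  fixes f :: "'a::euclidean_space \<Rightarrow> real"
  assumes [measurable]: "f \<in> borel_measurable borel"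
  shows "(\<integral> x. f (t + x) \<partial>lborel) = (\<integral> x. f x \<partial>lborel)" and "integrable lborel (\<lambda>x. f (t + x)) \<longleftrightarrow> integrable lborel f"
proof -
  have "(lborel :: 'a measure) = distr lborel borel (\<lambda>x. t + x)"
    using lborel_affine[of 1 t] by (simp add: density_1)
  note eq = this
  have "(\<integral> x. f x \<partial>distr lborel borel (\<lambda>x. t + x)) = (\<integral> x. f (t + x) \<partial>lborel)" by (rule integral_distr) auto
  thus "(\<integral> x. f (t + x) \<partial>lborel) = (\<integral> x. f x \<partial>lborel)" using eq by simp
  have "integrable (distr lborel borel (\<lambda>x. t + x)) f \<longleftrightarrow> integrable lborel (\<lambda>x. f (t + x))"
    by (rule integrable_distr_eq) auto
  thus "integrable lborel (\<lambda>x. f (t + x)) \<longleftrightarrow> integrable lborel f" using eq by simp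
qed

text \<open>The flow argument for the translations x \<mapsto> x + t e: the integral of
  \<open>F'\<close> over x does not depend on t, and the time integral from 0 to 1 is F(x + e) -
  F(x), whose integral over x is 0.\<close>

lemma integral_directional_derivative_zero:
  fixes F F' :: "'a::euclidean_space \<Rightarrow> real"
  assumes der: "\<And>x. ((\<lambda>t. F (x + t *\<^sub>R e)) has_real_derivative F' x) (at 0)"
    and F: "integrable lborel F" and F': "integrable lborel F'"
  shows "(\<integral>x. F' x \<partial>lborel) = 0"
proof (rule integral_flow_zero[where M = lborel and H = "\<lambda>t x. F' (t *\<^sub>R e + x)" and C = "\<integral>x. \<bar>F' x\<bar> \<partial>lborel"
      and Ka = F and Kb = "\<lambda>x. F (e + x)"])
  have [measurable]: "F \<in> borel_measurable borel" "F' \<in> borel_measurable borel" using F F' by auto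
  show "sigma_finite_measure (lborel :: 'a measure)" ..
  show "(\<lambda>(t, x). indicator {0..1} t * F' (t *\<^sub>R e + x)) \<in> borel_measurable (lborel \<Otimes>\<^sub>M lborel)" by measurable
  show "(\<integral>\<^sup>+ x. ennreal \<bar>F' (t *\<^sub>R e + x)\<bar> \<partial>lborel) \<le> ennreal (\<integral>x. \<bar>F' x\<bar> \<partial>lborel)" for t
    using nn_integral_lborel_shift[of "\<lambda>x. ennreal \<bar>F' x\<bar>" "t *\<^sub>R e"] nn_integral_eq_integral[of lborel "\<lambda>x. \<bar>F' x\<bar>"] F'
    by simp
  show "(\<integral>x. F' (t *\<^sub>R e + x) \<partial>lborel) = (\<integral>x. F' x \<partial>lborel)" for t by (rule integral_lborel_shift) simp
  show "integrable lborel (\<lambda>x. F (e + x))" using F by (subst integral_lborel_shift(2)) auto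
  show "(\<integral>x. F (e + x) \<partial>lborel) = (\<integral>x. F x \<partial>lborel)" by (rule integral_lborel_shift) simp
  show "((\<lambda>t. F' (t *\<^sub>R e + x)) has_integral F (e + x) - F x) {0..1}" for x
  proof -
    have "((\<lambda>t. F (t *\<^sub>R e + x)) has_real_derivative F' (t *\<^sub>R e + x)) (at t)" for t
    proof -
      let ?G = "\<lambda>s. F ((t *\<^sub>R e + x) + s *\<^sub>R e)"
      have "(?G has_real_derivative F' (t *\<^sub>R e + x)) (at (t + - t))"
        using der[of "t *\<^sub>R e + x"] by simp
      hence "((\<lambda>u. ?G (u + - t)) has_real_derivative F' (t *\<^sub>R e + x)) (at t)"
        by (simp only: DERIV_shift)
      thus ?thesis by (simp add: scaleR_add_left algebra_simps)
    qed
    hence "((\<lambda>t. F' (t *\<^sub>R e + x)) has_integral F (1 *\<^sub>R e + x) - F (0 *\<^sub>R e + x)) {0..1}"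
      by (intro fundamental_theorem_of_calculus)
         (auto simp: has_real_derivative_iff_has_vector_derivative[symmetric] intro: has_field_derivative_at_within)
    thus ?thesis by simp
  qed
qed (use F in auto)

section \<open>The matrix normal density\<close>

lemma matnormal_pos: "0 < v \<Longrightarrow> 0 < matnormal v \<Theta> W"
  by (simp add: matnormal_def)

lemma matnormal_nonneg [simp]: "0 \<le> matnormal v \<Theta> W"
  by (simp add: matnormal_def)

lemma matnormal_commute: "matnormal v \<Theta> W = matnormal v W \<Theta>"
  by (simp add: matnormal_def norm_minus_commute)

lemma matnormal_shift: "matnormal v (c + \<Theta>) (c + W) = matnormal v \<Theta> W"
  by (simp add: matnormal_def)

lemma borel_measurable_matnormal [measurable (raw)]:
  assumes "f \<in> borel_measurable M" "g \<in> borel_measurable M"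
  shows "(\<lambda>x. matnormal v (f x) (g x :: real^'q^'r)) \<in> borel_measurable M"
  using assms unfolding matnormal_def by measurable

lemma matnormal_eq_prod:
  fixes \<Theta> W :: "real^'q^'r"
  assumes v: "0 < v"
  shows "matnormal v \<Theta> W = (\<Prod>b\<in>Basis. normal_density (\<Theta> \<bullet> b) (sqrt v) (W \<bullet> b))"
proof -
  have "(\<Prod>b\<in>(Basis::(real^'q^'r) set). normal_density (\<Theta> \<bullet> b) (sqrt v) (W \<bullet> b)) =
      (1 / sqrt (2 * pi * v)) ^ DIM(real^'q^'r) * exp (\<Sum>b\<in>(Basis::(real^'q^'r) set). - (W \<bullet> b - \<Theta> \<bullet> b)\<^sup>2 / (2 * v))"
    using v by (simp only: normal_density_def prod.distrib exp_sum[OF finite_Basis] prod_constant) simp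
  also have "(\<Sum>b\<in>(Basis::(real^'q^'r) set). - (W \<bullet> b - \<Theta> \<bullet> b)\<^sup>2 / (2 * v)) = - (norm (W - \<Theta>))\<^sup>2 / (2 * v)"
  proof -
    have "(norm (W - \<Theta>))\<^sup>2 = (\<Sum>b\<in>Basis. (W \<bullet> b - \<Theta> \<bullet> b)\<^sup>2)"
      unfolding inner_diff_left[symmetric]
      by (subst power2_norm_eq_inner, subst euclidean_inner) (simp only: power2_eq_square)
    thus ?thesis by (simp only: sum_divide_distrib[symmetric] sum_negf)
  qed
  also have "(1 / sqrt (2 * pi * v)) ^ DIM(real^'q^'r) = (2 * pi * v) powr (- (real (CARD('q) * CARD('r)) / 2))"
  proof -
    have "1 / sqrt (2 * pi * v) = (2 * pi * v) powr (- 1 / 2)"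
      using v by (simp add: powr_minus_divide powr_half_sqrt)
    hence "(1 / sqrt (2 * pi * v)) ^ DIM(real^'q^'r) = ((2 * pi * v) powr (- 1 / 2)) powr (real DIM(real^'q^'r))"
      using powr_realpow[of "(2 * pi * v) powr (- 1 / 2)" "DIM(real^'q^'r)"] v by (simp only: powr_gt_zero) simp
    thus ?thesis by (simp add: powr_powr mult.commute)
  qed
  finally show ?thesis by (simp add: matnormal_def)
qed

lemma nn_integral_matnormal:
  assumes v: "0 < v" shows "(\<integral>\<^sup>+ W. ennreal (matnormal v \<Theta> W) \<partial>lborel) = 1"
proof -
  have "(\<integral>\<^sup>+ W. ennreal (matnormal v \<Theta> W) \<partial>lborel) = (\<integral>\<^sup>+ W. (\<Prod>b\<in>Basis. ennreal (normal_density (\<Theta> \<bullet> b) (sqrt v) (W \<bullet> b))) \<partial>lborel)"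
    by (simp only: matnormal_eq_prod[OF v] prod_ennreal[symmetric] normal_density_nonneg)
  also have "\<dots> = (\<Prod>b\<in>Basis. (\<integral>\<^sup>+ x. ennreal (normal_density (\<Theta> \<bullet> b) (sqrt v) x) \<partial>lborel))"
    by (rule nn_integral_lborel_prod) auto
  also have "\<dots> = 1"
  proof (rule prod.neutral, rule ballI)
    fix b
    show "(\<integral>\<^sup>+ x. ennreal (normal_density (\<Theta> \<bullet> b) (sqrt v) x) \<partial>lborel) = 1"
      using v by (subst nn_integral_eq_integral) auto
  qed
  finally show ?thesis .
qed

lemma integrable_matnormal [simp]:
  assumes "0 < v" shows "integrable lborel (matnormal v \<Theta>)"
  by (rule integrableI_nonneg) (simp_all add: nn_integral_matnormal[OF assms])

lemma integral_matnormal: "0 < v \<Longrightarrow> (\<integral> W. matnormal v \<Theta> W \<partial>lborel) = 1"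
  by (simp add: integral_eq_nn_integral nn_integral_matnormal)

text \<open>Half of the exponent absorbs the quadratic growth. With s = |W - \<Theta>|^2 / (4 v) the
  exponential is exp(-s) exp(-s): one factor keeps exp(-s) (1 + |W|^2) bounded, the other is the
  density of variance 2 v up to the normalising factor.\<close>

lemma matnormal_quadratic_le:
  fixes \<Theta> W :: "real^'q^'r"
  assumes v: "0 < v"
  shows "matnormal v \<Theta> W * (1 + (norm W)\<^sup>2) \<le>
     (1 + 2 * (norm \<Theta>)\<^sup>2 + 8 * v) * (2 powr (real (CARD('q) * CARD('r)) / 2)) * matnormal (2 * v) \<Theta> W"
proof -
  let ?k = "real (CARD('q) * CARD('r)) / 2"
  define s where "s = (norm (W - \<Theta>))\<^sup>2 / (4 * v)"
  have s: "s \<ge> 0" using v by (simp add: s_def)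
  have "(norm W)\<^sup>2 \<le> (norm (W - \<Theta>) + norm \<Theta>)\<^sup>2"
    using norm_triangle_sub[of W \<Theta>] by (intro power_mono) auto
  also have "\<dots> \<le> 2 * (norm (W - \<Theta>))\<^sup>2 + 2 * (norm \<Theta>)\<^sup>2"
    using sum_squares_bound[of "norm (W - \<Theta>)" "norm \<Theta>"] by (simp add: power2_sum)
  also have "(norm (W - \<Theta>))\<^sup>2 = 4 * v * s" using v by (simp add: s_def)
  finally have n: "1 + (norm W)\<^sup>2 \<le> (1 + 2 * (norm \<Theta>)\<^sup>2) + 8 * v * s" by simp
  have e1: "exp (- s) \<le> 1" using s by simp
  have e2: "s * exp (- s) \<le> 1"
  proof -
    have "s \<le> exp s" using exp_ge_add_one_self[of s] by linarith
    thus ?thesis by (simp add: exp_minus divide_inverse[symmetric])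
  qed
  have "exp (- s) * (1 + (norm W)\<^sup>2) \<le> exp (- s) * ((1 + 2 * (norm \<Theta>)\<^sup>2) + 8 * v * s)"
    by (intro mult_left_mono n) simp
  also have "\<dots> = (1 + 2 * (norm \<Theta>)\<^sup>2) * exp (- s) + 8 * v * (s * exp (- s))" by (simp add: algebra_simps)
  also have "\<dots> \<le> (1 + 2 * (norm \<Theta>)\<^sup>2) * 1 + 8 * v * 1"
    by (intro add_mono mult_left_mono e1 e2) (use v in auto)
  finally have b: "exp (- s) * (1 + (norm W)\<^sup>2) \<le> 1 + 2 * (norm \<Theta>)\<^sup>2 + 8 * v" by simp
  have m: "matnormal v \<Theta> W = (2 * pi * v) powr (- ?k) * (exp (- s) * exp (- s))"
  proof -
    have "- (norm (W - \<Theta>))\<^sup>2 / (2 * v) = - s + - s" using v by (simp add: s_def field_simps)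
    thus ?thesis by (simp only: matnormal_def exp_add)
  qed
  have m2: "2 powr ?k * matnormal (2 * v) \<Theta> W = (2 * pi * v) powr (- ?k) * exp (- s)"
  proof -
    have "(2 * pi * (2 * v)) powr (- ?k) = 2 powr (- ?k) * (2 * pi * v) powr (- ?k)"
      using v by (subst powr_mult[symmetric]) (auto simp: mult_ac)
    moreover have "2 powr ?k * 2 powr (- ?k) = (1::real)" by (simp add: powr_add[symmetric])
    moreover have "- (norm (W - \<Theta>))\<^sup>2 / (2 * (2 * v)) = - s" using v by (simp add: s_def)
    ultimately show ?thesis by (simp add: matnormal_def)
  qed
  have "matnormal v \<Theta> W * (1 + (norm W)\<^sup>2) = ((2 * pi * v) powr (- ?k) * exp (- s)) * (exp (- s) * (1 + (norm W)\<^sup>2))"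
    by (simp add: m)
  also have "\<dots> \<le> ((2 * pi * v) powr (- ?k) * exp (- s)) * (1 + 2 * (norm \<Theta>)\<^sup>2 + 8 * v)"
    by (intro mult_left_mono b) auto
  also have "\<dots> = (1 + 2 * (norm \<Theta>)\<^sup>2 + 8 * v) * (2 powr ?k) * matnormal (2 * v) \<Theta> W"
    unfolding m2[symmetric] by (simp only: mult_ac)
  finally show ?thesis .
qed

lemma integrable_matnormal_quadratic_bound:
  fixes f :: "real^'q^'r \<Rightarrow> real"
  assumes v: "0 < v" and fm: "f \<in> borel_measurable borel" and f: "\<And>W. \<bar>f W\<bar> \<le> C * (1 + (norm W)\<^sup>2)"
  shows "integrable lborel (\<lambda>W. matnormal v \<Theta> W * f W)"
proof (rule Bochner_Integration.integrable_bound)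
  let ?K = "\<bar>C\<bar> * ((1 + 2 * (norm \<Theta>)\<^sup>2 + 8 * v) * (2 powr (real (CARD('q) * CARD('r)) / 2)))"
  show "integrable lborel (\<lambda>W. ?K * matnormal (2 * v) \<Theta> W)" using v by (intro integrable_mult_right) simp
  show "(\<lambda>W. matnormal v \<Theta> W * f W) \<in> borel_measurable lborel" using fm by measurable
  show "AE W in lborel. norm (matnormal v \<Theta> W * f W) \<le> norm (?K * matnormal (2 * v) \<Theta> W)"
  proof (rule AE_I2)
    fix W :: "real^'q^'r"
    have "\<bar>f W\<bar> \<le> \<bar>C\<bar> * (1 + (norm W)\<^sup>2)"
      by (rule order_trans[OF f mult_right_mono[OF abs_ge_self]]) simp
    hence "norm (matnormal v \<Theta> W * f W) \<le> matnormal v \<Theta> W * (\<bar>C\<bar> * (1 + (norm W)\<^sup>2))"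
      by (simp add: abs_mult mult_left_mono)
    also have "\<dots> = \<bar>C\<bar> * (matnormal v \<Theta> W * (1 + (norm W)\<^sup>2))" by simp
    also have "\<dots> \<le> ?K * matnormal (2 * v) \<Theta> W"
      using mult_left_mono[OF matnormal_quadratic_le[OF v, of \<Theta> W], of "\<bar>C\<bar>"] by (simp only: mult.assoc abs_ge_zero)
    also have "\<dots> \<le> norm (?K * matnormal (2 * v) \<Theta> W)" by simp
    finally show "norm (matnormal v \<Theta> W * f W) \<le> norm (?K * matnormal (2 * v) \<Theta> W)" .
  qed
qed

text \<open>Completing the square in \<Theta>. The factor \<open>matnormal (a + b) X Y\<close> no
  longer contains \<Theta>, and the other one is the likelihood of the precision-weighted mean. By
  symmetry of the normal density the identity also serves for combining a normal prior with a
  likelihood.\<close>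

lemma matnormal_product:
  fixes X Y \<Theta> :: "real^'q^'r"
  assumes a: "0 < a" and b: "0 < b"
  shows "matnormal a \<Theta> X * matnormal b \<Theta> Y =
    matnormal (a * b / (a + b)) \<Theta> ((b / (a + b)) *\<^sub>R X + (a / (a + b)) *\<^sub>R Y) * matnormal (a + b) X Y"
proof -
  let ?k = "real (CARD('q) * CARD('r)) / 2"
  have s: "a + b > 0" using a b by simp
  have "(2 * pi * a) * (2 * pi * b) = (2 * pi * (a * b / (a + b))) * (2 * pi * (a + b))"
    using s by (simp add: field_simps)
  hence c: "(2 * pi * a) powr (- ?k) * (2 * pi * b) powr (- ?k) = (2 * pi * (a * b / (a + b))) powr (- ?k) * (2 * pi * (a + b)) powr (- ?k)"
  proof -
    assume eq: "(2 * pi * a) * (2 * pi * b) = (2 * pi * (a * b / (a + b))) * (2 * pi * (a + b))"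
    have m: "x powr (- ?k) * y powr (- ?k) = (x * y) powr (- ?k)" if "0 < x" "0 < y" for x y :: real
      using that by (simp add: powr_mult)
    have p: "0 < 2 * pi * a" "0 < 2 * pi * b" "0 < 2 * pi * (a * b / (a + b))" "0 < 2 * pi * (a + b)"
      using a b s by auto
    show ?thesis by (simp only: m[OF p(1,2)] m[OF p(3,4)] eq)
  qed
  define x where "x = X - \<Theta>"
  define y where "y = Y - \<Theta>"
  have z: "(b / (a + b)) *\<^sub>R X + (a / (a + b)) *\<^sub>R Y - \<Theta> = (1 / (a + b)) *\<^sub>R (b *\<^sub>R x + a *\<^sub>R y)"
  proof -
    have "(1 / (a + b)) *\<^sub>R (b *\<^sub>R x + a *\<^sub>R y) = (b / (a + b)) *\<^sub>R X + (a / (a + b)) *\<^sub>R Y - (b / (a + b) + a / (a + b)) *\<^sub>R \<Theta>"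
      by (simp add: x_def y_def scaleR_add_right scaleR_diff_right scaleR_add_left)
    moreover have "b / (a + b) + a / (a + b) = 1" using s by (simp add: add_divide_distrib[symmetric])
    ultimately show ?thesis by simp
  qed
  have yx: "Y - X = y - x" by (simp add: x_def y_def)
  have n1: "(norm (b *\<^sub>R x + a *\<^sub>R y))\<^sup>2 = b^2 * (x \<bullet> x) + 2 * a * b * (x \<bullet> y) + a^2 * (y \<bullet> y)"
    unfolding power2_norm_eq_inner by (simp add: inner_add inner_commute[of y x] power2_eq_square algebra_simps)
  have n2: "(norm (y - x))\<^sup>2 = y \<bullet> y - 2 * (x \<bullet> y) + x \<bullet> x"
    unfolding power2_norm_eq_inner by (simp add: inner_diff inner_commute[of y x] algebra_simps)
  have "(norm ((1 / (a + b)) *\<^sub>R (b *\<^sub>R x + a *\<^sub>R y)))\<^sup>2 / (a * b / (a + b)) + (norm (y - x))\<^sup>2 / (a + b) = (norm x)\<^sup>2 / a + (norm y)\<^sup>2 / b"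
  proof -
    have "(norm ((1 / (a + b)) *\<^sub>R (b *\<^sub>R x + a *\<^sub>R y)))\<^sup>2 / (a * b / (a + b)) = (norm (b *\<^sub>R x + a *\<^sub>R y))\<^sup>2 / (a * b * (a + b))"
      using a b s by (simp add: power_mult_distrib power_divide power2_eq_square)
    also have "\<dots> + (norm (y - x))\<^sup>2 / (a + b) = ((norm (b *\<^sub>R x + a *\<^sub>R y))\<^sup>2 + a * b * (norm (y - x))\<^sup>2) / (a * b * (a + b))"
      using a b s by (simp add: add_divide_distrib)
    also have "(norm (b *\<^sub>R x + a *\<^sub>R y))\<^sup>2 + a * b * (norm (y - x))\<^sup>2 = (a + b) * (b * (x \<bullet> x) + a * (y \<bullet> y))"
      unfolding n1 n2 by (simp add: power2_eq_square algebra_simps)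
    also have "\<dots> / (a * b * (a + b)) = (b * (x \<bullet> x) + a * (y \<bullet> y)) / (a * b)" using s by simp
    also have "\<dots> = (norm x)\<^sup>2 / a + (norm y)\<^sup>2 / b" using a b by (simp add: power2_norm_eq_inner add_divide_distrib)
    finally show ?thesis .
  qed
  hence e: "- (norm x)\<^sup>2 / (2 * a) + - (norm y)\<^sup>2 / (2 * b) =
     - (norm ((1 / (a + b)) *\<^sub>R (b *\<^sub>R x + a *\<^sub>R y)))\<^sup>2 / (2 * (a * b / (a + b))) + - (norm (y - x))\<^sup>2 / (2 * (a + b))"
  proof -
    have h: "- u / (2 * w) = - (u / w) / 2" for u w :: real by simp
    assume "(norm ((1 / (a + b)) *\<^sub>R (b *\<^sub>R x + a *\<^sub>R y)))\<^sup>2 / (a * b / (a + b)) + (norm (y - x))\<^sup>2 / (a + b) = (norm x)\<^sup>2 / a + (norm y)\<^sup>2 / b"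
    moreover have "p + q = x + y \<Longrightarrow> - x / 2 + - y / 2 = - p / 2 + - q / 2" for p q x y :: real by simp
    ultimately show ?thesis unfolding h by blast
  qed
  have "matnormal a \<Theta> X * matnormal b \<Theta> Y = ((2 * pi * a) powr (- ?k) * (2 * pi * b) powr (- ?k)) * exp (- (norm x)\<^sup>2 / (2 * a) + - (norm y)\<^sup>2 / (2 * b))"
    unfolding exp_add by (simp add: matnormal_def x_def y_def)
  also have "\<dots> = matnormal (a * b / (a + b)) \<Theta> ((b / (a + b)) *\<^sub>R X + (a / (a + b)) *\<^sub>R Y) * matnormal (a + b) X Y"
    unfolding c e exp_add matnormal_def z yx by (simp only: mult_ac)
  finally show ?thesis .
qed

text \<open>The class in which all log densities lie. It is stable under linear combinations and
  affine substitutions and integrable against every normal density, so the risks computed below are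
  finite real numbers.\<close>

definition quad_bounded :: "('a::euclidean_space \<Rightarrow> real) \<Rightarrow> bool" where
  "quad_bounded f \<longleftrightarrow> f \<in> borel_measurable borel \<and> (\<exists>C. \<forall>W. \<bar>f W\<bar> \<le> C * (1 + (norm W)\<^sup>2))"

lemma quad_bounded_measurable: "quad_bounded f \<Longrightarrow> f \<in> borel_measurable borel"
  by (simp add: quad_bounded_def)

lemma quad_boundedE:
  assumes "quad_bounded f"
  obtains C where "C \<ge> 0" "\<And>W. \<bar>f W\<bar> \<le> C * (1 + (norm W)\<^sup>2)"
proof -
  obtain C where C: "\<And>W. \<bar>f W\<bar> \<le> C * (1 + (norm W)\<^sup>2)" using assms by (auto simp: quad_bounded_def)
  have "\<bar>f W\<bar> \<le> \<bar>C\<bar> * (1 + (norm W)\<^sup>2)" for W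
    by (rule order_trans[OF C mult_right_mono[OF abs_ge_self]]) simp
  thus ?thesis using that[of "\<bar>C\<bar>"] by simp
qed

lemma quad_boundedI:
  "f \<in> borel_measurable borel \<Longrightarrow> (\<And>W. \<bar>f W\<bar> \<le> C * (1 + (norm W)\<^sup>2)) \<Longrightarrow> quad_bounded f"
  by (auto simp: quad_bounded_def)

lemma quad_bounded_const: "quad_bounded (\<lambda>_. c)"
proof (rule quad_boundedI[where C = "\<bar>c\<bar>"])
  fix W :: 'a
  show "\<bar>c\<bar> \<le> \<bar>c\<bar> * (1 + (norm W)\<^sup>2)" using mult_left_mono[of 1 "1 + (norm W)\<^sup>2" "\<bar>c\<bar>"] by simp
qed simp

lemma quad_bounded_add:
  assumes "quad_bounded f" "quad_bounded g" shows "quad_bounded (\<lambda>W. f W + g W)"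
proof -
  obtain C where C: "\<And>W. \<bar>f W\<bar> \<le> C * (1 + (norm W)\<^sup>2)" using assms(1) by (rule quad_boundedE) blast
  obtain D where D: "\<And>W. \<bar>g W\<bar> \<le> D * (1 + (norm W)\<^sup>2)" using assms(2) by (rule quad_boundedE) blast
  show ?thesis
  proof (rule quad_boundedI[where C = "C + D"])
    fix W show "\<bar>f W + g W\<bar> \<le> (C + D) * (1 + (norm W)\<^sup>2)"
      using add_mono[OF C[of W] D[of W]] abs_triangle_ineq[of "f W" "g W"] by (simp only: distrib_right)
  qed (rule borel_measurable_add[OF quad_bounded_measurable[OF assms(1)] quad_bounded_measurable[OF assms(2)]])
qed

lemma quad_bounded_cmult:
  assumes "quad_bounded f" shows "quad_bounded (\<lambda>W. c * f W)"
proof -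
  obtain C where C: "\<And>W. \<bar>f W\<bar> \<le> C * (1 + (norm W)\<^sup>2)" using assms(1) by (rule quad_boundedE) blast
  show ?thesis
  proof (rule quad_boundedI[where C = "\<bar>c\<bar> * C"])
    fix W show "\<bar>c * f W\<bar> \<le> \<bar>c\<bar> * C * (1 + (norm W)\<^sup>2)"
      using mult_left_mono[OF C[of W], of "\<bar>c\<bar>"] by (simp only: abs_mult mult.assoc abs_ge_zero)
  qed (rule borel_measurable_times[OF borel_measurable_const quad_bounded_measurable[OF assms]])
qed

lemma quad_bounded_uminus: "quad_bounded f \<Longrightarrow> quad_bounded (\<lambda>W. - f W)"
  using quad_bounded_cmult[of f "-1"] by simp

lemma quad_bounded_diff: "quad_bounded f \<Longrightarrow> quad_bounded g \<Longrightarrow> quad_bounded (\<lambda>W. f W - g W)"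
  using quad_bounded_add[OF _ quad_bounded_uminus, of f g] by simp

lemma quad_bounded_norm_affine: "quad_bounded (\<lambda>W. (norm (a *\<^sub>R W + b))\<^sup>2)"
proof (rule quad_boundedI[where C = "2 * a\<^sup>2 + 2 * (norm b)\<^sup>2"])
  fix W :: 'a
  have "(norm (a *\<^sub>R W + b))\<^sup>2 \<le> (\<bar>a\<bar> * norm W + norm b)\<^sup>2"
    using norm_triangle_ineq[of "a *\<^sub>R W" b] by (intro power_mono) auto
  also have "\<dots> \<le> 2 * (a\<^sup>2 * (norm W)\<^sup>2) + 2 * (norm b)\<^sup>2"
    using sum_squares_bound[of "\<bar>a\<bar> * norm W" "norm b"] by (simp add: power2_sum power_mult_distrib)
  also have "\<dots> \<le> (2 * a\<^sup>2 + 2 * (norm b)\<^sup>2) * (1 + (norm W)\<^sup>2)"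
    by (simp add: algebra_simps)
  finally show "\<bar>(norm (a *\<^sub>R W + b))\<^sup>2\<bar> \<le> (2 * a\<^sup>2 + 2 * (norm b)\<^sup>2) * (1 + (norm W)\<^sup>2)" by simp
qed measurable

lemma quad_bounded_affine:
  assumes f: "quad_bounded f" shows "quad_bounded (\<lambda>W. f (a *\<^sub>R W + b))"
proof -
  obtain C where C: "C \<ge> 0" "\<And>W. \<bar>f W\<bar> \<le> C * (1 + (norm W)\<^sup>2)" using f by (rule quad_boundedE) blast
  obtain D where D: "\<And>W. \<bar>(norm (a *\<^sub>R W + b))\<^sup>2\<bar> \<le> D * (1 + (norm W)\<^sup>2)" using quad_bounded_norm_affine by (rule quad_boundedE) blast
  have [measurable]: "f \<in> borel_measurable borel" using f by (rule quad_bounded_measurable)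
  show ?thesis
  proof (rule quad_boundedI[where C = "C * (1 + D)"])
    fix W
    have "1 + (norm (a *\<^sub>R W + b))\<^sup>2 \<le> (1 + D) * (1 + (norm W)\<^sup>2)"
      using D[of W] by (simp add: distrib_right) (smt (verit) zero_le_power2)
    from mult_left_mono[OF this C(1)] C(2)[of "a *\<^sub>R W + b"]
    show "\<bar>f (a *\<^sub>R W + b)\<bar> \<le> C * (1 + D) * (1 + (norm W)\<^sup>2)" by (simp only: mult.assoc)
  qed measurable
qed

lemma integrable_matnormal_quad:
  fixes f :: "real^'q^'r \<Rightarrow> real"
  assumes "0 < v" "quad_bounded f" shows "integrable lborel (\<lambda>W. matnormal v \<Theta> W * f W)"
proof -
  obtain C where "\<And>W. \<bar>f W\<bar> \<le> C * (1 + (norm W)\<^sup>2)" using assms(2) by (rule quad_boundedE) blast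
  thus ?thesis by (rule integrable_matnormal_quadratic_bound[OF assms(1) quad_bounded_measurable[OF assms(2)]])
qed

lemma ln_matnormal:
  fixes \<Theta> W :: "real^'q^'r"
  assumes "0 < v"
  shows "ln (matnormal v \<Theta> W) = - (real (CARD('q) * CARD('r)) / 2) * ln (2 * pi * v) - (norm (W - \<Theta>))\<^sup>2 / (2 * v)"
  using assms by (simp add: matnormal_def ln_mult ln_powr)

lemma quad_bounded_ln_matnormal: "0 < v \<Longrightarrow> quad_bounded (\<lambda>W. ln (matnormal v \<Theta> W))"
  using quad_bounded_add[OF quad_bounded_const quad_bounded_cmult[OF quad_bounded_norm_affine[of 1 "-\<Theta>"], of "- 1 / (2 * v)"]]
  by (simp add: ln_matnormal)

text \<open>The substitution W = \<Theta> + sqrt v z moves the variance from the weight into the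
  integrand; a derivative in v then meets a fixed standard normal weight.\<close>

lemma nn_integral_matnormal_scale:
  fixes g :: "real^'q^'r \<Rightarrow> ennreal"
  assumes v: "0 < v" and g [measurable]: "g \<in> borel_measurable borel"
  shows "(\<integral>\<^sup>+ W. matnormal v \<Theta> W * g W \<partial>lborel) = (\<integral>\<^sup>+ z. matnormal 1 0 z * g (\<Theta> + sqrt v *\<^sub>R z) \<partial>lborel)"
proof -
  let ?d = "CARD('q) * CARD('r)"
  have d: "sqrt v ^ ?d * (2 * pi * v) powr (- (real ?d / 2)) = (2 * pi) powr (- (real ?d / 2))"
  proof -
    have "sqrt v ^ ?d = v powr (real ?d / 2)"
      using v by (simp add: powr_realpow[symmetric] powr_half_sqrt[symmetric] powr_powr del: of_nat_mult)
    moreover have "(2 * pi * v) powr (- (real ?d / 2)) = (2 * pi) powr (- (real ?d / 2)) * v powr (- (real ?d / 2))"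
      using v by (simp add: powr_mult)
    moreover have "v powr (real ?d / 2) * v powr (- (real ?d / 2)) = 1" using v by (simp add: powr_add[symmetric])
    ultimately show ?thesis by simp
  qed
  have "(\<integral>\<^sup>+ W. matnormal v \<Theta> W * g W \<partial>lborel) = (\<integral>\<^sup>+ W. matnormal v \<Theta> W * g W \<partial>density (distr lborel borel (\<lambda>x. \<Theta> + sqrt v *\<^sub>R x)) (\<lambda>_. \<bar>sqrt v\<bar> ^ DIM(real^'q^'r)))"
    using lborel_affine[of "sqrt v" \<Theta>] v by simp
  also have "\<dots> = (\<integral>\<^sup>+ z. ennreal (sqrt v ^ ?d) * (matnormal v \<Theta> (\<Theta> + sqrt v *\<^sub>R z) * g (\<Theta> + sqrt v *\<^sub>R z)) \<partial>lborel)"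
    using v by (simp add: nn_integral_density nn_integral_distr mult.commute[of "CARD('r)"])
  also have "\<dots> = (\<integral>\<^sup>+ z. matnormal 1 0 z * g (\<Theta> + sqrt v *\<^sub>R z) \<partial>lborel)"
  proof (intro nn_integral_cong)
    fix z :: "real^'q^'r"
    have "sqrt v ^ ?d * matnormal v \<Theta> (\<Theta> + sqrt v *\<^sub>R z) = matnormal 1 0 z"
      using v d by (simp add: matnormal_def power_mult_distrib)
    hence "ennreal (sqrt v ^ ?d) * ennreal (matnormal v \<Theta> (\<Theta> + sqrt v *\<^sub>R z)) = ennreal (matnormal 1 0 z)"
      using v by (subst ennreal_mult[symmetric]) auto
    thus "ennreal (sqrt v ^ ?d) * (matnormal v \<Theta> (\<Theta> + sqrt v *\<^sub>R z) * g (\<Theta> + sqrt v *\<^sub>R z)) = matnormal 1 0 z * g (\<Theta> + sqrt v *\<^sub>R z)"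
      by (simp only: mult.assoc[symmetric])
  qed
  finally show ?thesis .
qed

text \<open>Carries substitutions proved for nonnegative integrands over to signed ones, through
  positive and negative parts.\<close>

lemma integral_eq_of_nn_integrals:
  fixes f :: "'a \<Rightarrow> real" and g :: "'b \<Rightarrow> real"
  assumes "integrable M f" "integrable N g"
    and "(\<integral>\<^sup>+ x. ennreal (f x) \<partial>M) = (\<integral>\<^sup>+ x. ennreal (g x) \<partial>N)" "(\<integral>\<^sup>+ x. ennreal (- f x) \<partial>M) = (\<integral>\<^sup>+ x. ennreal (- g x) \<partial>N)"
  shows "(\<integral>x. f x \<partial>M) = (\<integral>x. g x \<partial>N)"
  using assms by (simp add: real_lebesgue_integral_def)

lemma integral_matnormal_scale:
  fixes f :: "real^'q^'r \<Rightarrow> real"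
  assumes v: "0 < v" and f: "quad_bounded f"
  shows "(\<integral>W. matnormal v \<Theta> W * f W \<partial>lborel) = (\<integral>z. matnormal 1 0 z * f (\<Theta> + sqrt v *\<^sub>R z) \<partial>lborel)"
proof (rule integral_eq_of_nn_integrals)
  have [measurable]: "f \<in> borel_measurable borel" using f by (rule quad_bounded_measurable)
  show "integrable lborel (\<lambda>W. matnormal v \<Theta> W * f W)" by (rule integrable_matnormal_quad[OF v f])
  show "integrable lborel (\<lambda>z. matnormal 1 0 z * f (\<Theta> + sqrt v *\<^sub>R z))"
    using integrable_matnormal_quad[OF _ quad_bounded_affine[OF f, of "sqrt v" \<Theta>], of 1 0] by (simp add: add.commute)
  show "(\<integral>\<^sup>+ W. ennreal (matnormal v \<Theta> W * f W) \<partial>lborel) = (\<integral>\<^sup>+ z. ennreal (matnormal 1 0 z * f (\<Theta> + sqrt v *\<^sub>R z)) \<partial>lborel)"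
    using nn_integral_matnormal_scale[OF v, of "\<lambda>W. ennreal (f W)" \<Theta>] by (simp add: ennreal_mult')
  have "ennreal (- (matnormal v \<Theta> W * f W)) = matnormal v \<Theta> W * ennreal (- f W)" for v \<Theta> W f
    by (simp add: ennreal_mult'[symmetric])
  note neg = this
  show "(\<integral>\<^sup>+ W. ennreal (- (matnormal v \<Theta> W * f W)) \<partial>lborel) = (\<integral>\<^sup>+ z. ennreal (- (matnormal 1 0 z * f (\<Theta> + sqrt v *\<^sub>R z))) \<partial>lborel)"
    using nn_integral_matnormal_scale[OF v, of "\<lambda>W. ennreal (- f W)" \<Theta>] neg[of v \<Theta> _ f] neg[of 1 0 _ "\<lambda>z. f (\<Theta> + sqrt v *\<^sub>R z)"]
    by simp
qed

text \<open>After rescaling, the term linear in z vanishes under the reflection z \<mapsto> - z. The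
  second moment of the standard normal is left as an integral, because its coefficient in the
  minimax bound tends to 0.\<close>

lemma integral_matnormal_norm2:
  fixes \<Theta> :: "real^'q^'r"
  assumes v: "0 < v"
  shows "(\<integral>W. matnormal v \<Theta> W * (norm W)\<^sup>2 \<partial>lborel) = (norm \<Theta>)\<^sup>2 + v * (\<integral>z. matnormal 1 0 z * (norm (z :: real^'q^'r))\<^sup>2 \<partial>lborel)"
proof -
  have q: "quad_bounded (\<lambda>W :: real^'q^'r. (norm W)\<^sup>2)" using quad_bounded_norm_affine[of 1 0] by simp
  have lin: "quad_bounded (\<lambda>W :: real^'q^'r. \<Theta> \<bullet> W)"
  proof (rule quad_boundedI[where C = "norm \<Theta>"])
    fix W :: "real^'q^'r"
    have "2 * norm W \<le> 1 + (norm W)\<^sup>2" using sum_squares_bound[of "norm W" 1] by simp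
    hence "norm W \<le> 1 + (norm W)\<^sup>2" using norm_ge_zero[of W] by linarith
    hence "norm \<Theta> * norm W \<le> norm \<Theta> * (1 + (norm W)\<^sup>2)" by (intro mult_left_mono) auto
    thus "\<bar>\<Theta> \<bullet> W\<bar> \<le> norm \<Theta> * (1 + (norm W)\<^sup>2)" using Cauchy_Schwarz_ineq2[of \<Theta> W] by linarith
  qed measurable
  note i1 = integrable_matnormal_quad[OF zero_less_one q, of 0] and i2 = integrable_matnormal_quad[OF zero_less_one lin, of 0]
  have i0: "integrable lborel (matnormal 1 (0 :: real^'q^'r))" by simp
  have zero: "(\<integral>z. matnormal 1 0 z * (\<Theta> \<bullet> z) \<partial>lborel) = 0"
  proof -
    let ?F = "\<lambda>z. matnormal 1 0 z * (\<Theta> \<bullet> z)"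
    have eq: "distr lborel borel (\<lambda>x. - x) = (lborel :: (real^'q^'r) measure)"
      using lborel_affine[of "-1 :: real" "0 :: real^'q^'r"] by (simp add: density_1)
    have "(\<integral>z. ?F z \<partial>distr lborel borel (\<lambda>x. - x)) = (\<integral>z. ?F (- z) \<partial>lborel)" by (rule integral_distr) measurable
    hence "(\<integral>z. ?F z \<partial>lborel) = (\<integral>z. ?F (- z) \<partial>lborel)" by (simp only: eq)
    also have "\<dots> = (\<integral>z. - (matnormal 1 0 z * (\<Theta> \<bullet> z)) \<partial>lborel)" by (simp add: matnormal_def)
    finally show ?thesis by simp
  qed
  have "(\<integral>W. matnormal v \<Theta> W * (norm W)\<^sup>2 \<partial>lborel) = (\<integral>z. matnormal 1 0 z * (norm (\<Theta> + sqrt v *\<^sub>R z))\<^sup>2 \<partial>lborel)"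
    by (rule integral_matnormal_scale[OF v q])
  also have "\<dots> = (\<integral>z. (norm \<Theta>)\<^sup>2 * matnormal 1 0 z + (2 * sqrt v) * (matnormal 1 0 z * (\<Theta> \<bullet> z)) + v * (matnormal 1 0 z * (norm z)\<^sup>2) \<partial>lborel)"
  proof (intro Bochner_Integration.integral_cong refl)
    fix z :: "real^'q^'r"
    have "(norm (\<Theta> + sqrt v *\<^sub>R z))\<^sup>2 = (norm \<Theta>)\<^sup>2 + 2 * sqrt v * (\<Theta> \<bullet> z) + v * (norm z)\<^sup>2"
      unfolding power2_norm_eq_inner using v by (simp add: inner_add inner_commute[of z \<Theta>] algebra_simps)
    thus "matnormal 1 0 z * (norm (\<Theta> + sqrt v *\<^sub>R z))\<^sup>2 = (norm \<Theta>)\<^sup>2 * matnormal 1 0 z + (2 * sqrt v) * (matnormal 1 0 z * (\<Theta> \<bullet> z)) + v * (matnormal 1 0 z * (norm z)\<^sup>2)"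
      by (simp add: algebra_simps)
  qed
  also have "\<dots> = (norm \<Theta>)\<^sup>2 * 1 + (2 * sqrt v) * 0 + v * (\<integral>z. matnormal 1 0 z * (norm (z :: real^'q^'r))\<^sup>2 \<partial>lborel)"
    using i0 i1 i2 by (simp add: zero integral_matnormal)
  finally show ?thesis by simp
qed

text \<open>An integrable minorant keeps the negative part of \<open>f\<close> finite, which
  excludes an indeterminate difference. The proof uses monotonicity of \<open>nn_integral\<close>
  alone, valid for arbitrary functions; \<open>f\<close> will be the loss of an unspecified
  competitor, possibly infinite.\<close>

lemma ext_integral_ge:
  assumes h: "integrable M h" and le: "AE x in M. ereal (h x) \<le> f x"
  shows "ereal (\<integral>x. h x \<partial>M) \<le> ext_integral M f"
proof -
  have hm: "h \<in> borel_measurable M" using h by simp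
  have fin: "(\<integral>\<^sup>+ x. ennreal (h x) \<partial>M) < \<infinity>" "(\<integral>\<^sup>+ x. ennreal (- h x) \<partial>M) < \<infinity>"
    using h by (auto simp: real_integrable_def top.not_eq_extremum)
  have p: "(\<integral>\<^sup>+ x. ennreal (h x) \<partial>M) \<le> (\<integral>\<^sup>+ x. e2ennreal (f x) \<partial>M)"
  proof (rule nn_integral_mono_AE)
    show "AE x in M. ennreal (h x) \<le> e2ennreal (f x)" using le
      by eventually_elim (metis e2ennreal_ereal e2ennreal_mono)
  qed
  have n: "(\<integral>\<^sup>+ x. e2ennreal (- f x) \<partial>M) \<le> (\<integral>\<^sup>+ x. ennreal (- h x) \<partial>M)"
  proof (rule nn_integral_mono_AE)
    show "AE x in M. e2ennreal (- f x) \<le> ennreal (- h x)" using le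
    proof eventually_elim
      case (elim x)
      hence "- f x \<le> ereal (- h x)" by (metis ereal_minus_le_minus uminus_ereal.simps(1))
      thus ?case by (metis e2ennreal_ereal e2ennreal_mono)
    qed
  qed
  have "ereal (\<integral>x. h x \<partial>M) = enn2ereal (\<integral>\<^sup>+ x. ennreal (h x) \<partial>M) - enn2ereal (\<integral>\<^sup>+ x. ennreal (- h x) \<partial>M)"
  proof -
    obtain a b where "(\<integral>\<^sup>+ x. ennreal (h x) \<partial>M) = ennreal a" "(\<integral>\<^sup>+ x. ennreal (- h x) \<partial>M) = ennreal b" "a \<ge> 0" "b \<ge> 0"
      using fin by (metis ennreal_cases infinity_ennreal_def less_irrefl)
    thus ?thesis using real_lebesgue_integral_def[OF h] by (simp add: enn2ereal_ennreal)
  qed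
  also have "\<dots> \<le> enn2ereal (\<integral>\<^sup>+ x. e2ennreal (f x) \<partial>M) - enn2ereal (\<integral>\<^sup>+ x. e2ennreal (- f x) \<partial>M)"
    by (intro ereal_minus_mono) (use p n in \<open>simp_all add: less_eq_ennreal.rep_eq\<close>)
  finally show ?thesis by (simp add: ext_integral_def)
qed

lemma ext_integral_ereal:
  assumes h: "integrable M h"
  shows "ext_integral M (\<lambda>x. ereal (h x)) = ereal (\<integral>x. h x \<partial>M)"
proof -
  have fin: "(\<integral>\<^sup>+ x. ennreal (h x) \<partial>M) < \<infinity>" "(\<integral>\<^sup>+ x. ennreal (- h x) \<partial>M) < \<infinity>"
    using h by (auto simp: real_integrable_def top.not_eq_extremum)
  obtain a b where "(\<integral>\<^sup>+ x. ennreal (h x) \<partial>M) = ennreal a" "(\<integral>\<^sup>+ x. ennreal (- h x) \<partial>M) = ennreal b" "a \<ge> 0" "b \<ge> 0"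
    using fin by (metis ennreal_cases infinity_ennreal_def less_irrefl)
  thus ?thesis using real_lebesgue_integral_def[OF h] by (simp add: ext_integral_def enn2ereal_ennreal e2ennreal_ereal)
qed

text \<open>The mean of X and Y weighted by their precisions 1/a and 1/b, the sufficient statistic
  for \<Theta>.\<close>

definition pool :: "real \<Rightarrow> real \<Rightarrow> real^'q^'r \<Rightarrow> real^'q^'r \<Rightarrow> real^'q^'r" where
  "pool a b X Y = (b / (a + b)) *\<^sub>R X + (a / (a + b)) *\<^sub>R Y"

lemma borel_measurable_pool [measurable (raw)]:
  assumes [measurable]: "f \<in> borel_measurable M" "g \<in> borel_measurable M"
  shows "(\<lambda>x. pool a b (f x) (g x)) \<in> borel_measurable M"
  unfolding pool_def by measurable

text \<open>After the sampling densities are factored, write Y = X + D. The remaining weight is a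
  density in D alone, and the pooled value is X plus a multiple of D; integrating over X first
  removes this shift, and the weight then integrates to 1.\<close>

lemma nn_integral_pool:
  fixes g :: "real^'q^'r \<Rightarrow> ennreal"
  assumes a: "0 < a" and b: "0 < b" and g [measurable]: "g \<in> borel_measurable borel"
  shows "(\<integral>\<^sup>+ X. (\<integral>\<^sup>+ Y. ennreal (matnormal a \<Theta> X * matnormal b \<Theta> Y) * g (pool a b X Y) \<partial>lborel) \<partial>lborel)
     = (\<integral>\<^sup>+ W. matnormal (a * b / (a + b)) \<Theta> W * g W \<partial>lborel)"
proof -
  define h where "h W = ennreal (matnormal (a * b / (a + b)) \<Theta> W) * g W" for W
  have hm [measurable]: "h \<in> borel_measurable borel" unfolding h_def by measurable
  have "(\<integral>\<^sup>+ Y. ennreal (matnormal a \<Theta> X * matnormal b \<Theta> Y) * g (pool a b X Y) \<partial>lborel) =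
     (\<integral>\<^sup>+ D. matnormal (a + b) 0 D * h ((a / (a + b)) *\<^sub>R D + X) \<partial>lborel)" for X
  proof -
    have "(\<integral>\<^sup>+ Y. ennreal (matnormal a \<Theta> X * matnormal b \<Theta> Y) * g (pool a b X Y) \<partial>lborel) =
      (\<integral>\<^sup>+ Y. matnormal (a + b) X Y * h (pool a b X Y) \<partial>lborel)"
      unfolding matnormal_product[OF a b] h_def pool_def[symmetric]
      by (intro nn_integral_cong) (simp add: ennreal_mult' mult_ac)
    also have "\<dots> = (\<integral>\<^sup>+ D. matnormal (a + b) X (X + D) * h (pool a b X (X + D)) \<partial>lborel)"
      by (rule nn_integral_lborel_shift[symmetric]) measurable
    also have "\<dots> = (\<integral>\<^sup>+ D. matnormal (a + b) 0 D * h ((a / (a + b)) *\<^sub>R D + X) \<partial>lborel)"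
    proof (intro nn_integral_cong)
      fix D
      have "pool a b X (X + D) = (b / (a + b) + a / (a + b)) *\<^sub>R X + (a / (a + b)) *\<^sub>R D"
        unfolding pool_def by (simp only: scaleR_add_right scaleR_add_left add.assoc)
      also have "b / (a + b) + a / (a + b) = 1" using a b by (simp add: add_divide_distrib[symmetric])
      finally have "pool a b X (X + D) = (a / (a + b)) *\<^sub>R D + X" by (simp add: add.commute)
      moreover have "matnormal (a + b) X (X + D) = matnormal (a + b) 0 D" by (simp add: matnormal_def)
      ultimately show "ennreal (matnormal (a + b) X (X + D)) * h (pool a b X (X + D)) = ennreal (matnormal (a + b) 0 D) * h ((a / (a + b)) *\<^sub>R D + X)" by simp
    qed
    finally show ?thesis .
  qed
  hence "(\<integral>\<^sup>+ X. (\<integral>\<^sup>+ Y. ennreal (matnormal a \<Theta> X * matnormal b \<Theta> Y) * g (pool a b X Y) \<partial>lborel) \<partial>lborel)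
    = (\<integral>\<^sup>+ X. (\<integral>\<^sup>+ D. matnormal (a + b) 0 D * h ((a / (a + b)) *\<^sub>R D + X) \<partial>lborel) \<partial>lborel)" by simp
  also have "\<dots> = (\<integral>\<^sup>+ D. (\<integral>\<^sup>+ X. matnormal (a + b) 0 D * h ((a / (a + b)) *\<^sub>R D + X) \<partial>lborel) \<partial>lborel)"
    by (rule lborel_pair.Fubini') measurable
  also have "\<dots> = (\<integral>\<^sup>+ D. matnormal (a + b) (0 :: real^'q^'r) D * (\<integral>\<^sup>+ X. h X \<partial>lborel) \<partial>lborel)"
    by (intro nn_integral_cong) (simp add: nn_integral_cmult nn_integral_lborel_shift)
  also have "\<dots> = (\<integral>\<^sup>+ X. h X \<partial>lborel)"
    using a b by (subst nn_integral_multc) (auto simp: nn_integral_matnormal)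
  finally show ?thesis by (simp add: h_def)
qed

lemma integral_pool:
  fixes f :: "real^'q^'r \<Rightarrow> real"
  assumes a: "0 < a" and b: "0 < b" and f: "quad_bounded f"
  shows "integrable lborel (\<lambda>X. matnormal a \<Theta> X * (\<integral>Y. matnormal b \<Theta> Y * f (pool a b X Y) \<partial>lborel))"
    and "(\<integral>X. matnormal a \<Theta> X * (\<integral>Y. matnormal b \<Theta> Y * f (pool a b X Y) \<partial>lborel) \<partial>lborel) =
      (\<integral>W. matnormal (a * b / (a + b)) \<Theta> W * f W \<partial>lborel)"
proof -
  have fm [measurable]: "f \<in> borel_measurable borel" using f by (rule quad_bounded_measurable)
  have w: "0 < a * b / (a + b)" using a b by simp
  define Q where "Q = (\<lambda>(X, Y). matnormal a \<Theta> X * matnormal b \<Theta> Y * f (pool a b X Y))"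
  have nn: "(\<integral>\<^sup>+ p. ennreal (matnormal a \<Theta> (fst p) * matnormal b \<Theta> (snd p)) * ennreal (F (pool a b (fst p) (snd p))) \<partial>(lborel \<Otimes>\<^sub>M lborel)) =
      (\<integral>\<^sup>+ W. ennreal (matnormal (a * b / (a + b)) \<Theta> W) * ennreal (F W) \<partial>lborel)" if [measurable]: "F \<in> borel_measurable borel" for F :: "real^'q^'r \<Rightarrow> real"
    by (subst lborel.nn_integral_fst[symmetric]) (simp_all add: nn_integral_pool[OF a b, of "\<lambda>W. ennreal (F W)"])
  have nonneg: "0 \<le> matnormal a \<Theta> X * matnormal b \<Theta> Y" for X Y by simp
  have iw: "integrable lborel (\<lambda>W. matnormal (a * b / (a + b)) \<Theta> W * f W)" by (rule integrable_matnormal_quad[OF w f])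
  have iQ: "integrable (lborel \<Otimes>\<^sub>M lborel) Q"
  proof (rule integrableI_bounded)
    show "Q \<in> borel_measurable (lborel \<Otimes>\<^sub>M lborel)" unfolding Q_def by measurable
    have "(\<integral>\<^sup>+ p. ennreal (norm (Q p)) \<partial>(lborel \<Otimes>\<^sub>M lborel)) = (\<integral>\<^sup>+ p. ennreal (matnormal a \<Theta> (fst p) * matnormal b \<Theta> (snd p)) * ennreal \<bar>f (pool a b (fst p) (snd p))\<bar> \<partial>(lborel \<Otimes>\<^sub>M lborel))"
      by (intro nn_integral_cong) (auto simp: Q_def split_beta abs_mult ennreal_mult'[symmetric])
    also have "\<dots> = (\<integral>\<^sup>+ W. ennreal (norm (matnormal (a * b / (a + b)) \<Theta> W * f W)) \<partial>lborel)"
      by (subst nn) (auto simp: abs_mult ennreal_mult'[symmetric])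
    also have "\<dots> < \<infinity>" using iw by (simp add: integrable_iff_bounded)
    finally show "(\<integral>\<^sup>+ p. ennreal (norm (Q p)) \<partial>(lborel \<Otimes>\<^sub>M lborel)) < \<infinity>" .
  qed
  have eq: "(\<integral>p. Q p \<partial>(lborel \<Otimes>\<^sub>M lborel)) = (\<integral>W. matnormal (a * b / (a + b)) \<Theta> W * f W \<partial>lborel)"
  proof (rule integral_eq_of_nn_integrals[OF iQ iw])
    have "(\<integral>\<^sup>+ p. ennreal (Q p) \<partial>(lborel \<Otimes>\<^sub>M lborel)) = (\<integral>\<^sup>+ p. ennreal (matnormal a \<Theta> (fst p) * matnormal b \<Theta> (snd p)) * ennreal (f (pool a b (fst p) (snd p))) \<partial>(lborel \<Otimes>\<^sub>M lborel))"
      by (intro nn_integral_cong) (auto simp: Q_def split_beta ennreal_mult'[symmetric])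
    also have "\<dots> = (\<integral>\<^sup>+ W. ennreal (matnormal (a * b / (a + b)) \<Theta> W) * ennreal (f W) \<partial>lborel)" by (rule nn) measurable
    also have "\<dots> = (\<integral>\<^sup>+ W. ennreal (matnormal (a * b / (a + b)) \<Theta> W * f W) \<partial>lborel)"
      by (intro nn_integral_cong) (auto simp: ennreal_mult'[symmetric])
    finally show "(\<integral>\<^sup>+ p. ennreal (Q p) \<partial>(lborel \<Otimes>\<^sub>M lborel)) = (\<integral>\<^sup>+ W. ennreal (matnormal (a * b / (a + b)) \<Theta> W * f W) \<partial>lborel)" .
    have "(\<integral>\<^sup>+ p. ennreal (- Q p) \<partial>(lborel \<Otimes>\<^sub>M lborel)) = (\<integral>\<^sup>+ p. ennreal (matnormal a \<Theta> (fst p) * matnormal b \<Theta> (snd p)) * ennreal (- f (pool a b (fst p) (snd p))) \<partial>(lborel \<Otimes>\<^sub>M lborel))"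
      by (intro nn_integral_cong) (auto simp: Q_def split_beta ennreal_mult'[symmetric])
    also have "\<dots> = (\<integral>\<^sup>+ W. ennreal (matnormal (a * b / (a + b)) \<Theta> W) * ennreal (- f W) \<partial>lborel)" by (rule nn) measurable
    also have "\<dots> = (\<integral>\<^sup>+ W. ennreal (- (matnormal (a * b / (a + b)) \<Theta> W * f W)) \<partial>lborel)"
      by (intro nn_integral_cong) (auto simp: ennreal_mult'[symmetric])
    finally show "(\<integral>\<^sup>+ p. ennreal (- Q p) \<partial>(lborel \<Otimes>\<^sub>M lborel)) = (\<integral>\<^sup>+ W. ennreal (- (matnormal (a * b / (a + b)) \<Theta> W * f W)) \<partial>lborel)" .
  qed
  have inner: "(\<integral>Y. Q (X, Y) \<partial>lborel) = matnormal a \<Theta> X * (\<integral>Y. matnormal b \<Theta> Y * f (pool a b X Y) \<partial>lborel)" for X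
    by (simp add: Q_def mult.assoc)
  show "integrable lborel (\<lambda>X. matnormal a \<Theta> X * (\<integral>Y. matnormal b \<Theta> Y * f (pool a b X Y) \<partial>lborel))"
    using lborel_pair.integrable_fst'[OF iQ] by (simp only: inner)
  show "(\<integral>X. matnormal a \<Theta> X * (\<integral>Y. matnormal b \<Theta> Y * f (pool a b X Y) \<partial>lborel) \<partial>lborel) =
      (\<integral>W. matnormal (a * b / (a + b)) \<Theta> W * f W \<partial>lborel)"
    using lborel_pair.integral_fst'[OF iQ] by (simp only: inner eq)
qed

section \<open>Kullback-Leibler risk and the minimax value\<close>

text \<open>Growth in Y is integrated away into the second moment \<open>K\<close>, and quadratic
  growth in X survives.\<close>

lemma quad_bounded_matnormal_integral:
  fixes f :: "real^'q^'r \<Rightarrow> real^'q^'r \<Rightarrow> real"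
  assumes v: "0 < v" and m: "(\<lambda>(X, Y). f X Y) \<in> borel_measurable (borel \<Otimes>\<^sub>M borel)"
    and b: "\<And>X Y. \<bar>f X Y\<bar> \<le> C * (1 + (norm X)\<^sup>2 + (norm Y)\<^sup>2)"
  shows "quad_bounded (\<lambda>X. \<integral>Y. matnormal v \<Theta> Y * f X Y \<partial>lborel)"
proof -
  define K where "K = (\<integral>Y. matnormal v \<Theta> Y * (norm Y)\<^sup>2 \<partial>lborel)"
  have q: "quad_bounded (\<lambda>W :: real^'q^'r. (norm W)\<^sup>2)" using quad_bounded_norm_affine[of 1 0] by simp
  have C: "C \<ge> 0" using b[of 0 0] by simp
  have m' [measurable]: "(\<lambda>p. f (fst p) (snd p)) \<in> borel_measurable (borel \<Otimes>\<^sub>M borel)" using m by (simp add: split_beta)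
  have fX: "(\<lambda>Y. f X Y) \<in> borel_measurable borel" for X
    using measurable_compose[OF measurable_Pair1'[of X borel borel] m'] by simp
  have qf: "quad_bounded (\<lambda>Y. f X Y)" for X
  proof (rule quad_boundedI[where C = "C * (1 + (norm X)\<^sup>2)", OF fX])
    fix Y :: "real^'q^'r"
    have "C * (1 + (norm X)\<^sup>2 + (norm Y)\<^sup>2) \<le> C * ((1 + (norm X)\<^sup>2) * (1 + (norm Y)\<^sup>2))"
      using C by (intro mult_left_mono) (auto simp: algebra_simps)
    thus "\<bar>f X Y\<bar> \<le> C * (1 + (norm X)\<^sup>2) * (1 + (norm Y)\<^sup>2)" using b[of X Y] by (simp only: mult.assoc)
  qed
  have K0: "K \<ge> 0" unfolding K_def by (intro integral_nonneg_AE) simp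
  show ?thesis
  proof (rule quad_boundedI[where C = "C * (1 + K)"])
    show "(\<lambda>X. \<integral>Y. matnormal v \<Theta> Y * f X Y \<partial>lborel) \<in> borel_measurable borel"
      by (rule lborel.borel_measurable_lebesgue_integral) (simp add: split_beta')
    fix X :: "real^'q^'r"
    have "\<bar>\<integral>Y. matnormal v \<Theta> Y * f X Y \<partial>lborel\<bar> \<le> (\<integral>Y. \<bar>matnormal v \<Theta> Y * f X Y\<bar> \<partial>lborel)"
      by (rule integral_abs_bound)
    also have "\<dots> \<le> (\<integral>Y. C * (1 + (norm X)\<^sup>2) * matnormal v \<Theta> Y + C * (matnormal v \<Theta> Y * (norm Y)\<^sup>2) \<partial>lborel)"
    proof (rule integral_mono)
      show "integrable lborel (\<lambda>Y. \<bar>matnormal v \<Theta> Y * f X Y\<bar>)" by (intro integrable_abs integrable_matnormal_quad v qf)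
      show "integrable lborel (\<lambda>Y. C * (1 + (norm X)\<^sup>2) * matnormal v \<Theta> Y + C * (matnormal v \<Theta> Y * (norm Y)\<^sup>2))"
        by (intro Bochner_Integration.integrable_add integrable_mult_right integrable_matnormal_quad v q integrable_matnormal)
      fix Y
      have "\<bar>matnormal v \<Theta> Y * f X Y\<bar> \<le> matnormal v \<Theta> Y * (C * (1 + (norm X)\<^sup>2 + (norm Y)\<^sup>2))"
        using mult_left_mono[OF b matnormal_nonneg] by (simp add: abs_mult)
      thus "\<bar>matnormal v \<Theta> Y * f X Y\<bar> \<le> C * (1 + (norm X)\<^sup>2) * matnormal v \<Theta> Y + C * (matnormal v \<Theta> Y * (norm Y)\<^sup>2)"
        by (simp add: algebra_simps)
    qed
    also have "\<dots> = C * (1 + (norm X)\<^sup>2) + C * K"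
      using integrable_matnormal[OF v, of \<Theta>] integrable_matnormal_quad[OF v q, of \<Theta>] by (simp add: integral_matnormal[OF v] K_def)
    also have "\<dots> \<le> C * (1 + K) * (1 + (norm X)\<^sup>2)"
      using C K0 by (simp add: algebra_simps)
    finally show "\<bar>\<integral>Y. matnormal v \<Theta> Y * f X Y \<partial>lborel\<bar> \<le> C * (1 + K) * (1 + (norm X)\<^sup>2)" .
  qed
qed

text \<open>The risk of the predictive density \<open>matnormal (a + b) X\<close>, which belongs to the uniform prior.\<close>

definition base_loss :: "real \<Rightarrow> real \<Rightarrow> real^'q^'r \<Rightarrow> real^'q^'r \<Rightarrow> real" where
  "base_loss a b \<Theta> X = (\<integral>Y. matnormal b \<Theta> Y * (ln (matnormal b \<Theta> Y) - ln (matnormal (a + b) X Y)) \<partial>lborel)"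

definition base_risk :: "real \<Rightarrow> real \<Rightarrow> real^'q^'r \<Rightarrow> real" where
  "base_risk a b \<Theta> = (\<integral>X. matnormal a \<Theta> X * base_loss a b \<Theta> X \<partial>lborel)"

text \<open>The problem and the predictive density \<open>matnormal (a + b) X\<close> are invariant
  under a common shift of X, Y and \<Theta>.\<close>

lemma base_risk_const:
  assumes a: "0 < a" and b: "0 < b" shows "base_risk a b (\<Theta> :: real^'q^'r) = base_risk a b (0 :: real^'q^'r)"
proof -
  have s0: "matnormal v \<Theta> (\<Theta> + Y) = matnormal v 0 Y" for v Y by (simp add: matnormal_def)
  have L: "base_loss a b \<Theta> (\<Theta> + X) = base_loss a b 0 X" for X
  proof -
    let ?G = "\<lambda>Y. matnormal b \<Theta> Y * (ln (matnormal b \<Theta> Y) - ln (matnormal (a + b) (\<Theta> + X) Y))"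
    have "?G \<in> borel_measurable borel" by measurable
    from integral_lborel_shift(1)[OF this, of \<Theta>] show ?thesis
      unfolding base_loss_def s0 matnormal_shift by simp
  qed
  let ?H = "\<lambda>X. matnormal a \<Theta> X * base_loss a b \<Theta> X"
  have "?H \<in> borel_measurable borel"
    unfolding base_loss_def by (intro borel_measurable_times lborel.borel_measurable_lebesgue_integral) (auto simp: split_beta')
  from integral_lborel_shift(1)[OF this, of \<Theta>] show ?thesis
    unfolding base_risk_def L s0 by simp
qed

lemma quad_bounded_base_loss:
  assumes a: "0 < a" and b: "0 < b" shows "quad_bounded (base_loss a b (\<Theta> :: real^'q^'r))"
proof -
  obtain C where C: "C \<ge> 0" "\<And>Y. \<bar>ln (matnormal b \<Theta> Y)\<bar> \<le> C * (1 + (norm Y)\<^sup>2)"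
    using quad_bounded_ln_matnormal[OF b] by (rule quad_boundedE) blast
  have ab: "0 < a + b" using a b by simp
  let ?c = "\<bar>real (CARD('q) * CARD('r)) / 2 * ln (2 * pi * (a + b))\<bar>"
  have D: "\<bar>ln (matnormal (a + b) X Y)\<bar> \<le> (?c + 1 / (a + b)) * (1 + (norm X)\<^sup>2 + (norm Y)\<^sup>2)" for X Y :: "real^'q^'r"
  proof -
    have "(norm (Y - X))\<^sup>2 \<le> (norm Y + norm X)\<^sup>2" using norm_triangle_ineq4[of Y X] by (intro power_mono) auto
    also have "\<dots> \<le> 2 * (norm X)\<^sup>2 + 2 * (norm Y)\<^sup>2" using sum_squares_bound[of "norm Y" "norm X"] by (simp add: power2_sum)
    also have "\<dots> \<le> 2 * (1 + (norm X)\<^sup>2 + (norm Y)\<^sup>2)" by simp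
    finally have "(norm (Y - X))\<^sup>2 / (2 * (a + b)) \<le> (2 * (1 + (norm X)\<^sup>2 + (norm Y)\<^sup>2)) / (2 * (a + b))" using ab by (intro divide_right_mono) auto
    also have "\<dots> = 1 / (a + b) * (1 + (norm X)\<^sup>2 + (norm Y)\<^sup>2)"
    proof -
      have "(2 * u) / (2 * s) = 1 / s * u" for u s :: real by simp
      thus ?thesis .
    qed
    finally have 1: "(norm (Y - X))\<^sup>2 / (2 * (a + b)) \<le> 1 / (a + b) * (1 + (norm X)\<^sup>2 + (norm Y)\<^sup>2)" .
    have 2: "?c \<le> ?c * (1 + (norm X)\<^sup>2 + (norm Y)\<^sup>2)" by (intro mult_right_le_one_le[THEN order_trans] order_refl | simp add: distrib_left)+
    have "\<bar>ln (matnormal (a + b) X Y)\<bar> \<le> ?c + (norm (Y - X))\<^sup>2 / (2 * (a + b))"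
      unfolding ln_matnormal[OF ab] using ab abs_triangle_ineq4[of "- (real (CARD('q) * CARD('r)) / 2) * ln (2 * pi * (a + b))" "(norm (Y - X))\<^sup>2 / (2 * (a + b))"] by simp
    thus ?thesis using 1 2 unfolding distrib_right by linarith
  qed
  show ?thesis unfolding base_loss_def[abs_def]
  proof (rule quad_bounded_matnormal_integral[OF b, where C = "C + (?c + 1 / (a + b))"])
    fix X Y :: "real^'q^'r"
    have "\<bar>ln (matnormal b \<Theta> Y)\<bar> \<le> C * (1 + (norm X)\<^sup>2 + (norm Y)\<^sup>2)"
      using C(2)[of Y] mult_left_mono[of "1 + (norm Y)\<^sup>2" "1 + (norm X)\<^sup>2 + (norm Y)\<^sup>2" C] C(1) by simp
    thus "\<bar>ln (matnormal b \<Theta> Y) - ln (matnormal (a + b) X Y)\<bar> \<le> (C + (?c + 1 / (a + b))) * (1 + (norm X)\<^sup>2 + (norm Y)\<^sup>2)"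
      using D[of X Y] abs_triangle_ineq4[of "ln (matnormal b \<Theta> Y)" "ln (matnormal (a + b) X Y)"] unfolding distrib_right by linarith
  qed (simp add: split_beta')
qed

text \<open>The shape of a Bayes predictive density after pooling: A stands for the marginal density
  at variance a b / (a + b) and B for the one at variance a. The locale is used twice, for the
  normal priors behind the lower bound and for the hierarchical prior.\<close>

locale prior_ratio =
  fixes a b :: real and A B :: "real^'q^'r \<Rightarrow> real"
  assumes a: "0 < a" and b: "0 < b" and Apos: "\<And>W. 0 < A W" and Bpos: "\<And>W. 0 < B W"
    and lnA: "quad_bounded (\<lambda>W. ln (A W))" and lnB: "quad_bounded (\<lambda>W. ln (B W))"
begin

definition dens :: "real^'q^'r \<Rightarrow> real^'q^'r \<Rightarrow> real" where
  "dens X Y = matnormal (a + b) X Y * A (pool a b X Y) / B X"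

definition logr :: "real^'q^'r \<Rightarrow> real^'q^'r \<Rightarrow> real^'q^'r \<Rightarrow> real" where
  "logr \<Theta> X Y = ln (matnormal b \<Theta> Y) - ln (matnormal (a + b) X Y) - ln (A (pool a b X Y)) + ln (B X)"

definition loss :: "real^'q^'r \<Rightarrow> real^'q^'r \<Rightarrow> real" where
  "loss \<Theta> X = base_loss a b \<Theta> X - (\<integral>Y. matnormal b \<Theta> Y * ln (A (pool a b X Y)) \<partial>lborel) + ln (B X)"

text \<open>The double integral of \<open>ln (A (pool a b X Y))\<close> appears here as a single
  one, under the law of the pooled observation, and the base risk at 0 stands for that at every
  \<Theta>.\<close>

definition risk :: "real^'q^'r \<Rightarrow> real" where
  "risk \<Theta> = base_risk a b (0 :: real^'q^'r) - (\<integral>W. matnormal (a * b / (a + b)) \<Theta> W * ln (A W) \<partial>lborel) + (\<integral>X. matnormal a \<Theta> X * ln (B X) \<partial>lborel)"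

lemma dens_pos: "0 < dens X Y"
  unfolding dens_def by (intro divide_pos_pos mult_pos_pos matnormal_pos Apos Bpos add_pos_pos a b)

lemma logr_eq: "ln (matnormal b \<Theta> Y / dens X Y) = logr \<Theta> X Y"
proof -
  have ab: "0 < a + b" using a b by simp
  note p = matnormal_pos[OF b, of \<Theta> Y] matnormal_pos[OF ab, of X Y] Apos[of "pool a b X Y"] Bpos[of X]
  have "ln (matnormal b \<Theta> Y / dens X Y) = ln (matnormal b \<Theta> Y) - ln (dens X Y)"
    using p(1) dens_pos[of X Y] by (simp add: ln_div)
  moreover have "ln (dens X Y) = ln (matnormal (a + b) X Y * A (pool a b X Y)) - ln (B X)"
    unfolding dens_def using p by (simp add: ln_div)
  moreover have "ln (matnormal (a + b) X Y * A (pool a b X Y)) = ln (matnormal (a + b) X Y) + ln (A (pool a b X Y))"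
    using p by (simp add: ln_mult)
  ultimately show ?thesis unfolding logr_def by linarith
qed

lemma pool_affine: "pool a b X Y = (a / (a + b)) *\<^sub>R Y + (b / (a + b)) *\<^sub>R X"
  by (simp add: pool_def add.commute)

lemma integrable_logr: "integrable lborel (\<lambda>Y. matnormal b \<Theta> Y * logr \<Theta> X Y)"
  and integral_logr: "(\<integral>Y. matnormal b \<Theta> Y * logr \<Theta> X Y \<partial>lborel) = loss \<Theta> X"
proof -
  have ab: "0 < a + b" using a b by simp
  have q1: "quad_bounded (\<lambda>Y. ln (matnormal b \<Theta> Y) - ln (matnormal (a + b) X Y))"
    by (intro quad_bounded_diff quad_bounded_ln_matnormal b ab)
  have q2: "quad_bounded (\<lambda>Y. ln (A (pool a b X Y)))"
    unfolding pool_affine by (rule quad_bounded_affine[OF lnA])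
  note i1 = integrable_matnormal_quad[OF b q1, of \<Theta>] and i2 = integrable_matnormal_quad[OF b q2, of \<Theta>]
  have i3: "integrable lborel (\<lambda>Y. matnormal b \<Theta> Y * ln (B X))" by (intro integrable_mult_left integrable_matnormal b)
  have I3: "(\<integral>Y. matnormal b \<Theta> Y * ln (B X) \<partial>lborel) = ln (B X)"
    using integrable_matnormal[OF b, of \<Theta>] by (simp add: integral_matnormal[OF b])
  have eq: "matnormal b \<Theta> Y * logr \<Theta> X Y = matnormal b \<Theta> Y * (ln (matnormal b \<Theta> Y) - ln (matnormal (a + b) X Y)) - matnormal b \<Theta> Y * ln (A (pool a b X Y)) + matnormal b \<Theta> Y * ln (B X)" for Y
    by (simp add: logr_def algebra_simps)
  show "integrable lborel (\<lambda>Y. matnormal b \<Theta> Y * logr \<Theta> X Y)"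
    unfolding eq using i1 i2 i3 by (intro Bochner_Integration.integrable_add Bochner_Integration.integrable_diff)
  show "(\<integral>Y. matnormal b \<Theta> Y * logr \<Theta> X Y \<partial>lborel) = loss \<Theta> X"
    unfolding eq loss_def base_loss_def using i1 i2 i3
    by (simp only: Bochner_Integration.integral_add Bochner_Integration.integral_diff Bochner_Integration.integrable_diff I3)
qed

lemma integrable_loss: "integrable lborel (\<lambda>X. matnormal a \<Theta> X * loss \<Theta> X)"
  and integral_loss: "(\<integral>X. matnormal a \<Theta> X * loss \<Theta> X \<partial>lborel) = risk \<Theta>"
proof -
  note i1 = integrable_matnormal_quad[OF a quad_bounded_base_loss[OF a b, of \<Theta>], of \<Theta>]
    and i2 = integral_pool[OF a b lnA, of \<Theta>] and i3 = integrable_matnormal_quad[OF a lnB, of \<Theta>]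
  have eq: "matnormal a \<Theta> X * loss \<Theta> X = matnormal a \<Theta> X * base_loss a b \<Theta> X - matnormal a \<Theta> X * (\<integral>Y. matnormal b \<Theta> Y * ln (A (pool a b X Y)) \<partial>lborel) + matnormal a \<Theta> X * ln (B X)" for X
    by (simp add: loss_def algebra_simps)
  show "integrable lborel (\<lambda>X. matnormal a \<Theta> X * loss \<Theta> X)"
    unfolding eq using i1 i2(1) i3 by (intro Bochner_Integration.integrable_add Bochner_Integration.integrable_diff)
  have br: "base_risk a b (0 :: real^'q^'r) = (\<integral>X. matnormal a \<Theta> X * base_loss a b \<Theta> X \<partial>lborel)"
    using base_risk_const[OF a b, of \<Theta>] unfolding base_risk_def by (rule sym)
  show "(\<integral>X. matnormal a \<Theta> X * loss \<Theta> X \<partial>lborel) = risk \<Theta>"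
    unfolding eq risk_def br using i1 i2 i3
    by (simp only: Bochner_Integration.integral_add Bochner_Integration.integral_diff Bochner_Integration.integrable_diff)
qed

lemma KL_risk_dens: "KL_risk a b dens \<Theta> = ereal (risk \<Theta>)"
proof -
  have "KL_loss b dens \<Theta> X = ereal (loss \<Theta> X)" for X
  proof -
    have "KL_loss b dens \<Theta> X = ext_integral lborel (\<lambda>Y. ereal (matnormal b \<Theta> Y * logr \<Theta> X Y))"
      unfolding KL_loss_def by (rule arg_cong[where f = "ext_integral lborel"]) (use dens_pos[of X] in \<open>auto simp: logr_eq less_le\<close>)
    thus ?thesis using ext_integral_ereal[OF integrable_logr] integral_logr by simp
  qed
  thus ?thesis unfolding KL_risk_def using ext_integral_ereal[OF integrable_loss[of \<Theta>]] integral_loss[of \<Theta>] by simp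
qed

lemma dens_measurable: "(\<lambda>(X, Y). dens X Y) \<in> borel_measurable (borel \<Otimes>\<^sub>M borel)"
proof -
  note [measurable] = quad_bounded_measurable[OF lnA] quad_bounded_measurable[OF lnB]
  have "(\<lambda>W. exp (ln (A W))) = A" "(\<lambda>W. exp (ln (B W))) = B" using Apos Bpos by auto
  moreover have "(\<lambda>W. exp (ln (A W))) \<in> borel_measurable borel" "(\<lambda>W. exp (ln (B W))) \<in> borel_measurable borel" by measurable
  ultimately have [measurable]: "A \<in> borel_measurable borel" "B \<in> borel_measurable borel" by simp_all
  show ?thesis unfolding dens_def by measurable
qed

text \<open>The bound rests on \<open>ln (p / g) \<ge> 1 - g / p\<close> with \<open>g\<close> the given and \<open>dens\<close> the reference density.\<close>

lemma KL_risk_ge: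
  assumes p: "predictive_density p"
    and fin: "(\<integral>\<^sup>+ X. (\<integral>\<^sup>+ Y. ennreal (matnormal a \<Theta> X * matnormal b \<Theta> Y * (p X Y / dens X Y)) \<partial>lborel) \<partial>lborel) = ennreal T" and T: "T \<ge> 0"
  shows "ereal (risk \<Theta> + 1 - T) \<le> KL_risk a b p \<Theta>"
proof -
  have pm [measurable]: "(\<lambda>x. p (fst x) (snd x)) \<in> borel_measurable (borel \<Otimes>\<^sub>M borel)" and p0: "\<And>X Y. 0 \<le> p X Y"
    using p by (auto simp: predictive_density_def borel_prod split_beta')
  have dm [measurable]: "(\<lambda>x. dens (fst x) (snd x)) \<in> borel_measurable (borel \<Otimes>\<^sub>M borel)"
    using dens_measurable by (simp add: split_beta')
  define r where "r X Y = matnormal b \<Theta> Y * (p X Y / dens X Y)" for X Y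
  have r0: "0 \<le> r X Y" for X Y using p0 dens_pos[of X Y] by (simp add: r_def)
  have rm [measurable]: "(\<lambda>x. r (fst x) (snd x)) \<in> borel_measurable (borel \<Otimes>\<^sub>M borel)" unfolding r_def by measurable
  have rmX [measurable]: "r X \<in> borel_measurable borel" for X
    using measurable_compose[OF measurable_Pair1'[of X borel borel] rm] by simp
  define t where "t X = (\<integral>\<^sup>+ Y. ennreal (r X Y) \<partial>lborel)" for X
  have tm [measurable]: "t \<in> borel_measurable borel" unfolding t_def
    by (rule lborel.borel_measurable_nn_integral) (simp add: split_beta')
  have "(\<integral>\<^sup>+ X. (\<integral>\<^sup>+ Y. ennreal (matnormal a \<Theta> X * matnormal b \<Theta> Y * (p X Y / dens X Y)) \<partial>lborel) \<partial>lborel) = (\<integral>\<^sup>+ X. ennreal (matnormal a \<Theta> X) * t X \<partial>lborel)"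
  proof (intro nn_integral_cong)
    fix X
    have "(\<integral>\<^sup>+ Y. ennreal (matnormal a \<Theta> X * matnormal b \<Theta> Y * (p X Y / dens X Y)) \<partial>lborel) = (\<integral>\<^sup>+ Y. ennreal (matnormal a \<Theta> X) * ennreal (r X Y) \<partial>lborel)"
      by (intro nn_integral_cong) (simp only: r_def mult.assoc ennreal_mult'[OF matnormal_nonneg])
    also have "\<dots> = ennreal (matnormal a \<Theta> X) * t X" unfolding t_def by (rule nn_integral_cmult) measurable
    finally show "(\<integral>\<^sup>+ Y. ennreal (matnormal a \<Theta> X * matnormal b \<Theta> Y * (p X Y / dens X Y)) \<partial>lborel) = ennreal (matnormal a \<Theta> X) * t X" .
  qed
  hence tT: "(\<integral>\<^sup>+ X. ennreal (matnormal a \<Theta> X) * t X \<partial>lborel) = ennreal T" using fin by simp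
  \<comment> \<open>Finiteness of \<open>T\<close> makes the inner integral finite for almost every
    X, as the normal weight is positive; the remaining X do not matter for the risk.\<close>
  have "AE X in lborel. ennreal (matnormal a \<Theta> X) * t X \<noteq> \<infinity>"
    by (rule nn_integral_noteq_infinite) (use tT in auto)
  hence AEt: "AE X in lborel. t X \<noteq> \<infinity>"
  proof eventually_elim
    case (elim X) thus ?case using matnormal_pos[OF a, of \<Theta> X] by (auto simp: ennreal_mult_eq_top_iff)
  qed
  define u where "u X = enn2real (t X)" for X
  have u0: "0 \<le> u X" for X by (simp add: u_def)
  have um [measurable]: "u \<in> borel_measurable borel" unfolding u_def by measurable
  have Teq: "(\<integral>\<^sup>+ X. ennreal (matnormal a \<Theta> X * u X) \<partial>lborel) = ennreal T"
    unfolding tT[symmetric]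
  proof (rule nn_integral_cong_AE, use AEt in eventually_elim)
    case (elim X)
    thus ?case by (simp add: u_def ennreal_mult' top.not_eq_extremum)
  qed
  have iu: "integrable lborel (\<lambda>X. matnormal a \<Theta> X * u X)"
    by (rule integrableI_nonneg) (simp_all add: Teq u0)
  have Iu: "(\<integral>X. matnormal a \<Theta> X * u X \<partial>lborel) = T"
    using T by (simp add: integral_eq_nn_integral Teq u0)
  have lossb: "ereal (loss \<Theta> X + 1 - u X) \<le> KL_loss b p \<Theta> X" if tX: "t X \<noteq> \<infinity>" for X
  proof -
    have ir: "integrable lborel (r X)"
      by (rule integrableI_nonneg) (use r0 tX in \<open>auto simp: t_def[symmetric] top.not_eq_extremum\<close>)
    have Ir: "(\<integral>Y. r X Y \<partial>lborel) = u X"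
      using r0 by (simp add: integral_eq_nn_integral u_def t_def)
    note i = integrable_logr[of \<Theta> X] integrable_matnormal[OF b, of \<Theta>]
    \<comment> \<open>The minorant is finite and integrable for each such X, even when the loss of
      \<open>p\<close> is infinite; where \<open>p\<close> vanishes the integrand of the loss is
      infinite and there is nothing to compare.\<close>
    have "ereal (\<integral>Y. matnormal b \<Theta> Y * logr \<Theta> X Y + matnormal b \<Theta> Y - r X Y \<partial>lborel) \<le> KL_loss b p \<Theta> X"
      unfolding KL_loss_def
    proof (rule ext_integral_ge)
      show "integrable lborel (\<lambda>Y. matnormal b \<Theta> Y * logr \<Theta> X Y + matnormal b \<Theta> Y - r X Y)"
        using i ir by (intro Bochner_Integration.integrable_add Bochner_Integration.integrable_diff)
      show "AE Y in lborel. ereal (matnormal b \<Theta> Y * logr \<Theta> X Y + matnormal b \<Theta> Y - r X Y) \<le>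
         (if p X Y = 0 then \<infinity> else ereal (matnormal b \<Theta> Y * ln (matnormal b \<Theta> Y / p X Y)))"
      proof (rule AE_I2)
        fix Y
        let ?n = "matnormal b \<Theta> Y"
        show "ereal (?n * logr \<Theta> X Y + ?n - r X Y) \<le> (if p X Y = 0 then \<infinity> else ereal (?n * ln (?n / p X Y)))"
        proof (cases "p X Y = 0")
          case False
          hence pp: "0 < p X Y" using p0[of X Y] by simp
          have n: "0 < ?n" by (rule matnormal_pos[OF b])
          note d = dens_pos[of X Y]
          have "ln (p X Y / dens X Y) \<le> p X Y / dens X Y - 1" using pp d by (intro ln_le_minus_one) simp
          moreover have "ln (p X Y / dens X Y) = ln (p X Y) - ln (dens X Y)" using pp d by (simp add: ln_div)
          moreover have "logr \<Theta> X Y = ln ?n - ln (dens X Y)" using n d unfolding logr_eq[symmetric] by (simp add: ln_div)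
          moreover have "ln (?n / p X Y) = ln ?n - ln (p X Y)" using n pp by (simp add: ln_div)
          ultimately have "logr \<Theta> X Y + 1 - p X Y / dens X Y \<le> ln (?n / p X Y)" by linarith
          from mult_left_mono[OF this less_imp_le[OF n]]
          have "?n * logr \<Theta> X Y + ?n - r X Y \<le> ?n * ln (?n / p X Y)" by (simp add: r_def algebra_simps)
          thus ?thesis using False by simp
        qed simp
      qed
    qed
    also have "(\<integral>Y. matnormal b \<Theta> Y * logr \<Theta> X Y + matnormal b \<Theta> Y - r X Y \<partial>lborel) = loss \<Theta> X + 1 - u X"
      using i ir by (simp add: integral_logr integral_matnormal[OF b] Ir)
    finally show ?thesis .
  qed
  have "ereal (\<integral>X. matnormal a \<Theta> X * loss \<Theta> X + matnormal a \<Theta> X - matnormal a \<Theta> X * u X \<partial>lborel) \<le> KL_risk a b p \<Theta>"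
    unfolding KL_risk_def
  proof (rule ext_integral_ge)
    show "integrable lborel (\<lambda>X. matnormal a \<Theta> X * loss \<Theta> X + matnormal a \<Theta> X - matnormal a \<Theta> X * u X)"
      using integrable_loss[of \<Theta>] integrable_matnormal[OF a, of \<Theta>] iu by (intro Bochner_Integration.integrable_add Bochner_Integration.integrable_diff)
    show "AE X in lborel. ereal (matnormal a \<Theta> X * loss \<Theta> X + matnormal a \<Theta> X - matnormal a \<Theta> X * u X) \<le> ereal (matnormal a \<Theta> X) * KL_loss b p \<Theta> X"
      using AEt
    proof eventually_elim
      case (elim X)
      from ereal_mult_left_mono[OF lossb[OF elim], of "ereal (matnormal a \<Theta> X)"]
      show ?case by (simp add: algebra_simps)
    qed
  qed
  also have "(\<integral>X. matnormal a \<Theta> X * loss \<Theta> X + matnormal a \<Theta> X - matnormal a \<Theta> X * u X \<partial>lborel) = risk \<Theta> + 1 - T"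
    using integrable_loss[of \<Theta>] integrable_matnormal[OF a, of \<Theta>] iu by (simp add: integral_loss integral_matnormal[OF a] Iu)
  finally show ?thesis .
qed

end

section \<open>Lower bound for the maximal risk from normal priors\<close>

lemma integral_lincomb_diff:
  fixes f g :: "'a \<Rightarrow> real"
  assumes "integrable M f" "integrable M g"
  shows "(\<integral>x. c * f x - d * g x \<partial>M) = c * (\<integral>x. f x \<partial>M) - d * (\<integral>x. g x \<partial>M)"
  using assms by simp

lemma integral_matnormal_ln_matnormal:
  fixes \<Theta> :: "real^'q^'r"
  assumes v: "0 < v" and t: "0 < t"
  shows "(\<integral>W. matnormal v \<Theta> W * ln (matnormal t 0 W) \<partial>lborel) =
    - (real (CARD('q) * CARD('r)) / 2) * ln (2 * pi * t) - ((norm \<Theta>)\<^sup>2 + v * (\<integral>z. matnormal 1 0 z * (norm (z :: real^'q^'r))\<^sup>2 \<partial>lborel)) / (2 * t)"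
proof -
  let ?k = "- (real (CARD('q) * CARD('r)) / 2) * ln (2 * pi * t)"
  have q: "quad_bounded (\<lambda>W :: real^'q^'r. (norm W)\<^sup>2)" using quad_bounded_norm_affine[of 1 0] by simp
  note i = integrable_matnormal[OF v, of \<Theta>] and i' = integrable_matnormal_quad[OF v q, of \<Theta>]
  have eq: "matnormal v \<Theta> W * ln (matnormal t 0 W) = ?k * matnormal v \<Theta> W - 1 / (2 * t) * (matnormal v \<Theta> W * (norm W)\<^sup>2)" for W
    by (simp add: ln_matnormal[OF t] right_diff_distrib)
  have "(\<integral>W. matnormal v \<Theta> W * ln (matnormal t 0 W) \<partial>lborel) = ?k * (\<integral>W. matnormal v \<Theta> W \<partial>lborel) - 1 / (2 * t) * (\<integral>W. matnormal v \<Theta> W * (norm W)\<^sup>2 \<partial>lborel)"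
    unfolding eq by (rule integral_lincomb_diff[OF i i'])
  thus ?thesis by (simp add: integral_matnormal[OF v] integral_matnormal_norm2[OF v])
qed

lemma gaussian_prior_ratio:
  assumes a: "0 < a" and b: "0 < b" and t: "0 < \<tau>"
  shows "prior_ratio a b (matnormal (\<tau> + a * b / (a + b)) 0) (matnormal (\<tau> + a) 0 :: real^'q^'r \<Rightarrow> real)"
proof -
  have 1: "0 < \<tau> + a * b / (a + b)" "0 < \<tau> + a" using a b t by (auto intro!: add_pos_pos divide_pos_pos)
  show ?thesis by unfold_locales (use a b in \<open>simp_all add: matnormal_pos[OF 1(1)] matnormal_pos[OF 1(2)] quad_bounded_ln_matnormal[OF 1(1)] quad_bounded_ln_matnormal[OF 1(2)]\<close>)
qed

text \<open>The product formula twice: once to pool X and Y, once to combine the prior with the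
  pooled observation. What still contains \<Theta> is a normal density in \<Theta> and integrates to
  1.\<close>

lemma nn_integral_matnormal_prior:
  fixes X Y :: "real^'q^'r"
  assumes a: "0 < a" and b: "0 < b" and t: "0 < \<tau>"
  shows "(\<integral>\<^sup>+ \<Theta>. ennreal (matnormal \<tau> 0 \<Theta> * (matnormal a \<Theta> X * matnormal b \<Theta> Y)) \<partial>lborel) =
    ennreal (matnormal (a + b) X Y * matnormal (\<tau> + a * b / (a + b)) 0 (pool a b X Y))"
proof -
  let ?w = "a * b / (a + b)" and ?Z = "pool a b X Y"
  have w: "0 < ?w" using a b by simp
  have tw: "0 < \<tau> * ?w / (\<tau> + ?w)" by (intro divide_pos_pos mult_pos_pos add_pos_pos t a b)
  have eq: "matnormal \<tau> 0 \<Theta> * (matnormal a \<Theta> X * matnormal b \<Theta> Y) = (matnormal (a + b) X Y * matnormal (\<tau> + ?w) 0 ?Z) * matnormal (\<tau> * ?w / (\<tau> + ?w)) (pool \<tau> ?w 0 ?Z) \<Theta>" for \<Theta>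
  proof -
    have "matnormal a \<Theta> X * matnormal b \<Theta> Y = matnormal ?w \<Theta> ?Z * matnormal (a + b) X Y"
      unfolding matnormal_product[OF a b] pool_def ..
    moreover have "matnormal \<tau> \<Theta> 0 * matnormal ?w \<Theta> ?Z = matnormal (\<tau> * ?w / (\<tau> + ?w)) \<Theta> (pool \<tau> ?w 0 ?Z) * matnormal (\<tau> + ?w) 0 ?Z"
      unfolding matnormal_product[OF t w] pool_def ..
    moreover have "m = x * y \<Longrightarrow> t * x = u * z \<Longrightarrow> t * m = (y * z) * u" for m x y t u z :: real by algebra
    ultimately show ?thesis unfolding matnormal_commute[of \<tau> 0 \<Theta>] matnormal_commute[of _ "pool \<tau> ?w 0 ?Z" \<Theta>]
      by blast
  qed
  have "(\<integral>\<^sup>+ \<Theta>. ennreal (matnormal \<tau> 0 \<Theta> * (matnormal a \<Theta> X * matnormal b \<Theta> Y)) \<partial>lborel) =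
    (\<integral>\<^sup>+ \<Theta>. ennreal (matnormal (a + b) X Y * matnormal (\<tau> + ?w) 0 ?Z) * ennreal (matnormal (\<tau> * ?w / (\<tau> + ?w)) (pool \<tau> ?w 0 ?Z) \<Theta>) \<partial>lborel)"
    unfolding eq by (intro nn_integral_cong ennreal_mult) auto
  also have "\<dots> = ennreal (matnormal (a + b) X Y * matnormal (\<tau> + ?w) 0 ?Z) * 1"
    by (subst nn_integral_cmult) (simp, simp only: nn_integral_matnormal[OF tw])
  finally show ?thesis by simp
qed

text \<open>The competitor is compared with the Bayes rule for the prior \<open>matnormal \<tau> 0\<close>; on average over this prior the error term \<open>T\<close> of \<open>KL_risk_ge\<close> is 1.\<close>

lemma minimax_lower_bound:
  fixes p :: "real^'q^'r \<Rightarrow> real^'q^'r \<Rightarrow> real"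
  assumes a: "0 < a" and b: "0 < b" and t: "0 < \<tau>" and p: "predictive_density p"
    and s: "\<And>\<Theta>. KL_risk a b p \<Theta> \<le> ereal s"
  shows "base_risk a b (0 :: real^'q^'r) + real (CARD('q) * CARD('r)) / 2 * ln ((\<tau> + a * b / (a + b)) / (\<tau> + a))
    + (\<integral>z. matnormal 1 0 z * (norm (z :: real^'q^'r))\<^sup>2 \<partial>lborel) / 2 * (a * b / (a + b) / (\<tau> + a * b / (a + b)) - a / (\<tau> + a)) \<le> s"
    (is "?r \<le> s")
proof (rule ccontr)
  assume neg: "\<not> ?r \<le> s"
  let ?w = "a * b / (a + b)" and ?k = "real (CARD('q) * CARD('r)) / 2"
  define K where "K = (\<integral>z. matnormal 1 0 z * (norm (z :: real^'q^'r))\<^sup>2 \<partial>lborel)"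
  have w: "0 < ?w" using a b by simp
  have wa: "?w \<le> a" using a b by (simp add: field_simps)
  have tw: "0 < \<tau> + ?w" and ta: "0 < \<tau> + a" using t w a by auto
  interpret G: prior_ratio a b "matnormal (\<tau> + ?w) 0" "matnormal (\<tau> + a) 0 :: real^'q^'r \<Rightarrow> real"
    by (rule gaussian_prior_ratio[OF a b t])
  \<comment> \<open>The part of the risk that depends on \<Theta> is a difference of |\<Theta>|^2
    terms, nonnegative because a b / (a + b) \<le> a. Dropping it leaves a bound that is uniform in
    \<Theta>.\<close>
  have risk: "?r \<le> G.risk \<Theta>" for \<Theta>
  proof -
    have "G.risk \<Theta> = base_risk a b (0 :: real^'q^'r) - (- ?k * ln (2 * pi * (\<tau> + ?w)) - ((norm \<Theta>)\<^sup>2 + ?w * K) / (2 * (\<tau> + ?w)))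
       + (- ?k * ln (2 * pi * (\<tau> + a)) - ((norm \<Theta>)\<^sup>2 + a * K) / (2 * (\<tau> + a)))"
      unfolding G.risk_def integral_matnormal_ln_matnormal[OF w tw] integral_matnormal_ln_matnormal[OF a ta] K_def ..
    also have "\<dots> = base_risk a b (0 :: real^'q^'r) + ?k * (ln (2 * pi * (\<tau> + ?w)) - ln (2 * pi * (\<tau> + a)))
       + (((norm \<Theta>)\<^sup>2 + ?w * K) / (2 * (\<tau> + ?w)) - ((norm \<Theta>)\<^sup>2 + a * K) / (2 * (\<tau> + a)))"
      by (simp add: algebra_simps)
    also have "ln (2 * pi * (\<tau> + ?w)) - ln (2 * pi * (\<tau> + a)) = ln ((\<tau> + ?w) / (\<tau> + a))"
    proof -
      have "ln (2 * pi * (\<tau> + ?w)) = ln (2 * pi) + ln (\<tau> + ?w)" "ln (2 * pi * (\<tau> + a)) = ln (2 * pi) + ln (\<tau> + a)"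
        using tw ta by (simp_all add: ln_mult)
      moreover have "ln ((\<tau> + ?w) / (\<tau> + a)) = ln (\<tau> + ?w) - ln (\<tau> + a)" using tw ta by (simp add: ln_div)
      ultimately show ?thesis by linarith
    qed
    also have "((norm \<Theta>)\<^sup>2 + ?w * K) / (2 * (\<tau> + ?w)) - ((norm \<Theta>)\<^sup>2 + a * K) / (2 * (\<tau> + a)) =
       ((norm \<Theta>)\<^sup>2 / (2 * (\<tau> + ?w)) - (norm \<Theta>)\<^sup>2 / (2 * (\<tau> + a))) + K / 2 * (?w / (\<tau> + ?w) - a / (\<tau> + a))"
    proof -
      have h: "(n + x * K) / (2 * y) = n / (2 * y) + K / 2 * (x / y)" for n x y :: real by (simp add: add_divide_distrib)
      show ?thesis unfolding h by (simp only: right_diff_distrib)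
    qed
    finally have eq: "G.risk \<Theta> = ?r + ((norm \<Theta>)\<^sup>2 / (2 * (\<tau> + ?w)) - (norm \<Theta>)\<^sup>2 / (2 * (\<tau> + a)))" unfolding K_def by simp
    have "(norm \<Theta>)\<^sup>2 / (2 * (\<tau> + a)) \<le> (norm \<Theta>)\<^sup>2 / (2 * (\<tau> + ?w))"
      using tw ta wa by (intro divide_left_mono mult_pos_pos) auto
    thus ?thesis unfolding eq by simp
  qed
  define Q where "Q x = p (fst x) (snd x) / G.dens (fst x) (snd x)" for x
  have [measurable]: "(\<lambda>x. p (fst x) (snd x)) \<in> borel_measurable (borel \<Otimes>\<^sub>M borel)"
    and p0: "\<And>X Y. 0 \<le> p X Y" and p1: "\<And>X. (\<integral>\<^sup>+ Y. ennreal (p X Y) \<partial>lborel) = 1"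
    using p by (auto simp: predictive_density_def borel_prod split_beta')
  have [measurable]: "(\<lambda>x. G.dens (fst x) (snd x)) \<in> borel_measurable (borel \<Otimes>\<^sub>M borel)"
    using G.dens_measurable by (simp add: split_beta')
  have Qm [measurable]: "Q \<in> borel_measurable (borel \<Otimes>\<^sub>M borel)" unfolding Q_def by measurable
  have Q0: "0 \<le> Q x" for x using p0 G.dens_pos[of "fst x" "snd x"] by (simp add: Q_def)
  define T where "T \<Theta> = (\<integral>\<^sup>+ X. (\<integral>\<^sup>+ Y. ennreal (matnormal a \<Theta> X * matnormal b \<Theta> Y * Q (X, Y)) \<partial>lborel) \<partial>lborel)" for \<Theta>
  have Tge: "ennreal (?r + 1 - s) \<le> T \<Theta>" for \<Theta>
  proof (cases "T \<Theta>" rule: ennreal_cases)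
    case (real x)
    have "ereal (G.risk \<Theta> + 1 - x) \<le> KL_risk a b p \<Theta>"
      by (rule G.KL_risk_ge[OF p]) (use real in \<open>simp_all add: T_def Q_def\<close>)
    hence "ereal (G.risk \<Theta> + 1 - x) \<le> ereal s" using s order_trans by blast
    hence "?r + 1 - s \<le> x" using risk[of \<Theta>] by simp
    thus ?thesis unfolding real(2) by (rule ennreal_leI)
  qed simp
  have "(\<integral>\<^sup>+ \<Theta>. ennreal (matnormal \<tau> 0 \<Theta>) * T \<Theta> \<partial>lborel) = 1"
  proof -
    \<comment> \<open>Once \<Theta> is integrated first, the joint density of X and Y is
      \<open>G.dens\<close> times the marginal of X. The denominator of \<open>Q\<close> cancels,
      and there remains the marginal times the competitor, of total mass 1.\<close>
    let ?h = "\<lambda>\<Theta> X Y. ennreal (matnormal \<tau> 0 \<Theta> * (matnormal a \<Theta> X * matnormal b \<Theta> Y)) * ennreal (Q (X, Y))"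
    have "(\<integral>\<^sup>+ \<Theta>. ennreal (matnormal \<tau> 0 \<Theta>) * T \<Theta> \<partial>lborel) = (\<integral>\<^sup>+ \<Theta>. (\<integral>\<^sup>+ X. (\<integral>\<^sup>+ Y. ?h \<Theta> X Y \<partial>lborel) \<partial>lborel) \<partial>lborel)"
    proof (intro nn_integral_cong)
      fix \<Theta> :: "real^'q^'r"
      have 1: "?h \<Theta> X Y = ennreal (matnormal \<tau> 0 \<Theta>) * ennreal (matnormal a \<Theta> X * matnormal b \<Theta> Y * Q (X, Y))" for X Y
        by (simp add: ennreal_mult' mult.assoc)
      have "(\<integral>\<^sup>+ Y. ?h \<Theta> X Y \<partial>lborel) = ennreal (matnormal \<tau> 0 \<Theta>) * (\<integral>\<^sup>+ Y. ennreal (matnormal a \<Theta> X * matnormal b \<Theta> Y * Q (X, Y)) \<partial>lborel)" for X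
        unfolding 1 by (rule nn_integral_cmult) measurable
      thus "ennreal (matnormal \<tau> 0 \<Theta>) * T \<Theta> = (\<integral>\<^sup>+ X. (\<integral>\<^sup>+ Y. ?h \<Theta> X Y \<partial>lborel) \<partial>lborel)"
        unfolding T_def by (simp only:) (rule nn_integral_cmult[symmetric], measurable)
    qed
    also have "\<dots> = (\<integral>\<^sup>+ X. (\<integral>\<^sup>+ \<Theta>. (\<integral>\<^sup>+ Y. ?h \<Theta> X Y \<partial>lborel) \<partial>lborel) \<partial>lborel)"
      by (rule lborel_pair.Fubini'[symmetric]) measurable
    also have "\<dots> = (\<integral>\<^sup>+ X. (\<integral>\<^sup>+ Y. (\<integral>\<^sup>+ \<Theta>. ?h \<Theta> X Y \<partial>lborel) \<partial>lborel) \<partial>lborel)"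
      by (intro nn_integral_cong lborel_pair.Fubini'[symmetric]) measurable
    also have "\<dots> = (\<integral>\<^sup>+ X. (\<integral>\<^sup>+ Y. ennreal (matnormal (\<tau> + a) 0 X) * ennreal (p X Y) \<partial>lborel) \<partial>lborel)"
    proof (intro nn_integral_cong)
      fix X Y :: "real^'q^'r"
      have "(\<integral>\<^sup>+ \<Theta>. ?h \<Theta> X Y \<partial>lborel) = ennreal (matnormal (a + b) X Y * matnormal (\<tau> + ?w) 0 (pool a b X Y)) * ennreal (Q (X, Y))"
        by (subst nn_integral_multc) (simp_all add: nn_integral_matnormal_prior[OF a b t])
      also have "\<dots> = ennreal (matnormal (a + b) X Y * matnormal (\<tau> + ?w) 0 (pool a b X Y) * Q (X, Y))"
        by (rule ennreal_mult[symmetric]) (simp_all add: Q0)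
      also have "matnormal (a + b) X Y * matnormal (\<tau> + ?w) 0 (pool a b X Y) * Q (X, Y) = matnormal (\<tau> + a) 0 X * p X Y"
      proof -
        have d: "matnormal (a + b) X Y * matnormal (\<tau> + ?w) 0 (pool a b X Y) = G.dens X Y * matnormal (\<tau> + a) 0 X"
          using matnormal_pos[OF ta, of 0 X] by (simp add: G.dens_def)
        show ?thesis unfolding d using G.dens_pos[of X Y] by (simp add: Q_def)
      qed
      also have "ennreal (matnormal (\<tau> + a) 0 X * p X Y) = ennreal (matnormal (\<tau> + a) 0 X) * ennreal (p X Y)"
        by (rule ennreal_mult) (simp_all add: p0)
      finally show "(\<integral>\<^sup>+ \<Theta>. ?h \<Theta> X Y \<partial>lborel) = ennreal (matnormal (\<tau> + a) 0 X) * ennreal (p X Y)" .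
    qed
    also have "\<dots> = (\<integral>\<^sup>+ X. ennreal (matnormal (\<tau> + a) (0 :: real^'q^'r) X) \<partial>lborel)"
    proof (intro nn_integral_cong)
      fix X :: "real^'q^'r"
      have [measurable]: "p X \<in> borel_measurable borel"
        using measurable_compose[OF measurable_Pair1'[of X borel borel], of "\<lambda>x. p (fst x) (snd x)" borel] by simp
      show "(\<integral>\<^sup>+ Y. ennreal (matnormal (\<tau> + a) 0 X) * ennreal (p X Y) \<partial>lborel) = ennreal (matnormal (\<tau> + a) 0 X)"
        by (subst nn_integral_cmult) (simp_all add: p1)
    qed
    also have "\<dots> = 1" by (rule nn_integral_matnormal[OF ta])
    finally show ?thesis .
  qed
  moreover have "(\<integral>\<^sup>+ \<Theta>. ennreal (matnormal \<tau> (0 :: real^'q^'r) \<Theta>) * ennreal (?r + 1 - s) \<partial>lborel) \<le> (\<integral>\<^sup>+ \<Theta>. ennreal (matnormal \<tau> 0 \<Theta>) * T \<Theta> \<partial>lborel)"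
    by (intro nn_integral_mono mult_left_mono Tge) auto
  moreover have "(\<integral>\<^sup>+ \<Theta>. ennreal (matnormal \<tau> (0 :: real^'q^'r) \<Theta>) * ennreal (?r + 1 - s) \<partial>lborel) = ennreal (?r + 1 - s)"
    by (subst nn_integral_multc) (simp_all add: nn_integral_matnormal[OF t])
  ultimately have "ennreal (?r + 1 - s) \<le> 1" by simp
  hence "?r + 1 - s \<le> 1" by simp
  thus False using neg by simp
qed

text \<open>As \<tau> tends to infinity the logarithm tends to ln 1 and the correction term to 0.
  Every predictive density thus has maximal risk at least the constant base risk, and one whose risk
  nowhere exceeds this value is minimax.\<close>

theorem KL_minimax_if_risk_le:
  fixes p :: "real^'q^'r \<Rightarrow> real^'q^'r \<Rightarrow> real"
  assumes a: "0 < a" and b: "0 < b" and p: "predictive_density p"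
    and le: "\<And>\<Theta>. KL_risk a b p \<Theta> \<le> ereal (base_risk a b (0 :: real^'q^'r))"
  shows "KL_minimax a b p"
proof -
  let ?c = "base_risk a b (0 :: real^'q^'r)" and ?w = "a * b / (a + b)"
  have lower: "ereal ?c \<le> (SUP \<Theta>. KL_risk a b p' \<Theta>)" if p': "predictive_density p'" for p' :: "real^'q^'r \<Rightarrow> real^'q^'r \<Rightarrow> real"
  proof (rule ereal_le_real)
    fix s assume s: "(SUP \<Theta>. KL_risk a b p' \<Theta>) \<le> ereal s"
    have s': "KL_risk a b p' \<Theta> \<le> ereal s" for \<Theta> using s by (rule order_trans[OF SUP_upper[OF UNIV_I]])
    define w where "w = ?w"
    define k where "k = real (CARD('q) * CARD('r)) / 2"
    define K where "K = (\<integral>z. matnormal 1 0 z * (norm (z :: real^'q^'r))\<^sup>2 \<partial>lborel)"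
    have w: "0 < w" using a b by (simp add: w_def)
    have lim0: "((\<lambda>\<tau>. x / (\<tau> + y)) \<longlongrightarrow> 0) at_top" for x y :: real
    proof -
      have "filterlim (\<lambda>\<tau>. y + \<tau>) at_top at_top" by (rule filterlim_tendsto_add_at_top[OF tendsto_const filterlim_ident])
      hence "filterlim (\<lambda>\<tau>. \<tau> + y) at_infinity at_top" by (simp add: add.commute filterlim_at_top_imp_at_infinity)
      thus ?thesis by (rule tendsto_divide_0[OF tendsto_const])
    qed
    have "((\<lambda>\<tau>. 1 + (w - a) / (\<tau> + a)) \<longlongrightarrow> 1 + 0) at_top" by (intro tendsto_intros lim0)
    moreover have "eventually (\<lambda>\<tau>. 1 + (w - a) / (\<tau> + a) = (\<tau> + w) / (\<tau> + a)) at_top"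
      using eventually_gt_at_top[of 0]
    proof eventually_elim
      case (elim \<tau>)
      hence "\<tau> + a \<noteq> 0" using a by linarith
      thus ?case by (simp add: field_simps)
    qed
    ultimately have lim1: "((\<lambda>\<tau>. (\<tau> + w) / (\<tau> + a)) \<longlongrightarrow> 1) at_top"
      by (simp add: tendsto_cong)
    have "((\<lambda>\<tau>. ?c + k * ln ((\<tau> + w) / (\<tau> + a)) + K / 2 * (w / (\<tau> + w) - a / (\<tau> + a))) \<longlongrightarrow> ?c + k * ln 1 + K / 2 * (0 - 0)) at_top"
      by (intro tendsto_add tendsto_mult tendsto_diff tendsto_const tendsto_ln lim0 lim1) simp
    moreover have "eventually (\<lambda>\<tau>. ?c + k * ln ((\<tau> + w) / (\<tau> + a)) + K / 2 * (w / (\<tau> + w) - a / (\<tau> + a)) \<le> s) at_top"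
      using eventually_gt_at_top[of 0]
    proof eventually_elim
      case (elim \<tau>)
      show ?case using minimax_lower_bound[OF a b elim p' s'] unfolding w_def k_def K_def .
    qed
    ultimately have "?c + k * ln 1 + K / 2 * (0 - 0) \<le> s" by (rule tendsto_upperbound) simp
    thus "ereal ?c \<le> ereal s" by simp
  qed
  have up: "(SUP \<Theta>. KL_risk a b p \<Theta>) \<le> ereal ?c" by (rule SUP_least) (rule le)
  show ?thesis unfolding KL_minimax_def
  proof (intro conjI p antisym)
    show "(SUP \<Theta>. KL_risk a b p \<Theta>) \<le> (INF p'\<in>{p' :: real^'q^'r \<Rightarrow> real^'q^'r \<Rightarrow> real. predictive_density p'}. SUP \<Theta>. KL_risk a b p' \<Theta>)"
    proof (rule INF_greatest)
      fix p' :: "real^'q^'r \<Rightarrow> real^'q^'r \<Rightarrow> real" assume "p' \<in> {p' :: real^'q^'r \<Rightarrow> real^'q^'r \<Rightarrow> real. predictive_density p'}"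
      hence "predictive_density p'" by simp
      from order_trans[OF up lower[OF this]] show "(SUP \<Theta>. KL_risk a b p \<Theta>) \<le> (SUP \<Theta>. KL_risk a b p' \<Theta>)" .
    qed
    show "(INF p'\<in>{p' :: real^'q^'r \<Rightarrow> real^'q^'r \<Rightarrow> real. predictive_density p'}. SUP \<Theta>. KL_risk a b p' \<Theta>) \<le> (SUP \<Theta>. KL_risk a b p \<Theta>)"
      by (rule INF_lower) (simp add: p)
  qed
qed

section \<open>Divergence identities on RR\<close>

text \<open>\<open>RR\<close> is relatively open, hence its own interior among the symmetric
  matrices, and its frontier is what the closure adds.\<close>

lemma symmetric_RR_bdry:
  fixes A :: "real^'n^'n"
  assumes A: "transpose A = A" "A \<notin> RR" and c: "A \<in> closure RR"
  shows "A \<in> bdry_RR"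
proof -
  let ?X = "top_of_set (sym_matrices :: (real^'n^'n) set)"
  have sub: "RR \<subseteq> (sym_matrices :: (real^'n^'n) set)" by (auto simp: RR_def)
  obtain V :: "(real^'n^'n) set" where V: "open V" "RR = sym_matrices \<inter> V" by (rule RR_openin)
  have "openin ?X RR" unfolding V(2) using V(1) by (simp add: openin_open_Int)
  hence i: "?X interior_of RR = RR" by (simp add: interior_of_openin)
  have "?X closure_of RR = sym_matrices \<inter> closure RR"
    using sub by (simp add: closure_of_subtopology Int_absorb1)
  hence "A \<in> ?X closure_of RR" using A c by (simp add: sym_matrices_def)
  thus ?thesis using A i by (simp add: bdry_RR_def frontier_of_def)
qed

text \<open>A symmetric matrix outside \<open>RR\<close> either is a boundary point, where the limit
  0 is assumed, or has a neighbourhood free of \<open>RR\<close>. The extension allows a function to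
  be followed along a path that crosses the boundary.\<close>

lemma continuous_on_zero_extension:
  fixes f :: "real^'n^'n \<Rightarrow> real"
  assumes cont: "continuous_on RR f"
    and bd: "\<And>A. A \<in> bdry_RR \<Longrightarrow> (f \<longlongrightarrow> 0) (at A within RR)"
  shows "continuous_on sym_matrices (\<lambda>A. if A \<in> RR then f A else 0)" (is "continuous_on _ ?F")
  unfolding continuous_on_def
proof (rule ballI)
  fix A :: "real^'n^'n" assume A: "A \<in> sym_matrices"
  obtain V :: "(real^'n^'n) set" where V: "open V" "RR = sym_matrices \<inter> V" by (rule RR_openin)
  show "(?F \<longlongrightarrow> ?F A) (at A within sym_matrices)"
  proof (cases "A \<in> RR")
    case True
    have "(f \<longlongrightarrow> f A) (at A within RR)" using cont True by (simp add: continuous_on_def)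
    moreover have "at A within RR = at A within sym_matrices"
      using True V by (intro at_within_nhd[of A V]) auto
    ultimately have "(f \<longlongrightarrow> f A) (at A within sym_matrices)" by simp
    moreover have "eventually (\<lambda>B. f B = ?F B) (at A within sym_matrices)"
      unfolding eventually_at_topological using True V by auto
    ultimately show ?thesis using True by (simp add: tendsto_cong)
  next
    case False
    have lim: "(f \<longlongrightarrow> 0) (at A within RR)"
    proof (cases "A \<in> closure RR")
      case True
      thus ?thesis using bd symmetric_RR_bdry[OF _ False] A by (simp add: sym_matrices_def)
    next
      case False
      hence "at A within RR = bot" by (metis closure_def UnI2 mem_Collect_eq trivial_limit_within)
      thus ?thesis by simp
    qed
    have "(?F \<longlongrightarrow> 0) (at A within sym_matrices)"
      unfolding tendsto_iff
    proof (intro allI impI)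
      fix e :: real assume e: "0 < e"
      have "eventually (\<lambda>B. dist (f B) 0 < e) (at A within RR)" using lim e by (simp add: tendsto_iff)
      then obtain d where d: "d > 0" "\<And>B. B \<in> RR \<Longrightarrow> B \<noteq> A \<Longrightarrow> dist B A < d \<Longrightarrow> dist (f B) 0 < e"
        by (auto simp: eventually_at)
      show "eventually (\<lambda>B. dist (?F B) 0 < e) (at A within sym_matrices)"
        unfolding eventually_at using d e by (intro exI[of _ d]) auto
    qed
    thus ?thesis using False by simp
  qed
qed

text \<open>The divergence theorem for the field \<open>X\<close> with divergence \<open>\<delta>\<close>. Since \<open>f\<close> is only differentiable, the integral is
  differentiated along the flow \<open>\<phi>\<close> of \<open>X\<close>; as \<open>f\<close> vanishes on the boundary, points may enter \<^const>\<open>RR\<close> under the flow.\<close>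

lemma RR_flow_integral_zero:
  fixes f h :: "real^'r::{finite,linorder}^'r::{finite,linorder} \<Rightarrow> real"
    and \<phi> :: "real \<Rightarrow> real^'r::{finite,linorder}^'r::{finite,linorder} \<Rightarrow> real^'r::{finite,linorder}^'r::{finite,linorder}"
    and J :: "real \<Rightarrow> real^'r::{finite,linorder}^'r::{finite,linorder} \<Rightarrow> real"
  assumes der: "\<And>A. A \<in> RR \<Longrightarrow> (f has_derivative D A) (at A within RR)"
    and bd: "\<And>A. A \<in> bdry_RR \<Longrightarrow> (f \<longlongrightarrow> 0) (at A within RR)"
    and f: "set_integrable sym_lborel RR f" and h: "set_integrable sym_lborel RR h"
    and h_eq: "\<And>A. A \<in> RR \<Longrightarrow> h A = D A (X A) + f A * \<delta> A"
    and cv: "\<And>s g. s \<in> {0..1} \<Longrightarrow> g \<in> borel_measurable borel \<Longrightarrow> (\<And>A. A \<notin> RR \<Longrightarrow> g A = 0) \<Longrightarrow>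
        (\<integral>\<^sup>+ A. ennreal (J s A) * g (\<phi> s A) * indicator (Collect pos_def) A \<partial>sym_lborel) = (\<integral>\<^sup>+ A. g A \<partial>sym_lborel)"
    and J0: "\<And>s A. s \<in> {0..1} \<Longrightarrow> pos_def A \<Longrightarrow> 0 \<le> J s A"
    and \<phi>_sym: "\<And>s A. s \<in> {0..1} \<Longrightarrow> pos_def A \<Longrightarrow> transpose (\<phi> s A) = \<phi> s A"
    and enter: "\<And>s t A. pos_def A \<Longrightarrow> 0 \<le> s \<Longrightarrow> s \<le> t \<Longrightarrow> t \<le> 1 \<Longrightarrow> \<phi> s A \<in> RR \<Longrightarrow> \<phi> t A \<in> RR"
    and \<phi>_cont: "continuous_on ({0..1} \<times> Collect pos_def) (\<lambda>(s, A). \<phi> s A)"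
    and J_cont: "continuous_on ({0..1} \<times> Collect pos_def) (\<lambda>(s, A). J s A)"
    and \<phi>_der: "\<And>s A. s \<in> {0<..<1} \<Longrightarrow> pos_def A \<Longrightarrow> ((\<lambda>s. \<phi> s A) has_vector_derivative X (\<phi> s A)) (at s)"
    and J_der: "\<And>s A. s \<in> {0<..<1} \<Longrightarrow> pos_def A \<Longrightarrow> ((\<lambda>s. J s A) has_real_derivative \<delta> (\<phi> s A) * J s A) (at s)"
  shows "(LINT A:RR|sym_lborel. h A) = 0"
proof -
  define F where "F A = (if A \<in> RR then f A else 0)" for A
  define G where "G A = (if A \<in> RR then h A else 0)" for A
  define \<Phi> where "\<Phi> = (\<lambda>x. if x \<in> {0..1} \<times> Collect pos_def then (case x of (s, A) \<Rightarrow> \<phi> s A) else 0)"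
  define \<J> where "\<J> = (\<lambda>x. if x \<in> {0..1} \<times> Collect pos_def then (case x of (s, A) \<Rightarrow> J s A) else 0)"
  have FG: "F = (\<lambda>A. indicator RR A *\<^sub>R f A)" "G = (\<lambda>A. indicator RR A *\<^sub>R h A)"
    by (auto simp: F_def G_def indicator_def)
  have iF: "integrable sym_lborel F" and iG: "integrable sym_lborel G"
    using f h by (simp_all add: FG set_integrable_def)
  have Fm [measurable]: "F \<in> borel_measurable borel" and Gm [measurable]: "G \<in> borel_measurable borel"
    using borel_measurable_integrable[OF iF] borel_measurable_integrable[OF iG] by simp_all
  have SB: "{0..1::real} \<times> (Collect pos_def :: (real^'r::{finite,linorder}^'r::{finite,linorder}) set) \<in> sets borel"
    by (simp add: borel_prod[symmetric])
  have \<Phi>m [measurable]: "\<Phi> \<in> borel_measurable (borel \<Otimes>\<^sub>M borel)"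
    unfolding borel_prod \<Phi>_def
    by (rule borel_measurable_continuous_on_if[OF SB \<phi>_cont continuous_on_const])
  have \<J>m [measurable]: "\<J> \<in> borel_measurable (borel \<Otimes>\<^sub>M borel)"
    unfolding borel_prod \<J>_def
    by (rule borel_measurable_continuous_on_if[OF SB J_cont continuous_on_const])
  have ps: "(\<lambda>A. Pair s A) \<in> borel \<rightarrow>\<^sub>M borel \<Otimes>\<^sub>M borel" for s :: real by measurable
  \<comment> \<open>The pull-back of \<open>L\<close> under the flow, weighted with the Jacobian. By
    the change of variables its integral does not depend on the time s; for \<open>L\<close> =
    \<open>F\<close> its time derivative is the same expression with \<open>L\<close> =
    \<open>G\<close>.\<close>
  define H where "H L s A = L (\<Phi> (s, A)) * \<J> (s, A)" for L :: "real^'r::{finite,linorder}^'r::{finite,linorder} \<Rightarrow> real" and s A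
  have HA: "H L s A = (if pos_def A then L (\<phi> s A) * J s A else 0)" if "s \<in> {0..1}" for L s A
    using that by (simp add: H_def \<Phi>_def \<J>_def)
  have Hm [measurable]: "H L s \<in> borel_measurable borel" if [measurable]: "L \<in> borel_measurable borel" for L s
    unfolding H_def by measurable
  have nnH: "(\<integral>\<^sup>+ A. k (H L s A) \<partial>sym_lborel) = (\<integral>\<^sup>+ A. k (L A) \<partial>sym_lborel)"
    if s: "s \<in> {0..1}" and L [measurable]: "L \<in> borel_measurable borel" and L0: "\<And>A. A \<notin> RR \<Longrightarrow> L A = 0"
      and k [measurable]: "k \<in> borel_measurable borel" and k0: "k 0 = 0" and kh: "\<And>x c. 0 \<le> c \<Longrightarrow> k (x * c) = ennreal c * k x"
    for s L and k :: "real \<Rightarrow> ennreal"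
  proof -
    have "(\<integral>\<^sup>+ A. k (H L s A) \<partial>sym_lborel) = (\<integral>\<^sup>+ A. ennreal (J s A) * k (L (\<phi> s A)) * indicator (Collect pos_def) A \<partial>sym_lborel)"
      by (intro nn_integral_cong) (use J0[OF s] in \<open>simp add: HA[OF s] kh k0 indicator_def\<close>)
    also have "\<dots> = (\<integral>\<^sup>+ A. k (L A) \<partial>sym_lborel)"
      by (rule cv[OF s]) (use L0 k0 in auto)
    finally show ?thesis .
  qed
  have k1: "ennreal (x * c) = ennreal c * ennreal x" "ennreal (- (x * c)) = ennreal c * ennreal (- x)"
      "ennreal \<bar>x * c\<bar> = ennreal c * ennreal \<bar>x\<bar>" if "0 \<le> c" for x c :: real
    using that by (simp_all add: ennreal_mult'[symmetric] mult.commute abs_mult)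
  have intH: "integrable sym_lborel (H L s)" and IH: "(\<integral>A. H L s A \<partial>sym_lborel) = (\<integral>A. L A \<partial>sym_lborel)"
     and absH: "(\<integral>\<^sup>+ A. ennreal \<bar>H L s A\<bar> \<partial>sym_lborel) = (\<integral>\<^sup>+ A. ennreal \<bar>L A\<bar> \<partial>sym_lborel)"
    if s: "s \<in> {0..1}" and iL: "integrable sym_lborel L" and L0: "\<And>A. A \<notin> RR \<Longrightarrow> L A = 0" for s L
  proof -
    have L [measurable]: "L \<in> borel_measurable borel" using borel_measurable_integrable[OF iL] by simp
    show abs: "(\<integral>\<^sup>+ A. ennreal \<bar>H L s A\<bar> \<partial>sym_lborel) = (\<integral>\<^sup>+ A. ennreal \<bar>L A\<bar> \<partial>sym_lborel)"
      by (rule nnH[OF s L L0, of "\<lambda>x. ennreal \<bar>x\<bar>"]) (simp_all add: k1)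
    show iH: "integrable sym_lborel (H L s)"
      unfolding integrable_iff_bounded using abs iL[unfolded integrable_iff_bounded] Hm[OF L] by simp
    show "(\<integral>A. H L s A \<partial>sym_lborel) = (\<integral>A. L A \<partial>sym_lborel)"
    proof (rule integral_eq_of_nn_integrals[OF iH iL])
      show "(\<integral>\<^sup>+ A. ennreal (H L s A) \<partial>sym_lborel) = (\<integral>\<^sup>+ A. ennreal (L A) \<partial>sym_lborel)"
        by (rule nnH[OF s L L0, of "\<lambda>x. ennreal x"]) (simp_all add: k1)
      show "(\<integral>\<^sup>+ A. ennreal (- H L s A) \<partial>sym_lborel) = (\<integral>\<^sup>+ A. ennreal (- L A) \<partial>sym_lborel)"
        by (rule nnH[OF s L L0, of "\<lambda>x. ennreal (- x)"]) (simp_all add: k1)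
    qed
  qed
  have F0: "F A = 0" "G A = 0" if "A \<notin> RR" for A using that by (simp_all add: F_def G_def)
  have contf: "continuous_on RR f"
    using der by (auto simp: continuous_on_eq_continuous_within intro: has_derivative_continuous)
  have contF: "continuous_on sym_matrices F"
    unfolding F_def[abs_def] by (rule continuous_on_zero_extension[OF contf bd])
  have path: "((\<lambda>s. H G s A) has_integral (H F 1 A - H F 0 A)) {0..1}" for A
  proof (cases "pos_def A")
    case False
    have "((\<lambda>s. H G s A) has_integral 0) {0..1}"
      by (rule has_integral_is_0) (simp add: False HA)
    moreover have "H F 1 A - H F 0 A = 0" using False by (simp add: HA)
    ultimately show ?thesis by (simp only:)
  next
    case True
    define S where "S = {s \<in> {0..1}. \<phi> s A \<in> RR}"
    \<comment> \<open>Entry time of the path into \<open>RR\<close>: before it the extended function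
      is 0, after it the path stays inside. For a path that never enters, the value 1 makes the
      whole time interval count as outside.\<close>
    define s0 where "s0 = (if S = {} then 1 else Inf S)"
    have bS: "bdd_below S" by (auto simp: S_def)
    have below: "s \<notin> S" if "s < s0" for s using that cInf_lower[OF _ bS, of s] by (auto simp: s0_def split: if_splits)
    have above: "\<phi> s A \<in> RR" if "s0 < s" "0 \<le> s" "s \<le> 1" for s
    proof -
      have ne: "S \<noteq> {}" using that by (auto simp: s0_def)
      hence "Inf S < s" using that(1) by (simp add: s0_def)
      then obtain s' where s': "s' \<in> S" "s' < s" using cInf_lessD[OF ne] by blast
      hence "0 \<le> s'" "\<phi> s' A \<in> RR" by (auto simp: S_def)
      with enter[OF True _ _ that(3)] s'(2) show ?thesis by simp
    qed
    have cphi: "continuous_on {0..1} (\<lambda>s. \<phi> s A)"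
      using continuous_on_compose2[OF \<phi>_cont continuous_on_Pair[OF continuous_on_id continuous_on_const[of _ A]], of "{0..1}"] True by auto
    have cJ: "continuous_on {0..1} (\<lambda>s. J s A)"
      using continuous_on_compose2[OF J_cont continuous_on_Pair[OF continuous_on_id continuous_on_const[of _ A]], of "{0..1}"] True by auto
    have cFp: "continuous_on {0..1} (\<lambda>s. F (\<phi> s A))"
      by (rule continuous_on_compose2[OF contF cphi]) (use \<phi>_sym True in \<open>auto simp: sym_matrices_def\<close>)
    have cH: "continuous_on {0..1} (\<lambda>s. H F s A)"
      using continuous_on_mult[OF cFp cJ] by (rule continuous_on_eq) (simp add: HA True)
    have "((\<lambda>s. H F s A) has_vector_derivative H G s A) (at s)" if s: "s \<in> {0<..<1} - {s0}" for s
    proof (cases "s < s0")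
      case True': True
      let ?I = "{0<..<min s0 1}"
      have z: "H F t A = 0 \<and> H G t A = 0" if "t \<in> ?I" for t
      proof -
        have "\<phi> t A \<notin> RR" using below[of t] that by (auto simp: S_def)
        thus ?thesis using that F0 by (simp add: HA)
      qed
      have sI: "s \<in> ?I" using s True' by auto
      have "((\<lambda>_. 0) has_vector_derivative H G s A) (at s)" using z[OF sI] by simp
      thus ?thesis by (rule has_vector_derivative_transform_within_open[of _ _ _ ?I]) (use z sI in auto)
    next
      case False
      let ?I = "{max s0 0<..<1}"
      have sI: "s \<in> ?I" using s False by auto
      have inR: "\<phi> t A \<in> RR" if "t \<in> ?I" for t using above[of t] that by auto
      have s01: "s \<in> {0<..<1}" using s by auto
      have "((\<lambda>t. \<phi> t A) has_vector_derivative X (\<phi> s A)) (at s within ?I)"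
        using \<phi>_der[OF s01 True] by (rule has_vector_derivative_at_within)
      moreover have "(f has_derivative D (\<phi> s A)) (at (\<phi> s A) within (\<lambda>t. \<phi> t A) ` ?I)"
        by (rule has_derivative_subset[OF der[OF inR[OF sI]]]) (use inR in auto)
      ultimately have "(f \<circ> (\<lambda>t. \<phi> t A) has_vector_derivative D (\<phi> s A) (X (\<phi> s A))) (at s within ?I)"
        by (rule vector_derivative_diff_chain_within)
      hence 1: "((\<lambda>t. f (\<phi> t A)) has_real_derivative D (\<phi> s A) (X (\<phi> s A))) (at s within ?I)"
        by (simp add: has_real_derivative_iff_has_vector_derivative o_def)
      have 2: "((\<lambda>t. J t A) has_real_derivative \<delta> (\<phi> s A) * J s A) (at s within ?I)"
        using J_der[OF s01 True] by (rule has_field_derivative_at_within)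
      have "((\<lambda>t. f (\<phi> t A) * J t A) has_real_derivative H G s A) (at s within ?I)"
        using DERIV_mult[OF 1 2] s01 inR[OF sI] by (simp add: HA True G_def h_eq algebra_simps)
      hence "((\<lambda>t. f (\<phi> t A) * J t A) has_vector_derivative H G s A) (at s)"
        using at_within_open[OF sI] by (simp add: has_real_derivative_iff_has_vector_derivative)
      thus ?thesis
        by (rule has_vector_derivative_transform_within_open[of _ _ _ ?I]) (use sI inR True in \<open>auto simp: HA F_def\<close>)
    qed
    \<comment> \<open>At the entry time differentiability may fail. Continuity of the extension is
      enough there, since the fundamental theorem tolerates a finite exceptional set.\<close>
    from fundamental_theorem_of_calculus_interior_strong[of "{s0}", OF _ _ this cH]
    show ?thesis by simp
  qed
  have "(\<integral>A. G A \<partial>sym_lborel) = 0"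
  proof (rule integral_flow_zero[OF sigma_finite_sym_lborel, where H = "\<lambda>s A. H G s A" and Ka = "H F 0" and Kb = "H F 1" and C = "\<integral>A. \<bar>G A\<bar> \<partial>sym_lborel"])
    have "sets (lborel \<Otimes>\<^sub>M sym_lborel) = sets (borel \<Otimes>\<^sub>M (borel :: (real^'r::{finite,linorder}^'r::{finite,linorder}) measure))"
      by (intro sets_pair_measure_cong) auto
    moreover have "(\<lambda>(s, A). indicator {0..1} s * H G s A) \<in> borel_measurable (borel \<Otimes>\<^sub>M borel)"
      unfolding H_def by measurable
    ultimately show "(\<lambda>(s, A). indicator {0..1} s * H G s A) \<in> borel_measurable (lborel \<Otimes>\<^sub>M sym_lborel)"
      by (simp cong: measurable_cong_sets)
    show "(\<integral>\<^sup>+ A. ennreal \<bar>H G t A\<bar> \<partial>sym_lborel) \<le> ennreal (\<integral>A. \<bar>G A\<bar> \<partial>sym_lborel)" if "t \<in> {0..1}" for t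
      using absH[OF that iG F0(2)] nn_integral_eq_integral[of sym_lborel "\<lambda>A. \<bar>G A\<bar>"] iG by simp
    show "(\<integral>A. H G t A \<partial>sym_lborel) = (\<integral>A. G A \<partial>sym_lborel)" if "t \<in> {0..1}" for t by (rule IH[OF that iG F0(2)])
    show "((\<lambda>s. H G s A) has_integral (H F 1 A - H F 0 A)) {0..1}" for A by (rule path)
    show "integrable sym_lborel (H F 0)" "integrable sym_lborel (H F 1)" by (intro intH[OF _ iF F0(1)]; simp)+
    show "(\<integral>A. H F 1 A \<partial>sym_lborel) = (\<integral>A. H F 0 A \<partial>sym_lborel)"
      using IH[OF _ iF F0(1), of 0] IH[OF _ iF F0(1), of 1] by simp
  qed
  thus ?thesis by (simp add: set_lebesgue_integral_def FG)
qed

lemma has_vector_derivative_spmat: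
  assumes "\<And>i. ((\<lambda>s. d s i) has_real_derivative d' i) (at x within S)"
  shows "((\<lambda>s. spmat U (d s)) has_vector_derivative spmat U d') (at x within S)"
proof -
  have "((\<lambda>s. \<Sum>k\<in>UNIV. U $ i $ k * d s k * U $ j $ k) has_real_derivative (\<Sum>k\<in>UNIV. U $ i $ k * d' k * U $ j $ k)) (at x within S)" for i j
    by (intro DERIV_sum DERIV_cmult_right DERIV_cmult assms)
  hence "((\<lambda>s. spmat U (d s) $ i $ j) has_vector_derivative spmat U d' $ i $ j) (at x within S)" for i j
    by (simp add: spmat_nth has_real_derivative_iff_has_vector_derivative)
  thus ?thesis unfolding has_vector_derivative_def
    by (subst has_derivative_componentwise_within) (auto simp: Basis_vec_def inner_axis)
qed

lemma has_derivative_uminus_arg: "(f has_derivative D) F \<Longrightarrow> D (- x) = - D x"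
  by (meson has_derivative_linear linear_neg)

lemma set_integrable_uminus:
  fixes f :: "'a \<Rightarrow> real"
  assumes "set_integrable M S f" shows "set_integrable M S (\<lambda>x. - f x)"
  using assms unfolding set_integrable_def by simp

text \<open>The flow of \<open>- A\<^sup>2\<close> is \<open>A \<mapsto> mob 1 s A\<close>.\<close>

lemma RR_mob_flow:
  fixes f :: "real^'r::{finite,linorder}^'r::{finite,linorder} \<Rightarrow> real"
  assumes der: "\<And>A. A \<in> RR \<Longrightarrow> (f has_derivative D A) (at A within RR)"
    and bd: "\<And>A. A \<in> bdry_RR \<Longrightarrow> (f \<longlongrightarrow> 0) (at A within RR)"
    and f: "set_integrable sym_lborel RR f"
    and h: "set_integrable sym_lborel RR (\<lambda>A. D A (A ** A) + real (CARD('r) + 1) * trace A * f A)"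
  shows "(LINT A:RR|sym_lborel. D A (A ** A) + real (CARD('r) + 1) * trace A * f A) = 0"
proof -
  let ?h = "\<lambda>A. D A (A ** A) + real (CARD('r) + 1) * trace A * f A"
  have sp: "mob 1 s (spmat U d) = spmat U (\<lambda>i. d i / (1 + s * d i))" "\<And>i. 0 < 1 + s * d i"
    if "orthogonal_matrix U" "\<And>i. 0 < d i" "0 \<le> s" for U d s
  proof -
    show p: "0 < 1 + s * d i" for i using that(2)[of i] that(3) by (simp add: add_pos_nonneg)
    show "mob 1 s (spmat U d) = spmat U (\<lambda>i. d i / (1 + s * d i))"
      by (rule mob_spmat[OF that(1)]) (metis p less_irrefl)
  qed
  have pd: "pos_def (mob 1 s A)" if "pos_def A" "0 \<le> s" for s and A :: "real^'r::{finite,linorder}^'r::{finite,linorder}"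
    using mob_image_pos_def[of 1 s] that by auto
  \<comment> \<open>The sign is reversed because the flow has to lead into \<open>RR\<close>: along
    - A^2 the eigenvalues d / (1 + s d) decrease in s, so a path that has come below the identity
    stays there.\<close>
  have "(LINT A:RR|sym_lborel. - ?h A) = 0"
  proof (rule RR_flow_integral_zero[OF der bd f, where \<phi> = "mob 1" and J = "mob_jac 1" and X = "\<lambda>A. - (A ** A)" and \<delta> = "\<lambda>A. - (real (CARD('r) + 1) * trace A)"])
    show "set_integrable sym_lborel RR (\<lambda>A. - ?h A)" by (rule set_integrable_uminus[OF h])
    show "- ?h A = D A (- (A ** A)) + f A * - (real (CARD('r) + 1) * trace A)" if "A \<in> RR" for A
      using has_derivative_uminus_arg[OF der[OF that], of "A ** A"] by (simp add: mult_ac)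
    show "0 \<le> mob_jac 1 s A" if "s \<in> {0..1}" "pos_def A" for s and A :: "real^'r::{finite,linorder}^'r::{finite,linorder}"
      using mob_jac_pos[OF that(2), of 1 s] that(1) by simp
    show "transpose (mob 1 s A) = mob 1 s A" if "s \<in> {0..1}" "pos_def A" for s and A :: "real^'r::{finite,linorder}^'r::{finite,linorder}"
      using pd[OF that(2), of s] that(1) by (simp add: pos_def_def)
    show "(\<integral>\<^sup>+ A. ennreal (mob_jac 1 s A) * g (mob 1 s A) * indicator (Collect pos_def) A \<partial>sym_lborel) = (\<integral>\<^sup>+ A. g A \<partial>sym_lborel)"
      if s: "s \<in> {0..1}" and g: "g \<in> borel_measurable borel" and g0: "\<And>A. A \<notin> RR \<Longrightarrow> g A = 0"
      for s and g :: "real^'r::{finite,linorder}^'r::{finite,linorder} \<Rightarrow> ennreal"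
    proof -
      have s0: "0 \<le> s" "s \<le> 1" using s by auto
      let ?I = "mob 1 s ` (Collect pos_def :: (real^'r::{finite,linorder}^'r::{finite,linorder}) set)"
      have I: "?I = {A. pos_def A \<and> pos_def (mat 1 - s *\<^sub>R A)}" by (rule mob_image_pos_def) (use s0 in auto)
      have "(\<lambda>A::real^'r::{finite,linorder}^'r::{finite,linorder}. mat 1 - s *\<^sub>R A) \<in> borel \<rightarrow>\<^sub>M borel"
        by (intro borel_measurable_continuous_onI continuous_intros)
      from measurable_sets[OF this borel_pos_def] have "{A::real^'r::{finite,linorder}^'r::{finite,linorder}. pos_def (mat 1 - s *\<^sub>R A)} \<in> sets borel"
        by (simp add: vimage_def)
      hence Ib: "?I \<in> sets borel" unfolding I using borel_pos_def by (simp add: Collect_conj_eq sets.Int)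
      \<comment> \<open>Eigenvalues of a matrix in \<open>RR\<close> are below 1 and s \<le> 1, so
        each such matrix is reached by the flow at time s; a function supported on \<open>RR\<close>
        loses no mass in the substitution.\<close>
      have RI: "RR \<subseteq> ?I" unfolding I
      proof
        fix A :: "real^'r::{finite,linorder}^'r::{finite,linorder}" assume A: "A \<in> RR"
        obtain U d where U: "orthogonal_matrix U" and Ad: "A = spmat U d" and d: "\<And>i. 0 < d i" "\<And>i. d i < 1" by (rule RR_obtain[OF A]) blast
        have "0 < 1 - s * d i" for i
        proof -
          have "s * d i \<le> 1 * d i" using s0 d(1)[of i] by (intro mult_right_mono) auto
          thus ?thesis using d(2)[of i] by linarith
        qed
        thus "A \<in> {A. pos_def A \<and> pos_def (mat 1 - s *\<^sub>R A)}"
          using RR_pos_def[OF A] by (simp add: Ad spmat_1[OF U] spmat_scaleR spmat_diff pos_def_spmat[OF U])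
      qed
      have "(\<integral>\<^sup>+ A. ennreal (mob_jac 1 s A) * g (mob 1 s A) * indicator (Collect pos_def) A \<partial>sym_lborel) = (\<integral>\<^sup>+ A. g A * indicator ?I A \<partial>sym_lborel)"
        by (rule nn_integral_mob) (use s0 Ib g borel_pos_def in auto)
      also have "\<dots> = (\<integral>\<^sup>+ A. g A \<partial>sym_lborel)"
      proof (intro nn_integral_cong)
        fix A show "g A * indicator ?I A = g A"
          by (cases "A \<in> RR") (use RI g0[of A] in \<open>auto simp: indicator_def\<close>)
      qed
      finally show ?thesis .
    qed
    show "mob 1 t A \<in> RR" if A: "pos_def A" and st: "0 \<le> s" "s \<le> t" "t \<le> 1" and R: "mob 1 s A \<in> RR"
      for s t and A :: "real^'r::{finite,linorder}^'r::{finite,linorder}"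
    proof -
      obtain U d where U: "orthogonal_matrix U" and Ad: "A = spmat U d" and d: "\<And>i. 0 < d i" by (rule pos_def_obtain[OF A]) blast
      have t0: "0 \<le> t" using st by simp
      note s1 = sp[of U d s, OF U d st(1)] and t1 = sp[of U d t, OF U d t0]
      have "d i / (1 + t * d i) < 1" for i
      proof -
        have "d i / (1 + t * d i) \<le> d i / (1 + s * d i)"
          using s1(2)[of i] t1(2)[of i] d[of i] st by (intro divide_left_mono mult_pos_pos) (auto intro!: mult_right_mono)
        also have "\<dots> < 1" using R unfolding Ad s1(1) RR_spmat[OF U] by blast
        finally show ?thesis .
      qed
      thus ?thesis unfolding Ad t1(1) RR_spmat[OF U] using d t1(2) by simp
    qed
    have aff: "continuous_on ({0..1} \<times> Collect pos_def) (\<lambda>x::real \<times> (real^'r::{finite,linorder}^'r::{finite,linorder}). 1 *\<^sub>R mat 1 + fst x *\<^sub>R snd x)"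
      by (intro continuous_intros)
    have nz: "det (1 *\<^sub>R mat 1 + fst x *\<^sub>R snd x) \<noteq> 0" if "x \<in> {0..1} \<times> Collect pos_def" for x :: "real \<times> (real^'r::{finite,linorder}^'r::{finite,linorder})"
    proof -
      have "pos_def (snd x)" "0 \<le> fst x" using that by auto
      from affine_pos_def(1)[OF this(1) zero_less_one this(2)] show ?thesis by simp
    qed
    show "continuous_on ({0..1} \<times> Collect pos_def) (\<lambda>(s, A :: real^'r::{finite,linorder}^'r::{finite,linorder}). mob 1 s A)"
      unfolding mob_def split_beta'
      by (rule continuous_on_matrix_mult[OF continuous_on_snd[OF continuous_on_id] continuous_on_matrix_inv[OF aff nz]])
    show "continuous_on ({0..1} \<times> Collect pos_def) (\<lambda>(s, A :: real^'r::{finite,linorder}^'r::{finite,linorder}). mob_jac 1 s A)"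
      unfolding mob_jac_def split_beta'
      by (intro continuous_on_power continuous_on_divide continuous_on_det aff continuous_on_const ballI nz)
    fix s and A :: "real^'r::{finite,linorder}^'r::{finite,linorder}" assume s: "s \<in> {0<..<1::real}" and A: "pos_def A"
    obtain U d where U: "orthogonal_matrix U" and Ad: "A = spmat U d" and d: "\<And>i. 0 < d i" by (rule pos_def_obtain[OF A]) blast
    have s0: "0 \<le> s" using s by simp
    have p: "0 < 1 + s * d i" if "0 \<le> s" for s i by (rule sp(2)[of U d, OF U d that])
    have dd: "((\<lambda>s. d i / (1 + s * d i)) has_real_derivative - (d i / (1 + s * d i) * (d i / (1 + s * d i)))) (at s within UNIV)" for i
      using p[OF s0, of i] by (auto intro!: derivative_eq_intros simp: field_simps power2_eq_square)
    have "((\<lambda>s. spmat U (\<lambda>i. d i / (1 + s * d i))) has_vector_derivative spmat U (\<lambda>i. - (d i / (1 + s * d i) * (d i / (1 + s * d i))))) (at s)"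
      by (rule has_vector_derivative_spmat[OF dd])
    moreover have "spmat U (\<lambda>i. - (d i / (1 + s * d i) * (d i / (1 + s * d i)))) = - (mob 1 s A ** mob 1 s A)"
    proof -
      have "spmat U (\<lambda>i. - e i) = - spmat U e" for e using spmat_scaleR[of "-1" U e] by simp
      thus ?thesis unfolding Ad sp(1)[of U d, OF U d s0] spmat_mult[OF U] by simp
    qed
    ultimately have "((\<lambda>s. spmat U (\<lambda>i. d i / (1 + s * d i))) has_vector_derivative - (mob 1 s A ** mob 1 s A)) (at s)" by simp
    thus "((\<lambda>s. mob 1 s A) has_vector_derivative - (mob 1 s A ** mob 1 s A)) (at s)"
      by (rule has_vector_derivative_transform_within_open[of _ _ _ "{0<..<1}"]) (use s in \<open>auto simp: Ad sp(1)[of U d, OF U d]\<close>)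
    \<comment> \<open>The Jacobian as an exponential, so that its logarithmic derivative is read off
      as - (r + 1) times the trace of the moving matrix.\<close>
    let ?E = "\<lambda>s. exp (- (real (CARD('r) + 1) * (\<Sum>i\<in>UNIV. ln (1 + s * d i))))"
    have JE: "mob_jac 1 s A = ?E s" if "0 \<le> s" for s
    proof -
      have "det (1 *\<^sub>R mat 1 + s *\<^sub>R A) = (\<Prod>i\<in>UNIV. 1 + s * d i)"
        unfolding Ad affine_spmat[OF U] det_spmat[OF U] by simp
      also have "\<dots> = exp (\<Sum>i\<in>UNIV. ln (1 + s * d i))" using p[OF that] by (simp add: exp_sum)
      finally have "mob_jac 1 s A = (1 / exp (\<Sum>i\<in>UNIV. ln (1 + s * d i))) ^ (CARD('r) + 1)" by (simp add: mob_jac_def)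
      also have "\<dots> = exp (- (\<Sum>i\<in>UNIV. ln (1 + s * d i))) ^ (CARD('r) + 1)" by (simp only: exp_minus inverse_eq_divide)
      also have "\<dots> = ?E s" by (simp only: exp_of_nat_mult[symmetric] mult_minus_right)
      finally show ?thesis .
    qed
    have "(?E has_real_derivative ?E s * (- (real (CARD('r) + 1) * (\<Sum>i\<in>UNIV. d i / (1 + s * d i))))) (at s)"
      using p[OF s0] by (auto intro!: derivative_eq_intros simp: divide_inverse mult_ac)
    moreover have "trace (mob 1 s A) = (\<Sum>i\<in>UNIV. d i / (1 + s * d i))"
      unfolding Ad sp(1)[of U d, OF U d s0] by (rule trace_spmat[OF U])
    ultimately have "(?E has_real_derivative - (real (CARD('r) + 1) * trace (mob 1 s A)) * mob_jac 1 s A) (at s)"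
      unfolding JE[OF s0] by (simp only: mult.commute)
    thus "((\<lambda>s. mob_jac 1 s A) has_real_derivative - (real (CARD('r) + 1) * trace (mob 1 s A)) * mob_jac 1 s A) (at s)"
      by (rule has_field_derivative_transform_within_open[of _ _ _ "{0<..<1}"]) (use s in \<open>auto simp: JE\<close>)
  qed
  moreover have "(LINT A:RR|sym_lborel. - ?h A) = - (LINT A:RR|sym_lborel. ?h A)"
    unfolding set_lebesgue_integral_def scaleR_minus_right by (rule Bochner_Integration.integral_minus)
  ultimately show ?thesis by linarith
qed

text \<open>The field \<open>(M A + A M) / 2\<close> generates the congruences \<open>A \<mapsto> exp (s M / 2) A exp (s M / 2)\<close>.\<close>

lemma RR_congruence_flow:
  fixes f :: "real^'r::{finite,linorder}^'r::{finite,linorder} \<Rightarrow> real" and M :: "real^'r::{finite,linorder}^'r::{finite,linorder}"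
  assumes der: "\<And>A. A \<in> RR \<Longrightarrow> (f has_derivative D A) (at A within RR)"
    and bd: "\<And>A. A \<in> bdry_RR \<Longrightarrow> (f \<longlongrightarrow> 0) (at A within RR)"
    and f: "set_integrable sym_lborel RR f"
    and M: "pos_def M"
    and h: "set_integrable sym_lborel RR (\<lambda>A. D A ((1/2) *\<^sub>R (M ** A + A ** M)) + real (CARD('r) + 1) / 2 * trace M * f A)"
  shows "(LINT A:RR|sym_lborel. D A ((1/2) *\<^sub>R (M ** A + A ** M)) + real (CARD('r) + 1) / 2 * trace M * f A) = 0"
proof -
  let ?h = "\<lambda>A. D A ((1/2) *\<^sub>R (M ** A + A ** M)) + real (CARD('r) + 1) / 2 * trace M * f A"
  obtain U m where U: "orthogonal_matrix U" and Mm: "M = spmat U m" and m: "\<And>i. 0 < m i" by (rule pos_def_obtain[OF M]) blast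
  \<comment> \<open>exp(- s M / 2), with the opposite sign: the flow of the negative field is
    contracting because M is positive definite, and so it cannot leave \<open>RR\<close> after
    entering.\<close>
  define E where "E s = spmat U (\<lambda>i. exp (- s * m i / 2))" for s
  have tE: "transpose (E s) = E s" for s by (simp add: E_def)
  have dE: "det (E s) = exp (- s * trace M / 2)" for s
    by (simp add: E_def det_spmat[OF U] Mm trace_spmat[OF U] exp_sum[symmetric] sum_distrib_left sum_divide_distrib sum_negf)
  have dE0: "det (E s) \<noteq> 0" for s by (simp add: dE)
  have EE: "E s ** E t = E (s + t)" for s t
    by (simp add: E_def spmat_mult[OF U] exp_add[symmetric] algebra_simps add_divide_distrib diff_divide_distrib)
  have Ecomm: "E s ** E t = E t ** E s" for s t by (simp add: EE add.commute)
  have "continuous_on S (\<lambda>s. if i = j then exp (- s * m i / 2) else 0)" for S and i j :: 'r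
    by (cases "i = j") (auto intro!: continuous_intros)
  hence contE: "continuous_on S E" for S
    unfolding E_def spmat_def by (intro continuous_on_matrix_mult continuous_on_vec_lambda continuous_on_const)
  have dEs: "(E has_vector_derivative - (1/2) *\<^sub>R (M ** E s)) (at s)" for s
  proof -
    have "((\<lambda>s. exp (- s * m i / 2)) has_real_derivative - (1/2) * (m i * exp (- s * m i / 2))) (at s within UNIV)" for i
      by (auto intro!: derivative_eq_intros)
    from has_vector_derivative_spmat[OF this, of U] show ?thesis
      by (simp add: E_def[abs_def] Mm spmat_mult[OF U] spmat_scaleR)
  qed
  have ME: "M ** E s = E s ** M" for s by (simp add: Mm E_def spmat_mult[OF U] mult.commute)
  have pd: "pos_def (E s ** A ** E s)" if "pos_def A" for s A by (rule pos_def_congruence[OF that tE dE0])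
  have "(LINT A:RR|sym_lborel. - ?h A) = 0"
  proof (rule RR_flow_integral_zero[OF der bd f, where \<phi> = "\<lambda>s A. E s ** A ** E s" and J = "\<lambda>s A. det (E s) ^ (CARD('r) + 1)"
        and X = "\<lambda>A. - ((1/2) *\<^sub>R (M ** A + A ** M))" and \<delta> = "\<lambda>A. - (real (CARD('r) + 1) / 2 * trace M)"])
    show "set_integrable sym_lborel RR (\<lambda>A. - ?h A)" by (rule set_integrable_uminus[OF h])
    show "- ?h A = D A (- ((1/2) *\<^sub>R (M ** A + A ** M))) + f A * - (real (CARD('r) + 1) / 2 * trace M)" if "A \<in> RR" for A
      using has_derivative_uminus_arg[OF der[OF that], of "(1/2) *\<^sub>R (M ** A + A ** M)"] by simp
    show "0 \<le> det (E s) ^ (CARD('r) + 1)" for s by (simp add: dE)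
    show "transpose (E s ** A ** E s) = E s ** A ** E s" if "pos_def A" for s and A :: "real^'r::{finite,linorder}^'r::{finite,linorder}"
      using pd[OF that, of s] by (simp add: pos_def_def)
    show "(\<integral>\<^sup>+ A. ennreal (det (E s) ^ (CARD('r) + 1)) * g (E s ** A ** E s) * indicator (Collect pos_def) A \<partial>sym_lborel) = (\<integral>\<^sup>+ A. g A \<partial>sym_lborel)"
      if g: "g \<in> borel_measurable borel" and g0: "\<And>A. A \<notin> RR \<Longrightarrow> g A = 0"
      for s and g :: "real^'r::{finite,linorder}^'r::{finite,linorder} \<Rightarrow> ennreal"
    proof -
      have "(\<integral>\<^sup>+ A. ennreal (det (E s) ^ (CARD('r) + 1)) * g (E s ** A ** E s) * indicator (Collect pos_def) A \<partial>sym_lborel) = (\<integral>\<^sup>+ A. g A * indicator (Collect pos_def) A \<partial>sym_lborel)"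
        unfolding E_def by (rule nn_integral_congruence[OF U _ g]) simp
      also have "\<dots> = (\<integral>\<^sup>+ A. g A \<partial>sym_lborel)"
      proof (intro nn_integral_cong)
        fix A show "g A * indicator (Collect pos_def) A = g A"
          by (cases "A \<in> RR") (use RR_pos_def[of A] g0[of A] in \<open>auto simp: indicator_def\<close>)
      qed
      finally show ?thesis .
    qed
    show "E t ** A ** E t \<in> RR" if A: "pos_def A" and st: "s \<le> t" and R: "E s ** A ** E s \<in> RR"
      for s t and A :: "real^'r::{finite,linorder}^'r::{finite,linorder}"
    proof -
      let ?B = "E s ** A ** E s" and ?C = "E (t - s)"
      have tB: "E t ** A ** E t = ?C ** ?B ** ?C"
      proof -
        have "E t ** A ** E t = (?C ** E s) ** A ** (E s ** ?C)" by (simp add: EE)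
        thus ?thesis by (simp only: matrix_mul_assoc)
      qed
      have B1: "pos_def (mat 1 - ?B)" using R by (simp add: RR_def)
      \<comment> \<open>Put C = E(t - s) and let B be the matrix at time s. The quadratic form of C
        B C at x is that of B at C x, less than |C x|^2 because B is below the identity, and |C x|^2
        is at most |x|^2 because the eigenvalues of C^2 are at most 1.\<close>
      have "0 < x \<bullet> ((mat 1 - E t ** A ** E t) *v x)" if x: "x \<noteq> 0" for x
      proof -
        let ?y = "?C *v x"
        have "?y \<noteq> 0"
        proof
          assume "?y = 0"
          hence "matrix_inv ?C *v (?C *v x) = 0" by (simp only: matrix_vector_mult_0_right)
          hence "x = 0" using dE0[of "t - s"] by (simp add: matrix_vector_mul_assoc invertible_matrix_inv invertible_det_nz)
          thus False using x by simp
        qed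
        hence "0 < ?y \<bullet> ((mat 1 - ?B) *v ?y)" using B1 by (simp add: pos_def_def)
        hence 1: "?y \<bullet> (?B *v ?y) < ?y \<bullet> ?y" by (simp add: matrix_vector_mult_diff_rdistrib inner_diff_right)
        have 2: "x \<bullet> ((E t ** A ** E t) *v x) = ?y \<bullet> (?B *v ?y)"
        proof -
          have "(E t ** A ** E t) *v x = ?C *v (?B *v ?y)" unfolding tB by (simp only: matrix_vector_mul_assoc matrix_mul_assoc)
          thus ?thesis using self_adjoint_iff_symmetric[OF tE] by simp
        qed
        have "?y \<bullet> ?y = x \<bullet> (?C *v (?C *v x))" by (rule self_adjoint_iff_symmetric[OF tE, symmetric])
        also have "\<dots> = x \<bullet> (E (2 * (t - s)) *v x)" by (simp add: matrix_vector_mul_assoc EE)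
        also have "\<dots> \<le> x \<bullet> (mat 1 *v x)"
          unfolding E_def spmat_1[OF U] spmat_quadratic using st m by (intro sum_mono mult_right_mono) (auto intro!: mult_nonpos_nonneg simp: less_imp_le)
        also have "\<dots> = x \<bullet> x" by simp
        finally have "?y \<bullet> ?y \<le> x \<bullet> x" .
        with 1 2 show ?thesis by (simp add: matrix_vector_mult_diff_rdistrib inner_diff_right)
      qed
      moreover have p: "pos_def (E t ** A ** E t)" by (rule pd[OF A])
      moreover have "transpose (mat 1 - E t ** A ** E t) = mat 1 - E t ** A ** E t"
      proof -
        have "transpose (mat 1 - X) = mat 1 - X" if "transpose X = X" for X :: "real^'r::{finite,linorder}^'r::{finite,linorder}"
        proof -
          have "transpose (mat 1 - X) = transpose (mat 1) - transpose X" by (simp add: transpose_def vec_eq_iff)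
          thus ?thesis using that by simp
        qed
        thus ?thesis using p by (simp add: pos_def_def)
      qed
      ultimately show ?thesis by (simp add: RR_def sym_matrices_def pos_def_def)
    qed
    show "continuous_on ({0..1} \<times> Collect pos_def) (\<lambda>(s, A :: real^'r::{finite,linorder}^'r::{finite,linorder}). E s ** A ** E s)"
      unfolding split_beta'
      by (intro continuous_on_matrix_mult continuous_on_snd continuous_on_id continuous_on_compose2[OF contE[of UNIV] continuous_on_fst[OF continuous_on_id]] subset_UNIV)
    show "continuous_on ({0..1} \<times> Collect pos_def) (\<lambda>(s, A :: real^'r::{finite,linorder}^'r::{finite,linorder}). det (E s) ^ (CARD('r) + 1))"
      unfolding split_beta'
      by (intro continuous_on_power continuous_on_det continuous_on_compose2[OF contE[of UNIV] continuous_on_fst[OF continuous_on_id]] subset_UNIV)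
    fix s :: real and A :: "real^'r::{finite,linorder}^'r::{finite,linorder}"
    have "((\<lambda>s. E s ** A) has_vector_derivative (- (1/2) *\<^sub>R (M ** E s)) ** A) (at s)"
      using bounded_bilinear.has_vector_derivative[OF bounded_bilinear_matrix_mult dEs[of s] has_vector_derivative_const[of A]] by (simp add: matrix_mult_zero_right)
    from bounded_bilinear.has_vector_derivative[OF bounded_bilinear_matrix_mult this dEs[of s]]
    have "((\<lambda>s. E s ** A ** E s) has_vector_derivative (E s ** A) ** (- (1/2) *\<^sub>R (M ** E s)) + ((- (1/2) *\<^sub>R (M ** E s)) ** A) ** E s) (at s)" .
    moreover have "(E s ** A) ** (- (1/2) *\<^sub>R (M ** E s)) + ((- (1/2) *\<^sub>R (M ** E s)) ** A) ** E s = - ((1/2) *\<^sub>R (M ** (E s ** A ** E s) + (E s ** A ** E s) ** M))"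
    proof -
      have "(E s ** A) ** (- (1/2) *\<^sub>R (M ** E s)) = - (1/2) *\<^sub>R ((E s ** A ** E s) ** M)"
        by (simp only: matrix_mult_scaleR_right ME matrix_mul_assoc)
      moreover have "((- (1/2) *\<^sub>R (M ** E s)) ** A) ** E s = - (1/2) *\<^sub>R (M ** (E s ** A ** E s))"
        by (simp only: matrix_mult_scaleR_left matrix_mul_assoc)
      ultimately show ?thesis by (simp add: scaleR_add_right)
    qed
    ultimately show "((\<lambda>s. E s ** A ** E s) has_vector_derivative - ((1/2) *\<^sub>R (M ** (E s ** A ** E s) + (E s ** A ** E s) ** M))) (at s)" by simp
    have J: "det (E s) ^ (CARD('r) + 1) = exp (real (CARD('r) + 1) * (- s * trace M / 2))" for s
      by (simp only: dE exp_of_nat_mult[symmetric])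
    show "((\<lambda>s. det (E s) ^ (CARD('r) + 1)) has_real_derivative - (real (CARD('r) + 1) / 2 * trace M) * det (E s) ^ (CARD('r) + 1)) (at s)"
      unfolding J by (rule derivative_eq_intros refl | simp)+
  qed
  moreover have "(LINT A:RR|sym_lborel. - ?h A) = - (LINT A:RR|sym_lborel. ?h A)"
    unfolding set_lebesgue_integral_def scaleR_minus_right by (rule Bochner_Integration.integral_minus)
  ultimately show ?thesis by linarith
qed

section \<open>The inequality encoded by Delta\<close>

lemma trace_mult_inner: "trace (A ** transpose B) = A \<bullet> (B :: real^'m^'n)"
  by (metis inner_commute inner_matrix_eq_trace trace_mul_sym transpose_transpose matrix_transpose_mul trace_transpose)

lemma bounded_linear_trace: "bounded_linear (trace :: real^'n^'n \<Rightarrow> real)"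
  unfolding linear_conv_bounded_linear[symmetric] by (rule linearI) (simp_all add: trace_def sum.distrib sum_distrib_left)

lemma inner_mult_symmetric:
  fixes A :: "real^'n^'n" and X Y :: "real^'m^'n"
  assumes "transpose A = A" shows "(A ** X) \<bullet> Y = X \<bullet> (A ** Y)"
proof -
  have "(A ** X) \<bullet> Y = trace (transpose X ** transpose A ** Y)" by (simp add: inner_matrix_eq_trace matrix_transpose_mul)
  also have "\<dots> = X \<bullet> (A ** Y)" by (simp add: inner_matrix_eq_trace assms matrix_mul_assoc)
  finally show ?thesis .
qed

text \<open>Jacobi's formula in the directions A N and N A with symmetric N, which cover A^2 and A M
  + M A. There det(A + t A N) = det A det(I + t N), and the second factor is a product over the
  eigenvalues of N, so the inverse of A does not appear.\<close>

lemma det_derivative: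
  fixes A :: "real^'n^'n"
  obtains dd where "(det has_derivative dd) (at A)"
    "\<And>N. transpose N = N \<Longrightarrow> dd (A ** N) = det A * trace N" "\<And>N. transpose N = N \<Longrightarrow> dd (N ** A) = det A * trace N"
proof -
  obtain dd where dd: "(det has_derivative dd) (at A)" using differentiable_det[of A UNIV] by (auto simp: differentiable_def)
  have lin: "((\<lambda>t. det (mat 1 + t *\<^sub>R N)) has_real_derivative trace N) (at 0)" if N: "transpose N = N" for N :: "real^'n^'n"
  proof -
    obtain V n where V: "orthogonal_matrix V" and Nn: "N = spmat V n" using N by (rule spectral_theorem) blast
    have "mat 1 + t *\<^sub>R N = spmat V (\<lambda>i. 1 + t * n i)" for t using affine_spmat[OF V, of 1 t n] by (simp add: Nn)
    hence "det (mat 1 + t *\<^sub>R N) = (\<Prod>i\<in>UNIV. 1 + t * n i)" for t by (simp only: det_spmat[OF V])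
    moreover have "((\<lambda>t. \<Prod>i\<in>UNIV. 1 + t * n i) has_real_derivative (\<Sum>i\<in>UNIV. n i * (\<Prod>j\<in>UNIV - {i}. 1 + 0 * n j))) (at 0)"
      by (rule has_field_derivative_prod) (auto intro!: derivative_eq_intros)
    ultimately show ?thesis by (simp add: Nn trace_spmat[OF V])
  qed
  have path: "((\<lambda>t. det (A + t *\<^sub>R H)) has_real_derivative dd H) (at 0)" for H
  proof -
    have "((\<lambda>t. A + t *\<^sub>R H) has_vector_derivative H) (at 0)" by (auto intro!: derivative_eq_intros)
    from vector_derivative_diff_chain_within[OF this, of det dd] has_derivative_at_withinI[OF dd]
    show ?thesis by (simp add: o_def has_real_derivative_iff_has_vector_derivative)
  qed
  have "dd (A ** N) = det A * trace N" if N: "transpose N = N" for N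
  proof -
    have "A + t *\<^sub>R (A ** N) = A ** (mat 1 + t *\<^sub>R N)" for t by (simp add: matrix_mult_add_right matrix_mult_scaleR_right)
    hence "((\<lambda>t. det (A + t *\<^sub>R (A ** N))) has_real_derivative det A * trace N) (at 0)"
      using DERIV_cmult[OF lin[OF N], of "det A"] by (simp add: det_mul)
    thus ?thesis by (rule DERIV_unique[OF path])
  qed
  moreover have "dd (N ** A) = det A * trace N" if N: "transpose N = N" for N
  proof -
    have "A + t *\<^sub>R (N ** A) = (mat 1 + t *\<^sub>R N) ** A" for t by (simp add: matrix_mult_add_left matrix_mult_scaleR_left)
    hence "((\<lambda>t. det (A + t *\<^sub>R (N ** A))) has_real_derivative det A * trace N) (at 0)"
      using DERIV_cmult[OF lin[OF N], of "det A"] by (simp add: det_mul mult.commute)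
    thus ?thesis by (rule DERIV_unique[OF path])
  qed
  ultimately show ?thesis using that dd by blast
qed

section \<open>Directional derivatives on \<open>RR\<close> and the operator
  \<open>DD\<close>\<close>

lemma RR_line:
  fixes A S :: "real^'n^'n"
  assumes A: "A \<in> RR" and S: "transpose S = S"
  obtains e where "0 < e" "\<And>t. \<bar>t\<bar> < e \<Longrightarrow> A + t *\<^sub>R S \<in> RR"
proof -
  obtain V :: "(real^'n^'n) set" where V: "open V" "RR = sym_matrices \<inter> V" by (rule RR_openin)
  have "open ((\<lambda>t. A + t *\<^sub>R S) -` V)" by (intro open_vimage V continuous_intros)
  moreover have "0 \<in> (\<lambda>t. A + t *\<^sub>R S) -` V" using A V(2) by auto
  ultimately obtain e where e: "e > 0" "ball 0 e \<subseteq> (\<lambda>t. A + t *\<^sub>R S) -` V" by (meson openE)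
  have "A + t *\<^sub>R S \<in> RR" if "\<bar>t\<bar> < e" for t
  proof -
    have "t \<in> (\<lambda>t. A + t *\<^sub>R S) -` V" using e(2) that by (auto simp: dist_norm)
    moreover have "transpose (A + t *\<^sub>R S) = A + t *\<^sub>R S"
      using RR_symmetric[OF A] S by (simp add: transpose_def vec_eq_iff)
    ultimately show ?thesis unfolding V(2) by (simp add: sym_matrices_def)
  qed
  thus ?thesis using that e(1) by blast
qed

lemma RR_directional_derivative:
  fixes g :: "real^'n^'n \<Rightarrow> real"
  assumes A: "A \<in> RR" and g: "(g has_derivative g') (at A within RR)" and S: "transpose S = S"
  shows "((\<lambda>t. g (A + t *\<^sub>R S)) has_real_derivative g' S) (at 0)"
proof -
  obtain e where e: "0 < e" "\<And>t. \<bar>t\<bar> < e \<Longrightarrow> A + t *\<^sub>R S \<in> RR" using RR_line[OF A S] by blast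
  let ?I = "ball (0::real) e"
  have "((\<lambda>t. A + t *\<^sub>R S) has_vector_derivative S) (at 0 within ?I)" by (auto intro!: derivative_eq_intros)
  moreover have "(g has_derivative g') (at (A + 0 *\<^sub>R S) within (\<lambda>t. A + t *\<^sub>R S) ` ?I)"
  proof -
    have "(\<lambda>t. A + t *\<^sub>R S) ` ?I \<subseteq> RR" by (auto simp: dist_norm intro!: e(2))
    from has_derivative_subset[OF g this] show ?thesis by simp
  qed
  ultimately have "(g \<circ> (\<lambda>t. A + t *\<^sub>R S) has_vector_derivative g' S) (at 0 within ?I)"
    by (rule vector_derivative_diff_chain_within)
  moreover have "at 0 within ?I = at 0" using e(1) by (intro at_within_open) auto
  ultimately show ?thesis by (simp add: has_real_derivative_iff_has_vector_derivative o_def)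
qed

lemma transpose_sym_unit [simp]: "transpose (sym_unit i j) = sym_unit i j"
  by (auto simp: transpose_def sym_unit_def vec_eq_iff)

lemma sym_unit_commute: "sym_unit i j = sym_unit j i"
  by (auto simp: sym_unit_def vec_eq_iff)

text \<open>An off-diagonal unit is summed for (i, j) and again for (j, i); the weight (1 +
  \<delta>) / 2 in \<open>DD\<close> compensates exactly for this.\<close>

lemma sum_sym_unit:
  fixes S :: "real^'n^'n"
  assumes S: "transpose S = S"
  shows "(\<Sum>i\<in>UNIV. \<Sum>j\<in>UNIV. (S $ i $ j * ((1 + (if i = j then 1 else 0)) / 2)) *\<^sub>R sym_unit i j) = S"
proof -
  have s2: "(\<Sum>i\<in>UNIV. \<Sum>j\<in>UNIV. if i = a then (if j = b then x else 0) else 0) = x" for a b :: 'n and x :: real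
  proof -
    have "(\<Sum>j\<in>UNIV. if i = a then (if j = b then x else 0) else 0) = (if i = a then x else 0)" for i
      by (cases "i = a") simp_all
    thus ?thesis by simp
  qed
  have "(\<Sum>i\<in>UNIV. \<Sum>j\<in>UNIV. (S $ i $ j * ((1 + (if i = j then 1 else 0)) / 2)) * (sym_unit i j :: real^'n^'n) $ k $ l) = S $ k $ l" for k l
  proof -
    let ?c = "\<lambda>i j. S $ i $ j * ((1 + (if i = j then 1 else 0)) / 2)"
    have u: "?c i j * (sym_unit i j :: real^'n^'n) $ k $ l =
       (if i = k then (if j = l then ?c k l else 0) else 0) + (if i = l then (if j = k then (if k = l then 0 else ?c l k) else 0) else 0)" for i j
      by (auto simp: sym_unit_def)
    have "(\<Sum>i\<in>UNIV. \<Sum>j\<in>UNIV. ?c i j * (sym_unit i j :: real^'n^'n) $ k $ l) = ?c k l + (if k = l then 0 else ?c l k)"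
      unfolding u sum.distrib by (simp only: s2)
    thus ?thesis using transpose_eq_nth[OF S, of l k] by auto
  qed
  thus ?thesis by (simp add: vec_eq_iff)
qed

text \<open>\<open>DD g\<close> is the gradient for the trace inner product on symmetric matrices,
  so pairing it with X gives the derivative in the direction of the symmetric part of X. For X =
  \<Lambda> M this direction is (\<Lambda> M + M \<Lambda>) / 2, the field used for
  \<open>Delta2\<close>.\<close>

lemma trace_DD:
  fixes g :: "real^'n^'n \<Rightarrow> real"
  assumes A: "A \<in> RR" and g: "(g has_derivative g') (at A within RR)"
  shows "trace (X ** DD g A) = g' ((1/2) *\<^sub>R (X + transpose X))"
proof -
  interpret g': linear g' using has_derivative_linear[OF g] .
  have part: "sym_partial i j g A = g' (sym_unit i j)" for i j
    unfolding sym_partial_def by (rule DERIV_imp_deriv[OF RR_directional_derivative[OF A g]]) simp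
  have sym: "transpose (DD g A) = DD g A"
    by (auto simp: DD_def transpose_def vec_eq_iff part sym_unit_commute)
  have key: "trace (S ** DD g A) = g' S" if S: "transpose S = S" for S
  proof -
    have "trace (S ** DD g A) = (\<Sum>i\<in>UNIV. \<Sum>j\<in>UNIV. S $ i $ j * DD g A $ j $ i)"
      by (simp add: trace_def matrix_matrix_mult_def)
    also have "\<dots> = (\<Sum>i\<in>UNIV. \<Sum>j\<in>UNIV. S $ i $ j * ((1 + (if i = j then 1 else 0)) / 2) * g' (sym_unit i j))"
      by (intro sum.cong refl) (auto simp: DD_def part sym_unit_commute)
    also have "\<dots> = g' (\<Sum>i\<in>UNIV. \<Sum>j\<in>UNIV. (S $ i $ j * ((1 + (if i = j then 1 else 0)) / 2)) *\<^sub>R sym_unit i j)"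
      by (simp add: g'.sum g'.scale)
    finally show ?thesis unfolding sum_sym_unit[OF S] .
  qed
  have "trace (transpose X ** DD g A) = trace (X ** DD g A)"
  proof -
    have "trace (transpose X ** DD g A) = trace (transpose (transpose X ** DD g A))" by (simp only: trace_transpose)
    also have "\<dots> = trace (DD g A ** X)" by (simp add: matrix_transpose_mul sym)
    also have "\<dots> = trace (X ** DD g A)" by (rule trace_mul_sym)
    finally show ?thesis .
  qed
  hence "trace (X ** DD g A) = trace (((1/2) *\<^sub>R (X + transpose X)) ** DD g A)"
    by (simp add: matrix_mult_scaleR_left matrix_mult_add_left trace_add linear_scale[OF bounded_linear.linear[OF bounded_linear_trace]])
  also have "\<dots> = g' ((1/2) *\<^sub>R (X + transpose X))"
    by (rule key) (simp add: transpose_def vec_eq_iff add.commute)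
  finally show ?thesis .
qed

text \<open>On the segment through A in a symmetric direction, which stays in \<open>RR\<close> for
  a short time both ways, the value 0 is a minimum. This makes the quotient by
  \<open>prior2J\<close> in the integrands of \<open>Delta\<close> harmless at zeros.\<close>

lemma RR_derivative_at_zero:
  fixes g :: "real^'n^'n \<Rightarrow> real"
  assumes A: "A \<in> RR" and g: "(g has_derivative g') (at A within RR)" and S: "transpose S = S"
    and nn: "\<And>B. B \<in> RR \<Longrightarrow> 0 \<le> g B" and z: "g A = 0"
  shows "g' S = 0"
proof -
  obtain e where e: "0 < e" "\<And>t. \<bar>t\<bar> < e \<Longrightarrow> A + t *\<^sub>R S \<in> RR" using RR_line[OF A S] by blast
  show ?thesis
    by (rule DERIV_local_min[OF RR_directional_derivative[OF A g S] e(1)]) (use e(2) nn z in auto)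
qed

text \<open>The powers in \<open>prior2J\<close> are the Jacobian of the substitution, so it is the
  density of \<Lambda> when \<Omega> = \<open>mob (v / v0) (1 - v / v0) \<Lambda>\<close> has
  density \<pi>2.\<close>

lemma prior2J_eq:
  fixes A :: "real^'n^'n"
  assumes v: "0 < v" "v \<le> v0" and A: "pos_def A"
  shows "prior2J v0 v \<pi>2 A = mob_jac (v / v0) (1 - v / v0) A * \<pi>2 (mob (v / v0) (1 - v / v0) A)"
proof -
  let ?b = "v / v0" and ?B = "(v / v0) *\<^sub>R mat 1 + (1 - v / v0) *\<^sub>R A" and ?n = "CARD('n)"
  have b: "0 < ?b" "0 \<le> 1 - ?b" using v by (auto simp: field_simps)
  have dB: "0 < det ?B" by (rule affine_pos_def(1)[OF A b])
  have "(sqrt ?b ^ ?n) ^ (?n + 1) = ?b powr (real ?n * (real ?n + 1) / 2)"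
  proof -
    have "(sqrt ?b ^ ?n) ^ (?n + 1) = (?b powr (1/2)) powr (real (?n * (?n + 1)))"
      using b(1) by (simp only: power_mult[symmetric] powr_half_sqrt[OF less_imp_le[OF b(1)]] powr_realpow[of "sqrt ?b"] real_sqrt_gt_zero)
    thus ?thesis by (simp add: powr_powr algebra_simps add_divide_distrib)
  qed
  moreover have "det ?B powr (- real ?n - 1) = 1 / det ?B ^ (?n + 1)"
  proof -
    have "- real ?n - 1 = - real (?n + 1)" by simp
    hence "det ?B powr (- real ?n - 1) = det ?B powr (- real (?n + 1))" by (simp only:)
    also have "\<dots> = 1 / det ?B ^ (?n + 1)" using dB by (simp only: powr_minus powr_realpow inverse_eq_divide)
    finally show ?thesis .
  qed
  ultimately have "?b powr (real ?n * (real ?n + 1) / 2) * det ?B powr (- real ?n - 1) = mob_jac ?b (1 - ?b) A"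
    by (simp only: mob_jac_def power_divide) simp
  thus ?thesis by (simp add: prior2J_def Let_def mob_def)
qed

lemma prior2J_nonneg:
  assumes v: "0 < v" "v \<le> v0" and nn: "\<And>\<Omega>. \<Omega> \<in> RR \<Longrightarrow> 0 \<le> \<pi>2 \<Omega>" and A: "A \<in> RR"
  shows "0 \<le> prior2J v0 v \<pi>2 A"
proof -
  have b: "0 < v / v0" "0 \<le> 1 - v / v0" "v / v0 + (1 - v / v0) = 1" using v by (auto simp: field_simps)
  have "mob (v / v0) (1 - v / v0) A \<in> RR" using mob_image_RR[OF b] A by blast
  thus ?thesis unfolding prior2J_eq[OF v RR_pos_def[OF A]]
    using mob_jac_pos[OF RR_pos_def[OF A] b(1,2)] nn by (intro mult_nonneg_nonneg) (auto intro: less_imp_le)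
qed

lemma prior2J_differentiable:
  fixes \<pi>2 :: "real^'n^'n \<Rightarrow> real"
  assumes v: "0 < v" "v \<le> v0" and d: "\<pi>2 differentiable_on RR" and A: "A \<in> RR"
  obtains g' where "(prior2J v0 v \<pi>2 has_derivative g') (at A within RR)"
proof -
  let ?b = "v / v0" let ?c = "1 - v / v0"
  have b: "0 < ?b" "0 \<le> ?c" "?b + ?c = 1" using v by (auto simp: field_simps)
  note img = mob_image_RR[OF b]
  have pd: "RR \<subseteq> Collect (pos_def :: real^'n^'n \<Rightarrow> bool)" using RR_pos_def by blast
  have "mob ?b ?c differentiable (at A within RR)"
    using has_derivative_subset[OF has_derivative_mob[OF RR_pos_def[OF A] b(1,2)] pd] by (auto simp: differentiable_def)
  moreover have "\<pi>2 differentiable (at (mob ?b ?c A) within mob ?b ?c ` RR)"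
    using d A img unfolding differentiable_on_def by (metis imageI)
  ultimately have 1: "(\<pi>2 \<circ> mob ?b ?c) differentiable (at A within RR)" by (rule differentiable_chain_within)
  have aff: "(\<lambda>A :: real^'n^'n. ?b *\<^sub>R mat 1 + ?c *\<^sub>R A) differentiable (at A within RR)"
    by (intro derivative_intros differentiable_add differentiable_const differentiable_scaleR differentiable_ident)
  have "(det \<circ> (\<lambda>A :: real^'n^'n. ?b *\<^sub>R mat 1 + ?c *\<^sub>R A)) differentiable (at A within RR)"
    by (rule differentiable_chain_within[OF aff differentiable_det])
  hence "(\<lambda>A. det (?b *\<^sub>R mat 1 + ?c *\<^sub>R A)) differentiable (at A within RR)" by (simp add: o_def)
  hence 2: "mob_jac ?b ?c differentiable (at A within RR)"
    unfolding mob_jac_def[abs_def] using affine_pos_def(1)[OF RR_pos_def[OF A] b(1,2)]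
    by (intro differentiable_power differentiable_divide differentiable_const) auto
  have "(\<lambda>A. mob_jac ?b ?c A * (\<pi>2 \<circ> mob ?b ?c) A) differentiable (at A within RR)" by (rule differentiable_mult[OF 2 1])
  then obtain g' where "((\<lambda>A. mob_jac ?b ?c A * (\<pi>2 \<circ> mob ?b ?c) A) has_derivative g') (at A within RR)" by (auto simp: differentiable_def)
  hence "(prior2J v0 v \<pi>2 has_derivative g') (at A within RR)"
    by (rule has_derivative_transform[OF A, rotated]) (simp add: prior2J_eq[OF v RR_pos_def])
  thus ?thesis using that by blast
qed

text \<open>The contribution of the prior is written as a positive coefficient times
  \<open>g'\<close>, not as \<open>f_pi\<close> times a logarithmic derivative, because
  \<open>prior2J\<close> may have zeros.\<close>

lemma f_pi_has_derivative:
  fixes W :: "real^'q^'r"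
  assumes A: "A \<in> RR" and g: "(prior2J v0 v \<pi>2 has_derivative g') (at A within RR)" and dd: "(det has_derivative dd) (at A)"
  shows "(f_pi v0 v \<pi>2 W has_derivative (\<lambda>H. f_pi v0 v \<pi>2 W A * (real CARD('q) / 2 * (dd H / det A) - trace (H ** W ** transpose W) / (2 * v))
     + (2 * pi * v) powr (- (real (CARD('q) * CARD('r)) / 2)) * det A powr (real CARD('q) / 2) * exp (- trace (A ** W ** transpose W) / (2 * v)) * g' H)) (at A within RR)"
proof -
  let ?k = "real CARD('q) / 2" and ?T = "\<lambda>A. trace (A ** W ** transpose W)"
  have dA: "0 < det A"
  proof -
    obtain U d where "orthogonal_matrix U" "A = spmat U d" "\<And>i. 0 < d i" using RR_obtain[OF A] by metis
    thus ?thesis by (simp add: det_spmat prod_pos)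
  qed
  have "bounded_linear (\<lambda>A. A ** W ** transpose W)"
    by (rule bounded_linear_compose[OF bounded_bilinear.bounded_linear_left[OF bounded_bilinear_matrix_mult] bounded_bilinear.bounded_linear_left[OF bounded_bilinear_matrix_mult]])
  hence T: "bounded_linear ?T" by (rule bounded_linear_compose[OF bounded_linear_trace])
  have d1: "((\<lambda>A. det A powr ?k) has_derivative (\<lambda>H. dd H * (?k * det A powr (?k - 1)))) (at A within RR)"
    by (rule DERIV_compose_FDERIV[OF has_real_derivative_powr[OF dA] has_derivative_at_withinI[OF dd]])
  have p: "det A powr (?k - 1) = det A powr ?k / det A" using dA by (simp add: powr_diff)
  have d2: "((\<lambda>A. exp (- ?T A / (2 * v))) has_derivative (\<lambda>H. (- ?T H / (2 * v)) * exp (- ?T A / (2 * v)))) (at A within RR)"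
  proof (rule DERIV_compose_FDERIV[OF DERIV_exp])
    show "((\<lambda>A. - ?T A / (2 * v)) has_derivative (\<lambda>H. - ?T H / (2 * v))) (at A within RR)"
      by (rule bounded_linear_imp_has_derivative) (use T in \<open>intro bounded_linear_divide[THEN bounded_linear_compose] bounded_linear_minus\<close>)
  qed
  have d3: "((\<lambda>A. (2 * pi * v) powr (- (real (CARD('q) * CARD('r)) / 2)) * det A powr ?k) has_derivative
     (\<lambda>H. (2 * pi * v) powr (- (real (CARD('q) * CARD('r)) / 2)) * (dd H * (?k * det A powr (?k - 1))))) (at A within RR)"
    by (rule has_derivative_mult_right[OF d1])
  from has_derivative_mult[OF has_derivative_mult[OF d3 g] d2]
  show ?thesis unfolding f_pi_def[abs_def]
    by (rule has_derivative_eq_rhs) (simp add: fun_eq_iff p algebra_simps diff_divide_distrib add_divide_distrib)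
qed

section \<open>Integrability over \<open>RR\<close>\<close>

lemma set_integrable_mult_bounded:
  fixes f k :: "real^'r::{finite,linorder}^'r::{finite,linorder} \<Rightarrow> real"
  assumes f: "set_integrable sym_lborel RR f" and k: "k \<in> borel_measurable borel" and b: "\<And>A. A \<in> RR \<Longrightarrow> \<bar>k A\<bar> \<le> C"
  shows "set_integrable sym_lborel RR (\<lambda>A. k A * f A)"
  unfolding set_integrable_def
proof (rule Bochner_Integration.integrable_bound)
  have fi: "integrable sym_lborel (\<lambda>A. indicator RR A *\<^sub>R f A)" using f by (simp add: set_integrable_def)
  show "integrable sym_lborel (\<lambda>A. C * (indicator RR A *\<^sub>R f A))" by (rule integrable_mult_right[OF fi])
  have eq: "(\<lambda>A. indicator RR A *\<^sub>R (k A * f A)) = (\<lambda>A. k A * (indicator RR A *\<^sub>R f A))" by (auto simp: fun_eq_iff)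
  show "(\<lambda>A. indicator RR A *\<^sub>R (k A * f A)) \<in> borel_measurable sym_lborel"
    unfolding eq using borel_measurable_integrable[OF fi] k by (intro borel_measurable_times) auto
  show "AE A in sym_lborel. norm (indicator RR A *\<^sub>R (k A * f A)) \<le> norm (C * (indicator RR A *\<^sub>R f A))"
  proof (rule AE_I2)
    fix A :: "real^'r::{finite,linorder}^'r::{finite,linorder}"
    have "\<bar>k A\<bar> * \<bar>f A\<bar> \<le> \<bar>C\<bar> * \<bar>f A\<bar>" if "A \<in> RR"
      using order_trans[OF b[OF that] abs_ge_self] by (intro mult_right_mono) auto
    thus "norm (indicator RR A *\<^sub>R (k A * f A)) \<le> norm (C * (indicator RR A *\<^sub>R f A))"
      by (cases "A \<in> RR") (auto simp: abs_mult)
  qed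
qed

lemma norm_RR_le:
  fixes A :: "real^'n^'n"
  assumes "A \<in> RR" shows "norm A \<le> real CARD('n)"
proof -
  obtain U d where U: "orthogonal_matrix U" "A = spmat U d" and d: "\<And>i. 0 < d i" "\<And>i. d i < 1" using RR_obtain[OF assms] by metis
  have "norm (spmat U d) \<le> real CARD('n) * 1"
    by (rule norm_spmat_le[OF U(1)]) (use d in \<open>auto simp: less_imp_le\<close>)
  thus ?thesis using U(2) by simp
qed

text \<open>\<open>RR\<close> lies in a fixed ball, on which a continuous factor is bounded; so
  every polynomial weight in \<Lambda> inherits integrability from \<open>f_pi\<close>.\<close>

lemma set_integrable_continuous_mult:
  fixes f k :: "real^'r::{finite,linorder}^'r::{finite,linorder} \<Rightarrow> real"
  assumes f: "set_integrable sym_lborel RR f" and k: "continuous_on UNIV k"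
  shows "set_integrable sym_lborel RR (\<lambda>A. k A * f A)"
proof -
  let ?B = "cball (0 :: real^'r::{finite,linorder}^'r::{finite,linorder}) (real CARD('r))"
  have "compact (k ` ?B)" by (intro compact_continuous_image continuous_on_subset[OF k]) auto
  hence "bounded (k ` ?B)" by (rule compact_imp_bounded)
  then obtain C where "\<forall>x\<in>k ` ?B. norm x \<le> C" unfolding bounded_iff by blast
  hence C: "\<And>A. A \<in> ?B \<Longrightarrow> \<bar>k A\<bar> \<le> C" by simp
  show ?thesis
    by (rule set_integrable_mult_bounded[OF f borel_measurable_continuous_onI[OF k], of C]) (use C norm_RR_le in auto)
qed

lemma set_lebesgue_integral_bounded_linear:
  assumes T: "bounded_linear T" and f: "set_integrable M S f"
  shows "set_integrable M S (\<lambda>x. T (f x))" and "(LINT x:S|M. T (f x)) = T (LINT x:S|M. f x)"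
proof -
  interpret T: bounded_linear T by (rule T)
  have eq: "indicator S x *\<^sub>R T (f x) = T (indicator S x *\<^sub>R f x)" for x by (simp add: T.scaleR)
  show "set_integrable M S (\<lambda>x. T (f x))" unfolding set_integrable_def eq
    by (rule integrable_bounded_linear[OF T f[unfolded set_integrable_def]])
  show "(LINT x:S|M. T (f x)) = T (LINT x:S|M. f x)" unfolding set_lebesgue_integral_def eq
    by (rule integral_bounded_linear[OF T f[unfolded set_integrable_def]])
qed

lemma set_integral_lincomb:
  fixes f g h :: "'a \<Rightarrow> real"
  assumes "set_integrable M S f" "set_integrable M S g" "set_integrable M S h"
  shows "set_integrable M S (\<lambda>x. c * f x - d * g x + h x)"
    and "(LINT x:S|M. c * f x - d * g x + h x) = c * (LINT x:S|M. f x) - d * (LINT x:S|M. g x) + (LINT x:S|M. h x)"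
proof -
  let ?i = "\<lambda>f x. indicator S x *\<^sub>R f x"
  have i: "integrable M (?i f)" "integrable M (?i g)" "integrable M (?i h)" using assms by (simp_all add: set_integrable_def)
  have eq: "?i (\<lambda>x. c * f x - d * g x + h x) = (\<lambda>x. c * ?i f x - d * ?i g x + ?i h x)"
    by (simp add: fun_eq_iff algebra_simps)
  show "set_integrable M S (\<lambda>x. c * f x - d * g x + h x)"
    unfolding set_integrable_def eq by (intro Bochner_Integration.integrable_add Bochner_Integration.integrable_diff integrable_mult_right i)
  have "(\<integral>x. c * ?i f x - d * ?i g x + ?i h x \<partial>M) = (\<integral>x. c * ?i f x - d * ?i g x \<partial>M) + (\<integral>x. ?i h x \<partial>M)"
    by (intro Bochner_Integration.integral_add Bochner_Integration.integrable_diff integrable_mult_right i)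
  thus "(LINT x:S|M. c * f x - d * g x + h x) = c * (LINT x:S|M. f x) - d * (LINT x:S|M. g x) + (LINT x:S|M. h x)"
    unfolding set_lebesgue_integral_def eq integral_lincomb_diff[OF i(1,2)] .
qed

text \<open>The left-hand side is a positive multiple of the Laplacian of the square root of the marginal density \<open>m_pi\<close>.\<close>

lemma Delta_inequality:
  fixes W :: "real^'q^'r::{finite,linorder}" and \<pi>2 :: "real^'r::{finite,linorder}^'r::{finite,linorder} \<Rightarrow> real"
  assumes v: "0 < v" "v \<le> v0"
    and pd: "\<pi>2 differentiable_on RR" and nn: "\<And>\<Omega>. \<Omega> \<in> RR \<Longrightarrow> 0 \<le> \<pi>2 \<Omega>"
    and bd: "\<And>A. A \<in> bdry_RR \<Longrightarrow> (f_pi v0 v \<pi>2 W \<longlongrightarrow> 0) (at A within RR)"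
    and f: "set_integrable sym_lborel RR (f_pi v0 v \<pi>2 W)"
    and fA: "set_integrable sym_lborel RR (\<lambda>A. f_pi v0 v \<pi>2 W A *\<^sub>R A)"
    and D1: "set_integrable sym_lborel RR (Delta1_integrand v0 v \<pi>2 W)"
    and D2: "set_integrable sym_lborel RR (Delta2_integrand v0 v \<pi>2 W)"
    and m: "0 < m_pi v0 v \<pi>2 W" and Mp: "pos_def (M_pi v0 v \<pi>2 W)"
    and D: "Delta v0 v \<pi>2 W \<le> 0"
  shows "m_pi v0 v \<pi>2 W * (2 / v\<^sup>2 * (LINT A:RR|sym_lborel. (norm (A ** W))\<^sup>2 * f_pi v0 v \<pi>2 W A) - 2 * real CARD('q) / v * trace (M_pi v0 v \<pi>2 W))
     - (norm (M_pi v0 v \<pi>2 W ** W))\<^sup>2 / v\<^sup>2 \<le> 0"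
proof -
  let ?g = "prior2J v0 v \<pi>2" and ?f = "f_pi v0 v \<pi>2 W" and ?M = "M_pi v0 v \<pi>2 W" and ?m = "m_pi v0 v \<pi>2 W"
  let ?q = "real CARD('q)" and ?r1 = "real (CARD('r) + 1)"
  define c where "c A = (2 * pi * v) powr (- (real (CARD('q) * CARD('r)) / 2)) * det A powr (?q / 2) * exp (- trace (A ** W ** transpose W) / (2 * v))" for A :: "real^'r::{finite,linorder}^'r::{finite,linorder}"
  have fc: "?f A = c A * ?g A" for A by (simp add: f_pi_def c_def)
  have "\<exists>g'. (?g has_derivative g') (at A within RR)" if "A \<in> RR" for A
    using prior2J_differentiable[OF v pd that] by blast
  then obtain g' where g': "\<And>A. A \<in> RR \<Longrightarrow> (?g has_derivative g' A) (at A within RR)" by metis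
  have "\<exists>dd. (det has_derivative dd) (at A) \<and> (\<forall>N. transpose N = N \<longrightarrow> dd (A ** N) = det A * trace N \<and> dd (N ** A) = det A * trace N)" for A :: "real^'r::{finite,linorder}^'r::{finite,linorder}"
    by (rule det_derivative[of A]) blast
  then obtain dd where dd: "\<And>A. (det has_derivative dd A) (at (A :: real^'r::{finite,linorder}^'r::{finite,linorder}))"
    and dd1: "\<And>A N. transpose N = N \<Longrightarrow> dd A (A ** N) = det A * trace N" and dd2: "\<And>A N. transpose N = N \<Longrightarrow> dd A (N ** A) = det A * trace N"
    by metis
  define D' where "D' A H = ?f A * (?q / 2 * (dd A H / det A) - trace (H ** W ** transpose W) / (2 * v)) + c A * g' A H" for A H
  have der: "(?f has_derivative D' A) (at A within RR)" if "A \<in> RR" for A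
    using f_pi_has_derivative[OF that g'[OF that] dd, of W] by (simp add: D'_def[abs_def] c_def)
  have detnz: "det A \<noteq> 0" if AR: "A \<in> RR" for A :: "real^'r::{finite,linorder}^'r::{finite,linorder}"
  proof -
    obtain U d where U: "orthogonal_matrix U" "A = spmat U d" "\<And>i. 0 < d i" using RR_obtain[OF AR] by metis
    have "0 < det A" unfolding U(2) det_spmat[OF U(1)] by (intro prod_pos U(3))
    thus ?thesis by simp
  qed
  have g0: "g' A S = 0" if "A \<in> RR" "transpose S = S" "?g A = 0" for A S
    by (rule RR_derivative_at_zero[OF that(1) g'[OF that(1)] that(2) _ that(3)]) (rule prior2J_nonneg[OF v nn])
  \<comment> \<open>Away from zeros of \<open>prior2J\<close> the quotient cancels against
    \<open>f_pi\<close>; at a zero both sides are 0, the right one because the derivative vanishes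
    too.\<close>
  have lift: "1 / ?g A * g' A S * ?f A = c A * g' A S" if "A \<in> RR" "transpose S = S" for A S
    using g0[OF that] by (cases "?g A = 0") (simp_all add: fc)
  have tA: "transpose A = A" if "A \<in> RR" for A :: "real^'r::{finite,linorder}^'r::{finite,linorder}" using RR_symmetric[OF that] .
  have tM: "transpose ?M = ?M" using Mp by (simp add: pos_def_def)
  have tt: "transpose ((1/2) *\<^sub>R (X + transpose X)) = (1/2) *\<^sub>R (X + transpose X)" for X :: "real^'r::{finite,linorder}^'r::{finite,linorder}"
    by (simp add: transpose_def vec_eq_iff add.commute)
  have e1: "Delta1_integrand v0 v \<pi>2 W A = c A * g' A (A ** A)" if "A \<in> RR" for A
  proof -
    have tAA: "transpose (A ** A) = A ** A" using tA[OF that] by (simp add: matrix_transpose_mul)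
    have "trace (A ** A ** DD ?g A) = g' A (A ** A)"
      unfolding trace_DD[OF that g'[OF that]] tAA by (simp add: scaleR_2[symmetric])
    thus ?thesis using lift[OF that tAA] by (simp add: Delta1_integrand_def)
  qed
  have e2: "Delta2_integrand v0 v \<pi>2 W A = c A * g' A ((1/2) *\<^sub>R (?M ** A + A ** ?M))" if "A \<in> RR" for A
  proof -
    have "transpose (A ** ?M) = ?M ** A" using tA[OF that] tM by (simp add: matrix_transpose_mul)
    hence e: "(1/2) *\<^sub>R (A ** ?M + transpose (A ** ?M)) = (1/2) *\<^sub>R (?M ** A + A ** ?M)" by (simp add: add.commute)
    have "trace (A ** ?M ** DD ?g A) = g' A ((1/2) *\<^sub>R (?M ** A + A ** ?M))"
      unfolding trace_DD[OF that g'[OF that]] e ..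
    thus ?thesis using lift[OF that tt[of "A ** ?M"]] unfolding e by (simp add: Delta2_integrand_def)
  qed
  have fA': "set_integrable sym_lborel RR (\<lambda>A. trace (?f A *\<^sub>R A))" and trM: "(LINT A:RR|sym_lborel. trace (?f A *\<^sub>R A)) = trace ?M"
    using set_lebesgue_integral_bounded_linear[OF bounded_linear_trace fA] by (simp_all add: M_pi_def)
  have tr_sc: "trace (x *\<^sub>R A) = x * trace A" for x and A :: "real^'r::{finite,linorder}^'r::{finite,linorder}"
    by (simp add: linear_scale[OF bounded_linear.linear[OF bounded_linear_trace]])
  note fA'' = fA'[unfolded tr_sc] and trM' = trM[unfolded tr_sc]
  define s where "s A = (norm (A ** W))\<^sup>2" for A :: "real^'r::{finite,linorder}^'r::{finite,linorder}"
  have s_eq: "trace (A ** A ** W ** transpose W) = s A" if "transpose A = A" for A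
  proof -
    have "trace (A ** A ** W ** transpose W) = (A ** (A ** W)) \<bullet> W" by (simp add: trace_mult_inner matrix_mul_assoc)
    also have "\<dots> = s A" by (simp add: inner_mult_symmetric[OF that] s_def power2_norm_eq_inner)
    finally show ?thesis .
  qed
  have cs: "continuous_on UNIV s" unfolding s_def by (intro continuous_intros)
  have fs: "set_integrable sym_lborel RR (\<lambda>A. s A * ?f A)" by (rule set_integrable_continuous_mult[OF f cs])
  define t where "t A = (?M ** A ** W) \<bullet> W" for A :: "real^'r::{finite,linorder}^'r::{finite,linorder}"
  have blt: "bounded_linear t" unfolding t_def
    by (rule bounded_linear_compose[OF bounded_linear_inner_left bounded_linear_compose[OF bounded_bilinear.bounded_linear_left[OF bounded_bilinear_matrix_mult] bounded_bilinear.bounded_linear_right[OF bounded_bilinear_matrix_mult]]])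
  have ft: "set_integrable sym_lborel RR (\<lambda>A. t (?f A *\<^sub>R A))" and It: "(LINT A:RR|sym_lborel. t (?f A *\<^sub>R A)) = t ?M"
    using set_lebesgue_integral_bounded_linear[OF blt fA] by (simp_all add: M_pi_def)
  have t_sc: "t (x *\<^sub>R A) = x * t A" for x A using linear_scale[OF bounded_linear.linear[OF blt]] by simp
  note ft' = ft[unfolded t_sc] and It' = It[unfolded t_sc]
  have tM': "t ?M = (norm (?M ** W))\<^sup>2"
    unfolding t_def power2_norm_eq_inner using inner_mult_symmetric[OF tM, of "?M ** W" W] by (simp add: matrix_mul_assoc)
  \<comment> \<open>integration by parts along \<open>\<Lambda>\<^sup>2\<close>\<close>
  define h1 where "h1 A = (?q / 2 + ?r1) * (?f A * trace A) - 1 / (2 * v) * (s A * ?f A) + Delta1_integrand v0 v \<pi>2 W A" for A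
  have h1: "D' A (A ** A) + ?r1 * trace A * ?f A = h1 A" if "A \<in> RR" for A
    using e1[OF that] dd1[OF tA[OF that], of A] detnz[OF that] s_eq[OF tA[OF that]]
    by (simp add: D'_def h1_def algebra_simps)
  have ih1: "set_integrable sym_lborel RR h1" unfolding h1_def
    by (rule set_integral_lincomb(1)[OF fA'' fs D1])
  have "(LINT A:RR|sym_lborel. D' A (A ** A) + ?r1 * trace A * ?f A) = 0"
  proof (rule RR_mob_flow[OF der bd f])
    show "set_integrable sym_lborel RR (\<lambda>A. D' A (A ** A) + ?r1 * trace A * ?f A)"
      using ih1 h1 by (subst set_integrable_cong[OF refl refl, where f' = h1]) auto
  qed
  moreover have "(LINT A:RR|sym_lborel. D' A (A ** A) + ?r1 * trace A * ?f A) = (LINT A:RR|sym_lborel. h1 A)"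
    by (rule set_lebesgue_integral_cong) (use h1 borel_RR in auto)
  moreover have "(LINT A:RR|sym_lborel. h1 A) = (?q / 2 + ?r1) * trace ?M - 1 / (2 * v) * (LINT A:RR|sym_lborel. s A * ?f A) + (LINT A:RR|sym_lborel. Delta1_integrand v0 v \<pi>2 W A)"
    unfolding h1_def set_integral_lincomb(2)[OF fA'' fs D1] trM' ..
  ultimately have R1: "(?q / 2 + ?r1) * trace ?M - 1 / (2 * v) * (LINT A:RR|sym_lborel. s A * ?f A) + Delta1 v0 v \<pi>2 W / 4 = 0"
    by (simp add: Delta1_def)
  \<comment> \<open>Integration by parts along (\<Lambda> M + M \<Lambda>) / 2 with M held constant.
    The quadratic form in the exponent contributes \<open>t\<close>, which is linear in \<Lambda>
    and therefore integrates to \<open>t ?M\<close>, the squared norm of M W.\<close>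
  define h2 where "h2 A = ((?q / 2 + ?r1 / 2) * trace ?M) * ?f A - 1 / (2 * v) * (?f A * t A) + Delta2_integrand v0 v \<pi>2 W A" for A
  have h2: "D' A ((1/2) *\<^sub>R (?M ** A + A ** ?M)) + ?r1 / 2 * trace ?M * ?f A = h2 A" if "A \<in> RR" for A
  proof -
    have l: "linear (dd A)" using dd[of A] by (rule has_derivative_linear)
    have "dd A ((1/2) *\<^sub>R (?M ** A + A ** ?M)) = det A * trace ?M"
      unfolding linear_scale[OF l] linear_add[OF l] dd1[OF tM] dd2[OF tM] by simp
    moreover have "trace ((1/2) *\<^sub>R (?M ** A + A ** ?M) ** W ** transpose W) = t A"
    proof -
      have "(A ** ?M ** W) \<bullet> W = t A"
        unfolding t_def using inner_mult_symmetric[OF tA[OF that], of "?M ** W" W] inner_mult_symmetric[OF tM, of "A ** W" W]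
        by (simp add: matrix_mul_assoc[symmetric] inner_commute)
      thus ?thesis by (simp add: trace_mult_inner matrix_mult_scaleR_left matrix_mult_add_left tr_sc trace_add t_def)
    qed
    ultimately show ?thesis using e2[OF that] detnz[OF that]
      by (simp add: D'_def h2_def algebra_simps)
  qed
  have ih2: "set_integrable sym_lborel RR h2" unfolding h2_def
    by (rule set_integral_lincomb(1)[OF f ft' D2])
  have "(LINT A:RR|sym_lborel. D' A ((1/2) *\<^sub>R (?M ** A + A ** ?M)) + ?r1 / 2 * trace ?M * ?f A) = 0"
  proof (rule RR_congruence_flow[OF der bd f Mp])
    show "set_integrable sym_lborel RR (\<lambda>A. D' A ((1/2) *\<^sub>R (?M ** A + A ** ?M)) + ?r1 / 2 * trace ?M * ?f A)"
      using ih2 h2 by (subst set_integrable_cong[OF refl refl, where f' = h2]) auto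
  qed
  moreover have "(LINT A:RR|sym_lborel. D' A ((1/2) *\<^sub>R (?M ** A + A ** ?M)) + ?r1 / 2 * trace ?M * ?f A) = (LINT A:RR|sym_lborel. h2 A)"
    by (rule set_lebesgue_integral_cong) (use h2 borel_RR in auto)
  moreover have "(LINT A:RR|sym_lborel. h2 A) = ((?q / 2 + ?r1 / 2) * trace ?M) * ?m - 1 / (2 * v) * t ?M + (LINT A:RR|sym_lborel. Delta2_integrand v0 v \<pi>2 W A)"
    unfolding h2_def set_integral_lincomb(2)[OF f ft' D2] It' m_pi_def ..
  moreover have "(LINT A:RR|sym_lborel. Delta2_integrand v0 v \<pi>2 W A) = ?m / 2 * Delta2 v0 v \<pi>2 W"
    using m by (simp add: Delta2_def)
  ultimately have R2: "((?q / 2 + ?r1 / 2) * trace ?M) * ?m - 1 / (2 * v) * (norm (?M ** W))\<^sup>2 + ?m / 2 * Delta2 v0 v \<pi>2 W = 0"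
    by (simp add: tM')
  define a where "a = (LINT A:RR|sym_lborel. s A * ?f A)"
  define N where "N = (norm (?M ** W))\<^sup>2"
  have a: "a / v = (?q + 2 * ?r1) * trace ?M + Delta1 v0 v \<pi>2 W / 2"
    using R1 v unfolding a_def[symmetric] by (simp add: field_simps)
  have N: "N / v = (?q + ?r1) * trace ?M * ?m + ?m * Delta2 v0 v \<pi>2 W"
    using R2 v unfolding N_def[symmetric] by (simp add: field_simps)
  have "?m * (2 / v\<^sup>2 * a - 2 * ?q / v * trace ?M) - N / v\<^sup>2 = 1 / v * (?m * (2 * (a / v) - 2 * ?q * trace ?M) - N / v)"
    using v by (simp add: power2_eq_square field_simps)
  \<comment> \<open>Here the constant of \<open>Delta\<close> arises: with r1 = r + 1 the
    coefficient of tr M is 2 (q + 2 r1) - 2 q - (q + r1) = 3 r1 - q = - (q - 3 r - 3).\<close>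
  also have "?m * (2 * (a / v) - 2 * ?q * trace ?M) - N / v = ?m * Delta v0 v \<pi>2 W"
    unfolding a N Delta_def by (simp add: algebra_simps)
  also have "1 / v * (?m * Delta v0 v \<pi>2 W) \<le> 0"
    using v m D by (intro mult_nonneg_nonpos mult_nonneg_nonpos) auto
  finally show ?thesis by (simp add: a_def N_def s_def)
qed

section \<open>The marginal density given the hyperparameter\<close>

lemma nn_integral_lborel_reflect:
  fixes f :: "'a::euclidean_space \<Rightarrow> ennreal"
  assumes [measurable]: "f \<in> borel_measurable borel"
  shows "(\<integral>\<^sup>+ x. f (t - x) \<partial>lborel) = (\<integral>\<^sup>+ x. f x \<partial>lborel)"
proof -
  have "(lborel :: 'a measure) = distr lborel borel (\<lambda>x. t - x)"
    using lborel_affine[of "-1" t] by (simp add: density_1)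
  hence "(\<integral>\<^sup>+ x. f x \<partial>lborel) = (\<integral>\<^sup>+ x. f x \<partial>distr lborel borel (\<lambda>x. t - x))" by simp
  also have "\<dots> = (\<integral>\<^sup>+ x. f (t - x) \<partial>lborel)" by (rule nn_integral_distr) auto
  finally show ?thesis by simp
qed

text \<open>Two translation-invariant measures are proportional: integrate \<open>1\<^sub>B(T x) 1\<^sub>C(y + T x)\<close> in both orders.\<close>

lemma emeasure_lborel_isometry:
  fixes T S :: "'a::euclidean_space \<Rightarrow> 'a"
  assumes lin: "linear T" and iso: "\<And>x. norm (T x) = norm x" and TS: "\<And>y. T (S y) = y" and B: "B \<in> sets borel"
  shows "emeasure lborel (T -` B) = emeasure lborel B"
proof -
  \<comment> \<open>The unit ball is preserved by the isometry and has finite nonzero measure, so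
    its measure can be cancelled at the end.\<close>
  define C where "C = ball (0::'a) 1"
  have [measurable]: "C \<in> sets borel" by (simp add: C_def)
  have [measurable]: "T \<in> borel \<rightarrow>\<^sub>M borel"
    by (intro borel_measurable_continuous_onI linear_continuous_on) (simp add: lin linear_conv_bounded_linear[symmetric])
  note B [measurable]
  have TC: "T -` C = C" by (auto simp: iso C_def)
  have TB: "T -` B \<in> sets borel" using measurable_sets[of T borel borel B] by simp
  let ?h = "\<lambda>x y. indicator B (T x) * indicator C (y + T x) :: ennreal"
  have "(\<integral>\<^sup>+ x. (\<integral>\<^sup>+ y. ?h x y \<partial>lborel) \<partial>lborel) = (\<integral>\<^sup>+ x. indicator B (T x) * emeasure lborel C \<partial>lborel)"
  proof (rule nn_integral_cong)
    fix x
    have "(\<integral>\<^sup>+ y. ?h x y \<partial>lborel) = indicator B (T x) * (\<integral>\<^sup>+ y. indicator C (T x + y) \<partial>lborel)"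
      unfolding add.commute[of _ "T x"] by (rule nn_integral_cmult) measurable
    also have "(\<integral>\<^sup>+ y. indicator C (T x + y) \<partial>lborel) = emeasure lborel C"
      by (subst nn_integral_lborel_shift) simp_all
    finally show "(\<integral>\<^sup>+ y. ?h x y \<partial>lborel) = indicator B (T x) * emeasure lborel C" .
  qed
  also have "\<dots> = emeasure lborel (T -` B) * emeasure lborel C"
  proof -
    have eq: "indicator B (T x) = (indicator (T -` B) x :: ennreal)" for x by (simp only: indicator_def vimage_eq)
    have "(\<integral>\<^sup>+ x. indicator (T -` B) x * emeasure lborel C \<partial>lborel) = (\<integral>\<^sup>+ x. indicator (T -` B) x \<partial>lborel) * emeasure lborel C"
      by (rule nn_integral_multc) (use TB in simp)
    also have "\<dots> = emeasure lborel (T -` B) * emeasure lborel C" using TB by (subst nn_integral_indicator) simp_all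
    finally show ?thesis unfolding eq .
  qed
  finally have 1: "(\<integral>\<^sup>+ x. (\<integral>\<^sup>+ y. ?h x y \<partial>lborel) \<partial>lborel) = emeasure lborel (T -` B) * emeasure lborel C" .
  have "(\<integral>\<^sup>+ x. (\<integral>\<^sup>+ y. ?h x y \<partial>lborel) \<partial>lborel) = (\<integral>\<^sup>+ y. (\<integral>\<^sup>+ x. ?h x y \<partial>lborel) \<partial>lborel)"
    by (rule lborel_pair.Fubini'[symmetric]) measurable
  also have "\<dots> = (\<integral>\<^sup>+ y. (\<integral>\<^sup>+ x. indicator C (T x) * indicator B (T x - y) \<partial>lborel) \<partial>lborel)"
  proof (rule nn_integral_cong)
    fix y
    have "(\<integral>\<^sup>+ x. ?h x y \<partial>lborel) = (\<integral>\<^sup>+ x. ?h (S (- y) + x) y \<partial>lborel)"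
      by (rule nn_integral_lborel_shift[symmetric]) measurable
    also have "\<dots> = (\<integral>\<^sup>+ x. indicator C (T x) * indicator B (T x - y) \<partial>lborel)"
      by (intro nn_integral_cong) (simp add: linear_add[OF lin] TS mult.commute)
    finally show "(\<integral>\<^sup>+ x. ?h x y \<partial>lborel) = (\<integral>\<^sup>+ x. indicator C (T x) * indicator B (T x - y) \<partial>lborel)" .
  qed
  also have "\<dots> = (\<integral>\<^sup>+ x. (\<integral>\<^sup>+ y. indicator C (T x) * indicator B (T x - y) \<partial>lborel) \<partial>lborel)"
    by (rule lborel_pair.Fubini') measurable
  also have "\<dots> = (\<integral>\<^sup>+ x. indicator C (T x) * emeasure lborel B \<partial>lborel)"
  proof (rule nn_integral_cong)
    fix x
    have "(\<integral>\<^sup>+ y. indicator C (T x) * indicator B (T x - y) \<partial>lborel) = indicator C (T x) * (\<integral>\<^sup>+ y. indicator B (T x - y) \<partial>lborel)"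
      by (rule nn_integral_cmult) measurable
    also have "(\<integral>\<^sup>+ y. indicator B (T x - y) \<partial>lborel) = emeasure lborel B"
      by (subst nn_integral_lborel_reflect) simp_all
    finally show "(\<integral>\<^sup>+ y. indicator C (T x) * indicator B (T x - y) \<partial>lborel) = indicator C (T x) * emeasure lborel B" .
  qed
  also have "\<dots> = emeasure lborel C * emeasure lborel B"
  proof -
    have eq: "indicator C (T x) = (indicator C x :: ennreal)" for x by (simp add: indicator_def iso C_def)
    have "(\<integral>\<^sup>+ x. indicator C x * emeasure lborel B \<partial>lborel) = (\<integral>\<^sup>+ x. indicator C x \<partial>lborel) * emeasure lborel B"
      by (rule nn_integral_multc) simp
    thus ?thesis unfolding eq by (simp add: C_def[symmetric])
  qed
  finally have 2: "emeasure lborel (T -` B) * emeasure lborel C = emeasure lborel B * emeasure lborel C"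
    using 1 by (simp add: mult.commute)
  have fin: "emeasure lborel C < \<infinity>" by (rule emeasure_bounded_finite) (simp add: C_def)
  have pos: "emeasure lborel C \<noteq> 0"
    using open_not_negligible[of C] by (simp add: negligible_iff_emeasure0 C_def)
  have "emeasure lborel (T -` B) = emeasure lborel (T -` B) * emeasure lborel C / emeasure lborel C"
    by (rule mult_divide_eq_ennreal[symmetric]) (use fin pos in auto)
  also have "\<dots> = emeasure lborel B * emeasure lborel C / emeasure lborel C" by (simp only: 2)
  also have "\<dots> = emeasure lborel B"
    by (rule mult_divide_eq_ennreal) (use fin pos in auto)
  finally show ?thesis .
qed

lemma norm_orthogonal_mult:
  fixes X :: "real^'q^'r"
  assumes U: "orthogonal_matrix U" shows "norm (U ** X) = norm X"
proof -
  have "(U ** X) \<bullet> (U ** X) = X \<bullet> X"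
    unfolding inner_matrix_eq_trace using U
    by (simp add: matrix_transpose_mul matrix_mul_assoc[symmetric]) (simp add: matrix_mul_assoc orthogonal_matrix_def)
  thus ?thesis by (simp add: norm_eq_sqrt_inner)
qed

lemma nn_integral_orthogonal:
  fixes g :: "real^'q^'r \<Rightarrow> ennreal"
  assumes U: "orthogonal_matrix U" and g [measurable]: "g \<in> borel_measurable borel"
  shows "(\<integral>\<^sup>+ X. g (U ** X) \<partial>lborel) = (\<integral>\<^sup>+ X. g X \<partial>lborel)"
proof -
  let ?T = "\<lambda>X :: real^'q^'r. U ** X" and ?S = "\<lambda>X :: real^'q^'r. transpose U ** X"
  have lin: "linear ?T" by (rule bounded_linear.linear[OF bounded_bilinear.bounded_linear_right[OF bounded_bilinear_matrix_mult]])
  have iso: "norm (?T X) = norm X" for X by (rule norm_orthogonal_mult[OF U])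
  have TS: "?T (?S X) = X" for X using U by (simp add: matrix_mul_assoc orthogonal_matrix_def)
  have m [measurable]: "?T \<in> borel \<rightarrow>\<^sub>M borel"
    by (intro borel_measurable_continuous_onI linear_continuous_on) (simp add: lin linear_conv_bounded_linear[symmetric])
  have "distr lborel borel ?T = (lborel :: (real^'q^'r) measure)"
  proof (rule measure_eqI)
    fix B assume "B \<in> sets (distr lborel borel ?T)"
    hence B: "B \<in> sets borel" by simp
    show "emeasure (distr lborel borel ?T) B = emeasure lborel B"
      using emeasure_lborel_isometry[OF lin iso TS B] B by (simp add: emeasure_distr)
  qed simp
  moreover have "(\<integral>\<^sup>+ X. g X \<partial>distr lborel borel ?T) = (\<integral>\<^sup>+ X. g (U ** X) \<partial>lborel)" by (rule nn_integral_distr) measurable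
  ultimately show ?thesis by simp
qed

text \<open>In the rotated matrices the bilinear form decouples into the rows, each weighted with
  its eigenvalue.\<close>

lemma inner_spmat_mult:
  fixes X Z :: "real^'q^'r"
  shows "(spmat U d ** X) \<bullet> Z = (\<Sum>k\<in>UNIV. d k * ((transpose U ** X) $ k \<bullet> (transpose U ** Z) $ k))"
proof -
  let ?Y = "transpose U ** X" and ?V = "transpose U ** Z" and ?D = "(\<chi> i j. if i = j then d i else 0) :: real^'r^'r"
  have "(spmat U d ** X) \<bullet> Z = Z \<bullet> (spmat U d ** X)" by (rule inner_commute)
  also have "\<dots> = trace (transpose Z ** (spmat U d ** X))" by (rule inner_matrix_eq_trace)
  also have "\<dots> = trace (transpose ?V ** (?D ** ?Y))"
    by (simp only: spmat_def matrix_transpose_mul transpose_transpose matrix_mul_assoc)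
  also have "\<dots> = ?V \<bullet> (?D ** ?Y)" by (simp only: inner_matrix_eq_trace)
  also have "\<dots> = (\<Sum>k\<in>UNIV. ?V $ k \<bullet> (?D ** ?Y) $ k)" by (simp only: inner_vec_def[of ?V])
  also have "\<dots> = (\<Sum>k\<in>UNIV. d k * (?Y $ k \<bullet> ?V $ k))"
  proof (rule sum.cong[OF refl])
    fix k
    have "(?D ** ?Y) $ k = d k *\<^sub>R (?Y $ k)" by (simp add: vec_eq_iff diag_mult_nth)
    thus "?V $ k \<bullet> (?D ** ?Y) $ k = d k * (?Y $ k \<bullet> ?V $ k)" by (simp add: inner_commute)
  qed
  finally show ?thesis .
qed

lemma spmat_gram:
  fixes X :: "real^'q^'r"
  shows "(spmat U d ** X) \<bullet> X = (\<Sum>k\<in>UNIV. d k * (norm ((transpose U ** X) $ k))\<^sup>2)"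
  by (simp only: inner_spmat_mult power2_norm_eq_inner)

lemma prod_Basis_matrix: "(\<Prod>b\<in>(Basis :: (real^'q^'r) set). G b) = (\<Prod>i\<in>UNIV. \<Prod>j\<in>UNIV. G (axis i (axis j 1)))"
proof -
  have bij: "bij_betw (\<lambda>(i, j). axis i (axis j 1)) (UNIV \<times> UNIV) (Basis :: (real^'q^'r) set)"
    by (auto simp: bij_betw_def inj_on_def Basis_vec_def axis_eq_axis image_iff)
  show ?thesis
    by (subst prod.reindex_bij_betw[OF bij, symmetric]) (simp add: prod.cartesian_product split_beta')
qed

text \<open>Joint density of independent entries whose variance in row i is s i. The right-hand
  side, with its power of a determinant and its quadratic form, is the shape in which
  \<open>phi\<close> and \<open>prior1\<close> are given.\<close>

lemma prod_normal_density_rows: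
  fixes X :: "real^'q^'r" and s :: "'r \<Rightarrow> real"
  assumes s: "\<And>i. 0 < s i"
  shows "(\<Prod>i\<in>UNIV. \<Prod>j\<in>UNIV. normal_density 0 (sqrt (s i)) (X $ i $ j)) =
    (2 * pi) powr (- (real (CARD('q) * CARD('r)) / 2)) * (\<Prod>i\<in>UNIV. 1 / s i) powr (real CARD('q) / 2) * exp (- (\<Sum>i\<in>UNIV. (1 / s i) * (norm (X $ i))\<^sup>2) / 2)"
proof -
  let ?n = "CARD('q)"
  have row: "(\<Prod>j\<in>UNIV. normal_density 0 (sqrt (s i)) (X $ i $ j)) = (2 * pi) powr (- (real ?n / 2)) * (1 / s i) powr (real ?n / 2) * exp (- ((1 / s i) * (norm (X $ i))\<^sup>2) / 2)" for i
  proof -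
    have "(\<Prod>j\<in>(UNIV::'q set). normal_density 0 (sqrt (s i)) (X $ i $ j)) = (1 / sqrt (2 * pi * s i)) ^ ?n * exp (\<Sum>j\<in>UNIV. - (X $ i $ j)\<^sup>2 / (2 * s i))"
      using s[of i] by (simp add: normal_density_def prod_dividef exp_sum less_imp_le power_divide)
    also have "(\<Sum>j\<in>UNIV. - (X $ i $ j)\<^sup>2 / (2 * s i)) = - ((1 / s i) * (norm (X $ i))\<^sup>2) / 2"
    proof -
      have "(norm (X $ i))\<^sup>2 = (\<Sum>j\<in>UNIV. (X $ i $ j)\<^sup>2)"
        unfolding power2_norm_eq_inner inner_vec_def by (simp add: power2_eq_square)
      thus ?thesis by (simp add: sum_divide_distrib sum_negf sum_distrib_left mult.commute)
    qed
    also have "(1 / sqrt (2 * pi * s i)) ^ ?n = (2 * pi) powr (- (real ?n / 2)) * (1 / s i) powr (real ?n / 2)"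
    proof -
      have p: "0 < 1 / sqrt (2 * pi * s i)" using s[of i] by simp
      have e: "1 / sqrt (2 * pi * s i) = (2 * pi) powr (- (1 / 2)) * (1 / s i) powr (1 / 2)"
      proof -
        have "(2 * pi) powr (- (1 / 2)) = 1 / sqrt (2 * pi)" by (simp only: powr_minus_divide powr_half_sqrt pi_ge_zero mult_nonneg_nonneg zero_le_numeral)
        moreover have "(1 / s i) powr (1 / 2) = 1 / sqrt (s i)" using s[of i] by (simp add: powr_half_sqrt real_sqrt_divide)
        ultimately show ?thesis by (simp add: real_sqrt_mult)
      qed
      have "(1 / sqrt (2 * pi * s i)) ^ ?n = (1 / sqrt (2 * pi * s i)) powr (real ?n)" by (rule powr_realpow[OF p, symmetric])
      also have "\<dots> = ((2 * pi) powr (- (1 / 2))) powr (real ?n) * ((1 / s i) powr (1 / 2)) powr (real ?n)" unfolding e by (rule powr_mult)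
      also have "\<dots> = (2 * pi) powr (- (real ?n / 2)) * (1 / s i) powr (real ?n / 2)" by (simp only: powr_powr times_divide_eq_left mult_minus_left mult_1_left)
      finally show ?thesis .
    qed
    finally show ?thesis .
  qed
  have "(\<Prod>i\<in>(UNIV::'r set). (2 * pi) powr (- (real ?n / 2))) = (2 * pi) powr (- (real (CARD('q) * CARD('r)) / 2))"
  proof -
    have "(\<Prod>i\<in>(UNIV::'r set). (2 * pi) powr (- (real ?n / 2))) = ((2 * pi) powr (- (real ?n / 2))) powr (real CARD('r))"
      by (subst powr_realpow) simp_all
    thus ?thesis by (simp add: powr_powr)
  qed
  moreover have "(\<Prod>i\<in>UNIV. (1 / s i) powr (real ?n / 2)) = (\<Prod>i\<in>UNIV. 1 / s i) powr (real ?n / 2)"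
    by (rule prod_powr_distrib[symmetric])
  moreover have "(\<Prod>i\<in>UNIV. exp (- ((1 / s i) * (norm (X $ i))\<^sup>2) / 2)) = exp (- (\<Sum>i\<in>UNIV. (1 / s i) * (norm (X $ i))\<^sup>2) / 2)"
    by (simp add: exp_sum[symmetric] sum_divide_distrib sum_negf)
  ultimately show ?thesis unfolding row prod.distrib by simp
qed

lemma nn_integral_normal_conv:
  assumes "0 < v" "0 < a"
  shows "(\<integral>\<^sup>+ x. ennreal (normal_density w (sqrt v) x * normal_density 0 (sqrt a) x) \<partial>lborel) = ennreal (normal_density 0 (sqrt (v + a)) w)"
proof -
  have "normal_density w (sqrt v) x = normal_density 0 (sqrt v) (w - x)" for x
    by (simp add: normal_density_def power2_commute)
  thus ?thesis using fun_cong[OF conv_normal_density_zero_mean[of "sqrt v" "sqrt a"], of w] assms by simp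
qed

text \<open>Given \<open>\<Omega>\<close>, the columns of \<open>\<Theta>\<close> have covariance \<open>v0 (\<Omega>\<^sup>-\<^sup>1 - I)\<close>, so those of \<open>W\<close> have covariance
  \<open>v I + v0 (\<Omega>\<^sup>-\<^sup>1 - I)\<close>, whose inverse is \<open>prec v0 v \<Omega>\<close>; \<open>phi\<close> is the corresponding normal density.\<close>

definition prec :: "real \<Rightarrow> real \<Rightarrow> real^'r^'r \<Rightarrow> real^'r^'r" where
  "prec v0 v \<Omega> = mob v0 (v - v0) \<Omega>"

definition phi :: "real \<Rightarrow> real \<Rightarrow> real^'q^'r \<Rightarrow> real^'r^'r \<Rightarrow> real" where
  "phi v0 v W \<Omega> = (2 * pi) powr (- (real (CARD('q) * CARD('r)) / 2)) * det (prec v0 v \<Omega>) powr (real CARD('q) / 2) * exp (- ((prec v0 v \<Omega> ** W) \<bullet> W) / 2)"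

text \<open>If d are the eigenvalues of \<Omega>, then a = v0 (1 - d) / d are those of the
  covariance v0 (\<Omega>^(-1) - I) of the columns of \<Theta>. The same \<open>U\<close> and
  \<open>a\<close> serve all variances v, which makes \<open>prec\<close> explicit as a function of
  v.\<close>

lemma RR_prec_obtain:
  fixes \<Omega> :: "real^'r^'r"
  assumes O: "\<Omega> \<in> RR" and v0: "0 < v0"
  obtains U a where "orthogonal_matrix U" "\<And>i. 0 < a i" "\<And>v. 0 < v \<Longrightarrow> prec v0 v \<Omega> = spmat U (\<lambda>i. 1 / (v + a i))"
    "\<Omega> ** matrix_inv (mat 1 - \<Omega>) = spmat U (\<lambda>i. v0 / a i)"
proof -
  obtain U d where U: "orthogonal_matrix U" and Od: "\<Omega> = spmat U d" and d: "\<And>i. 0 < d i" "\<And>i. d i < 1" using RR_obtain[OF O] by metis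
  define a where "a i = v0 * (1 - d i) / d i" for i
  have d1: "1 - d i \<noteq> 0" "d i \<noteq> 0" for i using d[of i] by auto
  have a: "0 < a i" for i unfolding a_def using v0 d[of i] by (intro divide_pos_pos mult_pos_pos) auto
  have P: "prec v0 v \<Omega> = spmat U (\<lambda>i. 1 / (v + a i))" if v: "0 < v" for v
  proof -
    have e: "v0 + (v - v0) * d i = d i * (v + a i)" for i using d1[of i] by (simp add: a_def field_simps)
    have "0 < d i * (v + a i)" for i using d[of i] a[of i] v by simp
    hence nz: "v0 + (v - v0) * d i \<noteq> 0" for i unfolding e by (metis less_irrefl)
    have "d i / (v0 + (v - v0) * d i) = 1 / (v + a i)" for i unfolding e using d1[of i] by simp
    thus ?thesis unfolding prec_def Od mob_spmat[OF U nz] by simp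
  qed
  have K: "\<Omega> ** matrix_inv (mat 1 - \<Omega>) = spmat U (\<lambda>i. v0 / a i)"
  proof -
    have "mat 1 - \<Omega> = spmat U (\<lambda>i. 1 - d i)" by (simp add: Od spmat_1[OF U] spmat_diff)
    hence "\<Omega> ** matrix_inv (mat 1 - \<Omega>) = spmat U (\<lambda>i. d i * (1 / (1 - d i)))"
      using matrix_inv_spmat[OF U d1(1)] by (simp add: Od spmat_mult[OF U])
    moreover have "d i * (1 / (1 - d i)) = v0 / a i" for i using d1[of i] v0 by (simp add: a_def)
    ultimately show ?thesis by simp
  qed
  show ?thesis by (rule that[OF U a P K])
qed

lemma phi_spectral:
  fixes W :: "real^'q^'r"
  assumes U: "orthogonal_matrix U" and p: "prec v0 v \<Omega> = spmat U (\<lambda>i. 1 / s i)" and s: "\<And>i. 0 < s i"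
  shows "phi v0 v W \<Omega> = (\<Prod>i\<in>UNIV. \<Prod>j\<in>UNIV. normal_density 0 (sqrt (s i)) ((transpose U ** W) $ i $ j))"
  unfolding prod_normal_density_rows[OF s] phi_def p det_spmat[OF U] spmat_gram ..

lemma prior1_spectral:
  fixes \<Theta> :: "real^'q^'r"
  assumes U: "orthogonal_matrix U" and k: "\<Omega> ** matrix_inv (mat 1 - \<Omega>) = spmat U (\<lambda>i. v0 / a i)" and a: "\<And>i. 0 < a i" and v0: "0 < v0"
  shows "prior1 v0 \<Omega> \<Theta> = (\<Prod>i\<in>UNIV. \<Prod>j\<in>UNIV. normal_density 0 (sqrt (a i)) ((transpose U ** \<Theta>) $ i $ j))"
proof -
  let ?k = "real (CARD('q) * CARD('r)) / 2"
  have 1: "(\<Prod>i\<in>UNIV. v0 / a i) powr (real CARD('q) / 2) = v0 powr ?k * (\<Prod>i\<in>UNIV. 1 / a i) powr (real CARD('q) / 2)"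
  proof -
    have "(\<Prod>i\<in>(UNIV::'r set). v0 / a i) = v0 ^ CARD('r) * (\<Prod>i\<in>UNIV. 1 / a i)"
      by (simp add: prod_dividef)
    moreover have "(v0 ^ CARD('r)) powr (real CARD('q) / 2) = v0 powr ?k"
      using v0 by (simp add: powr_realpow[symmetric] powr_powr mult.commute)
    moreover have "0 \<le> (\<Prod>i\<in>(UNIV::'r set). 1 / a i)" by (intro prod_nonneg) (simp add: a less_imp_le)
    ultimately show ?thesis using v0 by (simp add: powr_mult)
  qed
  have 2: "(2 * pi * v0) powr (- ?k) * v0 powr ?k = (2 * pi) powr (- ?k)"
  proof -
    have "(2 * pi * v0) powr (- ?k) = (2 * pi) powr (- ?k) * v0 powr (- ?k)" using v0 by (simp add: powr_mult)
    moreover have "v0 powr (- ?k) * v0 powr ?k = 1" using v0 by (simp add: powr_add[symmetric])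
    ultimately show ?thesis by simp
  qed
  have 3: "- trace (spmat U (\<lambda>i. v0 / a i) ** \<Theta> ** transpose \<Theta>) / (2 * v0) = - (\<Sum>i\<in>UNIV. (1 / a i) * (norm ((transpose U ** \<Theta>) $ i))\<^sup>2) / 2"
    unfolding trace_mult_inner spmat_gram using v0 by (simp add: sum_divide_distrib sum_negf[symmetric])
  have "prior1 v0 \<Omega> \<Theta> = ((2 * pi * v0) powr (- ?k) * v0 powr ?k) * (\<Prod>i\<in>UNIV. 1 / a i) powr (real CARD('q) / 2) * exp (- (\<Sum>i\<in>UNIV. (1 / a i) * (norm ((transpose U ** \<Theta>) $ i))\<^sup>2) / 2)"
    unfolding prior1_def k det_spmat[OF U] 1 3 by simp
  thus ?thesis unfolding 2 prod_normal_density_rows[OF a] .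
qed

text \<open>After rotation by \<open>U\<close> prior and likelihood are products over the entries,
  and each entry integrates as a convolution of two centred normal densities, with variances v and a
  i.\<close>

lemma nn_integral_prior1:
  fixes W :: "real^'q^'r"
  assumes O: "\<Omega> \<in> RR" and v0: "0 < v0" and v: "0 < v"
  shows "(\<integral>\<^sup>+ \<Theta>. ennreal (matnormal v \<Theta> W * prior1 v0 \<Omega> \<Theta>) \<partial>lborel) = ennreal (phi v0 v W \<Omega>)"
proof -
  obtain U a where U: "orthogonal_matrix U" and a: "\<And>i. 0 < a i" and p: "\<And>v. 0 < v \<Longrightarrow> prec v0 v \<Omega> = spmat U (\<lambda>i. 1 / (v + a i))"
    and k: "\<Omega> ** matrix_inv (mat 1 - \<Omega>) = spmat U (\<lambda>i. v0 / a i)" by (rule RR_prec_obtain[OF O v0]) blast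
  \<comment> \<open>The product formula for integrals runs over basis elements, so the row variance
    has to be read off from a basis element; at the element for the entry (i, j) this gives
    \<open>a i\<close>.\<close>
  define a' where "a' b = (\<Sum>i\<in>UNIV. a i * (b $ i \<bullet> b $ i))" for b :: "real^'q^'r"
  have a'b: "a' (axis i (axis j 1)) = a i" for i j
  proof -
    have "a k * ((axis i (axis j 1) :: real^'q^'r) $ k \<bullet> (axis i (axis j 1) :: real^'q^'r) $ k) = (if k = i then a k else 0)" for k
      by (simp add: axis_def[of i] inner_axis_axis)
    thus ?thesis by (simp add: a'_def)
  qed
  have a'pos: "0 < a' b" if "b \<in> Basis" for b using that a'b a by (auto simp: Basis_vec_def)
  let ?W = "transpose U ** W"
  have Xb: "X \<bullet> axis i (axis j 1) = X $ i $ j" for X :: "real^'q^'r" and i j by (simp add: inner_axis)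
  have UU: "transpose U ** (U ** X) = X" for X :: "real^'q^'r" using U by (simp add: matrix_mul_assoc orthogonal_matrix_def)
  have UW: "U ** ?W = W" using U by (simp add: matrix_mul_assoc orthogonal_matrix_def)
  have pm: "(\<lambda>\<Theta> :: real^'q^'r. prior1 v0 \<Omega> \<Theta>) \<in> borel_measurable borel" unfolding prior1_def k trace_mult_inner
    by (rule borel_measurable_continuous_onI)
      (intro continuous_on_mult continuous_on_const continuous_on_exp continuous_on_divide continuous_on_minus
        continuous_on_inner continuous_on_id bounded_bilinear.continuous_on[OF bounded_bilinear_matrix_mult], use v0 in simp)
  have "(\<integral>\<^sup>+ \<Theta>. ennreal (matnormal v \<Theta> W * prior1 v0 \<Omega> \<Theta>) \<partial>lborel) = (\<integral>\<^sup>+ X. ennreal (matnormal v (U ** X) W * prior1 v0 \<Omega> (U ** X)) \<partial>lborel)"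
    by (rule nn_integral_orthogonal[OF U, symmetric]) (use pm in simp)
  also have "\<dots> = (\<integral>\<^sup>+ X. (\<Prod>b\<in>Basis. ennreal (normal_density (?W \<bullet> b) (sqrt v) (X \<bullet> b) * normal_density 0 (sqrt (a' b)) (X \<bullet> b))) \<partial>lborel)"
  proof (intro nn_integral_cong)
    fix X :: "real^'q^'r"
    have "W - U ** X = U ** (?W - X)" by (simp add: matrix_mult_diff_right UW)
    hence "norm (W - U ** X) = norm (?W - X)" by (simp add: norm_orthogonal_mult[OF U])
    hence "matnormal v (U ** X) W = matnormal v X ?W" by (simp add: matnormal_def)
    also have "\<dots> = matnormal v ?W X" by (rule matnormal_commute)
    also have "\<dots> = (\<Prod>b\<in>Basis. normal_density (?W \<bullet> b) (sqrt v) (X \<bullet> b))" by (rule matnormal_eq_prod[OF v])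
    finally have 1: "matnormal v (U ** X) W = (\<Prod>b\<in>Basis. normal_density (?W \<bullet> b) (sqrt v) (X \<bullet> b))" .
    have 2: "prior1 v0 \<Omega> (U ** X) = (\<Prod>b\<in>Basis. normal_density 0 (sqrt (a' b)) (X \<bullet> b))"
      unfolding prior1_spectral[OF U k a v0] UU prod_Basis_matrix a'b Xb ..
    show "ennreal (matnormal v (U ** X) W * prior1 v0 \<Omega> (U ** X)) = (\<Prod>b\<in>Basis. ennreal (normal_density (?W \<bullet> b) (sqrt v) (X \<bullet> b) * normal_density 0 (sqrt (a' b)) (X \<bullet> b)))"
      unfolding 1 2 prod.distrib[symmetric] by (rule prod_ennreal[symmetric]) simp
  qed
  also have "\<dots> = (\<Prod>b\<in>Basis. (\<integral>\<^sup>+ x. ennreal (normal_density (?W \<bullet> b) (sqrt v) x * normal_density 0 (sqrt (a' b)) x) \<partial>lborel))"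
    by (rule nn_integral_lborel_prod) auto
  also have "\<dots> = (\<Prod>b\<in>Basis. ennreal (normal_density 0 (sqrt (v + a' b)) (?W \<bullet> b)))"
    by (intro prod.cong refl nn_integral_normal_conv v a'pos)
  also have "\<dots> = ennreal (\<Prod>b\<in>Basis. normal_density 0 (sqrt (v + a' b)) (?W \<bullet> b))" by (rule prod_ennreal) simp
  also have "(\<Prod>b\<in>Basis. normal_density 0 (sqrt (v + a' b)) (?W \<bullet> b)) = phi v0 v W \<Omega>"
    using phi_spectral[OF U p[OF v], of W] a v by (simp add: prod_Basis_matrix a'b Xb add_pos_pos)
  finally show ?thesis .
qed

lemma orthogonal_transpose: "orthogonal_matrix U \<Longrightarrow> orthogonal_matrix (transpose U)"
  by (simp add: orthogonal_matrix_def)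

lemma norm_matrix_rows: "(norm (X :: real^'q^'r))\<^sup>2 = (\<Sum>k\<in>UNIV. (norm (X $ k))\<^sup>2)"
proof -
  have "(norm X)\<^sup>2 = X \<bullet> X" by (rule power2_norm_eq_inner)
  also have "\<dots> = (\<Sum>k\<in>UNIV. (X $ k) \<bullet> (X $ k))" by (rule inner_vec_def)
  finally show ?thesis by (simp only: power2_norm_eq_inner)
qed

lemma norm_spmat_mult:
  fixes X :: "real^'q^'r"
  assumes U: "orthogonal_matrix U"
  shows "(norm (spmat U d ** X))\<^sup>2 = (\<Sum>k\<in>UNIV. (d k)\<^sup>2 * (norm ((transpose U ** X) $ k))\<^sup>2)"
proof -
  have "(norm (spmat U d ** X))\<^sup>2 = (spmat U d ** X) \<bullet> (spmat U d ** X)" by (rule power2_norm_eq_inner)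
  also have "\<dots> = (spmat U d ** (spmat U d ** X)) \<bullet> X"
    by (simp only: inner_matrix_eq_trace matrix_transpose_mul transpose_spmat matrix_mul_assoc)
  also have "\<dots> = (spmat U (\<lambda>k. (d k)\<^sup>2) ** X) \<bullet> X"
    by (simp only: matrix_mul_assoc spmat_mult[OF U] power2_eq_square)
  also have "\<dots> = (\<Sum>k\<in>UNIV. (d k)\<^sup>2 * (norm ((transpose U ** X) $ k))\<^sup>2)" by (rule spmat_gram)
  finally show ?thesis .
qed

section \<open>Bounds and derivatives of the conditional density \<open>phi\<close>\<close>

context
  fixes v0 v :: real and \<Omega> :: "real^'r^'r"
  assumes v0: "0 < v0" and v: "0 < v" and O: "\<Omega> \<in> RR"
begin

lemma norm_prec_mult: "norm (prec v0 v \<Omega> ** (X :: real^'q^'r)) \<le> norm X / v"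
proof -
  obtain U a where U: "orthogonal_matrix U" and a: "\<And>i. 0 < a i" and p: "\<And>v. 0 < v \<Longrightarrow> prec v0 v \<Omega> = spmat U (\<lambda>i. 1 / (v + a i))"
    by (rule RR_prec_obtain[OF O v0]) blast
  have "(norm (prec v0 v \<Omega> ** X))\<^sup>2 = (\<Sum>k\<in>UNIV. (1 / (v + a k))\<^sup>2 * (norm ((transpose U ** X) $ k))\<^sup>2)"
    unfolding p[OF v] by (rule norm_spmat_mult[OF U])
  also have "\<dots> \<le> (\<Sum>k\<in>UNIV. (1 / v)\<^sup>2 * (norm ((transpose U ** X) $ k))\<^sup>2)"
  proof (intro sum_mono mult_right_mono power_mono)
    fix k show "1 / (v + a k) \<le> 1 / v" using a[of k] v by (intro divide_left_mono) auto
    show "0 \<le> 1 / (v + a k)" using a[of k] v by simp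
  qed simp
  also have "\<dots> = (1 / v)\<^sup>2 * (norm (transpose U ** X))\<^sup>2" by (simp only: norm_matrix_rows sum_distrib_left)
  also have "\<dots> = (norm X / v)\<^sup>2"
    by (simp only: norm_orthogonal_mult[OF orthogonal_transpose[OF U]] power_divide times_divide_eq_left power_one mult_1_left)
  finally show ?thesis by (rule power2_le_imp_le) (use v in simp)
qed

lemma inner_prec_mult_le: "\<bar>(prec v0 v \<Omega> ** (X :: real^'q^'r)) \<bullet> Z\<bar> \<le> norm X * norm Z / v"
proof -
  have "\<bar>(prec v0 v \<Omega> ** X) \<bullet> Z\<bar> \<le> norm (prec v0 v \<Omega> ** X) * norm Z" by (rule Cauchy_Schwarz_ineq2)
  also have "\<dots> \<le> norm X / v * norm Z" by (rule mult_right_mono[OF norm_prec_mult]) simp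
  finally show ?thesis by simp
qed

lemma inner_prec_commute: "(prec v0 v \<Omega> ** (X :: real^'q^'r)) \<bullet> Z = (prec v0 v \<Omega> ** Z) \<bullet> X"
proof -
  obtain U a where U: "orthogonal_matrix U" and a: "\<And>i. 0 < a i" and p: "\<And>v. 0 < v \<Longrightarrow> prec v0 v \<Omega> = spmat U (\<lambda>i. 1 / (v + a i))"
    by (rule RR_prec_obtain[OF O v0]) blast
  show ?thesis unfolding p[OF v] inner_spmat_mult by (simp only: inner_commute)
qed

lemma inner_prec_nonneg: "0 \<le> (prec v0 v \<Omega> ** (X :: real^'q^'r)) \<bullet> X"
proof -
  obtain U a where U: "orthogonal_matrix U" and a: "\<And>i. 0 < a i" and p: "\<And>v. 0 < v \<Longrightarrow> prec v0 v \<Omega> = spmat U (\<lambda>i. 1 / (v + a i))"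
    by (rule RR_prec_obtain[OF O v0]) blast
  have "0 \<le> 1 / (v + a k)" for k using a[of k] v by simp
  thus ?thesis unfolding p[OF v] spmat_gram by (intro sum_nonneg mult_nonneg_nonneg) auto
qed

lemma norm_prec_le: "norm (prec v0 v \<Omega>) \<le> real CARD('r) / v"
proof -
  obtain U a where U: "orthogonal_matrix U" and a: "\<And>i. 0 < a i" and p: "\<And>v. 0 < v \<Longrightarrow> prec v0 v \<Omega> = spmat U (\<lambda>i. 1 / (v + a i))"
    by (rule RR_prec_obtain[OF O v0]) blast
  have "\<bar>1 / (v + a i)\<bar> \<le> 1 / v" for i
  proof -
    have "0 \<le> 1 / (v + a i)" using a[of i] v by simp
    moreover have "1 / (v + a i) \<le> 1 / v" using a[of i] v by (intro divide_left_mono) auto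
    ultimately show ?thesis by simp
  qed
  from norm_spmat_le[OF U this] show ?thesis unfolding p[OF v] by simp
qed

lemma det_prec_pos: "0 < det (prec v0 v \<Omega>)"
proof -
  obtain U a where U: "orthogonal_matrix U" and a: "\<And>i. 0 < a i" and p: "\<And>v. 0 < v \<Longrightarrow> prec v0 v \<Omega> = spmat U (\<lambda>i. 1 / (v + a i))"
    by (rule RR_prec_obtain[OF O v0]) blast
  show ?thesis unfolding p[OF v] det_spmat[OF U] by (intro prod_pos) (use a v in \<open>simp add: add_pos_pos\<close>)
qed

lemma abs_trace_prec_le: "\<bar>trace (prec v0 v \<Omega>)\<bar> \<le> real CARD('r) / v"
proof -
  obtain U a where U: "orthogonal_matrix U" and a: "\<And>i. 0 < a i" and p: "\<And>v. 0 < v \<Longrightarrow> prec v0 v \<Omega> = spmat U (\<lambda>i. 1 / (v + a i))"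
    by (rule RR_prec_obtain[OF O v0]) blast
  have "\<bar>trace (prec v0 v \<Omega>)\<bar> \<le> (\<Sum>i\<in>(UNIV::'r set). \<bar>1 / (v + a i)\<bar>)"
    unfolding p[OF v] trace_spmat[OF U] by (rule sum_abs)
  also have "\<dots> \<le> (\<Sum>i\<in>(UNIV::'r set). 1 / v)"
  proof (rule sum_mono)
    fix i
    have "0 \<le> 1 / (v + a i)" using a[of i] v by simp
    moreover have "1 / (v + a i) \<le> 1 / v" using a[of i] v by (intro divide_left_mono) auto
    ultimately show "\<bar>1 / (v + a i)\<bar> \<le> 1 / v" by simp
  qed
  finally show ?thesis by simp
qed

lemma phi_pos: "0 < phi v0 v (W :: real^'q^'r) \<Omega>"
  unfolding phi_def using det_prec_pos by simp

lemma phi_le_phi_0: "phi v0 v (W :: real^'q^'r) \<Omega> \<le> phi v0 v (0 :: real^'q^'r) \<Omega>"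
proof -
  have "exp (- ((prec v0 v \<Omega> ** W) \<bullet> W) / 2) \<le> 1" using inner_prec_nonneg[of W] by simp
  thus ?thesis unfolding phi_def by (simp add: mult_left_le)
qed

text \<open>The eigenvalues of the precision matrix are at most 1 / v. The factor on the left does
  not involve \<Omega>, so the bound survives integration over the mixture and yields a lower bound
  for the marginal.\<close>

lemma phi_ge_phi_0: "exp (- (norm (W :: real^'q^'r))\<^sup>2 / (2 * v)) * phi v0 v (0 :: real^'q^'r) \<Omega> \<le> phi v0 v W \<Omega>"
proof -
  have "(prec v0 v \<Omega> ** W) \<bullet> W \<le> (norm W)\<^sup>2 / v" using inner_prec_mult_le[of W W] by (simp add: power2_eq_square)
  hence "exp (- (norm W)\<^sup>2 / (2 * v)) \<le> exp (- ((prec v0 v \<Omega> ** W) \<bullet> W) / 2)" by (simp add: field_simps)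
  hence "exp (- (norm W)\<^sup>2 / (2 * v)) * ((2 * pi) powr (- (real (CARD('q) * CARD('r)) / 2)) * det (prec v0 v \<Omega>) powr (real CARD('q) / 2))
     \<le> exp (- ((prec v0 v \<Omega> ** W) \<bullet> W) / 2) * ((2 * pi) powr (- (real (CARD('q) * CARD('r)) / 2)) * det (prec v0 v \<Omega>) powr (real CARD('q) / 2))"
    by (rule mult_right_mono) simp
  thus ?thesis unfolding phi_def by (simp add: mult.commute)
qed

text \<open>For v \<le> vx every a > 0 satisfies 1 / (v + a) \<le> (vx / v) / (vx + a), a bound
  uniform in a and hence in \<Omega>. It transfers integrability from the largest variance to all
  smaller ones.\<close>

lemma phi_0_le:
  assumes vx: "v \<le> vx"
  shows "phi v0 v (0 :: real^'q^'r) \<Omega> \<le> ((vx / v) ^ CARD('r)) powr (real CARD('q) / 2) * phi v0 vx (0 :: real^'q^'r) \<Omega>"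
proof -
  obtain U a where U: "orthogonal_matrix U" and a: "\<And>i. 0 < a i" and p: "\<And>v. 0 < v \<Longrightarrow> prec v0 v \<Omega> = spmat U (\<lambda>i. 1 / (v + a i))"
    by (rule RR_prec_obtain[OF O v0]) blast
  have vx0: "0 < vx" using v vx by simp
  have "det (prec v0 v \<Omega>) \<le> (\<Prod>i\<in>(UNIV::'r set). (vx / v) * (1 / (vx + a i)))"
    unfolding p[OF v] det_spmat[OF U]
  proof (rule prod_mono, rule conjI)
    fix i
    show "0 \<le> 1 / (v + a i)" using a[of i] v by simp
    have "v * (vx + a i) \<le> vx * (v + a i)" using mult_right_mono[OF vx, of "a i"] a[of i] by (simp add: algebra_simps)
    thus "1 / (v + a i) \<le> (vx / v) * (1 / (vx + a i))" using a[of i] v vx0 by (simp add: divide_simps mult.commute)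
  qed
  also have "\<dots> = (vx / v) ^ CARD('r) * det (prec v0 vx \<Omega>)"
    unfolding p[OF vx0] det_spmat[OF U] prod.distrib by simp
  finally have "det (prec v0 v \<Omega>) powr (real CARD('q) / 2) \<le> ((vx / v) ^ CARD('r) * det (prec v0 vx \<Omega>)) powr (real CARD('q) / 2)"
    by (intro powr_mono2) (use det_prec_pos in simp_all)
  also have "\<dots> = ((vx / v) ^ CARD('r)) powr (real CARD('q) / 2) * det (prec v0 vx \<Omega>) powr (real CARD('q) / 2)"
    by (rule powr_mult)
  finally show ?thesis unfolding phi_def by (simp add: mult_left_mono)
qed

lemma phi_derivative_line:
  "((\<lambda>t. phi v0 v (W + t *\<^sub>R E) \<Omega>) has_real_derivative - ((prec v0 v \<Omega> ** (W + s *\<^sub>R E)) \<bullet> E) * phi v0 v (W + s *\<^sub>R (E :: real^'q^'r)) \<Omega>) (at s within T)"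
proof -
  let ?P = "prec v0 v \<Omega>"
  have Q: "(?P ** (W + t *\<^sub>R E)) \<bullet> (W + t *\<^sub>R E) = (?P ** W) \<bullet> W + 2 * t * ((?P ** W) \<bullet> E) + t\<^sup>2 * ((?P ** E) \<bullet> E)" for t
    using inner_prec_commute[of E W]
    by (simp add: matrix_mult_add_right matrix_mult_scaleR_right inner_add_left inner_add_right power2_eq_square algebra_simps)
  have R: "(?P ** (W + s *\<^sub>R E)) \<bullet> E = (?P ** W) \<bullet> E + s * ((?P ** E) \<bullet> E)"
    by (simp add: matrix_mult_add_right matrix_mult_scaleR_right inner_add_left)
  show ?thesis unfolding phi_def Q R
    by (rule derivative_eq_intros refl | simp)+
qed

text \<open>Along W = \<Theta> + sqrt v z the logarithm of \<open>phi\<close> is an explicit sum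
  over eigenvalues. The first two terms of the derivative are half the Laplacian of
  \<open>phi\<close> divided by \<open>phi\<close>, as in the heat equation; the third comes from
  the motion of the point W.\<close>

lemma phi_derivative_variance:
  fixes \<Theta> z :: "real^'q^'r"
  defines "W \<equiv> \<Theta> + sqrt v *\<^sub>R z"
  shows "((\<lambda>t. phi v0 t (\<Theta> + sqrt t *\<^sub>R z) \<Omega>) has_real_derivative
     phi v0 v W \<Omega> * ((norm (prec v0 v \<Omega> ** W))\<^sup>2 / 2 - real CARD('q) / 2 * trace (prec v0 v \<Omega>) - ((prec v0 v \<Omega> ** W) \<bullet> z) / (2 * sqrt v))) (at v)"
proof -
  obtain U a where U: "orthogonal_matrix U" and a: "\<And>i. 0 < a i" and p: "\<And>v. 0 < v \<Longrightarrow> prec v0 v \<Omega> = spmat U (\<lambda>i. 1 / (v + a i))"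
    by (rule RR_prec_obtain[OF O v0]) blast
  let ?c = "(2 * pi) powr (- (real (CARD('q) * CARD('r)) / 2))" and ?n = "real CARD('q) / 2"
  define y where "y = transpose U ** \<Theta>"
  define w where "w = transpose U ** z"
  define L where "L t = - ?n * (\<Sum>k\<in>UNIV. ln (t + a k)) - (\<Sum>k\<in>UNIV. (y $ k \<bullet> y $ k + 2 * sqrt t * (y $ k \<bullet> w $ k) + t * (w $ k \<bullet> w $ k)) / (t + a k)) / 2" for t
  have Uy: "(transpose U ** (\<Theta> + sqrt t *\<^sub>R z)) $ k = y $ k + sqrt t *\<^sub>R w $ k" for t k
    by (simp add: y_def w_def matrix_mult_add_right matrix_mult_scaleR_right)
  have eq: "phi v0 t (\<Theta> + sqrt t *\<^sub>R z) \<Omega> = ?c * exp (L t)" if t: "0 < t" for t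
  proof -
    have ta: "0 < t + a k" for k using t a[of k] by simp
    have lk: "ln (1 / (t + a k)) = - ln (t + a k)" for k using ta[of k] by (simp add: ln_div)
    have D: "0 < (\<Prod>k\<in>UNIV. 1 / (t + a k))" by (intro prod_pos) (simp add: ta)
    have "ln (\<Prod>k\<in>UNIV. 1 / (t + a k)) = (\<Sum>k\<in>UNIV. ln (1 / (t + a k)))"
      by (rule ln_prod) (simp_all add: ta less_imp_neq[OF ta, symmetric])
    also have "\<dots> = - (\<Sum>k\<in>UNIV. ln (t + a k))" by (simp only: lk sum_negf)
    finally have lnD: "ln (\<Prod>k\<in>UNIV. 1 / (t + a k)) = - (\<Sum>k\<in>UNIV. ln (t + a k))" .
    have "(\<Prod>k\<in>UNIV. 1 / (t + a k)) powr ?n = exp (?n * ln (\<Prod>k\<in>UNIV. 1 / (t + a k)))"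
      using less_imp_neq[OF D, symmetric] unfolding powr_def by (rule if_not_P)
    hence 1: "(\<Prod>k\<in>UNIV. 1 / (t + a k)) powr ?n = exp (- ?n * (\<Sum>k\<in>UNIV. ln (t + a k)))"
      unfolding lnD by simp
    have "(norm (y $ k + sqrt t *\<^sub>R w $ k))\<^sup>2 = y $ k \<bullet> y $ k + 2 * sqrt t * (y $ k \<bullet> w $ k) + t * (w $ k \<bullet> w $ k)" for k
    proof -
      have s: "sqrt t * (sqrt t * x) = t * x" for x using t by (simp add: mult.assoc[symmetric])
      thus ?thesis unfolding power2_norm_eq_inner
        by (simp add: inner_add_left inner_add_right inner_commute[of "w $ k" "y $ k"] distrib_left s)
    qed
    hence 2: "(prec v0 t \<Omega> ** (\<Theta> + sqrt t *\<^sub>R z)) \<bullet> (\<Theta> + sqrt t *\<^sub>R z) = (\<Sum>k\<in>UNIV. (y $ k \<bullet> y $ k + 2 * sqrt t * (y $ k \<bullet> w $ k) + t * (w $ k \<bullet> w $ k)) / (t + a k))"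
      unfolding p[OF t] spmat_gram Uy by simp
    show ?thesis unfolding phi_def 2 unfolding p[OF t] det_spmat[OF U] 1 L_def
      by (simp add: exp_add[symmetric] diff_divide_distrib)
  qed
  have va: "v + a k \<noteq> 0" "0 < v + a k" for k using v a[of k] by auto
  have sv: "sqrt v \<noteq> 0" "sqrt v * sqrt v = v" using v by auto
  let ?N = "\<lambda>k. y $ k \<bullet> y $ k + 2 * sqrt v * (y $ k \<bullet> w $ k) + v * (w $ k \<bullet> w $ k)"
  let ?L' = "- ?n * (\<Sum>k\<in>UNIV. 1 / (v + a k)) - (\<Sum>k\<in>UNIV. (y $ k \<bullet> w $ k / sqrt v + w $ k \<bullet> w $ k) / (v + a k) - ?N k / (v + a k)\<^sup>2) / 2"
  have dk: "((\<lambda>t. (y $ k \<bullet> y $ k + 2 * sqrt t * (y $ k \<bullet> w $ k) + t * (w $ k \<bullet> w $ k)) / (t + a k)) has_real_derivative (y $ k \<bullet> w $ k / sqrt v + w $ k \<bullet> w $ k) / (v + a k) - ?N k / (v + a k)\<^sup>2) (at v)" for k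
  proof -
    have "((\<lambda>t. (y $ k \<bullet> y $ k + 2 * sqrt t * (y $ k \<bullet> w $ k) + t * (w $ k \<bullet> w $ k))) has_real_derivative (y $ k \<bullet> w $ k / sqrt v + w $ k \<bullet> w $ k)) (at v)"
      using v by (auto intro!: derivative_eq_intros simp: field_simps)
    moreover have "((\<lambda>t. t + a k) has_real_derivative 1) (at v)" by (auto intro!: derivative_eq_intros)
    ultimately have "((\<lambda>t. (y $ k \<bullet> y $ k + 2 * sqrt t * (y $ k \<bullet> w $ k) + t * (w $ k \<bullet> w $ k)) / (t + a k)) has_real_derivative ((y $ k \<bullet> w $ k / sqrt v + w $ k \<bullet> w $ k) * (v + a k) - ?N k * 1) / ((v + a k) * (v + a k))) (at v)"
      by (rule DERIV_divide) (rule va)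
    thus ?thesis using va(1)[of k] by (simp add: diff_divide_distrib power2_eq_square)
  qed
  have dl: "((\<lambda>t. ln (t + a k)) has_real_derivative 1 / (v + a k)) (at v)" for k
    using va(2)[of k] by (auto intro!: derivative_eq_intros)
  have "(L has_real_derivative ?L') (at v)" unfolding L_def
    by (intro DERIV_diff DERIV_cmult DERIV_cdivide DERIV_sum dk dl)
  hence d: "((\<lambda>t. ?c * exp (L t)) has_real_derivative ?c * (exp (L v) * ?L')) (at v)"
    by (intro DERIV_cmult DERIV_fun_exp)
  have L': "?L' = (norm (prec v0 v \<Omega> ** W))\<^sup>2 / 2 - ?n * trace (prec v0 v \<Omega>) - ((prec v0 v \<Omega> ** W) \<bullet> z) / (2 * sqrt v)"
  proof -
    have s: "sqrt v * (sqrt v * x) = v * x" for x using v by (simp add: mult.assoc[symmetric])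
    have WN: "(norm ((transpose U ** W) $ k))\<^sup>2 = ?N k" for k
      unfolding W_def Uy power2_norm_eq_inner
      by (simp add: inner_add_left inner_add_right inner_commute[of "w $ k" "y $ k"] distrib_left s)
    have 1: "(norm (prec v0 v \<Omega> ** W))\<^sup>2 = (\<Sum>k\<in>UNIV. ?N k / (v + a k)\<^sup>2)"
      unfolding p[OF v] norm_spmat_mult[OF U] WN by (simp add: power_divide)
    have 2: "trace (prec v0 v \<Omega>) = (\<Sum>k\<in>UNIV. 1 / (v + a k))" unfolding p[OF v] by (rule trace_spmat[OF U])
    have "((prec v0 v \<Omega> ** W) \<bullet> z) / sqrt v = (\<Sum>k\<in>UNIV. (y $ k \<bullet> w $ k / sqrt v + w $ k \<bullet> w $ k) / (v + a k))"
      unfolding p[OF v] inner_spmat_mult W_def Uy w_def[symmetric] sum_divide_distrib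
      by (rule sum.cong[OF refl]) (use sv va in \<open>simp add: inner_add_left add_divide_distrib\<close>)
    hence 3: "((prec v0 v \<Omega> ** W) \<bullet> z) / (2 * sqrt v) = (\<Sum>k\<in>UNIV. (y $ k \<bullet> w $ k / sqrt v + w $ k \<bullet> w $ k) / (v + a k)) / 2" by simp
    show ?thesis unfolding 1 2 3 sum_subtractf by (simp add: diff_divide_distrib)
  qed
  show ?thesis
  proof (rule has_field_derivative_transform_within[OF _ v])
    show "((\<lambda>t. ?c * exp (L t)) has_real_derivative phi v0 v W \<Omega> * ((norm (prec v0 v \<Omega> ** W))\<^sup>2 / 2 - ?n * trace (prec v0 v \<Omega>) - ((prec v0 v \<Omega> ** W) \<bullet> z) / (2 * sqrt v))) (at v)"
      using d unfolding L' W_def eq[OF v] by (simp only: mult.assoc)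
    show "?c * exp (L t) = phi v0 t (\<Theta> + sqrt t *\<^sub>R z) \<Omega>" if "dist t v < v" for t
      using that by (subst eq) (auto simp: dist_real_def)
  qed simp
qed

end

lemma sum_Basis_matrix: "(\<Sum>b\<in>(Basis :: (real^'q^'r) set). G b) = (\<Sum>i\<in>UNIV. \<Sum>j\<in>UNIV. G (axis i (axis j 1)))"
proof -
  have bij: "bij_betw (\<lambda>(i, j). axis i (axis j 1)) (UNIV \<times> UNIV) (Basis :: (real^'q^'r) set)"
    by (auto simp: bij_betw_def inj_on_def Basis_vec_def axis_eq_axis image_iff)
  show ?thesis
    by (subst sum.reindex_bij_betw[OF bij, symmetric]) (simp add: sum.cartesian_product split_beta')
qed

text \<open>The trace of E \<mapsto> P E on r x q matrices, where P acts on each of the q columns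
  separately.\<close>

lemma sum_Basis_matrix_mult: "(\<Sum>E\<in>(Basis :: (real^'q^'r) set). (P ** E) \<bullet> E) = real CARD('q) * trace P"
proof -
  have "(P ** axis i (axis j 1)) \<bullet> (axis i (axis j 1) :: real^'q^'r) = P $ i $ i" for i :: 'r and j :: 'q
  proof -
    have "P $ i $ k * (axis i (axis j 1) :: real^'q^'r) $ k $ j = (if k = i then P $ i $ i else 0)" for k
      by (simp add: axis_def)
    thus ?thesis by (simp add: inner_axis matrix_matrix_mult_def)
  qed
  thus ?thesis by (simp add: sum_Basis_matrix trace_def sum_distrib_left)
qed

section \<open>Monotonicity of the expected log marginal in the variance\<close>

lemma measurable_matrix_mult [measurable]:
  fixes f :: "'a \<Rightarrow> real^'n^'m" and g :: "'a \<Rightarrow> real^'k^'n"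
  assumes "f \<in> borel_measurable M" "g \<in> borel_measurable M"
  shows "(\<lambda>x. f x ** g x) \<in> borel_measurable M"
  by (rule borel_measurable_continuous_Pair[OF assms])
    (intro bounded_bilinear.continuous_on[OF bounded_bilinear_matrix_mult] continuous_on_fst continuous_on_snd continuous_on_id)

lemma measurable_det [measurable]:
  fixes f :: "'a \<Rightarrow> real^'n^'n"
  assumes "f \<in> borel_measurable M" shows "(\<lambda>x. det (f x)) \<in> borel_measurable M"
  by (rule measurable_compose[OF assms]) (intro borel_measurable_continuous_onI continuous_on_det continuous_on_id)

lemma measurable_trace [measurable]:
  fixes f :: "'a \<Rightarrow> real^'n^'n"
  assumes "f \<in> borel_measurable M" shows "(\<lambda>x. trace (f x)) \<in> borel_measurable M"
  by (rule measurable_compose[OF assms]) (intro borel_measurable_continuous_onI linear_continuous_on bounded_linear_trace)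

lemma quad_bounded_mult:
  assumes "f \<in> borel_measurable borel" "g \<in> borel_measurable borel"
    and f: "\<And>W. \<bar>f W\<bar> \<le> c * norm (a *\<^sub>R W + p)" and g: "\<And>W. \<bar>g W\<bar> \<le> d * norm (b *\<^sub>R W + q)"
    and c: "0 \<le> c" "0 \<le> d"
  shows "quad_bounded (\<lambda>W. f W * g W)"
proof -
  have q: "quad_bounded (\<lambda>W. (c * d) * ((norm (a *\<^sub>R W + p))\<^sup>2 + (norm (b *\<^sub>R W + q))\<^sup>2))"
    by (intro quad_bounded_cmult quad_bounded_add quad_bounded_norm_affine)
  obtain C where C: "\<And>W. \<bar>(c * d) * ((norm (a *\<^sub>R W + p))\<^sup>2 + (norm (b *\<^sub>R W + q))\<^sup>2)\<bar> \<le> C * (1 + (norm W)\<^sup>2)"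
    using q by (rule quad_boundedE) blast
  show ?thesis
  proof (rule quad_boundedI)
    show "(\<lambda>W. f W * g W) \<in> borel_measurable borel" using assms(1,2) by simp
    fix W
    let ?x = "norm (a *\<^sub>R W + p)" and ?y = "norm (b *\<^sub>R W + q)"
    have "\<bar>f W * g W\<bar> \<le> (c * ?x) * (d * ?y)" unfolding abs_mult using f[of W] g[of W] c by (intro mult_mono) auto
    also have "\<dots> = (c * d) * (?x * ?y)" by (simp add: mult_ac)
    also have "\<dots> \<le> (c * d) * (?x\<^sup>2 + ?y\<^sup>2)"
    proof (rule mult_left_mono)
      have "0 \<le> ?x * ?y" by simp
      thus "?x * ?y \<le> ?x\<^sup>2 + ?y\<^sup>2" using sum_squares_bound[of ?x ?y] by linarith
    qed (use c in simp)
    also have "\<dots> \<le> \<bar>(c * d) * (?x\<^sup>2 + ?y\<^sup>2)\<bar>" by (rule abs_ge_self)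
    finally show "\<bar>f W * g W\<bar> \<le> C * (1 + (norm W)\<^sup>2)" using C[of W] by (rule order_trans)
  qed
qed

text \<open>The measure \<open>\<mu>\<close> plays the role of the second-stage prior; \<open>qtype\<close> only fixes the type of the data.\<close>

locale precision_mixture = sigma_finite_measure \<mu>
  for \<mu> :: "(real^'r^'r) measure" +
  fixes v0 vw vx :: real and qtype :: "(real^'q^'r) itself"
  assumes space_RR: "\<And>\<Omega>. \<Omega> \<in> space \<mu> \<Longrightarrow> \<Omega> \<in> RR"
    and prec_measurable: "\<And>v. 0 < v \<Longrightarrow> prec v0 v \<in> borel_measurable \<mu>"
    and v0: "0 < v0" and vw: "0 < vw" "vw < vx"
    and integrable_phi_vx: "integrable \<mu> (phi v0 vx (0 :: real^'q^'r))"
    and nonzero: "emeasure \<mu> (space \<mu>) \<noteq> 0"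
begin

text \<open>Unnormalised posterior mean of a function of \<Omega> given W. Values in a Banach space
  let the same definition cover scalars and the matrix \<open>S\<close>.\<close>

definition avg :: "real \<Rightarrow> real^'q^'r \<Rightarrow> (real^'r^'r \<Rightarrow> 'b::{banach,second_countable_topology}) \<Rightarrow> 'b" where
  "avg v W h = (\<integral>\<Omega>. phi v0 v W \<Omega> *\<^sub>R h \<Omega> \<partial>\<mu>)"

definition mass :: "real \<Rightarrow> real^'q^'r \<Rightarrow> real" where
  "mass v W = (\<integral>\<Omega>. phi v0 v W \<Omega> \<partial>\<mu>)"

lemma phi_measurable:
  assumes "0 < v" shows "(\<lambda>\<Omega>. phi v0 v (W :: real^'q^'r) \<Omega>) \<in> borel_measurable \<mu>"
proof -
  note [measurable] = prec_measurable[OF assms]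
  show ?thesis unfolding phi_def by measurable
qed

lemma phi_pair_measurable:
  assumes "0 < v" shows "(\<lambda>(W :: real^'q^'r, \<Omega>). phi v0 v W \<Omega>) \<in> borel_measurable (borel \<Otimes>\<^sub>M \<mu>)"
proof -
  note [measurable] = prec_measurable[OF assms]
  show ?thesis unfolding phi_def by measurable
qed

lemma phi_le_vx:
  assumes v: "vw \<le> v" "v \<le> vx" and O: "\<Omega> \<in> space \<mu>"
  shows "phi v0 v (W :: real^'q^'r) \<Omega> \<le> ((vx / vw) ^ CARD('r)) powr (real CARD('q) / 2) * phi v0 vx (0 :: real^'q^'r) \<Omega>"
proof -
  have v': "0 < v" using v vw by simp
  have OR: "\<Omega> \<in> RR" using O by (rule space_RR)
  have "phi v0 v W \<Omega> \<le> phi v0 v (0 :: real^'q^'r) \<Omega>" by (rule phi_le_phi_0[OF v0 v' OR])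
  also have "\<dots> \<le> ((vx / v) ^ CARD('r)) powr (real CARD('q) / 2) * phi v0 vx (0 :: real^'q^'r) \<Omega>"
    by (rule phi_0_le[OF v0 v' OR v(2)])
  also have "\<dots> \<le> ((vx / vw) ^ CARD('r)) powr (real CARD('q) / 2) * phi v0 vx (0 :: real^'q^'r) \<Omega>"
  proof (intro mult_right_mono powr_mono2 power_mono)
    show "vx / v \<le> vx / vw" using v vw by (intro divide_left_mono) auto
    show "0 \<le> vx / v" using v' vw by simp
    show "0 \<le> (vx / v) ^ CARD('r)" using v' vw by simp
    show "0 \<le> phi v0 vx (0 :: real^'q^'r) \<Omega>" using phi_pos[OF v0 _ OR, of vx "0 :: real^'q^'r"] vw by simp
  qed simp
  finally show ?thesis .
qed

lemma integrable_phi_scaleR: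
  fixes h :: "real^'r^'r \<Rightarrow> 'b::{banach,second_countable_topology}"
  assumes v: "vw \<le> v" "v \<le> vx" and h: "h \<in> borel_measurable \<mu>" and b: "\<And>\<Omega>. \<Omega> \<in> space \<mu> \<Longrightarrow> norm (h \<Omega>) \<le> C"
  shows "integrable \<mu> (\<lambda>\<Omega>. phi v0 v (W :: real^'q^'r) \<Omega> *\<^sub>R h \<Omega>)"
proof (rule Bochner_Integration.integrable_bound)
  let ?K = "((vx / vw) ^ CARD('r)) powr (real CARD('q) / 2)"
  have v': "0 < v" using v vw by simp
  show "integrable \<mu> (\<lambda>\<Omega>. (?K * \<bar>C\<bar>) * phi v0 vx (0 :: real^'q^'r) \<Omega>)" using integrable_phi_vx by (rule integrable_mult_right)
  show "(\<lambda>\<Omega>. phi v0 v W \<Omega> *\<^sub>R h \<Omega>) \<in> borel_measurable \<mu>" by (rule borel_measurable_scaleR[OF phi_measurable[OF v'] h])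
  show "AE \<Omega> in \<mu>. norm (phi v0 v W \<Omega> *\<^sub>R h \<Omega>) \<le> norm ((?K * \<bar>C\<bar>) * phi v0 vx (0 :: real^'q^'r) \<Omega>)"
  proof (rule AE_I2)
    fix \<Omega> assume O: "\<Omega> \<in> space \<mu>"
    hence OR: "\<Omega> \<in> RR" by (rule space_RR)
    have p: "0 < phi v0 v W \<Omega>" by (rule phi_pos[OF v0 v' OR])
    have "norm (phi v0 v W \<Omega> *\<^sub>R h \<Omega>) = phi v0 v W \<Omega> * norm (h \<Omega>)" using p by simp
    also have "\<dots> \<le> (?K * phi v0 vx (0 :: real^'q^'r) \<Omega>) * \<bar>C\<bar>"
      by (rule mult_mono[OF phi_le_vx[OF v O] order_trans[OF b[OF O] abs_ge_self]]) (use order_trans[OF less_imp_le[OF p] phi_le_vx[OF v O]] in simp_all)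
    also have "\<dots> = (?K * \<bar>C\<bar>) * phi v0 vx (0 :: real^'q^'r) \<Omega>" by (simp only: mult_ac)
    also have "\<dots> \<le> norm \<dots>" unfolding real_norm_def by (rule abs_ge_self)
    finally show "norm (phi v0 v W \<Omega> *\<^sub>R h \<Omega>) \<le> norm ((?K * \<bar>C\<bar>) * phi v0 vx (0 :: real^'q^'r) \<Omega>)" .
  qed
qed

lemma integrable_phi:
  assumes v: "vw \<le> v" "v \<le> vx" shows "integrable \<mu> (\<lambda>\<Omega>. phi v0 v (W :: real^'q^'r) \<Omega>)"
  using integrable_phi_scaleR[OF v, of "\<lambda>_. 1::real" 1] by simp

lemma mass_pos:
  assumes v: "vw \<le> v" "v \<le> vx" shows "0 < mass v W"
proof -
  have v': "0 < v" using v vw by simp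
  have p: "0 < phi v0 v W \<Omega>" if "\<Omega> \<in> space \<mu>" for \<Omega> by (rule phi_pos[OF v0 v' space_RR[OF that]])
  have "0 \<le> mass v W" unfolding mass_def by (rule integral_nonneg_AE, rule AE_I2) (use p in \<open>simp add: less_imp_le\<close>)
  moreover have "mass v W \<noteq> 0"
  proof
    assume "mass v W = 0"
    hence "AE \<Omega> in \<mu>. phi v0 v W \<Omega> = 0" unfolding mass_def
      by (subst (asm) integral_nonneg_eq_0_iff_AE[OF integrable_phi[OF v]]) (use p in \<open>auto intro!: AE_I2 simp: less_imp_le\<close>)
    hence "AE \<Omega> in \<mu>. False" using AE_space by eventually_elim (use p in \<open>simp add: less_imp_neq[symmetric]\<close>)
    thus False using nonzero by (simp add: AE_iff_null null_sets_def)
  qed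
  ultimately show ?thesis by simp
qed

text \<open>Divided by the mass this bounds a posterior mean by the bound of its integrand; the
  growth estimates below are all of this kind.\<close>

lemma norm_avg_le:
  assumes v: "vw \<le> v" "v \<le> vx" and h: "h \<in> borel_measurable \<mu>" and b: "\<And>\<Omega>. \<Omega> \<in> space \<mu> \<Longrightarrow> norm (h \<Omega>) \<le> C"
  shows "norm (avg v W h) \<le> C * mass v W"
proof -
  have v': "0 < v" using v vw by simp
  have "norm (avg v W h) \<le> (\<integral>\<Omega>. norm (phi v0 v W \<Omega> *\<^sub>R h \<Omega>) \<partial>\<mu>)" unfolding avg_def by (rule integral_norm_bound)
  also have "\<dots> \<le> (\<integral>\<Omega>. C * phi v0 v W \<Omega> \<partial>\<mu>)"
  proof (rule integral_mono)
    show "integrable \<mu> (\<lambda>\<Omega>. norm (phi v0 v W \<Omega> *\<^sub>R h \<Omega>))" by (rule integrable_norm[OF integrable_phi_scaleR[OF v h b]])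
    show "integrable \<mu> (\<lambda>\<Omega>. C * phi v0 v W \<Omega>)" by (rule integrable_mult_right[OF integrable_phi[OF v]])
    fix \<Omega> assume O: "\<Omega> \<in> space \<mu>"
    have p: "0 < phi v0 v W \<Omega>" by (rule phi_pos[OF v0 v' space_RR[OF O]])
    have "norm (phi v0 v W \<Omega> *\<^sub>R h \<Omega>) = phi v0 v W \<Omega> * norm (h \<Omega>)" using p by simp
    also have "\<dots> \<le> phi v0 v W \<Omega> * C" by (rule mult_left_mono[OF b[OF O]]) (use p in simp)
    finally show "norm (phi v0 v W \<Omega> *\<^sub>R h \<Omega>) \<le> C * phi v0 v W \<Omega>" by (simp add: mult.commute)
  qed
  also have "\<dots> = C * mass v W" unfolding mass_def by (rule integral_mult_right_zero)
  finally show ?thesis .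
qed

lemma mass_measurable:
  assumes v: "0 < v" shows "mass v \<in> borel_measurable borel"
  unfolding mass_def using phi_pair_measurable[OF v] by (rule borel_measurable_lebesgue_integral)

lemma mass_bounds:
  assumes v: "vw \<le> v" "v \<le> vx"
  shows "exp (- (norm W)\<^sup>2 / (2 * v)) * mass v 0 \<le> mass v W" and "mass v W \<le> mass v 0"
proof -
  have v': "0 < v" using v vw by simp
  have "exp (- (norm W)\<^sup>2 / (2 * v)) * mass v 0 = (\<integral>\<Omega>. exp (- (norm W)\<^sup>2 / (2 * v)) * phi v0 v (0 :: real^'q^'r) \<Omega> \<partial>\<mu>)"
    unfolding mass_def by (rule integral_mult_right_zero[symmetric])
  also have "\<dots> \<le> mass v W" unfolding mass_def
    by (rule integral_mono[OF integrable_mult_right[OF integrable_phi[OF v]] integrable_phi[OF v]]) (rule phi_ge_phi_0[OF v0 v' space_RR])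
  finally show "exp (- (norm W)\<^sup>2 / (2 * v)) * mass v 0 \<le> mass v W" .
  show "mass v W \<le> mass v 0" unfolding mass_def
    by (rule integral_mono[OF integrable_phi[OF v] integrable_phi[OF v]]) (rule phi_le_phi_0[OF v0 v' space_RR])
qed

text \<open>The mass lies between \<open>mass v 0\<close> and that value times exp(- |W|^2 / (2 v)),
  so its logarithm grows at most quadratically.\<close>

lemma quad_bounded_ln_mass:
  assumes v: "vw \<le> v" "v \<le> vx" shows "quad_bounded (\<lambda>W. ln (mass v W))"
proof (rule quad_boundedI)
  have v': "0 < v" using v vw by simp
  note [measurable] = mass_measurable[OF v']
  show "(\<lambda>W. ln (mass v W)) \<in> borel_measurable borel" by measurable
  let ?C = "\<bar>ln (mass v 0)\<bar> + 1 / (2 * v)"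
  fix W
  have m: "0 < mass v 0" "0 < mass v W" using mass_pos[OF v] by auto
  have "ln (exp (- (norm W)\<^sup>2 / (2 * v)) * mass v 0) \<le> ln (mass v W)" by (rule ln_mono) (use m mass_bounds(1)[OF v, of W] in simp_all)
  hence 1: "ln (mass v 0) - (norm W)\<^sup>2 / (2 * v) \<le> ln (mass v W)" using m by (simp add: ln_mult)
  have 2: "ln (mass v W) \<le> ln (mass v 0)" by (rule ln_mono) (use m mass_bounds(2)[OF v, of W] in simp_all)
  have "\<bar>ln (mass v W)\<bar> \<le> \<bar>ln (mass v 0)\<bar> + (norm W)\<^sup>2 / (2 * v)" using 1 2 v' by (smt (verit) divide_nonneg_pos zero_le_power2)
  also have "\<dots> \<le> ?C * (1 + (norm W)\<^sup>2)" using v' by (simp add: algebra_simps)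
  finally show "\<bar>ln (mass v W)\<bar> \<le> ?C * (1 + (norm W)\<^sup>2)" .
qed

text \<open>Unnormalised posterior moments of the precision matrix.\<close>

definition S where "S v W = avg v W (prec v0 v)"
definition sq where "sq v W = avg v W (\<lambda>\<Omega>. (norm (prec v0 v \<Omega> ** W))\<^sup>2)"
definition sqE where "sqE v W E = avg v W (\<lambda>\<Omega>. ((prec v0 v \<Omega> ** W) \<bullet> E)\<^sup>2)"

lemma integrable_phi_prec:
  assumes v: "vw \<le> v" "v \<le> vx" shows "integrable \<mu> (\<lambda>\<Omega>. phi v0 v (W :: real^'q^'r) \<Omega> *\<^sub>R prec v0 v \<Omega>)"
proof -
  have v': "0 < v" using v vw by simp
  show ?thesis by (rule integrable_phi_scaleR[OF v prec_measurable[OF v']]) (rule norm_prec_le[OF v0 v' space_RR])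
qed

lemma S_linear:
  assumes v: "vw \<le> v" "v \<le> vx" and T: "bounded_linear T"
  shows "T (S v W) = avg v W (\<lambda>\<Omega>. T (prec v0 v \<Omega>))"
proof -
  have "(\<integral>\<Omega>. T (phi v0 v W \<Omega> *\<^sub>R prec v0 v \<Omega>) \<partial>\<mu>) = T (S v W)" unfolding S_def avg_def
    by (rule integral_bounded_linear[OF T integrable_phi_prec[OF v]])
  thus ?thesis unfolding avg_def by (simp add: linear_scale[OF bounded_linear.linear[OF T]])
qed

lemma bounded_linear_mult_inner: "bounded_linear (\<lambda>P :: real^'r^'r. (P ** (X :: real^'q^'r)) \<bullet> Z)"
  by (rule bounded_linear_compose[OF bounded_linear_inner_left bounded_bilinear.bounded_linear_left[OF bounded_bilinear_matrix_mult]])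

lemma S_inner: "vw \<le> v \<Longrightarrow> v \<le> vx \<Longrightarrow> (S v W ** (X :: real^'q^'r)) \<bullet> Z = avg v W (\<lambda>\<Omega>. (prec v0 v \<Omega> ** X) \<bullet> Z)"
  by (rule S_linear[OF _ _ bounded_linear_mult_inner])

lemma S_trace: "vw \<le> v \<Longrightarrow> v \<le> vx \<Longrightarrow> trace (S v W) = avg v W (\<lambda>\<Omega>. trace (prec v0 v \<Omega>))"
  by (rule S_linear[OF _ _ bounded_linear_trace])

lemma S_inner_bound:
  assumes v: "vw \<le> v" "v \<le> vx" shows "\<bar>(S v W ** (X :: real^'q^'r)) \<bullet> Z\<bar> \<le> norm X * norm Z / v * mass v W"
proof -
  have v': "0 < v" using v vw by simp
  note [measurable] = prec_measurable[OF v']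
  have "norm (avg v W (\<lambda>\<Omega>. (prec v0 v \<Omega> ** X) \<bullet> Z)) \<le> norm X * norm Z / v * mass v W"
    by (rule norm_avg_le[OF v]) (measurable, unfold real_norm_def, rule inner_prec_mult_le[OF v0 v' space_RR])
  thus ?thesis by (simp add: S_inner[OF v])
qed

lemma S_trace_bound:
  assumes v: "vw \<le> v" "v \<le> vx" shows "\<bar>trace (S v W)\<bar> \<le> real CARD('r) / v * mass v W"
proof -
  have v': "0 < v" using v vw by simp
  note [measurable] = prec_measurable[OF v']
  have "norm (avg v W (\<lambda>\<Omega>. trace (prec v0 v \<Omega>))) \<le> real CARD('r) / v * mass v W"
    by (rule norm_avg_le[OF v]) (measurable, unfold real_norm_def, rule abs_trace_prec_le[OF v0 v' space_RR])
  thus ?thesis by (simp add: S_trace[OF v])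
qed

lemma sq_bound:
  assumes v: "vw \<le> v" "v \<le> vx" shows "\<bar>sq v W\<bar> \<le> (norm W / v)\<^sup>2 * mass v W"
proof -
  have v': "0 < v" using v vw by simp
  note [measurable] = prec_measurable[OF v']
  have "norm (sq v W) \<le> (norm W / v)\<^sup>2 * mass v W" unfolding sq_def
  proof (rule norm_avg_le[OF v])
    fix \<Omega> assume "\<Omega> \<in> space \<mu>"
    thus "norm ((norm (prec v0 v \<Omega> ** W))\<^sup>2) \<le> (norm W / v)\<^sup>2"
      using norm_prec_mult[OF v0 v' space_RR, of \<Omega> W] by (simp add: power_mono)
  qed measurable
  thus ?thesis by simp
qed

lemma sqE_le:
  assumes v: "vw \<le> v" "v \<le> vx" and O: "\<Omega> \<in> space \<mu>"
  shows "norm (((prec v0 v \<Omega> ** W) \<bullet> (E :: real^'q^'r))\<^sup>2) \<le> (norm W * norm E / v)\<^sup>2"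
proof -
  have v': "0 < v" using v vw by simp
  have "\<bar>(prec v0 v \<Omega> ** W) \<bullet> E\<bar>\<^sup>2 \<le> (norm W * norm E / v)\<^sup>2"
    by (rule power_mono[OF inner_prec_mult_le[OF v0 v' space_RR[OF O]]]) simp
  thus ?thesis by simp
qed

lemma sqE_bound:
  assumes v: "vw \<le> v" "v \<le> vx" shows "\<bar>sqE v W E\<bar> \<le> (norm W * norm E / v)\<^sup>2 * mass v W"
proof -
  have v': "0 < v" using v vw by simp
  note [measurable] = prec_measurable[OF v']
  have "norm (sqE v W E) \<le> (norm W * norm E / v)\<^sup>2 * mass v W" unfolding sqE_def
    by (rule norm_avg_le[OF v _ sqE_le[OF v]]) measurable
  thus ?thesis by simp
qed

lemma sum_sqE:
  assumes v: "vw \<le> v" "v \<le> vx" shows "(\<Sum>E\<in>Basis. sqE v W E) = sq v W"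
proof -
  have v': "0 < v" using v vw by simp
  note [measurable] = prec_measurable[OF v']
  have "(\<Sum>E\<in>Basis. sqE v W E) = (\<integral>\<Omega>. (\<Sum>E\<in>Basis. phi v0 v W \<Omega> *\<^sub>R ((prec v0 v \<Omega> ** W) \<bullet> E)\<^sup>2) \<partial>\<mu>)"
    unfolding sqE_def avg_def
    by (rule Bochner_Integration.integral_sum[symmetric], rule integrable_phi_scaleR[OF v _ sqE_le[OF v]]) measurable
  also have "\<dots> = sq v W" unfolding sq_def avg_def
  proof (rule Bochner_Integration.integral_cong[OF refl])
    fix \<Omega>
    have "(norm (prec v0 v \<Omega> ** W))\<^sup>2 = (\<Sum>E\<in>Basis. ((prec v0 v \<Omega> ** W) \<bullet> E) * ((prec v0 v \<Omega> ** W) \<bullet> E))"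
      unfolding power2_norm_eq_inner by (rule euclidean_inner)
    thus "(\<Sum>E\<in>Basis. phi v0 v W \<Omega> *\<^sub>R ((prec v0 v \<Omega> ** W) \<bullet> E)\<^sup>2) = phi v0 v W \<Omega> *\<^sub>R (norm (prec v0 v \<Omega> ** W))\<^sup>2"
      by (simp add: sum_distrib_left power2_eq_square)
  qed
  finally show ?thesis .
qed

lemma avg_measurable:
  assumes v: "0 < v" and h: "(\<lambda>(W, \<Omega>). h W \<Omega> :: real) \<in> borel_measurable (borel \<Otimes>\<^sub>M \<mu>)"
  shows "(\<lambda>W. avg v W (h W)) \<in> borel_measurable borel"
proof -
  note [measurable] = phi_pair_measurable[OF v] h
  have "(\<lambda>(W, \<Omega>). phi v0 v W \<Omega> *\<^sub>R h W \<Omega>) \<in> borel_measurable (borel \<Otimes>\<^sub>M \<mu>)" by measurable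
  thus ?thesis unfolding avg_def by (rule borel_measurable_lebesgue_integral)
qed

lemma S_inner_measurable:
  assumes v: "vw \<le> v" "v \<le> vx" and [measurable]: "X \<in> borel_measurable borel" "Z \<in> borel_measurable borel"
  shows "(\<lambda>W. (S v W ** (X W :: real^'q^'r)) \<bullet> Z W) \<in> borel_measurable borel"
proof -
  have v': "0 < v" using v vw by simp
  note [measurable] = prec_measurable[OF v']
  show ?thesis unfolding S_inner[OF v] by (rule avg_measurable[OF v']) measurable
qed

lemma S_trace_measurable:
  assumes v: "vw \<le> v" "v \<le> vx" shows "(\<lambda>W. trace (S v W)) \<in> borel_measurable borel"
proof -
  have v': "0 < v" using v vw by simp
  note [measurable] = prec_measurable[OF v']
  show ?thesis unfolding S_trace[OF v] by (rule avg_measurable[OF v']) measurable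
qed

lemma sq_measurable:
  assumes v: "vw \<le> v" "v \<le> vx" shows "(\<lambda>W. sq v W) \<in> borel_measurable borel" and "(\<lambda>W. sqE v W E) \<in> borel_measurable borel"
proof -
  have v': "0 < v" using v vw by simp
  note [measurable] = prec_measurable[OF v']
  show "(\<lambda>W. sq v W) \<in> borel_measurable borel" unfolding sq_def by (rule avg_measurable[OF v']) measurable
  show "(\<lambda>W. sqE v W E) \<in> borel_measurable borel" unfolding sqE_def by (rule avg_measurable[OF v']) measurable
qed

end

section \<open>Derivatives of the marginal density in the observation and in the variance\<close>

context precision_mixture
begin

lemma phi_line_bound:
  assumes v: "vw \<le> v" "v \<le> vx" and O: "\<Omega> \<in> space \<mu>" and t: "t \<in> {-1..1::real}"
  shows "\<bar>(prec v0 v \<Omega> ** (W + t *\<^sub>R E)) \<bullet> (E :: real^'q^'r)\<bar> \<le> (norm W + norm E) * norm E / v"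
proof -
  have v': "0 < v" using v vw by simp
  have "norm (W + t *\<^sub>R E) \<le> norm W + \<bar>t\<bar> * norm E" using norm_triangle_ineq[of W "t *\<^sub>R E"] by simp
  also have "\<dots> \<le> norm W + 1 * norm E" using t by (intro add_left_mono mult_right_mono) auto
  finally have "norm (W + t *\<^sub>R E) * norm E / v \<le> (norm W + norm E) * norm E / v"
    using v' by (intro divide_right_mono mult_right_mono) auto
  thus ?thesis using inner_prec_mult_le[OF v0 v' space_RR[OF O], of "W + t *\<^sub>R E" E] by (rule order_trans[rotated])
qed

text \<open>The gradient of the marginal is - S W. The interval from -1 to 1 is an arbitrary
  neighbourhood of 0, on which |W + t E| \<le> |W| + |E| provides a dominating function.\<close>

lemma mass_derivative_line:
  assumes v: "vw \<le> v" "v \<le> vx"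
  shows "((\<lambda>t. mass v (W + t *\<^sub>R E)) has_real_derivative - ((S v W ** W) \<bullet> E)) (at 0)"
proof -
  have v': "0 < v" using v vw by simp
  let ?f' = "\<lambda>t \<Omega>. - ((prec v0 v \<Omega> ** (W + t *\<^sub>R E)) \<bullet> E) * phi v0 v (W + t *\<^sub>R E) \<Omega>"
  have "((\<lambda>t. \<integral>\<Omega>. phi v0 v (W + t *\<^sub>R E) \<Omega> \<partial>\<mu>) has_real_derivative (\<integral>\<Omega>. ?f' 0 \<Omega> \<partial>\<mu>)) (at 0 within {-1..1})"
  proof (rule has_real_derivative_integral(2)[where B = "\<lambda>\<Omega>. (norm W + norm E) * norm E / v * phi v0 v (0 :: real^'q^'r) \<Omega>"])
    show "(-1::real) < 1" "(0::real) \<in> {-1..1}" by simp_all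
    show "integrable \<mu> (phi v0 v (W + t *\<^sub>R E))" for t by (rule integrable_phi[OF v])
    show "integrable \<mu> (\<lambda>\<Omega>. (norm W + norm E) * norm E / v * phi v0 v (0 :: real^'q^'r) \<Omega>)"
      by (rule integrable_mult_right[OF integrable_phi[OF v]])
    fix t :: real and \<Omega> assume t: "t \<in> {-1..1}" and O: "\<Omega> \<in> space \<mu>"
    show "((\<lambda>t. phi v0 v (W + t *\<^sub>R E) \<Omega>) has_real_derivative ?f' t \<Omega>) (at t within {-1..1})"
      by (rule phi_derivative_line[OF v0 v' space_RR[OF O]])
    show "\<bar>?f' t \<Omega>\<bar> \<le> (norm W + norm E) * norm E / v * phi v0 v (0 :: real^'q^'r) \<Omega>"
      unfolding abs_mult abs_minus_cancel
    proof (rule mult_mono[OF phi_line_bound[OF v O t]])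
      show "\<bar>phi v0 v (W + t *\<^sub>R E) \<Omega>\<bar> \<le> phi v0 v (0 :: real^'q^'r) \<Omega>"
        using phi_le_phi_0[OF v0 v' space_RR[OF O], of "W + t *\<^sub>R E"] phi_pos[OF v0 v' space_RR[OF O], of "W + t *\<^sub>R E"] by simp
      show "0 \<le> (norm W + norm E) * norm E / v" using v' by simp
    qed simp
  qed
  moreover have "(\<integral>\<Omega>. ?f' 0 \<Omega> \<partial>\<mu>) = - ((S v W ** W) \<bullet> E)"
    unfolding S_inner[OF v] avg_def by (simp add: mult.commute)
  ultimately show ?thesis unfolding mass_def[symmetric] using at_within_Icc_at[of "-1" 0 "1::real"] by simp
qed

text \<open>Second derivative of the marginal along E, up to sign. Summed over a basis the
  right-hand side becomes q tr S - sq, minus the Laplacian.\<close>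

lemma S_derivative_line:
  assumes v: "vw \<le> v" "v \<le> vx"
  shows "((\<lambda>t. (S v (W + t *\<^sub>R E) ** (W + t *\<^sub>R E)) \<bullet> E) has_real_derivative (S v W ** E) \<bullet> E - sqE v W E) (at 0)"
proof -
  have v': "0 < v" using v vw by simp
  note [measurable] = prec_measurable[OF v'] phi_measurable[OF v']
  let ?p = "\<lambda>t \<Omega>. (prec v0 v \<Omega> ** (W + t *\<^sub>R E)) \<bullet> E"
  let ?f' = "\<lambda>t \<Omega>. phi v0 v (W + t *\<^sub>R E) \<Omega> * ((prec v0 v \<Omega> ** E) \<bullet> E - (?p t \<Omega>)\<^sup>2)"
  let ?C = "norm E * norm E / v + ((norm W + norm E) * norm E / v)\<^sup>2"
  have "((\<lambda>t. \<integral>\<Omega>. phi v0 v (W + t *\<^sub>R E) \<Omega> * ?p t \<Omega> \<partial>\<mu>) has_real_derivative (\<integral>\<Omega>. ?f' 0 \<Omega> \<partial>\<mu>)) (at 0 within {-1..1})"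
  proof (rule has_real_derivative_integral(2)[where B = "\<lambda>\<Omega>. phi v0 v (0 :: real^'q^'r) \<Omega> * ?C"])
    show "(-1::real) < 1" "(0::real) \<in> {-1..1}" by simp_all
    show "integrable \<mu> (\<lambda>\<Omega>. phi v0 v (W + t *\<^sub>R E) \<Omega> * ?p t \<Omega>)" if t: "t \<in> {-1..1}" for t
      using integrable_phi_scaleR[OF v, of "?p t" "(norm W + norm E) * norm E / v" "W + t *\<^sub>R E"] phi_line_bound[OF v _ t]
      by simp
    show "integrable \<mu> (\<lambda>\<Omega>. phi v0 v (0 :: real^'q^'r) \<Omega> * ?C)"
      by (rule integrable_mult_left[OF integrable_phi[OF v]])
    fix t :: real and \<Omega> assume t: "t \<in> {-1..1}" and O: "\<Omega> \<in> space \<mu>"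
    note R = space_RR[OF O]
    have "(?p t \<Omega>) = (prec v0 v \<Omega> ** W) \<bullet> E + t * ((prec v0 v \<Omega> ** E) \<bullet> E)" for t
      by (simp add: matrix_mult_add_right matrix_mult_scaleR_right inner_add_left)
    hence "((\<lambda>t. ?p t \<Omega>) has_real_derivative (prec v0 v \<Omega> ** E) \<bullet> E) (at t within {-1..1})"
      by (auto intro!: derivative_eq_intros)
    from DERIV_mult'[OF phi_derivative_line[OF v0 v' R] this, of W]
    show "((\<lambda>t. phi v0 v (W + t *\<^sub>R E) \<Omega> * ?p t \<Omega>) has_real_derivative ?f' t \<Omega>) (at t within {-1..1})"
      by (rule DERIV_cong) (simp add: algebra_simps power2_eq_square)
    show "\<bar>?f' t \<Omega>\<bar> \<le> phi v0 v (0 :: real^'q^'r) \<Omega> * ?C"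
      unfolding abs_mult
    proof (rule mult_mono)
      show "\<bar>phi v0 v (W + t *\<^sub>R E) \<Omega>\<bar> \<le> phi v0 v (0 :: real^'q^'r) \<Omega>"
        using phi_le_phi_0[OF v0 v' R, of "W + t *\<^sub>R E"] phi_pos[OF v0 v' R, of "W + t *\<^sub>R E"] by simp
      show "0 \<le> phi v0 v (0 :: real^'q^'r) \<Omega>" using phi_pos[OF v0 v' R, of "0 :: real^'q^'r"] by simp
      have "\<bar>?p t \<Omega>\<bar>\<^sup>2 \<le> ((norm W + norm E) * norm E / v)\<^sup>2" by (rule power_mono[OF phi_line_bound[OF v O t]]) simp
      moreover have "\<bar>(prec v0 v \<Omega> ** E) \<bullet> E\<bar> \<le> norm E * norm E / v" by (rule inner_prec_mult_le[OF v0 v' R])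
      ultimately show "\<bar>(prec v0 v \<Omega> ** E) \<bullet> E - (?p t \<Omega>)\<^sup>2\<bar> \<le> ?C"
        using abs_triangle_ineq4[of "(prec v0 v \<Omega> ** E) \<bullet> E" "(?p t \<Omega>)\<^sup>2"] by simp
    qed simp
  qed
  moreover have "(\<integral>\<Omega>. ?f' 0 \<Omega> \<partial>\<mu>) = (S v W ** E) \<bullet> E - sqE v W E"
  proof -
    have 1: "integrable \<mu> (\<lambda>\<Omega>. phi v0 v W \<Omega> *\<^sub>R ((prec v0 v \<Omega> ** E) \<bullet> E))"
      by (rule integrable_phi_scaleR[OF v]) (measurable, unfold real_norm_def, rule inner_prec_mult_le[OF v0 v' space_RR])
    have 2: "integrable \<mu> (\<lambda>\<Omega>. phi v0 v W \<Omega> *\<^sub>R ((prec v0 v \<Omega> ** W) \<bullet> E)\<^sup>2)"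
      by (rule integrable_phi_scaleR[OF v _ sqE_le[OF v]]) measurable
    show ?thesis unfolding S_inner[OF v] sqE_def avg_def Bochner_Integration.integral_diff[OF 1 2, symmetric]
      by (simp add: right_diff_distrib)
  qed
  moreover have "(\<lambda>t. \<integral>\<Omega>. phi v0 v (W + t *\<^sub>R E) \<Omega> * ?p t \<Omega> \<partial>\<mu>) = (\<lambda>t. (S v (W + t *\<^sub>R E) ** (W + t *\<^sub>R E)) \<bullet> E)"
    unfolding S_inner[OF v] avg_def by simp
  ultimately show ?thesis using at_within_Icc_at[of "-1" 0 "1::real"] by simp
qed

text \<open>At W = \<Theta> + sqrt v z it is the logarithmic derivative of \<open>phi\<close> in v
  along this moving point.\<close>

definition score where
  "score v W z \<Omega> = (norm (prec v0 v \<Omega> ** W))\<^sup>2 / 2 - real CARD('q) / 2 * trace (prec v0 v \<Omega>) - ((prec v0 v \<Omega> ** W) \<bullet> (z :: real^'q^'r)) / (2 * sqrt v)"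

text \<open>Bounds the score uniformly in \<Omega> and in v from vw to vx, with quadratic growth in
  z. It uses |W|^2 \<le> 2 |\<Theta>|^2 + 2 vx |z|^2 and the bound 1 / vw for the eigenvalues of the
  precision matrix.\<close>

definition score_bound where
  "score_bound \<Theta> z = (2 * (norm \<Theta>)\<^sup>2 + 2 * vx * (norm z)\<^sup>2) / (2 * vw\<^sup>2) + real CARD('q) / 2 * (real CARD('r) / vw)
     + (2 * (norm \<Theta>)\<^sup>2 + 2 * vx * (norm z)\<^sup>2 + (norm z)\<^sup>2) / (2 * vw * sqrt vw)" for \<Theta> z :: "real^'q^'r"

lemma score_le:
  assumes v: "vw \<le> v" "v \<le> vx" and O: "\<Omega> \<in> space \<mu>"
  shows "norm (score v (\<Theta> + sqrt v *\<^sub>R z) z \<Omega>) \<le> score_bound \<Theta> z"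
proof -
  have v': "0 < v" using v vw by simp
  note R = space_RR[OF O]
  let ?W = "\<Theta> + sqrt v *\<^sub>R z" and ?\<rho> = "2 * (norm \<Theta>)\<^sup>2 + 2 * vx * (norm z)\<^sup>2"
  have W: "(norm ?W)\<^sup>2 \<le> ?\<rho>"
  proof -
    have "(norm ?W)\<^sup>2 \<le> (norm \<Theta> + sqrt v * norm z)\<^sup>2"
      using norm_triangle_ineq[of \<Theta> "sqrt v *\<^sub>R z"] v' by (intro power_mono) auto
    also have "\<dots> \<le> 2 * (norm \<Theta>)\<^sup>2 + 2 * (sqrt v * norm z)\<^sup>2"
      using sum_squares_bound[of "norm \<Theta>" "sqrt v * norm z"] by (simp add: power2_sum)
    also have "(sqrt v * norm z)\<^sup>2 = v * (norm z)\<^sup>2" using v' by (simp add: power_mult_distrib)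
    also have "2 * (norm \<Theta>)\<^sup>2 + 2 * (v * (norm z)\<^sup>2) \<le> ?\<rho>" using v by (simp add: mult_right_mono)
    finally show ?thesis .
  qed
  have 1: "\<bar>(norm (prec v0 v \<Omega> ** ?W))\<^sup>2 / 2\<bar> \<le> ?\<rho> / (2 * vw\<^sup>2)"
  proof -
    have "(norm (prec v0 v \<Omega> ** ?W))\<^sup>2 \<le> (norm ?W / v)\<^sup>2" by (rule power_mono[OF norm_prec_mult[OF v0 v' R]]) simp
    also have "\<dots> = (norm ?W)\<^sup>2 / v\<^sup>2" by (rule power_divide)
    also have "\<dots> \<le> ?\<rho> / vw\<^sup>2" using W v vw by (intro frac_le power_mono) auto
    finally have le: "(norm (prec v0 v \<Omega> ** ?W))\<^sup>2 \<le> ?\<rho> / vw\<^sup>2" .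
    have e: "?\<rho> / (2 * vw\<^sup>2) = (?\<rho> / vw\<^sup>2) / 2" by simp
    show ?thesis unfolding e abs_of_nonneg[OF divide_nonneg_nonneg[OF zero_le_power2 zero_le_numeral]] by (rule divide_right_mono[OF le]) simp
  qed
  have 2: "\<bar>real CARD('q) / 2 * trace (prec v0 v \<Omega>)\<bar> \<le> real CARD('q) / 2 * (real CARD('r) / vw)"
  proof -
    have "\<bar>trace (prec v0 v \<Omega>)\<bar> \<le> real CARD('r) / v" by (rule abs_trace_prec_le[OF v0 v' R])
    also have "\<dots> \<le> real CARD('r) / vw" using v vw by (intro divide_left_mono) auto
    finally show ?thesis unfolding abs_mult by (intro mult_mono) auto
  qed
  have 3: "\<bar>((prec v0 v \<Omega> ** ?W) \<bullet> z) / (2 * sqrt v)\<bar> \<le> (?\<rho> + (norm z)\<^sup>2) / (2 * vw * sqrt vw)"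
  proof -
    have "norm ?W * norm z \<le> ?\<rho> + (norm z)\<^sup>2"
    proof -
      have "0 \<le> norm ?W * norm z" by simp
      thus ?thesis using sum_squares_bound[of "norm ?W" "norm z"] W by linarith
    qed
    hence "norm ?W * norm z / v \<le> (?\<rho> + (norm z)\<^sup>2) / vw" using v vw by (intro frac_le) auto
    hence "\<bar>(prec v0 v \<Omega> ** ?W) \<bullet> z\<bar> \<le> (?\<rho> + (norm z)\<^sup>2) / vw"
      using inner_prec_mult_le[OF v0 v' R, of ?W z] by linarith
    hence "\<bar>(prec v0 v \<Omega> ** ?W) \<bullet> z\<bar> / (2 * sqrt v) \<le> (?\<rho> + (norm z)\<^sup>2) / vw / (2 * sqrt vw)"
      using v vw by (intro frac_le) auto
    thus ?thesis using v' by (simp add: abs_divide mult_ac)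
  qed
  show ?thesis unfolding real_norm_def score_def score_bound_def using 1 2 3 by linarith
qed

lemma quad_bounded_score_bound: "quad_bounded (score_bound \<Theta>)"
proof -
  have n: "quad_bounded (\<lambda>z :: real^'q^'r. (norm z)\<^sup>2)" using quad_bounded_norm_affine[of 1 "0 :: real^'q^'r"] by simp
  have "quad_bounded (\<lambda>z :: real^'q^'r. 1 / (2 * vw\<^sup>2) * (2 * (norm \<Theta>)\<^sup>2 + (2 * vx) * (norm z)\<^sup>2) + real CARD('q) / 2 * (real CARD('r) / vw)
     + 1 / (2 * vw * sqrt vw) * ((2 * (norm \<Theta>)\<^sup>2 + (2 * vx) * (norm z)\<^sup>2) + (norm z)\<^sup>2))"
    by (intro quad_bounded_add quad_bounded_const quad_bounded_cmult n)
  thus ?thesis unfolding score_bound_def by simp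
qed

lemma score_measurable:
  assumes "0 < v" shows "(\<lambda>\<Omega>. score v W z \<Omega>) \<in> borel_measurable \<mu>"
proof -
  note [measurable] = prec_measurable[OF assms]
  show ?thesis unfolding score_def by measurable
qed

lemma avg_score:
  assumes v: "vw \<le> v" "v \<le> vx"
  shows "avg v W (score v W z) = sq v W / 2 - real CARD('q) / 2 * trace (S v W) - ((S v W ** W) \<bullet> z) / (2 * sqrt v)"
proof -
  have v': "0 < v" using v vw by simp
  note [measurable] = prec_measurable[OF v']
  have 1: "integrable \<mu> (\<lambda>\<Omega>. phi v0 v W \<Omega> *\<^sub>R (norm (prec v0 v \<Omega> ** W))\<^sup>2)"
  proof (rule integrable_phi_scaleR[OF v])
    fix \<Omega> assume "\<Omega> \<in> space \<mu>"
    thus "norm ((norm (prec v0 v \<Omega> ** W))\<^sup>2) \<le> (norm W / v)\<^sup>2"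
      using norm_prec_mult[OF v0 v' space_RR, of \<Omega> W] by (simp add: power_mono)
  qed measurable
  have 2: "integrable \<mu> (\<lambda>\<Omega>. phi v0 v W \<Omega> *\<^sub>R trace (prec v0 v \<Omega>))"
    by (rule integrable_phi_scaleR[OF v]) (measurable, unfold real_norm_def, rule abs_trace_prec_le[OF v0 v' space_RR])
  have 3: "integrable \<mu> (\<lambda>\<Omega>. phi v0 v W \<Omega> *\<^sub>R ((prec v0 v \<Omega> ** W) \<bullet> z))"
    by (rule integrable_phi_scaleR[OF v]) (measurable, unfold real_norm_def, rule inner_prec_mult_le[OF v0 v' space_RR])
  have "avg v W (score v W z) = (\<integral>\<Omega>. (1 / 2 * (phi v0 v W \<Omega> *\<^sub>R (norm (prec v0 v \<Omega> ** W))\<^sup>2) - real CARD('q) / 2 * (phi v0 v W \<Omega> *\<^sub>R trace (prec v0 v \<Omega>)))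
      - 1 / (2 * sqrt v) * (phi v0 v W \<Omega> *\<^sub>R ((prec v0 v \<Omega> ** W) \<bullet> z)) \<partial>\<mu>)"
    unfolding avg_def score_def by (rule Bochner_Integration.integral_cong[OF refl]) (simp add: algebra_simps)
  also have "\<dots> = (1 / 2 * sq v W - real CARD('q) / 2 * trace (S v W)) - 1 / (2 * sqrt v) * ((S v W ** W) \<bullet> z)"
    unfolding sq_def S_trace[OF v] S_inner[OF v] avg_def
    by (subst Bochner_Integration.integral_diff[OF Bochner_Integration.integrable_diff[OF integrable_mult_right[OF 1] integrable_mult_right[OF 2]] integrable_mult_right[OF 3]],
       subst integral_lincomb_diff[OF 1 2], subst integral_mult_right_zero) (rule refl)
  finally show ?thesis by simp
qed

lemma avg_score_bound:
  assumes v: "vw \<le> v" "v \<le> vx"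
  shows "\<bar>avg v (\<Theta> + sqrt v *\<^sub>R z) (score v (\<Theta> + sqrt v *\<^sub>R z) z)\<bar> \<le> score_bound \<Theta> z * mass v (\<Theta> + sqrt v *\<^sub>R z)"
  using norm_avg_le[OF v score_measurable score_le[OF v]] v vw by simp

lemma mass_derivative_variance:
  assumes v: "v \<in> {vw..vx}"
  shows "((\<lambda>t. mass t (\<Theta> + sqrt t *\<^sub>R z)) has_real_derivative avg v (\<Theta> + sqrt v *\<^sub>R z) (score v (\<Theta> + sqrt v *\<^sub>R z) z)) (at v within {vw..vx})"
  unfolding mass_def avg_def
proof (rule has_real_derivative_integral(2)[where B = "\<lambda>\<Omega>. (((vx / vw) ^ CARD('r)) powr (real CARD('q) / 2) * phi v0 vx (0 :: real^'q^'r) \<Omega>) * score_bound \<Theta> z"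
    and f' = "\<lambda>t \<Omega>. phi v0 t (\<Theta> + sqrt t *\<^sub>R z) \<Omega> *\<^sub>R score t (\<Theta> + sqrt t *\<^sub>R z) z \<Omega>"])
  show "vw < vx" "v \<in> {vw..vx}" using vw v by simp_all
  show "integrable \<mu> (phi v0 t (\<Theta> + sqrt t *\<^sub>R z))" if "t \<in> {vw..vx}" for t by (rule integrable_phi) (use that in auto)
  show "integrable \<mu> (\<lambda>\<Omega>. (((vx / vw) ^ CARD('r)) powr (real CARD('q) / 2) * phi v0 vx (0 :: real^'q^'r) \<Omega>) * score_bound \<Theta> z)"
    by (intro integrable_mult_left integrable_mult_right integrable_phi_vx)
  fix t \<Omega> assume t: "t \<in> {vw..vx}" and O: "\<Omega> \<in> space \<mu>"
  have t': "vw \<le> t" "t \<le> vx" "0 < t" using t vw by auto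
  note R = space_RR[OF O]
  show "((\<lambda>t. phi v0 t (\<Theta> + sqrt t *\<^sub>R z) \<Omega>) has_real_derivative phi v0 t (\<Theta> + sqrt t *\<^sub>R z) \<Omega> *\<^sub>R score t (\<Theta> + sqrt t *\<^sub>R z) z \<Omega>) (at t within {vw..vx})"
    unfolding score_def real_scaleR_def by (rule DERIV_subset[OF phi_derivative_variance[OF v0 t'(3) R] subset_UNIV])
  have p: "0 < phi v0 t (\<Theta> + sqrt t *\<^sub>R z) \<Omega>" by (rule phi_pos[OF v0 t'(3) R])
  show "\<bar>phi v0 t (\<Theta> + sqrt t *\<^sub>R z) \<Omega> *\<^sub>R score t (\<Theta> + sqrt t *\<^sub>R z) z \<Omega>\<bar> \<le> (((vx / vw) ^ CARD('r)) powr (real CARD('q) / 2) * phi v0 vx (0 :: real^'q^'r) \<Omega>) * score_bound \<Theta> z"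
    unfolding real_scaleR_def abs_mult
  proof (rule mult_mono)
    show "\<bar>phi v0 t (\<Theta> + sqrt t *\<^sub>R z) \<Omega>\<bar> \<le> ((vx / vw) ^ CARD('r)) powr (real CARD('q) / 2) * phi v0 vx (0 :: real^'q^'r) \<Omega>"
      using phi_le_vx[OF t'(1,2) O, of "\<Theta> + sqrt t *\<^sub>R z"] p by simp
    thus "0 \<le> ((vx / vw) ^ CARD('r)) powr (real CARD('q) / 2) * phi v0 vx (0 :: real^'q^'r) \<Omega>" by (rule order_trans[OF abs_ge_zero])
    show "\<bar>score t (\<Theta> + sqrt t *\<^sub>R z) z \<Omega>\<bar> \<le> score_bound \<Theta> z" using score_le[OF t'(1,2) O, of \<Theta> z] by simp
  qed simp
qed

end

lemma integral_nonpos: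
  fixes f :: "'a \<Rightarrow> real"
  assumes "\<And>x. f x \<le> 0" shows "(\<integral>x. f x \<partial>M) \<le> 0"
  using Bochner_Integration.integral_nonneg[of M "\<lambda>x. - f x"] assms by simp

lemma matnormal_std_derivative_line:
  "((\<lambda>t. matnormal 1 0 (z + t *\<^sub>R E)) has_real_derivative - (z \<bullet> E) * matnormal 1 0 (z :: real^'q^'r)) (at 0)"
proof -
  have n: "(norm (z + t *\<^sub>R E - 0))\<^sup>2 = z \<bullet> z + 2 * t * (z \<bullet> E) + t\<^sup>2 * (E \<bullet> E)" for t
    unfolding power2_norm_eq_inner by (simp add: inner_add_left inner_add_right inner_commute[of E z] power2_eq_square algebra_simps)
  have m: "matnormal 1 0 z = (2 * pi * 1) powr (- (real (CARD('q) * CARD('r)) / 2)) * exp (- (z \<bullet> z) / (2 * 1))"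
    unfolding matnormal_def power2_norm_eq_inner by simp
  show ?thesis unfolding m unfolding matnormal_def n by (rule derivative_eq_intros refl | simp)+
qed

section \<open>Stein's identity and the derivative of the expected log marginal\<close>

context precision_mixture
begin

text \<open>Minus the derivative of the log marginal along E. By Tweedie's formula v times this is
  the component along E of W minus the posterior mean of \<Theta>.\<close>

definition mean_diff where "mean_diff v W E = (S v W ** W) \<bullet> E / mass v W"
definition mean_diff' where
  "mean_diff' v W E = ((S v W ** E) \<bullet> E - sqE v W E) / mass v W + ((S v W ** W) \<bullet> E)\<^sup>2 / (mass v W)\<^sup>2"

lemma mean_diff_derivative:
  assumes v: "vw \<le> v" "v \<le> vx"
  shows "((\<lambda>t. mean_diff v (W + t *\<^sub>R E) E) has_real_derivative mean_diff' v W E) (at 0)"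
proof -
  have m: "mass v W \<noteq> 0" using mass_pos[OF v, of W] by simp
  have "((\<lambda>t. (S v (W + t *\<^sub>R E) ** (W + t *\<^sub>R E)) \<bullet> E / mass v (W + t *\<^sub>R E)) has_real_derivative
     (((S v W ** E) \<bullet> E - sqE v W E) * mass v (W + 0 *\<^sub>R E) - (S v (W + 0 *\<^sub>R E) ** (W + 0 *\<^sub>R E)) \<bullet> E * (- ((S v W ** W) \<bullet> E))) / (mass v (W + 0 *\<^sub>R E) * mass v (W + 0 *\<^sub>R E))) (at 0)"
    by (rule DERIV_divide[OF S_derivative_line[OF v] mass_derivative_line[OF v]]) (use m in simp)
  thus ?thesis unfolding mean_diff_def
    by (rule DERIV_cong) (use m in \<open>simp add: mean_diff'_def add_divide_distrib power2_eq_square\<close>)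
qed

lemma mean_diff_bound:
  assumes v: "vw \<le> v" "v \<le> vx" shows "\<bar>mean_diff v W E\<bar> \<le> norm W * norm E / v"
proof -
  have m: "0 < mass v W" by (rule mass_pos[OF v])
  show ?thesis using S_inner_bound[OF v, of W W E] m by (simp add: mean_diff_def abs_divide divide_le_eq)
qed

lemma mean_diff_measurable:
  assumes v: "vw \<le> v" "v \<le> vx"
  shows "(\<lambda>W. mean_diff v W E) \<in> borel_measurable borel" and "(\<lambda>W. mean_diff' v W E) \<in> borel_measurable borel"
proof -
  have v': "0 < v" using v vw by simp
  note [measurable] = mass_measurable[OF v'] sq_measurable[OF v]
    S_inner_measurable[OF v, of "\<lambda>W. W" "\<lambda>_. E"] S_inner_measurable[OF v, of "\<lambda>_. E" "\<lambda>_. E"]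
  show "(\<lambda>W. mean_diff v W E) \<in> borel_measurable borel" unfolding mean_diff_def by measurable
  show "(\<lambda>W. mean_diff' v W E) \<in> borel_measurable borel" unfolding mean_diff'_def by measurable
qed

lemma quad_bounded_mean_diff':
  assumes v: "vw \<le> v" "v \<le> vx" shows "quad_bounded (\<lambda>W. mean_diff' v W E)"
proof (rule quad_boundedI[OF mean_diff_measurable(2)[OF v]])
  fix W
  let ?c = "norm E * norm E / v" and ?d = "(norm E / v)\<^sup>2"
  have v': "0 < v" using v vw by simp
  have m: "0 < mass v W" by (rule mass_pos[OF v])
  have "\<bar>(S v W ** E) \<bullet> E\<bar> / mass v W \<le> ?c" using S_inner_bound[OF v, of W E E] m by (simp add: divide_le_eq)
  moreover have "\<bar>sqE v W E\<bar> / mass v W \<le> ?d * (norm W)\<^sup>2"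
    using sqE_bound[OF v, of W E] m by (simp add: divide_le_eq power_mult_distrib power_divide mult_ac)
  moreover have "((S v W ** W) \<bullet> E)\<^sup>2 / (mass v W)\<^sup>2 \<le> ?d * (norm W)\<^sup>2"
  proof -
    have "\<bar>mean_diff v W E\<bar>\<^sup>2 \<le> (norm W * norm E / v)\<^sup>2" by (rule power_mono[OF mean_diff_bound[OF v]]) simp
    thus ?thesis by (simp add: mean_diff_def power_divide power_mult_distrib mult_ac)
  qed
  moreover have "\<bar>mean_diff' v W E\<bar> \<le> \<bar>(S v W ** E) \<bullet> E\<bar> / mass v W + \<bar>sqE v W E\<bar> / mass v W + ((S v W ** W) \<bullet> E)\<^sup>2 / (mass v W)\<^sup>2"
  proof -
    let ?x = "(S v W ** E) \<bullet> E / mass v W" and ?y = "sqE v W E / mass v W" and ?u = "((S v W ** W) \<bullet> E)\<^sup>2 / (mass v W)\<^sup>2"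
    have "mean_diff' v W E = ?x - ?y + ?u" by (simp only: mean_diff'_def diff_divide_distrib)
    moreover have "\<bar>?x\<bar> = \<bar>(S v W ** E) \<bullet> E\<bar> / mass v W" "\<bar>?y\<bar> = \<bar>sqE v W E\<bar> / mass v W" using m by (simp_all add: abs_divide)
    moreover have "0 \<le> ?u" by simp
    ultimately show ?thesis by linarith
  qed
  ultimately have "\<bar>mean_diff' v W E\<bar> \<le> ?c + 2 * (?d * (norm W)\<^sup>2)" by linarith
  also have "\<dots> \<le> (?c + 2 * ?d) * (1 + (norm W)\<^sup>2)"
  proof -
    have "0 \<le> ?c * (norm W)\<^sup>2" "0 \<le> ?d" using v' by simp_all
    thus ?thesis unfolding distrib_right distrib_left mult_1_right mult.assoc by linarith
  qed
  finally show "\<bar>mean_diff' v W E\<bar> \<le> (?c + 2 * ?d) * (1 + (norm W)\<^sup>2)" .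
qed

lemma quad_bounded_mean_diff:
  assumes v: "vw \<le> v" "v \<le> vx"
  shows "quad_bounded (\<lambda>z. (z \<bullet> E) * mean_diff v (\<Theta> + sqrt v *\<^sub>R z) E)" and "quad_bounded (\<lambda>z. mean_diff v (\<Theta> + sqrt v *\<^sub>R z) E)"
proof -
  have v': "0 < v" using v vw by simp
  note [measurable] = mean_diff_measurable(1)[OF v]
  have b: "\<bar>mean_diff v (\<Theta> + sqrt v *\<^sub>R z) E\<bar> \<le> norm E / v * norm (sqrt v *\<^sub>R z + \<Theta>)" for z
    using mean_diff_bound[OF v, of "\<Theta> + sqrt v *\<^sub>R z" E] by (simp add: mult_ac add.commute)
  have m: "(\<lambda>z. mean_diff v (\<Theta> + sqrt v *\<^sub>R z) E) \<in> borel_measurable borel" by measurable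
  have e: "\<bar>z \<bullet> E\<bar> \<le> norm E * norm (1 *\<^sub>R z + 0)" for z using Cauchy_Schwarz_ineq2[of z E] by (simp add: mult.commute)
  show "quad_bounded (\<lambda>z. (z \<bullet> E) * mean_diff v (\<Theta> + sqrt v *\<^sub>R z) E)"
    by (rule quad_bounded_mult[OF _ m e b]) (use v' in simp_all)
  have n: "quad_bounded (\<lambda>z. norm E / v * ((norm (sqrt v *\<^sub>R z + \<Theta>))\<^sup>2 + 1))"
    by (intro quad_bounded_cmult quad_bounded_add quad_bounded_norm_affine quad_bounded_const)
  obtain C where C: "\<And>z. \<bar>norm E / v * ((norm (sqrt v *\<^sub>R z + \<Theta>))\<^sup>2 + 1)\<bar> \<le> C * (1 + (norm z)\<^sup>2)"
    using n by (rule quad_boundedE) blast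
  show "quad_bounded (\<lambda>z. mean_diff v (\<Theta> + sqrt v *\<^sub>R z) E)"
  proof (rule quad_boundedI[OF m])
    fix z
    let ?x = "norm (sqrt v *\<^sub>R z + \<Theta>)"
    have "0 \<le> (?x - 1)\<^sup>2" by simp
    hence "?x \<le> ?x\<^sup>2 + 1" unfolding power2_diff power_one mult_1_right using zero_le_power2[of ?x] norm_ge_zero[of "sqrt v *\<^sub>R z + \<Theta>"] by linarith
    hence "norm E / v * ?x \<le> norm E / v * (?x\<^sup>2 + 1)" using v' by (intro mult_left_mono) auto
    thus "\<bar>mean_diff v (\<Theta> + sqrt v *\<^sub>R z) E\<bar> \<le> C * (1 + (norm z)\<^sup>2)"
      using b[of z] C[of z] abs_ge_self[of "norm E / v * (?x\<^sup>2 + 1)"] by linarith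
  qed
qed

lemma quad_bounded_mean_diff'_affine:
  assumes v: "vw \<le> v" "v \<le> vx" shows "quad_bounded (\<lambda>z. mean_diff' v (\<Theta> + sqrt v *\<^sub>R z) E)"
  using quad_bounded_affine[OF quad_bounded_mean_diff'[OF v], of "sqrt v" \<Theta> E] by (simp add: add.commute)

text \<open>Integration by parts against the standard normal weight, whose derivative along E brings
  out the factor - (z \<bullet> E); the factor sqrt v is the chain rule for \<Theta> + sqrt v
  z.\<close>

lemma Stein_identity:
  fixes E :: "real^'q^'r"
  assumes v: "vw \<le> v" "v \<le> vx"
  shows "(\<integral>z. matnormal 1 0 z * ((z \<bullet> E) * mean_diff v (\<Theta> + sqrt v *\<^sub>R z) E) \<partial>lborel)
     = sqrt v * (\<integral>z. matnormal 1 0 z * mean_diff' v (\<Theta> + sqrt v *\<^sub>R z) E \<partial>lborel)"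
proof -
  let ?W = "\<lambda>z. \<Theta> + sqrt v *\<^sub>R z"
  let ?F' = "\<lambda>z. sqrt v * (matnormal 1 0 z * mean_diff' v (?W z) E) - 1 * (matnormal 1 0 z * ((z \<bullet> E) * mean_diff v (?W z) E))"
  have i1: "integrable lborel (\<lambda>z. matnormal 1 0 z * mean_diff v (?W z) E)"
    and i2: "integrable lborel (\<lambda>z. matnormal 1 0 z * ((z \<bullet> E) * mean_diff v (?W z) E))"
    and i3: "integrable lborel (\<lambda>z. matnormal 1 0 z * mean_diff' v (?W z) E)"
    by (rule integrable_matnormal_quad, simp, rule quad_bounded_mean_diff quad_bounded_mean_diff'_affine, rule v, rule v)+
  have "(\<integral>z. ?F' z \<partial>lborel) = 0"
  proof (rule integral_directional_derivative_zero[where e = E and F = "\<lambda>z. matnormal 1 0 z * mean_diff v (?W z) E"])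
    show "integrable lborel (\<lambda>z. matnormal 1 0 z * mean_diff v (?W z) E)" by (rule i1)
    show "integrable lborel ?F'" by (intro Bochner_Integration.integrable_diff integrable_mult_right i2 i3)
    fix z
    have "((\<lambda>t. mean_diff v (?W z + (sqrt v * t) *\<^sub>R E) E) has_real_derivative mean_diff' v (?W z) E * (sqrt v * 1)) (at 0)"
    proof (rule DERIV_chain2[where f = "\<lambda>s. mean_diff v (?W z + s *\<^sub>R E) E"])
      show "((\<lambda>s. mean_diff v (?W z + s *\<^sub>R E) E) has_real_derivative mean_diff' v (?W z) E) (at (sqrt v * 0))"
        using mean_diff_derivative[OF v, of "?W z" E] by simp
      show "((\<lambda>t. sqrt v * t) has_real_derivative sqrt v * 1) (at 0)" by (rule DERIV_cmult[OF DERIV_ident])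
    qed
    moreover have "?W z + (sqrt v * t) *\<^sub>R E = ?W (z + t *\<^sub>R E)" for t by (simp add: scaleR_add_right)
    ultimately have d: "((\<lambda>t. mean_diff v (?W (z + t *\<^sub>R E)) E) has_real_derivative mean_diff' v (?W z) E * (sqrt v * 1)) (at 0)" by simp
    show "((\<lambda>t. matnormal 1 0 (z + t *\<^sub>R E) * mean_diff v (?W (z + t *\<^sub>R E)) E) has_real_derivative ?F' z) (at 0)"
      by (rule DERIV_cong[OF DERIV_mult'[OF matnormal_std_derivative_line d]]) (simp add: algebra_simps)
  qed
  thus ?thesis unfolding integral_lincomb_diff[OF i3 i2] by simp
qed

definition avg_ln where
  "avg_ln \<Theta> v = (\<integral>z. matnormal 1 0 z * ln (mass v (\<Theta> + sqrt v *\<^sub>R z)) \<partial>lborel)"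

definition avg_ln' where
  "avg_ln' \<Theta> v = (\<integral>z. matnormal 1 0 z * (avg v (\<Theta> + sqrt v *\<^sub>R z) (score v (\<Theta> + sqrt v *\<^sub>R z) z) / mass v (\<Theta> + sqrt v *\<^sub>R z)) \<partial>lborel)"

lemma score_ratio_bound:
  assumes v: "vw \<le> v" "v \<le> vx"
  shows "\<bar>avg v (\<Theta> + sqrt v *\<^sub>R z) (score v (\<Theta> + sqrt v *\<^sub>R z) z) / mass v (\<Theta> + sqrt v *\<^sub>R z)\<bar> \<le> score_bound \<Theta> z"
  using avg_score_bound[OF v, of \<Theta> z] mass_pos[OF v, of "\<Theta> + sqrt v *\<^sub>R z"] by (simp add: abs_divide divide_le_eq)

lemma avg_ln_derivative:
  assumes v: "v \<in> {vw..vx}"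
  shows "(avg_ln \<Theta> has_real_derivative avg_ln' \<Theta> v) (at v within {vw..vx})"
proof -
  have "((\<lambda>t. \<integral>z. matnormal 1 0 z * ln (mass t (\<Theta> + sqrt t *\<^sub>R z)) \<partial>lborel) has_real_derivative avg_ln' \<Theta> v) (at v within {vw..vx})"
    unfolding avg_ln'_def
  proof (rule has_real_derivative_integral(2)[where B = "\<lambda>z. matnormal 1 0 z * score_bound \<Theta> z"
      and f' = "\<lambda>v z. matnormal 1 0 z * (avg v (\<Theta> + sqrt v *\<^sub>R z) (score v (\<Theta> + sqrt v *\<^sub>R z) z) / mass v (\<Theta> + sqrt v *\<^sub>R z))"])
    show "vw < vx" "v \<in> {vw..vx}" using vw v by simp_all
    show "integrable lborel (\<lambda>z. matnormal 1 0 z * score_bound \<Theta> z)"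
      by (rule integrable_matnormal_quad[OF _ quad_bounded_score_bound]) simp
    fix t assume t: "t \<in> {vw..vx}"
    hence t': "vw \<le> t" "t \<le> vx" by auto
    show "integrable lborel (\<lambda>z. matnormal 1 0 z * ln (mass t (\<Theta> + sqrt t *\<^sub>R z)))"
    proof (rule integrable_matnormal_quad)
      show "quad_bounded (\<lambda>z. ln (mass t (\<Theta> + sqrt t *\<^sub>R z)))"
        using quad_bounded_affine[OF quad_bounded_ln_mass[OF t'], of "sqrt t" \<Theta>] by (simp add: add.commute)
    qed simp
    fix z :: "real^'q^'r"
    have m: "0 < mass t (\<Theta> + sqrt t *\<^sub>R z)" by (rule mass_pos[OF t'])
    note DERIV_chain2[OF DERIV_ln_divide[OF m] mass_derivative_variance[OF t]]
    from DERIV_cmult[OF this, of "matnormal 1 0 z"]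
    show "((\<lambda>t. matnormal 1 0 z * ln (mass t (\<Theta> + sqrt t *\<^sub>R z))) has_real_derivative matnormal 1 0 z * (avg t (\<Theta> + sqrt t *\<^sub>R z) (score t (\<Theta> + sqrt t *\<^sub>R z) z) / mass t (\<Theta> + sqrt t *\<^sub>R z))) (at t within {vw..vx})"
      by (rule DERIV_cong) simp
    show "\<bar>matnormal 1 0 z * (avg t (\<Theta> + sqrt t *\<^sub>R z) (score t (\<Theta> + sqrt t *\<^sub>R z) z) / mass t (\<Theta> + sqrt t *\<^sub>R z))\<bar> \<le> matnormal 1 0 z * score_bound \<Theta> z"
      unfolding abs_mult abs_of_nonneg[OF matnormal_nonneg] by (rule mult_left_mono[OF score_ratio_bound[OF t'] matnormal_nonneg])
  qed
  thus ?thesis unfolding avg_ln_def .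
qed

text \<open>Stein's identity replaces the part of the score that is linear in z by derivatives of S
  W / m. Together with the heat-equation part this leaves the mean of (2 m Lap m - |grad m|^2) / (2
  m^2), that is, of 2 Lap sqrt m / sqrt m.\<close>

lemma avg_ln'_eq:
  assumes v: "vw \<le> v" "v \<le> vx"
  shows "avg_ln' \<Theta> v = (\<integral>z. matnormal 1 0 z * (let W = \<Theta> + sqrt v *\<^sub>R z in
      (sq v W - real CARD('q) * trace (S v W)) / mass v W - (norm (S v W ** W))\<^sup>2 / (2 * (mass v W)\<^sup>2)) \<partial>lborel)"
proof -
  have v': "0 < v" using v vw by simp
  let ?W = "\<lambda>z. \<Theta> + sqrt v *\<^sub>R z" and ?N = "\<lambda>z :: real^'q^'r. matnormal 1 0 z"
  define k where "k W = (sq v W / 2 - real CARD('q) / 2 * trace (S v W)) / mass v W" for W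
  have q1: "quad_bounded (\<lambda>z. (z \<bullet> E) * mean_diff v (?W z) E)" and q2: "quad_bounded (\<lambda>z. mean_diff' v (?W z) E)" for E
    by (rule quad_bounded_mean_diff[OF v], rule quad_bounded_mean_diff'_affine[OF v])
  have i1: "integrable lborel (\<lambda>z. ?N z * ((z \<bullet> E) * mean_diff v (?W z) E))" and i2: "integrable lborel (\<lambda>z. ?N z * mean_diff' v (?W z) E)" for E
    by (rule integrable_matnormal_quad[OF _ q1], simp, rule integrable_matnormal_quad[OF _ q2], simp)
  \<comment> \<open>Both sides of Stein's identity summed over the basis: \<open>?A\<close> collects
    the inner product of S W / m with z, and \<open>?B\<close> minus the Laplacian of the log
    marginal.\<close>
  let ?A = "\<lambda>z. \<Sum>E\<in>Basis. ?N z * ((z \<bullet> E) * mean_diff v (?W z) E)" and ?B = "\<lambda>z. \<Sum>E\<in>Basis. ?N z * mean_diff' v (?W z) E"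
  have iA: "integrable lborel ?A" and iB: "integrable lborel ?B" by (intro Bochner_Integration.integrable_sum i1 i2)+
  have AB: "(\<integral>z. ?A z \<partial>lborel) = sqrt v * (\<integral>z. ?B z \<partial>lborel)"
    unfolding Bochner_Integration.integral_sum[OF i1] Bochner_Integration.integral_sum[OF i2] Stein_identity[OF v] sum_distrib_left ..
  have A: "?A z = ?N z * (((S v (?W z) ** ?W z) \<bullet> z) / mass v (?W z))" for z
  proof -
    have "(\<Sum>E\<in>Basis. (z \<bullet> E) * mean_diff v (?W z) E) = (\<Sum>E\<in>Basis. ((S v (?W z) ** ?W z) \<bullet> E) * (z \<bullet> E)) / mass v (?W z)"
      unfolding mean_diff_def sum_divide_distrib by (rule sum.cong[OF refl]) simp
    also have "(\<Sum>E\<in>Basis. ((S v (?W z) ** ?W z) \<bullet> E) * (z \<bullet> E)) = (S v (?W z) ** ?W z) \<bullet> z" by (rule euclidean_inner[symmetric])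
    finally show ?thesis by (simp only: sum_distrib_left[symmetric])
  qed
  have B: "?B z = ?N z * ((real CARD('q) * trace (S v (?W z)) - sq v (?W z)) / mass v (?W z) + (norm (S v (?W z) ** ?W z))\<^sup>2 / (mass v (?W z))\<^sup>2)" for z
  proof -
    have "(norm (S v (?W z) ** ?W z))\<^sup>2 = (\<Sum>E\<in>Basis. ((S v (?W z) ** ?W z) \<bullet> E) * ((S v (?W z) ** ?W z) \<bullet> E))"
      unfolding power2_norm_eq_inner by (rule euclidean_inner)
    hence "(\<Sum>E\<in>Basis. mean_diff' v (?W z) E) = (real CARD('q) * trace (S v (?W z)) - sq v (?W z)) / mass v (?W z) + (norm (S v (?W z) ** ?W z))\<^sup>2 / (mass v (?W z))\<^sup>2"
      unfolding mean_diff'_def sum.distrib sum_divide_distrib[symmetric] sum_subtractf sum_Basis_matrix_mult sum_sqE[OF v]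
      by (simp add: power2_eq_square)
    thus ?thesis by (simp only: sum_distrib_left[symmetric])
  qed
  have iS: "integrable lborel (\<lambda>z. ?N z * k (?W z))"
  proof (rule integrable_matnormal_quad)
    note [measurable] = mass_measurable[OF v'] sq_measurable(1)[OF v] S_trace_measurable[OF v]
    have km: "k \<in> borel_measurable borel" unfolding k_def by measurable
    have "quad_bounded k"
    proof (rule quad_boundedI[OF km])
      fix W
      let ?a = "real CARD('q) / 2 * (real CARD('r) / v)" and ?b = "1 / (2 * v\<^sup>2)"
      have m: "0 < mass v W" by (rule mass_pos[OF v])
      have 1: "\<bar>sq v W / mass v W\<bar> \<le> (norm W)\<^sup>2 / v\<^sup>2"
        using sq_bound[OF v, of W] m by (simp add: abs_divide divide_le_eq power_divide)
      have 2: "\<bar>trace (S v W) / mass v W\<bar> \<le> real CARD('r) / v"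
        using S_trace_bound[OF v, of W] m by (simp add: abs_divide divide_le_eq)
      have 3: "\<bar>real CARD('q) / 2 * (trace (S v W) / mass v W)\<bar> \<le> ?a" unfolding abs_mult by (rule mult_mono[OF _ 2]) simp_all
      have 4: "\<bar>sq v W / mass v W / 2\<bar> \<le> ?b * (norm W)\<^sup>2" using 1 by simp
      have "k W = sq v W / mass v W / 2 - real CARD('q) / 2 * (trace (S v W) / mass v W)"
        by (simp add: k_def diff_divide_distrib)
      hence "\<bar>k W\<bar> \<le> ?b * (norm W)\<^sup>2 + ?a" using 3 4 by linarith
      also have "\<dots> \<le> (?a + ?b) * (1 + (norm W)\<^sup>2)"
      proof -
        have "0 \<le> ?a * (norm W)\<^sup>2" "0 \<le> ?b" using v' by simp_all
        thus ?thesis unfolding distrib_right distrib_left mult_1_right by linarith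
      qed
      finally show "\<bar>k W\<bar> \<le> (?a + ?b) * (1 + (norm W)\<^sup>2)" .
    qed
    from quad_bounded_affine[OF this, of "sqrt v" \<Theta>] show "quad_bounded (\<lambda>z. k (?W z))" by (simp add: add.commute)
  qed simp
  have "avg_ln' \<Theta> v = (\<integral>z. 1 * (?N z * k (?W z)) - 1 / (2 * sqrt v) * ?A z \<partial>lborel)"
    unfolding avg_ln'_def
  proof (rule Bochner_Integration.integral_cong[OF refl])
    fix z :: "real^'q^'r"
    have "avg v (?W z) (score v (?W z) z) / mass v (?W z) = k (?W z) - 1 / (2 * sqrt v) * (((S v (?W z) ** ?W z) \<bullet> z) / mass v (?W z))"
      unfolding avg_score[OF v] k_def by (simp only: diff_divide_distrib) (simp add: mult_ac)
    thus "?N z * (avg v (?W z) (score v (?W z) z) / mass v (?W z)) = 1 * (?N z * k (?W z)) - 1 / (2 * sqrt v) * ?A z"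
      unfolding A by (simp add: right_diff_distrib mult_ac)
  qed
  also have "\<dots> = 1 * (\<integral>z. ?N z * k (?W z) \<partial>lborel) - 1 / (2 * sqrt v) * (\<integral>z. ?A z \<partial>lborel)" by (rule integral_lincomb_diff[OF iS iA])
  also have "\<dots> = 1 * (\<integral>z. ?N z * k (?W z) \<partial>lborel) - 1 / 2 * (\<integral>z. ?B z \<partial>lborel)" unfolding AB using v' by simp
  also have "\<dots> = (\<integral>z. 1 * (?N z * k (?W z)) - 1 / 2 * ?B z \<partial>lborel)" by (rule integral_lincomb_diff[OF iS iB, symmetric])
  also have "\<dots> = (\<integral>z. ?N z * (let W = ?W z in
      (sq v W - real CARD('q) * trace (S v W)) / mass v W - (norm (S v W ** W))\<^sup>2 / (2 * (mass v W)\<^sup>2)) \<partial>lborel)"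
  proof (rule Bochner_Integration.integral_cong[OF refl])
    fix z :: "real^'q^'r"
    have m: "mass v (?W z) \<noteq> 0" using mass_pos[OF v, of "?W z"] by simp
    show "1 * (?N z * k (?W z)) - 1 / 2 * ?B z = ?N z * (let W = ?W z in
      (sq v W - real CARD('q) * trace (S v W)) / mass v W - (norm (S v W ** W))\<^sup>2 / (2 * (mass v W)\<^sup>2))"
      unfolding B k_def Let_def by (simp add: add_divide_distrib diff_divide_distrib right_diff_distrib distrib_left)
  qed
  finally show ?thesis .
qed

text \<open>By hypothesis the integrand of the derivative is nonpositive at every point. One-sided
  derivatives at the ends give continuity on the closed interval, so the endpoint values can be
  compared.\<close>

theorem avg_ln_antimono:
  assumes key: "\<And>v W. vw \<le> v \<Longrightarrow> v \<le> vx \<Longrightarrow> mass v W * (2 * sq v W - 2 * real CARD('q) * trace (S v W)) - (norm (S v W ** W))\<^sup>2 \<le> 0"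
  shows "(\<integral>W. matnormal vx \<Theta> W * ln (mass vx W) \<partial>lborel) \<le> (\<integral>W. matnormal vw \<Theta> W * ln (mass vw W) \<partial>lborel)"
proof -
  have le: "avg_ln' \<Theta> v \<le> 0" if v: "vw \<le> v" "v \<le> vx" for v
  proof -
    have k: "(let W = \<Theta> + sqrt v *\<^sub>R z in (sq v W - real CARD('q) * trace (S v W)) / mass v W - (norm (S v W ** W))\<^sup>2 / (2 * (mass v W)\<^sup>2)) \<le> 0" for z
    proof -
      define W where "W = \<Theta> + sqrt v *\<^sub>R z"
      have m: "0 < mass v W" by (rule mass_pos[OF v])
      have "(sq v W - real CARD('q) * trace (S v W)) / mass v W - (norm (S v W ** W))\<^sup>2 / (2 * (mass v W)\<^sup>2)
         = (mass v W * (2 * sq v W - 2 * real CARD('q) * trace (S v W)) - (norm (S v W ** W))\<^sup>2) / (2 * (mass v W)\<^sup>2)"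
        using m by (simp add: field_simps power2_eq_square)
      also have "\<dots> \<le> 0" by (rule divide_nonpos_nonneg[OF key[OF v]]) simp
      finally show ?thesis unfolding Let_def W_def .
    qed
    show ?thesis unfolding avg_ln'_eq[OF v]
      by (rule integral_nonpos) (rule mult_nonneg_nonpos[OF matnormal_nonneg k])
  qed
  have "avg_ln \<Theta> vx \<le> avg_ln \<Theta> vw"
  proof (rule DERIV_nonpos_imp_decreasing_open[where f = "avg_ln \<Theta>"])
    show "vw \<le> vx" using vw by simp
    show "\<exists>y. (avg_ln \<Theta> has_real_derivative y) (at v) \<and> y \<le> 0" if "vw < v" "v < vx" for v
      using avg_ln_derivative[of v \<Theta>] le[of v] that by (auto simp: at_within_Icc_at)
    show "continuous_on {vw..vx} (avg_ln \<Theta>)" by (rule DERIV_continuous_on[OF avg_ln_derivative])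
  qed
  moreover have "(\<integral>W. matnormal v \<Theta> W * ln (mass v W) \<partial>lborel) = avg_ln \<Theta> v" if "vw \<le> v" "v \<le> vx" for v
    unfolding avg_ln_def using that vw by (intro integral_matnormal_scale quad_bounded_ln_mass) auto
  ultimately show ?thesis using vw by simp
qed

end

context precision_mixture
begin

text \<open>An average of positive definite matrices with positive weights over a nonzero measure.
  It is needed because the congruence flow generated by M contracts only for positive definite
  M.\<close>

lemma S_pos_def:
  assumes v: "vw \<le> v" "v \<le> vx" shows "pos_def (S v W)"
  unfolding pos_def_def
proof (intro conjI allI impI)
  have v': "0 < v" using v vw by simp
  note [measurable] = prec_measurable[OF v']
  have P: "pos_def (prec v0 v \<Omega>)" if O: "\<Omega> \<in> space \<mu>" for \<Omega>
  proof -
    obtain U a where U: "orthogonal_matrix U" and a: "\<And>i. 0 < a i" and p: "\<And>v. 0 < v \<Longrightarrow> prec v0 v \<Omega> = spmat U (\<lambda>i. 1 / (v + a i))"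
      by (rule RR_prec_obtain[OF space_RR[OF O] v0]) blast
    show ?thesis unfolding p[OF v'] pos_def_spmat[OF U] using a v' by (simp add: add_pos_pos)
  qed
  have "S v W $ i $ j = S v W $ j $ i" for i j
  proof -
    have b: "bounded_linear (\<lambda>A :: real^'r^'r. A $ i $ j)" for i j
      by (rule bounded_linear_compose[OF bounded_linear_vec_nth bounded_linear_vec_nth])
    show ?thesis unfolding S_linear[OF v b] avg_def
    proof (rule Bochner_Integration.integral_cong[OF refl])
      fix \<Omega> assume "\<Omega> \<in> space \<mu>"
      hence "transpose (prec v0 v \<Omega>) = prec v0 v \<Omega>" using P unfolding pos_def_def by blast
      thus "phi v0 v W \<Omega> *\<^sub>R prec v0 v \<Omega> $ i $ j = phi v0 v W \<Omega> *\<^sub>R prec v0 v \<Omega> $ j $ i" by (simp only: transpose_eq_nth[of "prec v0 v \<Omega>" i j])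
    qed
  qed
  thus "transpose (S v W) = S v W" by (simp add: vec_eq_iff transpose_def)
  fix x :: "real^'r" assume x: "x \<noteq> 0"
  have bl: "bounded_linear (\<lambda>A :: real^'r^'r. x \<bullet> (A *v x))"
    by (rule bounded_linear_compose[OF bounded_linear_inner_right])
      (simp add: linear_conv_bounded_linear[symmetric] linear_iff matrix_vector_mult_add_rdistrib scaleR_matrix_vector_assoc)
  let ?h = "\<lambda>\<Omega>. x \<bullet> (prec v0 v \<Omega> *v x)"
  have e: "x \<bullet> (S v W *v x) = avg v W ?h" by (rule S_linear[OF v bl])
  have i: "integrable \<mu> (\<lambda>\<Omega>. phi v0 v W \<Omega> *\<^sub>R ?h \<Omega>)"
    using integrable_bounded_linear[OF bl integrable_phi_prec[OF v]]
    by (simp add: linear_scale[OF bounded_linear.linear[OF bl]])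
  have p: "0 < phi v0 v W \<Omega> *\<^sub>R ?h \<Omega>" if O: "\<Omega> \<in> space \<mu>" for \<Omega>
    unfolding real_scaleR_def
  proof (rule mult_pos_pos[OF phi_pos[OF v0 v' space_RR[OF O]]])
    show "0 < ?h \<Omega>" using P[OF O] x unfolding pos_def_def by blast
  qed
  have "0 \<le> avg v W ?h" unfolding avg_def by (rule Bochner_Integration.integral_nonneg) (use p in \<open>simp add: less_imp_le\<close>)
  moreover have "avg v W ?h \<noteq> 0"
  proof
    assume "avg v W ?h = 0"
    hence "AE \<Omega> in \<mu>. phi v0 v W \<Omega> *\<^sub>R ?h \<Omega> = 0" unfolding avg_def
      by (subst (asm) integral_nonneg_eq_0_iff_AE[OF i]) (use p in \<open>auto intro!: AE_I2 simp: less_imp_le\<close>)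
    hence "AE \<Omega> in \<mu>. False" using AE_space
    proof eventually_elim
      case (elim \<Omega>)
      show False using p[OF elim(2)] unfolding elim(1) by simp
    qed
    thus False using nonzero by (simp add: AE_iff_null null_sets_def)
  qed
  ultimately show "0 < x \<bullet> (S v W *v x)" unfolding e by simp
qed

end

section \<open>The hierarchical prior\<close>

text \<open>In the variable \<Lambda> the precision matrix is \<Lambda> / v, which is the purpose of
  the substitution. On eigenvalues it rests on v0 (b + c d) + (v - v0) d = v for b = v / v0 and c =
  1 - v / v0.\<close>

lemma prec_mob:
  fixes A :: "real^'r^'r"
  assumes v: "0 < v" "v \<le> v0" and A: "A \<in> RR"
  shows "prec v0 v (mob (v / v0) (1 - v / v0) A) = (1 / v) *\<^sub>R A"
proof -
  obtain U d where U: "orthogonal_matrix U" and Ad: "A = spmat U d" and d: "\<And>i. 0 < d i" "\<And>i. d i < 1" by (rule RR_obtain[OF A]) blast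
  let ?b = "v / v0" and ?c = "1 - v / v0"
  have b: "0 < ?b" "0 \<le> ?c" and v0: "0 < v0" using v by (auto simp: field_simps)
  have p: "0 < ?b + ?c * d i" for i
    by (rule add_pos_nonneg[OF b(1) mult_nonneg_nonneg[OF b(2) less_imp_le[OF d(1)]]])
  have nz: "?b + ?c * d i \<noteq> 0" for i using p[of i] by linarith
  have e: "v0 + (v - v0) * (d i / (?b + ?c * d i)) = v / (?b + ?c * d i)" for i
  proof -
    have "v0 * (?b + ?c * d i) + (v - v0) * d i = v" using v0 by (simp add: field_simps)
    hence "(v0 * (?b + ?c * d i) + (v - v0) * d i) / (?b + ?c * d i) = v / (?b + ?c * d i)" by simp
    moreover have "(v0 * (?b + ?c * d i) + (v - v0) * d i) / (?b + ?c * d i) = v0 + (v - v0) * (d i / (?b + ?c * d i))"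
      using nz[of i] by (simp only: add_divide_distrib nonzero_mult_div_cancel_right times_divide_eq_right not_False_eq_True)
    ultimately show ?thesis by simp
  qed
  have nz': "v0 + (v - v0) * (d i / (?b + ?c * d i)) \<noteq> 0" for i unfolding e using v p[of i] by simp
  have q: "d i / (?b + ?c * d i) / (v / (?b + ?c * d i)) = 1 / v * d i" for i using nz[of i] by (simp add: divide_divide_eq_left divide_divide_eq_right)
  show ?thesis unfolding prec_def Ad mob_spmat[OF U nz] mob_spmat[OF U nz'] spmat_scaleR unfolding e q ..
qed

text \<open>\<open>f_pi\<close> is the pull-back of \<pi>2 times \<open>phi\<close> under the
  substitution, Jacobian included. The powers of v in the normalising constant come from the
  determinant of \<Lambda> / v.\<close>

lemma f_pi_eq_phi_mob:
  fixes A :: "real^'r^'r" and W :: "real^'q^'r"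
  assumes v: "0 < v" "v \<le> v0" and A: "A \<in> RR"
  shows "f_pi v0 v \<pi>2 W A = mob_jac (v / v0) (1 - v / v0) A * (\<pi>2 (mob (v / v0) (1 - v / v0) A) * phi v0 v W (mob (v / v0) (1 - v / v0) A))"
proof -
  let ?k = "real (CARD('q) * CARD('r)) / 2"
  have dA: "0 < det A"
  proof -
    obtain U d where U: "orthogonal_matrix U" and Ad: "A = spmat U d" and d: "\<And>i. 0 < d i" "\<And>i. d i < 1" by (rule RR_obtain[OF A]) blast
    show ?thesis unfolding Ad det_spmat[OF U] by (intro prod_pos) (simp add: d)
  qed
  have "det ((1 / v) *\<^sub>R A) powr (real CARD('q) / 2) = ((1 / v) ^ CARD('r)) powr (real CARD('q) / 2) * det A powr (real CARD('q) / 2)"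
    unfolding det_scaleR by (rule powr_mult)
  also have "((1 / v) ^ CARD('r)) powr (real CARD('q) / 2) = v powr (- ?k)"
  proof -
    have "((1 / v) ^ CARD('r)) = v powr (- real CARD('r))" using v by (simp add: powr_minus powr_realpow power_divide divide_inverse power_inverse)
    thus ?thesis by (simp add: powr_powr mult.commute)
  qed
  finally have 1: "det ((1 / v) *\<^sub>R A) powr (real CARD('q) / 2) = v powr (- ?k) * det A powr (real CARD('q) / 2)" .
  have 2: "(2 * pi * v) powr (- ?k) = (2 * pi) powr (- ?k) * v powr (- ?k)" by (rule powr_mult)
  have 3: "- trace (A ** W ** transpose W) / (2 * v) = - ((((1 / v) *\<^sub>R A) ** W) \<bullet> W) / 2"
    unfolding trace_mult_inner by (simp add: matrix_mult_scaleR_left)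
  show ?thesis unfolding f_pi_def phi_def prior2J_eq[OF v RR_pos_def[OF A]] prec_mob[OF v A] 1 2 3 by (simp only: mult_ac)
qed

section \<open>The second-stage prior as a mixing measure\<close>

locale mixing_density =
  fixes v0 :: real and \<pi>2 :: "real^'r::{finite,linorder}^'r::{finite,linorder} \<Rightarrow> real"
  assumes v0: "0 < v0" and pi2_differentiable: "\<pi>2 differentiable_on RR"
    and pi2_nonneg: "\<And>\<Omega>. \<Omega> \<in> RR \<Longrightarrow> 0 \<le> \<pi>2 \<Omega>" and pi2_nonzero: "\<exists>\<Omega>\<in>RR. \<pi>2 \<Omega> \<noteq> 0"
begin

text \<open>Restricting the space to \<open>RR\<close> makes continuity on \<open>RR\<close>
  sufficient for measurability, and the measure depends on the values of \<pi>2 in \<open>RR\<close>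
  alone. An improper prior gives an infinite but sigma-finite measure.\<close>

definition \<mu> :: "(real^'r::{finite,linorder}^'r::{finite,linorder}) measure" where
  "\<mu> = density (restrict_space sym_lborel RR) (\<lambda>\<Omega>. ennreal (\<pi>2 \<Omega>))"

lemma space_mu: "space \<mu> = RR" by (simp add: \<mu>_def space_restrict_space)

lemma sets_mu: "sets \<mu> = sets (restrict_space borel RR)"
  by (simp add: \<mu>_def sets_restrict_space)

lemma continuous_imp_measurable_mu:
  assumes "continuous_on RR f" shows "f \<in> borel_measurable \<mu>"
  unfolding measurable_cong_sets[OF sets_mu refl] using assms by (rule borel_measurable_continuous_on_restrict)

lemma pi2_measurable: "(\<lambda>\<Omega>. ennreal (\<pi>2 \<Omega>)) \<in> borel_measurable (restrict_space sym_lborel RR)"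
proof -
  have "\<pi>2 \<in> borel_measurable (restrict_space borel RR)"
    by (rule borel_measurable_continuous_on_restrict[OF differentiable_imp_continuous_on[OF pi2_differentiable]])
  hence "\<pi>2 \<in> borel_measurable (restrict_space sym_lborel RR)"
    by (subst measurable_cong_sets[OF sets_restrict_space_cong refl, of _ borel]) simp_all
  thus ?thesis by measurable
qed

lemma sigma_finite_mu: "sigma_finite_measure \<mu>"
proof -
  interpret r: sigma_finite_measure "restrict_space sym_lborel (RR :: (real^'r::{finite,linorder}^'r::{finite,linorder}) set)"
    by (rule sigma_finite_measure_restrict_space[OF sigma_finite_sym_lborel]) simp
  show ?thesis unfolding \<mu>_def by (subst r.sigma_finite_iff_density_finite[OF pi2_measurable]) simp
qed

lemma nn_integral_mu:
  assumes g: "g \<in> borel_measurable \<mu>"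
  shows "(\<integral>\<^sup>+ \<Omega>. g \<Omega> \<partial>\<mu>) = (\<integral>\<^sup>+ \<Omega>. ennreal (\<pi>2 \<Omega>) * g \<Omega> * indicator RR \<Omega> \<partial>sym_lborel)"
proof -
  have "g \<in> borel_measurable (restrict_space sym_lborel RR)" using g by (simp add: \<mu>_def)
  hence "(\<integral>\<^sup>+ \<Omega>. g \<Omega> \<partial>\<mu>) = (\<integral>\<^sup>+ \<Omega>. ennreal (\<pi>2 \<Omega>) * g \<Omega> \<partial>restrict_space sym_lborel RR)"
    unfolding \<mu>_def by (rule nn_integral_density[OF pi2_measurable])
  also have "\<dots> = (\<integral>\<^sup>+ \<Omega>. ennreal (\<pi>2 \<Omega>) * g \<Omega> * indicator RR \<Omega> \<partial>sym_lborel)"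
    by (rule nn_integral_restrict_space) simp
  finally show ?thesis .
qed

text \<open>By continuity \<pi>2 is positive near a point where it is nonzero. As \<open>RR\<close>
  is relatively open, the coordinate vectors of nearby matrices contain a nonempty open set, which
  is not negligible.\<close>

lemma emeasure_mu_nonzero: "emeasure \<mu> (space \<mu>) \<noteq> 0"
proof
  assume "emeasure \<mu> (space \<mu>) = 0"
  hence z: "(\<integral>\<^sup>+ \<Omega>. ennreal (\<pi>2 \<Omega>) * indicator RR \<Omega> \<partial>sym_lborel) = 0" using nn_integral_mu[of "\<lambda>_. 1"] by simp
  have m: "(\<lambda>\<Omega>. ennreal (\<pi>2 \<Omega>) * indicator RR \<Omega>) \<in> borel_measurable sym_lborel"
    using pi2_measurable by (subst (asm) borel_measurable_restrict_space_iff_ennreal) simp_all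
  obtain \<Omega>0 where O0: "\<Omega>0 \<in> RR" "\<pi>2 \<Omega>0 \<noteq> 0" using pi2_nonzero by blast
  have cont: "continuous_on RR \<pi>2" by (rule differentiable_imp_continuous_on[OF pi2_differentiable])
  obtain T where T: "open T" "T \<inter> RR = \<pi>2 -` (- {0}) \<inter> RR"
    using cont[unfolded continuous_on_open_invariant, rule_format, of "- {0}"] by auto
  obtain V :: "(real^'r::{finite,linorder}^'r::{finite,linorder}) set" where V: "open V" "RR = sym_matrices \<inter> V" by (rule RR_openin) blast
  define Z where "Z = (sym_of_vec -` (T \<inter> V) :: (real^('r::{finite,linorder}) upair) set)"
  have oZ: "open Z" unfolding Z_def
    by (rule open_vimage[OF open_Int[OF T(1) V(1)]]) (rule linear_continuous_on[OF bounded_linear_sym_of_vec])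
  have "vec_of_sym \<Omega>0 \<in> Z"
  proof -
    have "sym_of_vec (vec_of_sym \<Omega>0) = \<Omega>0" by (rule sym_of_vec_of_sym[OF RR_symmetric[OF O0(1)]])
    moreover have "\<Omega>0 \<in> T" using O0 T(2) by blast
    moreover have "\<Omega>0 \<in> V" using O0(1) V(2) by blast
    ultimately show ?thesis by (simp add: Z_def)
  qed
  hence nn: "\<not> negligible Z" using open_not_negligible[OF oZ] by blast
  have AE: "AE x in lborel. ennreal (\<pi>2 (sym_of_vec x)) * indicator RR (sym_of_vec x) = (0 :: ennreal)"
  proof -
    have m': "(\<lambda>\<Omega>. ennreal (\<pi>2 \<Omega>) * indicator RR \<Omega>) \<in> borel_measurable borel" using m by (simp add: measurable_cong_sets[OF sets_sym_lborel refl])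
    have "(\<integral>\<^sup>+ x. ennreal (\<pi>2 (sym_of_vec x)) * indicator RR (sym_of_vec x) \<partial>lborel) = 0"
      using z unfolding nn_integral_sym_lborel[OF m'] .
    thus ?thesis by (subst (asm) nn_integral_0_iff_AE) (use measurable_compose[OF borel_measurable_sym_of_vec m'] in simp_all)
  qed
  have "AE x in lborel. x \<notin> Z"
    using AE
  proof eventually_elim
    fix x :: "real^('r::{finite,linorder}) upair" assume e: "ennreal (\<pi>2 (sym_of_vec x)) * indicator RR (sym_of_vec x) = (0 :: ennreal)"
    show "x \<notin> Z"
    proof
      assume "x \<in> Z"
      hence TV: "sym_of_vec x \<in> T" "sym_of_vec x \<in> V" by (simp_all add: Z_def)
      have R: "sym_of_vec x \<in> RR" unfolding V(2) using TV(2) by (simp add: sym_matrices_def)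
      hence "\<pi>2 (sym_of_vec x) \<noteq> 0" using T(2) TV(1) by blast
      hence "0 < \<pi>2 (sym_of_vec x)" using pi2_nonneg[OF R] by simp
      thus False using e R by simp
    qed
  qed
  hence "AE x in lebesgue. x \<notin> Z"
    by (rule AE_completion)
  moreover have "Z \<in> sets lebesgue" using oZ by (simp add: borel_open)
  ultimately have "negligible Z" unfolding negligible_iff_null_sets by (simp only: AE_iff_null_sets)
  thus False using nn by simp
qed

text \<open>Here c may be negative, as in \<open>prec\<close> with c = v - v0. The eigenvalues b + c
  d with 0 < d < 1 are convex combinations of b and b + c, both positive.\<close>

lemma det_affine_pos:
  fixes \<Omega> :: "real^'r::{finite,linorder}^'r::{finite,linorder}"
  assumes O: "\<Omega> \<in> RR" and bc: "0 < b" "0 < b + c" shows "0 < det (b *\<^sub>R mat 1 + c *\<^sub>R \<Omega>)"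
proof -
  obtain U d where U: "orthogonal_matrix U" and Od: "\<Omega> = spmat U d" and d: "\<And>i. 0 < d i" "\<And>i. d i < 1" by (rule RR_obtain[OF O]) blast
  have "0 < b + c * d i" for i
  proof -
    have "0 < b * (1 - d i)" using bc d[of i] by simp
    moreover have "0 < (b + c) * d i" using bc d[of i] by simp
    ultimately show ?thesis by (simp add: algebra_simps)
  qed
  thus ?thesis unfolding Od affine_spmat[OF U] det_spmat[OF U] by (intro prod_pos) simp
qed

lemma prec_measurable_mu: "0 < v \<Longrightarrow> prec v0 v \<in> borel_measurable \<mu>"
proof (rule continuous_imp_measurable_mu)
  assume v: "0 < v"
  have c: "continuous_on RR (\<lambda>\<Omega> :: real^'r::{finite,linorder}^'r::{finite,linorder}. matrix_inv (v0 *\<^sub>R mat 1 + (v - v0) *\<^sub>R \<Omega>))"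
  proof (rule continuous_on_matrix_inv)
    show "det (v0 *\<^sub>R mat 1 + (v - v0) *\<^sub>R \<Omega>) \<noteq> 0" if "\<Omega> \<in> RR" for \<Omega> :: "real^'r::{finite,linorder}^'r::{finite,linorder}"
      using det_affine_pos[OF that v0, of "v - v0"] v by simp
  qed (intro continuous_intros)
  show "continuous_on RR (prec v0 v :: real^'r::{finite,linorder}^'r::{finite,linorder} \<Rightarrow> _)"
    using bounded_bilinear.continuous_on[OF bounded_bilinear_matrix_mult continuous_on_id c] unfolding prec_def[abs_def] mob_def .
qed

lemma prior1_measurable: "(\<lambda>(\<Theta> :: real^'q^'r::{finite,linorder}, \<Omega>). prior1 v0 \<Omega> \<Theta>) \<in> borel_measurable (borel \<Otimes>\<^sub>M \<mu>)"
proof -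
  have c: "continuous_on RR (\<lambda>\<Omega> :: real^'r::{finite,linorder}^'r::{finite,linorder}. matrix_inv (mat 1 - \<Omega>))"
  proof (rule continuous_on_matrix_inv)
    fix \<Omega> :: "real^'r::{finite,linorder}^'r::{finite,linorder}" assume O: "\<Omega> \<in> RR"
    obtain U d where U: "orthogonal_matrix U" and Od: "\<Omega> = spmat U d" and d: "\<And>i. 0 < d i" "\<And>i. d i < 1" by (rule RR_obtain[OF O]) blast
    have "mat 1 - \<Omega> = spmat U (\<lambda>i. 1 - d i)" by (simp add: Od spmat_1[OF U] spmat_diff)
    moreover have "0 < det (spmat U (\<lambda>i. 1 - d i))" unfolding det_spmat[OF U] by (intro prod_pos) (simp add: d)
    ultimately show "det (mat 1 - \<Omega>) \<noteq> 0" by simp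
  qed (intro continuous_intros)
  have [measurable]: "(\<lambda>\<Omega>. \<Omega> ** matrix_inv (mat 1 - \<Omega>)) \<in> borel_measurable \<mu>"
    by (rule continuous_imp_measurable_mu[OF bounded_bilinear.continuous_on[OF bounded_bilinear_matrix_mult continuous_on_id c]])
  show ?thesis unfolding prior1_def trace_mult_inner by measurable
qed

lemma hier_prior_eq: "hier_prior v0 \<pi>2 \<Theta> = (\<integral>\<^sup>+ \<Omega>. ennreal (prior1 v0 \<Omega> \<Theta>) \<partial>\<mu>)"
proof -
  have m: "(\<lambda>\<Omega>. ennreal (prior1 v0 \<Omega> \<Theta>)) \<in> borel_measurable \<mu>"
    using measurable_Pair2[OF prior1_measurable, of \<Theta>] by simp
  show ?thesis unfolding hier_prior_def nn_integral_mu[OF m]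
  proof (rule nn_integral_cong)
    fix \<Omega> :: "real^'r::{finite,linorder}^'r::{finite,linorder}"
    show "ennreal (prior1 v0 \<Omega> \<Theta> * \<pi>2 \<Omega>) * indicator RR \<Omega> = ennreal (\<pi>2 \<Omega>) * ennreal (prior1 v0 \<Omega> \<Theta>) * indicator RR \<Omega>"
      using ennreal_mult'[OF pi2_nonneg[of \<Omega>], of "prior1 v0 \<Omega> \<Theta>"] by (cases "\<Omega> \<in> RR") (simp_all add: mult.commute[of _ "\<pi>2 \<Omega>"])
  qed
qed

lemma hier_prior_measurable: "hier_prior v0 \<pi>2 \<in> borel_measurable (borel :: (real^'q^'r::{finite,linorder}) measure)"
proof -
  interpret sigma_finite_measure \<mu> by (rule sigma_finite_mu)
  have "(\<lambda>(\<Theta> :: real^'q^'r::{finite,linorder}, \<Omega>). ennreal (prior1 v0 \<Omega> \<Theta>)) \<in> borel_measurable (borel \<Otimes>\<^sub>M \<mu>)"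
    using prior1_measurable by measurable
  thus ?thesis unfolding hier_prior_eq[abs_def] by (rule borel_measurable_nn_integral)
qed

lemma marginal_hier_prior:
  assumes v: "0 < v"
  shows "marginal v (hier_prior v0 \<pi>2) W = (\<integral>\<^sup>+ \<Omega>. ennreal (phi v0 v W \<Omega>) \<partial>\<mu>)"
proof -
  interpret mu: sigma_finite_measure \<mu> by (rule sigma_finite_mu)
  interpret pair_sigma_finite lborel \<mu> ..
  note [measurable] = prior1_measurable
  have m1: "(\<lambda>\<Omega>. ennreal (prior1 v0 \<Omega> \<Theta>)) \<in> borel_measurable \<mu>" for \<Theta>
    using measurable_Pair2[OF prior1_measurable, of \<Theta>] by simp
  have "marginal v (hier_prior v0 \<pi>2) W = (\<integral>\<^sup>+ \<Theta>. (\<integral>\<^sup>+ \<Omega>. ennreal (matnormal v \<Theta> W * prior1 v0 \<Omega> \<Theta>) \<partial>\<mu>) \<partial>lborel)"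
    unfolding marginal_def hier_prior_eq
    by (rule nn_integral_cong, subst nn_integral_cmult[OF m1, symmetric]) (simp add: ennreal_mult'[OF matnormal_nonneg])
  also have "\<dots> = (\<integral>\<^sup>+ \<Omega>. (\<integral>\<^sup>+ \<Theta>. ennreal (matnormal v \<Theta> W * prior1 v0 \<Omega> \<Theta>) \<partial>lborel) \<partial>\<mu>)"
    by (rule Fubini'[symmetric]) measurable
  also have "\<dots> = (\<integral>\<^sup>+ \<Omega>. ennreal (phi v0 v W \<Omega>) \<partial>\<mu>)"
    by (rule nn_integral_cong) (rule nn_integral_prior1[OF _ v0 v], simp add: space_mu)
  finally show ?thesis .
qed

text \<open>The marginal, the matrix \<open>S\<close> tested against a fixed matrix, and
  \<open>sq\<close> are all averages of some \<open>h\<close> of the precision matrix; stating the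
  substitution for general \<open>h\<close> covers them at once.\<close>

lemma nn_integral_transfer:
  fixes W :: "real^'q^'r::{finite,linorder}"
  assumes v: "0 < v" "v \<le> v0" and h: "h \<in> borel_measurable borel"
  shows "(\<integral>\<^sup>+ \<Omega>. ennreal (phi v0 v W \<Omega> * h (prec v0 v \<Omega>)) \<partial>\<mu>) = (\<integral>\<^sup>+ A. ennreal (f_pi v0 v \<pi>2 W A * h ((1 / v) *\<^sub>R A)) * indicator RR A \<partial>sym_lborel)"
proof -
  let ?b = "v / v0" and ?c = "1 - v / v0"
  have bc: "0 < ?b" "0 \<le> ?c" "?b + ?c = 1" using v v0 by (auto simp: field_simps)
  note [measurable] = prec_measurable_mu[OF v(1)] h
  have g: "(\<lambda>\<Omega>. ennreal (phi v0 v W \<Omega> * h (prec v0 v \<Omega>))) \<in> borel_measurable \<mu>" unfolding phi_def by measurable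
  define G where "G \<Omega> = ennreal (\<pi>2 \<Omega>) * ennreal (phi v0 v W \<Omega> * h (prec v0 v \<Omega>)) * indicator RR \<Omega>" for \<Omega>
  have G: "G \<in> borel_measurable borel"
  proof -
    have "(\<lambda>\<Omega>. ennreal (\<pi>2 \<Omega>) * ennreal (phi v0 v W \<Omega> * h (prec v0 v \<Omega>))) \<in> borel_measurable (restrict_space sym_lborel RR)"
      using pi2_measurable g by (simp add: \<mu>_def)
    hence "G \<in> borel_measurable sym_lborel" unfolding G_def
      by (subst (asm) borel_measurable_restrict_space_iff_ennreal) simp_all
    thus ?thesis by (simp add: measurable_cong_sets[OF sets_sym_lborel refl])
  qed
  have im: "mob ?b ?c ` RR = (RR :: (real^'r::{finite,linorder}^'r::{finite,linorder}) set)" by (rule mob_image_RR[OF bc])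
  have "(\<integral>\<^sup>+ \<Omega>. ennreal (phi v0 v W \<Omega> * h (prec v0 v \<Omega>)) \<partial>\<mu>) = (\<integral>\<^sup>+ \<Omega>. G \<Omega> * indicator (mob ?b ?c ` RR) \<Omega> \<partial>sym_lborel)"
    unfolding nn_integral_mu[OF g] im G_def by (rule nn_integral_cong) (simp split: split_indicator)
  also have "\<dots> = (\<integral>\<^sup>+ A. ennreal (mob_jac ?b ?c A) * G (mob ?b ?c A) * indicator RR A \<partial>sym_lborel)"
  proof (rule nn_integral_mob[OF bc(1,2) _ _ _ G, symmetric])
    show "RR \<in> sets borel" by simp
    show "RR \<subseteq> Collect pos_def" using RR_pos_def by blast
    show "mob ?b ?c ` RR \<in> sets (borel :: (real^'r::{finite,linorder}^'r::{finite,linorder}) measure)" unfolding im by simp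
  qed
  also have "\<dots> = (\<integral>\<^sup>+ A. ennreal (f_pi v0 v \<pi>2 W A * h ((1 / v) *\<^sub>R A)) * indicator RR A \<partial>sym_lborel)"
  proof (rule nn_integral_cong)
    fix A :: "real^'r::{finite,linorder}^'r::{finite,linorder}"
    show "ennreal (mob_jac ?b ?c A) * G (mob ?b ?c A) * indicator RR A = ennreal (f_pi v0 v \<pi>2 W A * h ((1 / v) *\<^sub>R A)) * indicator RR A"
    proof (cases "A \<in> RR")
      case A: True
      hence MR: "mob ?b ?c A \<in> RR" using im by blast
      have j: "0 \<le> mob_jac ?b ?c A" using mob_jac_pos[OF RR_pos_def[OF A] bc(1,2)] by simp
      have "ennreal (mob_jac ?b ?c A) * G (mob ?b ?c A) = ennreal (mob_jac ?b ?c A * (\<pi>2 (mob ?b ?c A) * (phi v0 v W (mob ?b ?c A) * h ((1 / v) *\<^sub>R A))))"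
        unfolding G_def prec_mob[OF v A] using MR j pi2_nonneg[OF MR] by (simp add: ennreal_mult')
      also have "mob_jac ?b ?c A * (\<pi>2 (mob ?b ?c A) * (phi v0 v W (mob ?b ?c A) * h ((1 / v) *\<^sub>R A))) = f_pi v0 v \<pi>2 W A * h ((1 / v) *\<^sub>R A)"
        unfolding f_pi_eq_phi_mob[OF v A] by (simp only: mult_ac)
      finally show ?thesis by simp
    qed simp
  qed
  finally show ?thesis .
qed

lemma integral_transfer:
  fixes W :: "real^'q^'r::{finite,linorder}"
  assumes v: "0 < v" "v \<le> v0" and h: "h \<in> borel_measurable borel"
    and i: "integrable \<mu> (\<lambda>\<Omega>. phi v0 v W \<Omega> * h (prec v0 v \<Omega>))"
    and s: "set_integrable sym_lborel RR (\<lambda>A. f_pi v0 v \<pi>2 W A * h ((1 / v) *\<^sub>R A))"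
  shows "(\<integral>\<Omega>. phi v0 v W \<Omega> * h (prec v0 v \<Omega>) \<partial>\<mu>) = (LINT A:RR|sym_lborel. f_pi v0 v \<pi>2 W A * h ((1 / v) *\<^sub>R A))"
  unfolding set_lebesgue_integral_def
proof (rule integral_eq_of_nn_integrals[OF i s[unfolded set_integrable_def]])
  show "(\<integral>\<^sup>+ \<Omega>. ennreal (phi v0 v W \<Omega> * h (prec v0 v \<Omega>)) \<partial>\<mu>) = (\<integral>\<^sup>+ A. ennreal (indicator RR A *\<^sub>R (f_pi v0 v \<pi>2 W A * h ((1 / v) *\<^sub>R A))) \<partial>sym_lborel)"
    unfolding nn_integral_transfer[OF v h] by (rule nn_integral_cong) (simp split: split_indicator)
  have h': "(\<lambda>A. - h A) \<in> borel_measurable borel" using h by simp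
  show "(\<integral>\<^sup>+ \<Omega>. ennreal (- (phi v0 v W \<Omega> * h (prec v0 v \<Omega>))) \<partial>\<mu>) = (\<integral>\<^sup>+ A. ennreal (- (indicator RR A *\<^sub>R (f_pi v0 v \<pi>2 W A * h ((1 / v) *\<^sub>R A)))) \<partial>sym_lborel)"
    using nn_integral_transfer[OF v h', of W] unfolding mult_minus_right
    by (rule trans) (rule nn_integral_cong, simp split: split_indicator)
qed

end

section \<open>The Bayesian predictive density of the hierarchical prior\<close>

context mixing_density
begin

text \<open>The product formula takes the factor without \<Theta> out of the integral, so the
  numerator of the predictive density is a marginal at the pooled variance, evaluated at the pooled
  observation.\<close>

lemma marginal_two_samples:
  fixes X Y :: "real^'q^'r::{finite,linorder}"
  assumes a: "0 < a" and b: "0 < b"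
  shows "(\<integral>\<^sup>+ \<Theta>. ennreal (matnormal a \<Theta> X) * ennreal (matnormal b \<Theta> Y) * hier_prior v0 \<pi>2 \<Theta> \<partial>lborel)
    = ennreal (matnormal (a + b) X Y) * marginal (a * b / (a + b)) (hier_prior v0 \<pi>2) (pool a b X Y)"
proof -
  note [measurable] = hier_prior_measurable
  let ?p = "hier_prior v0 \<pi>2 :: real^'q^'r::{finite,linorder} \<Rightarrow> ennreal"
  have "(\<integral>\<^sup>+ \<Theta>. ennreal (matnormal a \<Theta> X) * ennreal (matnormal b \<Theta> Y) * ?p \<Theta> \<partial>lborel)
    = (\<integral>\<^sup>+ \<Theta>. ennreal (matnormal (a + b) X Y) * (ennreal (matnormal (a * b / (a + b)) \<Theta> (pool a b X Y)) * ?p \<Theta>) \<partial>lborel)"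
  proof (rule nn_integral_cong)
    fix \<Theta> :: "real^'q^'r::{finite,linorder}"
    have "ennreal (matnormal a \<Theta> X) * ennreal (matnormal b \<Theta> Y) = ennreal (matnormal a \<Theta> X * matnormal b \<Theta> Y)"
      by (rule ennreal_mult'[OF matnormal_nonneg, symmetric])
    also have "matnormal a \<Theta> X * matnormal b \<Theta> Y = matnormal (a + b) X Y * matnormal (a * b / (a + b)) \<Theta> (pool a b X Y)"
      unfolding matnormal_product[OF a b] pool_def by (rule mult.commute)
    also have "ennreal \<dots> = ennreal (matnormal (a + b) X Y) * ennreal (matnormal (a * b / (a + b)) \<Theta> (pool a b X Y))"
      by (rule ennreal_mult'[OF matnormal_nonneg])
    finally show "ennreal (matnormal a \<Theta> X) * ennreal (matnormal b \<Theta> Y) * ?p \<Theta>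
      = ennreal (matnormal (a + b) X Y) * (ennreal (matnormal (a * b / (a + b)) \<Theta> (pool a b X Y)) * ?p \<Theta>)"
      by (simp only: mult.assoc)
  qed
  also have "\<dots> = ennreal (matnormal (a + b) X Y) * marginal (a * b / (a + b)) ?p (pool a b X Y)"
    unfolding marginal_def by (rule nn_integral_cmult) measurable
  finally show ?thesis .
qed

text \<open>With the order of integration exchanged, Y integrates to 1 for each \<Theta>. This is
  the reason why the predictive density has total mass 1.\<close>

lemma nn_integral_two_samples:
  fixes X :: "real^'q^'r::{finite,linorder}"
  assumes b: "0 < b"
  shows "(\<integral>\<^sup>+ Y. (\<integral>\<^sup>+ \<Theta>. ennreal (matnormal a \<Theta> X) * ennreal (matnormal b \<Theta> Y) * hier_prior v0 \<pi>2 \<Theta> \<partial>lborel) \<partial>lborel)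
    = marginal a (hier_prior v0 \<pi>2) X"
proof -
  note [measurable] = hier_prior_measurable
  let ?p = "hier_prior v0 \<pi>2 :: real^'q^'r::{finite,linorder} \<Rightarrow> ennreal"
  have "(\<integral>\<^sup>+ Y. (\<integral>\<^sup>+ \<Theta>. ennreal (matnormal a \<Theta> X) * ennreal (matnormal b \<Theta> Y) * ?p \<Theta> \<partial>lborel) \<partial>lborel)
    = (\<integral>\<^sup>+ \<Theta>. (\<integral>\<^sup>+ Y. ennreal (matnormal a \<Theta> X) * ennreal (matnormal b \<Theta> Y) * ?p \<Theta> \<partial>lborel) \<partial>lborel)"
    by (rule lborel_pair.Fubini'[symmetric]) measurable
  also have "\<dots> = marginal a ?p X" unfolding marginal_def
  proof (rule nn_integral_cong)
    fix \<Theta> :: "real^'q^'r::{finite,linorder}"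
    have "(\<integral>\<^sup>+ Y. ennreal (matnormal a \<Theta> X) * ennreal (matnormal b \<Theta> Y) * ?p \<Theta> \<partial>lborel)
      = (\<integral>\<^sup>+ Y. (ennreal (matnormal a \<Theta> X) * ?p \<Theta>) * ennreal (matnormal b \<Theta> Y) \<partial>lborel)"
      by (rule nn_integral_cong) (simp only: mult_ac)
    also have "\<dots> = (ennreal (matnormal a \<Theta> X) * ?p \<Theta>) * (\<integral>\<^sup>+ Y. ennreal (matnormal b \<Theta> Y) \<partial>lborel)"
      by (rule nn_integral_cmult) measurable
    finally show "(\<integral>\<^sup>+ Y. ennreal (matnormal a \<Theta> X) * ennreal (matnormal b \<Theta> Y) * ?p \<Theta> \<partial>lborel) = ennreal (matnormal a \<Theta> X) * ?p \<Theta>"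
      unfolding nn_integral_matnormal[OF b] by simp
  qed
  finally show ?thesis .
qed

end

theorem theorem3p1:
  fixes vx vy v0 vw :: real
    and \<pi>2 :: "real^'r::{finite,linorder}^'r::{finite,linorder} \<Rightarrow> real"
    and pH :: "real^'q::finite^'r::{finite,linorder} \<Rightarrow> real^'q^'r::{finite,linorder} \<Rightarrow> real"
  assumes dims: "CARD('r) \<le> CARD('q)"
    and variances: "0 < vx" "0 < vy" "vx \<le> v0"
    and vw_eq: "vw = 1 / (1 / vx + 1 / vy)"
    and pi2_differentiable: "\<pi>2 differentiable_on RR"
    and pi2_nonneg: "\<And>\<Omega>. \<Omega> \<in> RR \<Longrightarrow> 0 \<le> \<pi>2 \<Omega>"
    and pi2_nonzero: "\<exists>\<Omega>\<in>RR. \<pi>2 \<Omega> \<noteq> 0"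
    and marginal_finite:
      "\<And>W :: real^'q^'r::{finite,linorder}. marginal vx (hier_prior v0 \<pi>2) W < \<infinity>"
    and pH_eq: "pH = bayes_predictive vx vy (hier_prior v0 \<pi>2)"
    and f_boundary:
      "\<And>v (W :: real^'q^'r::{finite,linorder}) \<Lambda>0. v \<in> {vw..vx} \<Longrightarrow> \<Lambda>0 \<in> bdry_RR \<Longrightarrow>
         (f_pi v0 v \<pi>2 W \<longlongrightarrow> 0) (at \<Lambda>0 within RR)"
    and integrals_finite:
      "\<And>v (W :: real^'q^'r::{finite,linorder}). v \<in> {vw..vx} \<Longrightarrow>
         set_integrable sym_lborel RR (f_pi v0 v \<pi>2 W) \<and>
         set_integrable sym_lborel RR (\<lambda>\<Lambda>. f_pi v0 v \<pi>2 W \<Lambda> *\<^sub>R \<Lambda>) \<and>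
         set_integrable sym_lborel RR (Delta1_integrand v0 v \<pi>2 W) \<and>
         set_integrable sym_lborel RR (Delta2_integrand v0 v \<pi>2 W)"
    and Delta_nonpos:
      "\<And>v (W :: real^'q^'r::{finite,linorder}). v \<in> {vw..vx} \<Longrightarrow> Delta v0 v \<pi>2 W \<le> 0"
  shows "KL_minimax vx vy pH"
proof -
  have v0: "0 < v0" using variances by simp
  have vw: "vw = vx * vy / (vx + vy)" unfolding vw_eq using variances by (simp add: field_simps)
  have vw0: "0 < vw" unfolding vw using variances by simp
  have vwx: "vw < vx" unfolding vw using variances by (simp add: divide_less_eq)
  interpret md: mixing_density v0 \<pi>2
    by unfold_locales (rule v0, rule pi2_differentiable, erule pi2_nonneg, rule pi2_nonzero)
  have pm: "(\<lambda>\<Omega>. phi v0 v (W :: real^'q^'r::{finite,linorder}) \<Omega>) \<in> borel_measurable md.\<mu>" if "0 < v" for v W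
  proof -
    note [measurable] = md.prec_measurable_mu[OF that]
    show ?thesis unfolding phi_def by measurable
  qed
  have int_phi: "integrable md.\<mu> (phi v0 vx (0 :: real^'q^'r::{finite,linorder}))"
  proof (rule integrableI_nonneg)
    show "phi v0 vx (0 :: real^'q^'r::{finite,linorder}) \<in> borel_measurable md.\<mu>" by (rule pm[OF variances(1)])
    show "AE \<Omega> in md.\<mu>. 0 \<le> phi v0 vx (0 :: real^'q^'r::{finite,linorder}) \<Omega>"
      by (rule AE_I2) (rule less_imp_le[OF phi_pos[OF v0 variances(1)]], simp add: md.space_mu)
    show "(\<integral>\<^sup>+ \<Omega>. ennreal (phi v0 vx (0 :: real^'q^'r::{finite,linorder}) \<Omega>) \<partial>md.\<mu>) < \<infinity>"
      using marginal_finite[of 0] unfolding md.marginal_hier_prior[OF variances(1)] .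
  qed
  interpret sf: sigma_finite_measure md.\<mu> by (rule md.sigma_finite_mu)
  interpret pm: precision_mixture md.\<mu> v0 vw vx "TYPE(real^'q^'r::{finite,linorder})"
    by unfold_locales (simp add: md.space_mu, erule md.prec_measurable_mu, rule v0, rule vw0, rule vwx, rule int_phi, rule md.emeasure_mu_nonzero)
  \<comment> \<open>Dictionary between the two parametrisations: the mass is m, \<open>S\<close> is
    M / v, and \<open>sq\<close> is the integral of |\<Lambda> W|^2 \<open>f_pi\<close> divided by
    v^2. Under it the bound from \<open>Delta\<close> becomes the pointwise inequality that
    monotonicity requires.\<close>
  have key: "pm.mass v W * (2 * pm.sq v W - 2 * real CARD('q) * trace (pm.S v W)) - (norm (pm.S v W ** W))\<^sup>2 \<le> 0"
    if vr: "vw \<le> v" "v \<le> vx" for v and W :: "real^'q^'r::{finite,linorder}"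
  proof -
    have v: "0 < v" "v \<le> v0" and vI: "v \<in> {vw..vx}" using vr vw0 variances by auto
    note [measurable] = md.prec_measurable_mu[OF v(1)]
    have f: "set_integrable sym_lborel RR (f_pi v0 v \<pi>2 W)" and fA: "set_integrable sym_lborel RR (\<lambda>\<Lambda>. f_pi v0 v \<pi>2 W \<Lambda> *\<^sub>R \<Lambda>)"
      and D1: "set_integrable sym_lborel RR (Delta1_integrand v0 v \<pi>2 W)" and D2: "set_integrable sym_lborel RR (Delta2_integrand v0 v \<pi>2 W)"
      using integrals_finite[OF vI, of W] by blast+
    have mass: "pm.mass v W = m_pi v0 v \<pi>2 W"
      using md.integral_transfer[OF v, of "\<lambda>_. 1" W] pm.integrable_phi[OF vr, of W] f
      by (simp add: pm.mass_def m_pi_def)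
    have S: "pm.S v W = (1 / v) *\<^sub>R M_pi v0 v \<pi>2 W"
    \<comment> \<open>The transfer of integrals is for real integrands, so the matrix identity is
      tested against inner products with an arbitrary X.\<close>
    proof (rule vector_eq_rdot[THEN iffD1], rule allI)
      fix X :: "real^'r::{finite,linorder}^'r::{finite,linorder}"
      have bl: "bounded_linear (\<lambda>A :: real^'r::{finite,linorder}^'r::{finite,linorder}. A \<bullet> X)" by (rule bounded_linear_inner_left)
      have bl': "bounded_linear (\<lambda>A :: real^'r::{finite,linorder}^'r::{finite,linorder}. ((1 / v) *\<^sub>R A) \<bullet> X)"
        by (rule bounded_linear_compose[OF bl bounded_linear_scaleR_right])
      have sX: "set_integrable sym_lborel RR (\<lambda>A. f_pi v0 v \<pi>2 W A * (((1 / v) *\<^sub>R A) \<bullet> X))"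
        using set_lebesgue_integral_bounded_linear(1)[OF bl' fA] by (simp add: mult_ac)
      have iX: "integrable md.\<mu> (\<lambda>\<Omega>. phi v0 v W \<Omega> * (prec v0 v \<Omega> \<bullet> X))"
        using integrable_bounded_linear[OF bl pm.integrable_phi_prec[OF vr, of W]] by simp
      have "pm.S v W \<bullet> X = (\<integral>\<Omega>. phi v0 v W \<Omega> * (prec v0 v \<Omega> \<bullet> X) \<partial>md.\<mu>)"
        using pm.S_linear[OF vr bl] by (simp add: pm.avg_def)
      also have "\<dots> = (LINT A:RR|sym_lborel. f_pi v0 v \<pi>2 W A * (((1 / v) *\<^sub>R A) \<bullet> X))"
        by (rule md.integral_transfer[OF v _ iX sX]) measurable
      also have "\<dots> = ((1 / v) *\<^sub>R M_pi v0 v \<pi>2 W) \<bullet> X"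
        using set_lebesgue_integral_bounded_linear(2)[OF bl' fA] by (simp add: M_pi_def mult_ac)
      finally show "pm.S v W \<bullet> X = ((1 / v) *\<^sub>R M_pi v0 v \<pi>2 W) \<bullet> X" .
    qed
    have M: "M_pi v0 v \<pi>2 W = v *\<^sub>R pm.S v W" unfolding S using v by simp
    have sq: "pm.sq v W = 1 / v\<^sup>2 * (LINT A:RR|sym_lborel. (norm (A ** W))\<^sup>2 * f_pi v0 v \<pi>2 W A)"
    proof -
      have n: "(norm (((1 / v) *\<^sub>R A) ** W))\<^sup>2 = 1 / v\<^sup>2 * (norm (A ** W))\<^sup>2" for A :: "real^'r::{finite,linorder}^'r::{finite,linorder}"
        unfolding matrix_mult_scaleR_left norm_scaleR power_mult_distrib by (simp add: power_divide)
      have c: "continuous_on UNIV (\<lambda>A :: real^'r::{finite,linorder}^'r::{finite,linorder}. (norm (A ** W))\<^sup>2)"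
        by (intro continuous_on_power continuous_on_norm bounded_bilinear.continuous_on[OF bounded_bilinear_matrix_mult] continuous_on_id continuous_on_const)
      have s0: "set_integrable sym_lborel RR (\<lambda>A. (norm (A ** W))\<^sup>2 * f_pi v0 v \<pi>2 W A)"
        by (rule set_integrable_continuous_mult[OF f c])
      have eq: "f_pi v0 v \<pi>2 W A * (norm (((1 / v) *\<^sub>R A) ** W))\<^sup>2 = 1 / v\<^sup>2 * ((norm (A ** W))\<^sup>2 * f_pi v0 v \<pi>2 W A)" for A
        unfolding n by (simp only: mult_ac)
      have s: "set_integrable sym_lborel RR (\<lambda>A. f_pi v0 v \<pi>2 W A * (norm (((1 / v) *\<^sub>R A) ** W))\<^sup>2)"
        unfolding eq by (rule set_integrable_mult_right) (rule s0)
      have i: "integrable md.\<mu> (\<lambda>\<Omega>. phi v0 v W \<Omega> * (norm (prec v0 v \<Omega> ** W))\<^sup>2)"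
        using pm.integrable_phi_scaleR[OF vr, of "\<lambda>\<Omega>. (norm (prec v0 v \<Omega> ** W))\<^sup>2" "(norm W / v)\<^sup>2" W]
          norm_prec_mult[OF v0 v(1), of _ W] by (simp add: md.space_mu power_mono)
      have "pm.sq v W = (\<integral>\<Omega>. phi v0 v W \<Omega> * (norm (prec v0 v \<Omega> ** W))\<^sup>2 \<partial>md.\<mu>)" by (simp add: pm.sq_def pm.avg_def)
      also have "\<dots> = (LINT A:RR|sym_lborel. f_pi v0 v \<pi>2 W A * (norm (((1 / v) *\<^sub>R A) ** W))\<^sup>2)"
        by (rule md.integral_transfer[OF v _ i s]) measurable
      also have "\<dots> = 1 / v\<^sup>2 * (LINT A:RR|sym_lborel. (norm (A ** W))\<^sup>2 * f_pi v0 v \<pi>2 W A)"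
        unfolding eq by (rule set_integral_mult_right)
      finally show ?thesis .
    qed
    have "0 < m_pi v0 v \<pi>2 W" using pm.mass_pos[OF vr, of W] unfolding mass .
    moreover have "pos_def (M_pi v0 v \<pi>2 W)"
    proof -
      have "pos_def (pm.S v W)" by (rule pm.S_pos_def[OF vr])
      thus ?thesis unfolding M pos_def_def using v
        by (simp add: transpose_def vec_eq_iff scaleR_matrix_vector_assoc[symmetric])
    qed
    ultimately have "m_pi v0 v \<pi>2 W * (2 / v\<^sup>2 * (LINT A:RR|sym_lborel. (norm (A ** W))\<^sup>2 * f_pi v0 v \<pi>2 W A) - 2 * real CARD('q) / v * trace (M_pi v0 v \<pi>2 W))
       - (norm (M_pi v0 v \<pi>2 W ** W))\<^sup>2 / v\<^sup>2 \<le> 0"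
      by (intro Delta_inequality[OF v pi2_differentiable pi2_nonneg f_boundary[OF vI] f fA D1 D2] Delta_nonpos[OF vI])
    moreover have "(norm (pm.S v W ** W))\<^sup>2 = (norm (M_pi v0 v \<pi>2 W ** W))\<^sup>2 / v\<^sup>2"
      unfolding S matrix_mult_scaleR_left norm_scaleR power_mult_distrib by (simp add: power_divide)
    moreover have "trace (pm.S v W) = trace (M_pi v0 v \<pi>2 W) / v"
      unfolding S using linear_scale[OF bounded_linear.linear[OF bounded_linear_trace], of "1 / v" "M_pi v0 v \<pi>2 W"] by simp
    ultimately show ?thesis unfolding mass sq by simp
  qed
  have vwI: "vw \<le> vw" "vw \<le> vx" and vxI: "vw \<le> vx" "vx \<le> vx" using vwx by simp_all
  have marg: "marginal v (hier_prior v0 \<pi>2) W = ennreal (pm.mass v W)" if vr: "vw \<le> v" "v \<le> vx" for v W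
  proof -
    have v: "0 < v" using vr vw0 by simp
    show ?thesis unfolding md.marginal_hier_prior[OF v] pm.mass_def
      by (rule nn_integral_eq_integral[OF pm.integrable_phi[OF vr]]) (rule AE_I2, rule less_imp_le[OF phi_pos[OF v0 v]], simp add: md.space_mu)
  qed
  \<comment> \<open>The numerator of the predictive density is governed by the marginal at the
    pooled variance vw, and its denominator is the marginal at vx.\<close>
  interpret pr: prior_ratio vx vy "pm.mass vw" "pm.mass vx"
    by unfold_locales (rule variances, rule variances, rule pm.mass_pos[OF vwI], rule pm.mass_pos[OF vxI], rule pm.quad_bounded_ln_mass[OF vwI], rule pm.quad_bounded_ln_mass[OF vxI])
  let ?num = "\<lambda>X Y :: real^'q^'r::{finite,linorder}. \<integral>\<^sup>+ \<Theta>. ennreal (matnormal vx \<Theta> X) * ennreal (matnormal vy \<Theta> Y) * hier_prior v0 \<pi>2 \<Theta> \<partial>lborel"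
  have num: "?num X Y / marginal vx (hier_prior v0 \<pi>2) X = ennreal (pr.dens X Y)" for X Y
  proof -
    have m: "0 < pm.mass vx X" "0 < pm.mass vw (pool vx vy X Y)" by (rule pm.mass_pos[OF vxI], rule pm.mass_pos[OF vwI])
    have "?num X Y = ennreal (matnormal (vx + vy) X Y) * ennreal (pm.mass vw (pool vx vy X Y))"
      unfolding md.marginal_two_samples[OF variances(1,2)] vw[symmetric] marg[OF vwI] ..
    also have "\<dots> = ennreal (matnormal (vx + vy) X Y * pm.mass vw (pool vx vy X Y))"
      by (rule ennreal_mult'[OF matnormal_nonneg, symmetric])
    finally show ?thesis unfolding marg[OF vxI] pr.dens_def using m
      by (simp add: divide_ennreal matnormal_nonneg mult_nonneg_nonneg)
  qed
  have pH: "pH = pr.dens"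
    unfolding pH_eq by (intro ext) (use pr.dens_pos in \<open>simp add: bayes_predictive_def num less_imp_le\<close>)
  have dm: "(\<lambda>Y. pr.dens X Y) \<in> borel_measurable borel" for X
    using measurable_Pair2[OF pr.dens_measurable, of X] by simp
  have one: "(\<integral>\<^sup>+ Y. ennreal (pr.dens X Y) \<partial>lborel) = 1" for X
  proof -
    have m: "0 < pm.mass vx X" by (rule pm.mass_pos[OF vxI])
    note [measurable] = md.hier_prior_measurable
    have nm: "(\<lambda>Y. ?num X Y) \<in> borel_measurable lborel" by measurable
    have "(\<integral>\<^sup>+ Y. ennreal (pr.dens X Y) \<partial>lborel) = (\<integral>\<^sup>+ Y. ?num X Y / marginal vx (hier_prior v0 \<pi>2) X \<partial>lborel)"
      by (simp only: num)
    also have "\<dots> = (\<integral>\<^sup>+ Y. ?num X Y \<partial>lborel) / marginal vx (hier_prior v0 \<pi>2) X"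
      by (rule nn_integral_divide[OF nm])
    also have "\<dots> = marginal vx (hier_prior v0 \<pi>2) X / marginal vx (hier_prior v0 \<pi>2) X"
      unfolding md.nn_integral_two_samples[OF variances(2)] ..
    also have "\<dots> = 1" unfolding marg[OF vxI] using m by (simp add: divide_ennreal)
    finally show ?thesis .
  qed
  have pd: "predictive_density pr.dens"
    unfolding predictive_density_def
    using pr.dens_measurable pr.dens_pos one by (simp add: borel_prod less_imp_le)
  \<comment> \<open>The risk is the base risk minus the mean of ln m at variance vw plus that at vx;
    the last two terms together are at most 0 by monotonicity.\<close>
  have risk: "KL_risk vx vy pr.dens \<Theta> \<le> ereal (base_risk vx vy (0 :: real^'q^'r::{finite,linorder}))" for \<Theta>
    using pm.avg_ln_antimono[OF key, of \<Theta>] unfolding pr.KL_risk_dens pr.risk_def vw[symmetric] by simp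
  show ?thesis unfolding pH
    by (rule KL_minimax_if_risk_le[OF variances(1,2) pd]) (rule risk)
qed

end
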